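(* Consider self-similar compressible potential flow with polytropic pressure $p(\rho)=\rho^\gamma$, $\gamma\ge 1$. (1) There is no wall-corner regular reflection (as defined in the context) with $\measuredangle(\vec v^I-\vec v_r,\vec n_B)\neq 90^\circ$ whose reflected shock is strong-type at the reflection point $\vec\xi_r$. In particular, classical regular reflection has no global regular reflection solution whose reflected shock is strong-type at the reflection point, within the class of flows whose reflected shock $\overline S$ is $C^1$ (including endpoints) and whose velocity and density are continuous on the closed region $\overline E$ enclosed by the reflected shock and the walls. (2) There is no supersonic wedge flow (as defined in the context), with $C^1$ shock $\overline S$ (including the tip) and with velocity and density continuous on the closed region between shock and wall, whose shock is strong-type at the wedge tip $\vec\xi_r$.
   Context: **Self-similar potential flow.** Write $\vec\xi=(\xi,\eta)=(x/t,y/t)$. Let $p(\rho)=\rho^\gamma$ with $\gamma\in[1,\infty)$, $c=\sqrt{p'(\rho)}$ the sound speed, and $\pi$ a function with $\pi'(\rho)=c^2/\rho$. A flow is given by a potential $\psi(\vec\xi)$ with velocity $\vec v=\nabla\psi$, pseudo-potential $\chi=\psi-\frac12|\vec\xi|^2$, pseudo-velocity $\vec z=\nabla\chi=\vec v-\vec\xi$, and density $\rho=\pi^{-1}(-\chi-\frac12|\nabla\chi|^2)>0$. Where smooth it satisfies $$(c^2I-\vec z\vec z^{T}):\nabla^2\psi=0,$$ where $:$ is the Frobenius product and $\nabla^2$ the Hessian. With $L=|\vec z|/c$, the equation is elliptic where $L<1$ and hyperbolic where $L>1$. All notions are invariant under rotation, reflection, and change of inertial observer ($\vec v\leftarrow\vec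 v-\vec w$, $\vec\xi\leftarrow\vec\xi-\vec w$). On a solid wall with normal $\vec n$ the slip condition $\vec z\cdot\vec n=0$ holds. **Shocks.** Let the upstream region $I$ have constant velocity $\vec v^I$ and density $\rho^I$, with affine potential $\psi^I(\vec\xi)=\psi^I(0)+\vec v^I\cdot\vec\xi$. Let $\psi$ be the downstream potential (limits on the shock taken from the downstream side). With $\vec n$ the unit shock normal pointing downstream, the shock conditions are $\psi=\psi^I$ and $\rho^I(\vec v^I-\vec\xi)\cdot\vec n=\rho(\vec v-\vec\xi)\cdot\vec n$. Shocks are admissible with positive strength: $(\vec v^I-\vec\xi)\cdot\vec n>(\vec v-\vec\xi)\cdot\vec n>0$. Hence $\vec n=(\vec v^I-\vec v)/|\vec v^I-\vec v|$. **Strong-type.** Set $$g(\vec v,\vec\xi)=\Big(\pi^{-1}\big[-\psi^I(\vec\xi)+\vec v\cdot\vec\xi-\tfrac12|\vec v|^2\big](\vec v-\vec\xi)-\rho^I(\vec v^I-\vec\xi)\Big)\cdot\frac{\vec v^I-\vec v}{|\vec v^I-\vec v|},$$ and let $g_{\vec v}$ be its gradient in $\vec v$. A shock is *weak-type*, *critical-type*, *strong-type* at a point $\vec\xi$ if $g_{\vec v}(\vec v,\vec\xi)\cdot\vec z$ is $<0$, $=0$, $>0$ respectively, where $\vec v$ and $\vec z=\vec v-\vec\xi$ are the downstream values. **Wall-corner regular reflection.** Two straight walls $A$ (reflection wall) and $B$ (opposite wall) meet at a corner with angle in $(0^\circ,180^\circ)$ on the fluid side. The reflected shock $S$ is a curve,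 $C^1$ up to and including its endpoints, from the reflection point $\vec\xi_r\in A$ to a point of $B$ (neither being the corner). $E$ is the bounded open region enclosed by $\overline S$, the segment $A_E$ of $A$ from the corner to $\vec\xi_r$, and the segment $B_E$ of $B$ from the corner to the endpoint of $S$. $\vec n_A,\vec n_B$ are the unit normals of $A,B$ outer to $E$. On the other side of $S$ is the region $I$, in which the flow has constant velocity $\vec v^I$ and density $\rho^I$; $I$ is adjacent to $B$, and $\vec v^I$ satisfies the slip condition on $B$. In $E$: $\psi\in C^1(\overline E)\cap C^2(E)$ solves the potential flow equation with $L<1$ in $E$ and at $\vec\xi_r$ (transonic reflected shock); slip conditions hold on $A_E$ and $B_E$; the shock conditions and admissibility hold on $\overline S$ with upstream state $I$ and downstream side $E$. The angle at $\vec\xi_r$ between the shock tangent and $A_E$, measured through $E$, lies in $(0^\circ,90^\circ)$. $\vec v_r$ is the limit of $\vec v=\nabla\psi$ at $\vec\xi_r$ from $E$. **Classical regular reflection.** This is the special case where, for some $\theta\in(0^\circ,90^\circ)$, $B=\{(\xi,0):\xi\le 0\}$, $A=\{s(\cos\theta,\sin\theta):s\ge0\}$, and the fluid lies above $A\cup B$. An incident shock on the vertical line $\{\xi=\xi_0\}$, $\xi_0>0$, separates gas at rest (right) from the state $I$ (left) with $\vec v^I=(v^I,0)$, $v^I>0$ (shock conditions and admissibility satisfied, the state at rest being upstream of the incident shock). It meets the reflected shock $S$ at $\vec\xi_r=\xi_0(1,\tan\theta)$. **Supersonic wedge flow.** The wedge wall is a ray $W$ starting at the tip $\vec\xi_r$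 with unit direction $\vec e$; in the frame in which the wedge is at rest, $\vec\xi_r=0$. The upstream state has constant velocity $\vec v^I$, density $\rho^I$ and sound speed $c^I$, with $|\vec v^I-\vec\xi_r|>c^I$, where $\vec v^I-\vec\xi_r$ points into the wall and makes an angle in $(0^\circ,90^\circ)$ with $\vec e$. A shock $S$, $C^1$ including its endpoint $\vec\xi_r$, starts at $\vec\xi_r$ and goes to infinity on the fluid side of $W$. The region between $S$ and $W$ consists of a bounded open elliptic region $E$ adjacent to $\vec\xi_r$ and an unbounded region $H$ in which velocity $\vec v_H$ and density are constant (sound speed $c_H$) and $L>1$. They are separated by an arc $P$ (joining $W$ to $S$) of the circle $\{|\vec\xi-\vec v_H|=c_H\}$, on which $L=1$. The part of $S$ adjacent to $H$ is straight and parallel to $W$. The potential satisfies $\psi\in C^1(\overline{E\cup H})\cap C^2(E)$ and the potential flow equation in $E$, with $L<1$ in $E$ and at $\vec\xi_r$. The slip condition holds on $W$; the shock conditions and admissibility hold on $\overline S$ with the constant upstream state $I$. The angle at $\vec\xi_r$ between the shock tangent and $W$, measured through $E$, lies in $(0^\circ,90^\circ)$. *)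

theory Defs
  imports "HOL-Analysis.Analysis"
begin

type_synonym plane = "real^2"

definition angle :: "plane \<Rightarrow> plane \<Rightarrow> real" where
  "angle x y = arccos (x \<bullet> y / (norm x * norm y))"

definition ray :: "plane \<Rightarrow> plane \<Rightarrow> plane set" where
  "ray x d = {x + s *\<^sub>R d | s. s \<ge> 0}"

definition frobenius :: "real^2^2 \<Rightarrow> real^2^2 \<Rightarrow> real" where
  "frobenius M N = (\<Sum>i\<in>UNIV. \<Sum>j\<in>UNIV. M $ i $ j * N $ i $ j)"

definition outer_product :: "plane \<Rightarrow> plane \<Rightarrow> real^2^2" where
  "outer_product x y = (\<chi> i j. x $ i * y $ j)"

definition pressure :: "real \<Rightarrow> real \<Rightarrow> real" where
  "pressure \<gamma> \<rho> = \<rho> powr \<gamma>"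

definition sound_speed :: "real \<Rightarrow> real \<Rightarrow> real" where
  "sound_speed \<gamma> \<rho> = sqrt (deriv (pressure \<gamma>) \<rho>)"

text \<open>The additive constant of \<open>\<pi>\<close> is left free; values of \<open>\<pi>\<close> outside \<open>{0<..}\<close> are never used.\<close>

definition is_enthalpy :: "real \<Rightarrow> (real \<Rightarrow> real) \<Rightarrow> bool" where
  "is_enthalpy \<gamma> \<pi> \<longleftrightarrow>
     (\<forall>\<rho>>0. (\<pi> has_real_derivative (sound_speed \<gamma> \<rho>)\<^sup>2 / \<rho>) (at \<rho>))"

definition enthalpy_inv :: "(real \<Rightarrow> real) \<Rightarrow> real \<Rightarrow> real" where
  "enthalpy_inv \<pi> = the_inv_into {0<..} \<pi>"

text \<open>
  A flow is given by its potential \<open>\<psi>\<close> and velocity field \<open>v\<close>, both as functions of the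
  similarity coordinate \<open>\<xi>\<close>. The field \<open>v\<close> is a separate argument because it is also needed
  on the boundary, where it is the continuous extension of the gradient of \<open>\<psi>\<close>
  (see \<open>C1_closure\<close>).
\<close>

definition pseudo_potential :: "(plane \<Rightarrow> real) \<Rightarrow> plane \<Rightarrow> real" where
  "pseudo_potential \<psi> \<xi> = \<psi> \<xi> - (norm \<xi>)\<^sup>2 / 2"

definition pseudo_velocity :: "(plane \<Rightarrow> plane) \<Rightarrow> plane \<Rightarrow> plane" where
  "pseudo_velocity v \<xi> = v \<xi> - \<xi>"

definition bernoulli :: "(plane \<Rightarrow> real) \<Rightarrow> (plane \<Rightarrow> plane) \<Rightarrow> plane \<Rightarrow> real" where
  "bernoulli \<psi> v \<xi> = - pseudo_potential \<psi> \<xi> - (norm (pseudo_velocity v \<xi>))\<^sup>2 / 2"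

definition density ::
  "(real \<Rightarrow> real) \<Rightarrow> (plane \<Rightarrow> real) \<Rightarrow> (plane \<Rightarrow> plane) \<Rightarrow> plane \<Rightarrow> real" where
  "density \<pi> \<psi> v \<xi> = enthalpy_inv \<pi> (bernoulli \<psi> v \<xi>)"

text \<open>
  For \<open>\<gamma> > 1\<close> the range of \<open>\<pi>\<close> on \<open>{0<..}\<close> is bounded below, so existence of a
  positive density is a genuine condition on the flow.
\<close>

definition has_density ::
  "(real \<Rightarrow> real) \<Rightarrow> (plane \<Rightarrow> real) \<Rightarrow> (plane \<Rightarrow> plane) \<Rightarrow> plane \<Rightarrow> bool" where
  "has_density \<pi> \<psi> v \<xi> \<longleftrightarrow> bernoulli \<psi> v \<xi> \<in> \<pi> ` {0<..}"

definition local_sound_speed ::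
  "real \<Rightarrow> (real \<Rightarrow> real) \<Rightarrow> (plane \<Rightarrow> real) \<Rightarrow> (plane \<Rightarrow> plane) \<Rightarrow> plane \<Rightarrow> real" where
  "local_sound_speed \<gamma> \<pi> \<psi> v \<xi> = sound_speed \<gamma> (density \<pi> \<psi> v \<xi>)"

definition pseudo_Mach ::
  "real \<Rightarrow> (real \<Rightarrow> real) \<Rightarrow> (plane \<Rightarrow> real) \<Rightarrow> (plane \<Rightarrow> plane) \<Rightarrow> plane \<Rightarrow> real" where
  "pseudo_Mach \<gamma> \<pi> \<psi> v \<xi> = norm (pseudo_velocity v \<xi>) / local_sound_speed \<gamma> \<pi> \<psi> v \<xi>"

definition C1_closure :: "plane set \<Rightarrow> (plane \<Rightarrow> real) \<Rightarrow> (plane \<Rightarrow> plane) \<Rightarrow> bool" where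
  "C1_closure U \<psi> v \<longleftrightarrow>
     continuous_on (closure U) \<psi> \<and> continuous_on (closure U) v \<and>
     (\<forall>\<xi>\<in>U. GDERIV \<psi> \<xi> :> v \<xi>)"

text \<open>
  Given that \<open>v\<close> is the gradient of \<open>\<psi>\<close> in the open set \<open>U\<close>, the field \<open>D2\<close> is the Hessian
  of \<open>\<psi>\<close>; its continuity is \<open>C\<^sup>2\<close> regularity of \<open>\<psi>\<close>.
\<close>

definition C2_potential_flow ::
  "real \<Rightarrow> (real \<Rightarrow> real) \<Rightarrow> plane set \<Rightarrow> (plane \<Rightarrow> real) \<Rightarrow> (plane \<Rightarrow> plane) \<Rightarrow> bool" where
  "C2_potential_flow \<gamma> \<pi> U \<psi> v \<longleftrightarrow>
     (\<exists>D2 :: plane \<Rightarrow> real^2^2.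
        continuous_on U D2 \<and>
        (\<forall>\<xi>\<in>U.
           GDERIV \<psi> \<xi> :> v \<xi> \<and>
           (v has_derivative (\<lambda>h. D2 \<xi> *v h)) (at \<xi>) \<and>
           frobenius
             ((local_sound_speed \<gamma> \<pi> \<psi> v \<xi>)\<^sup>2 *\<^sub>R mat 1
                - outer_product (pseudo_velocity v \<xi>) (pseudo_velocity v \<xi>))
             (D2 \<xi>) = 0))"

definition slip :: "plane \<Rightarrow> (plane \<Rightarrow> plane) \<Rightarrow> plane \<Rightarrow> bool" where
  "slip n v \<xi> \<longleftrightarrow> pseudo_velocity v \<xi> \<bullet> n = 0"

definition constant_state ::
  "(real \<Rightarrow> real) \<Rightarrow> plane \<Rightarrow> real \<Rightarrow> (plane \<Rightarrow> real) \<Rightarrow> bool" where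
  "constant_state \<pi> vI \<rho>I \<psi>I \<longleftrightarrow>
     \<rho>I > 0 \<and> (\<forall>\<xi>. \<psi>I \<xi> = \<psi>I 0 + vI \<bullet> \<xi>) \<and> (\<forall>\<xi>. bernoulli \<psi>I (\<lambda>_. vI) \<xi> = \<pi> \<rho>I)"

text \<open>The arguments \<open>vI\<close>, \<open>\<rho>I\<close>, \<open>\<psi>I\<close> are upstream data, \<open>\<psi>\<close> and \<open>v\<close> are downstream data.\<close>

definition shock_at ::
  "(real \<Rightarrow> real) \<Rightarrow> plane \<Rightarrow> real \<Rightarrow> (plane \<Rightarrow> real) \<Rightarrow>
   (plane \<Rightarrow> real) \<Rightarrow> (plane \<Rightarrow> plane) \<Rightarrow> plane \<Rightarrow> plane \<Rightarrow> bool" where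
  "shock_at \<pi> vI \<rho>I \<psi>I \<psi> v n \<xi> \<longleftrightarrow>
     \<psi> \<xi> = \<psi>I \<xi> \<and>
     \<rho>I * ((vI - \<xi>) \<bullet> n) = density \<pi> \<psi> v \<xi> * ((v \<xi> - \<xi>) \<bullet> n)"

definition admissible_at :: "plane \<Rightarrow> (plane \<Rightarrow> plane) \<Rightarrow> plane \<Rightarrow> plane \<Rightarrow> bool" where
  "admissible_at vI v n \<xi> \<longleftrightarrow>
     (vI - \<xi>) \<bullet> n > (v \<xi> - \<xi>) \<bullet> n \<and> (v \<xi> - \<xi>) \<bullet> n > 0"

definition shock_g ::
  "(real \<Rightarrow> real) \<Rightarrow> plane \<Rightarrow> real \<Rightarrow> (plane \<Rightarrow> real) \<Rightarrow> plane \<Rightarrow> plane \<Rightarrow> real" where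
  "shock_g \<pi> vI \<rho>I \<psi>I w \<xi> =
     (enthalpy_inv \<pi> (- \<psi>I \<xi> + w \<bullet> \<xi> - (norm w)\<^sup>2 / 2) *\<^sub>R (w - \<xi>) - \<rho>I *\<^sub>R (vI - \<xi>))
       \<bullet> ((vI - w) /\<^sub>R norm (vI - w))"

definition strong_type ::
  "(real \<Rightarrow> real) \<Rightarrow> plane \<Rightarrow> real \<Rightarrow> (plane \<Rightarrow> real) \<Rightarrow> (plane \<Rightarrow> plane) \<Rightarrow> plane \<Rightarrow> bool" where
  "strong_type \<pi> vI \<rho>I \<psi>I v \<xi> \<longleftrightarrow>
     (\<exists>gv. GDERIV (\<lambda>w. shock_g \<pi> vI \<rho>I \<psi>I w \<xi>) (v \<xi>) :> gv \<and> gv \<bullet> pseudo_velocity v \<xi> > 0)"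

abbreviation tangent :: "real set \<Rightarrow> (real \<Rightarrow> plane) \<Rightarrow> real \<Rightarrow> plane" where
  "tangent J \<sigma> t \<equiv> vector_derivative \<sigma> (at t within J)"

definition C1_curve :: "real set \<Rightarrow> (real \<Rightarrow> plane) \<Rightarrow> bool" where
  "C1_curve J \<sigma> \<longleftrightarrow>
     inj_on \<sigma> J \<and>
     (\<forall>t\<in>J. \<sigma> differentiable (at t within J) \<and> tangent J \<sigma> t \<noteq> 0) \<and>
     continuous_on J (tangent J \<sigma>)"

text \<open>
  The normal at an end point of the curve need not point into \<open>U\<close> (it does not where the
  boundary of \<open>U\<close> has an acute corner); there it is fixed by continuity.
\<close>

definition normal_into :: "real set \<Rightarrow> (real \<Rightarrow> plane) \<Rightarrow> plane set \<Rightarrow> (real \<Rightarrow> plane) \<Rightarrow> bool" where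
  "normal_into J \<sigma> U n \<longleftrightarrow>
     continuous_on J n \<and>
     (\<forall>t\<in>J. norm (n t) = 1 \<and> n t \<bullet> tangent J \<sigma> t = 0) \<and>
     (\<forall>t\<in>interior J. \<forall>\<^sub>F s in at_right 0. \<sigma> t + s *\<^sub>R n t \<in> U)"

definition admissible_shock ::
  "(real \<Rightarrow> real) \<Rightarrow> plane \<Rightarrow> real \<Rightarrow> (plane \<Rightarrow> real) \<Rightarrow>
   (plane \<Rightarrow> real) \<Rightarrow> (plane \<Rightarrow> plane) \<Rightarrow> real set \<Rightarrow> (real \<Rightarrow> plane) \<Rightarrow> plane set \<Rightarrow> bool" where
  "admissible_shock \<pi> vI \<rho>I \<psi>I \<psi> v J \<sigma> U \<longleftrightarrow>
     (\<exists>n. normal_into J \<sigma> U n \<and>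
        (\<forall>t\<in>J. shock_at \<pi> vI \<rho>I \<psi>I \<psi> v (n t) (\<sigma> t) \<and> admissible_at vI v (n t) (\<sigma> t)))"

text \<open>
  The walls are the rays from the corner \<open>k\<close> in the unit directions \<open>a\<close> (reflection wall)
  and \<open>b\<close> (opposite wall). As the corner angle is less than a half turn, the fluid occupies
  the convex sector between them.
\<close>

definition sector :: "plane \<Rightarrow> plane \<Rightarrow> plane \<Rightarrow> plane set" where
  "sector k a b = {k + s *\<^sub>R a + t *\<^sub>R b | s t. s > 0 \<and> t > 0}"

definition elliptic_region :: "plane \<Rightarrow> (real \<Rightarrow> plane) \<Rightarrow> plane set" where
  "elliptic_region k \<sigma> =
     inside (path_image \<sigma> \<union> closed_segment k (pathstart \<sigma>) \<union> closed_segment k (pathfinish \<sigma>))"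

text \<open>Unit normal of a wall through \<open>k\<close> with direction \<open>d\<close>, for \<open>U\<close> on one side of that wall.\<close>

definition outer_wall_normal :: "plane \<Rightarrow> plane \<Rightarrow> plane set \<Rightarrow> plane \<Rightarrow> bool" where
  "outer_wall_normal k d U n \<longleftrightarrow> norm n = 1 \<and> n \<bullet> d = 0 \<and> (\<forall>x\<in>U. (x - k) \<bullet> n < 0)"

text \<open>
  \<open>\<sigma>\<close> parametrizes the closed reflected shock from the reflection point \<open>pathstart \<sigma>\<close> to
  the opposite wall; \<open>RI\<close> is the region on its upstream side. At the reflection point the
  elliptic region is the sector between the shock tangent and the direction towards the
  corner, both in the closed half-plane on the fluid side of the reflection wall, so the
  angle measured through it is the unoriented one.
\<close>

definition wall_corner_reflection ::
  "real \<Rightarrow> (real \<Rightarrow> real) \<Rightarrow> plane \<Rightarrow> plane \<Rightarrow> plane \<Rightarrow> plane \<Rightarrow> plane \<Rightarrow>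
   plane set \<Rightarrow> plane \<Rightarrow> real \<Rightarrow> (plane \<Rightarrow> real) \<Rightarrow>
   (real \<Rightarrow> plane) \<Rightarrow> (plane \<Rightarrow> real) \<Rightarrow> (plane \<Rightarrow> plane) \<Rightarrow> bool" where
  "wall_corner_reflection \<gamma> \<pi> k a b nA nB RI vI \<rho>I \<psi>I \<sigma> \<psi> v \<longleftrightarrow>
     (let E = elliptic_region k \<sigma>; \<xi>r = pathstart \<sigma>; \<xi>B = pathfinish \<sigma> in
       norm a = 1 \<and> norm b = 1 \<and> 0 < angle a b \<and> angle a b < pi \<and>
       outer_wall_normal k a E nA \<and> outer_wall_normal k b E nB \<and>
       C1_curve {0..1} \<sigma> \<and>
       \<xi>r \<in> ray k a - {k} \<and> \<xi>B \<in> ray k b - {k} \<and> \<sigma> ` {0<..<1} \<subseteq> sector k a b \<and>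
       0 < angle (tangent {0..1} \<sigma> 0) (k - \<xi>r) \<and> angle (tangent {0..1} \<sigma> 0) (k - \<xi>r) < pi / 2 \<and>
       constant_state \<pi> vI \<rho>I \<psi>I \<and>
       open RI \<and> RI \<subseteq> sector k a b - closure E \<and>
       (\<exists>n. normal_into {0..1} \<sigma> RI n) \<and>
       (\<forall>\<^sub>F s in at_right 0. \<xi>B + s *\<^sub>R b \<in> closure RI) \<and>
       (\<forall>\<xi>\<in>ray k b. slip nB (\<lambda>_. vI) \<xi>) \<and>
       C1_closure E \<psi> v \<and> (\<forall>\<xi>\<in>closure E. has_density \<pi> \<psi> v \<xi>) \<and>
       C2_potential_flow \<gamma> \<pi> E \<psi> v \<and>
       (\<forall>\<xi>\<in>E \<union> {\<xi>r}. pseudo_Mach \<gamma> \<pi> \<psi> v \<xi> < 1) \<and>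
       (\<forall>\<xi>\<in>closed_segment k \<xi>r. slip nA v \<xi>) \<and>
       (\<forall>\<xi>\<in>closed_segment k \<xi>B. slip nB v \<xi>) \<and>
       admissible_shock \<pi> vI \<rho>I \<psi>I \<psi> v {0..1} \<sigma> E)"

text \<open>
  The state at rest, with density \<open>\<rho>0\<close> and constant potential \<open>\<psi>0\<close>, is upstream of the
  incident shock, whose normal pointing downstream is \<open>(-1, 0)\<close>.
\<close>

definition classical_regular_reflection ::
  "real \<Rightarrow> (real \<Rightarrow> real) \<Rightarrow> real \<Rightarrow> real \<Rightarrow> real \<Rightarrow> (plane \<Rightarrow> real) \<Rightarrow>
   plane \<Rightarrow> plane \<Rightarrow> plane \<Rightarrow> real \<Rightarrow> (plane \<Rightarrow> real) \<Rightarrow>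
   (real \<Rightarrow> plane) \<Rightarrow> (plane \<Rightarrow> real) \<Rightarrow> (plane \<Rightarrow> plane) \<Rightarrow> bool" where
  "classical_regular_reflection \<gamma> \<pi> \<theta> \<xi>0 \<rho>0 \<psi>0 nA nB vI \<rho>I \<psi>I \<sigma> \<psi> v \<longleftrightarrow>
     (let a = vector [cos \<theta>, sin \<theta>]; b = vector [-1, 0];
          RI = {x \<in> sector 0 a b - closure (elliptic_region 0 \<sigma>). x $ 1 < \<xi>0} in
       0 < \<theta> \<and> \<theta> < pi / 2 \<and> \<xi>0 > 0 \<and>
       wall_corner_reflection \<gamma> \<pi> 0 a b nA nB RI vI \<rho>I \<psi>I \<sigma> \<psi> v \<and>
       pathstart \<sigma> = \<xi>0 *\<^sub>R vector [1, tan \<theta>] \<and>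
       vI $ 1 > 0 \<and> vI $ 2 = 0 \<and>
       constant_state \<pi> 0 \<rho>0 \<psi>0 \<and>
       (\<forall>\<xi>. \<xi> $ 1 = \<xi>0 \<and> \<xi> $ 2 \<ge> \<xi>0 * tan \<theta> \<longrightarrow>
          shock_at \<pi> 0 \<rho>0 \<psi>0 \<psi>I (\<lambda>_. vI) (vector [-1, 0]) \<xi> \<and>
          admissible_at 0 (\<lambda>_. vI) (vector [-1, 0]) \<xi>))"

text \<open>
  \<open>\<sigma>\<close> parametrizes the closed shock from the tip \<open>\<xi>r = \<sigma> 0\<close> to infinity, \<open>D\<close> is the region
  between shock and wall, and the path \<open>p\<close> parametrizes the sonic arc from wall to shock.
  The shock together with the wall cuts the plane into two components, of which exactly
  \<open>D\<close> is contained in the half-plane on the fluid side of the wall.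
\<close>

definition supersonic_wedge_flow ::
  "real \<Rightarrow> (real \<Rightarrow> real) \<Rightarrow> plane \<Rightarrow> plane \<Rightarrow> plane \<Rightarrow>
   plane \<Rightarrow> real \<Rightarrow> (plane \<Rightarrow> real) \<Rightarrow> (real \<Rightarrow> plane) \<Rightarrow> plane set \<Rightarrow>
   plane set \<Rightarrow> plane set \<Rightarrow> (real \<Rightarrow> plane) \<Rightarrow> plane \<Rightarrow> real \<Rightarrow>
   (plane \<Rightarrow> real) \<Rightarrow> (plane \<Rightarrow> plane) \<Rightarrow> bool" where
  "supersonic_wedge_flow \<gamma> \<pi> \<xi>r e nW vI \<rho>I \<psi>I \<sigma> D E H p vH \<rho>H \<psi> v \<longleftrightarrow>
     (let W = ray \<xi>r e; S = \<sigma> ` {0..}; P = path_image p; cH = sound_speed \<gamma> \<rho>H in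
       norm e = 1 \<and> outer_wall_normal \<xi>r e D nW \<and>
       constant_state \<pi> vI \<rho>I \<psi>I \<and>
       norm (vI - \<xi>r) > sound_speed \<gamma> \<rho>I \<and>
       (vI - \<xi>r) \<bullet> nW > 0 \<and> 0 < angle (vI - \<xi>r) e \<and> angle (vI - \<xi>r) e < pi / 2 \<and>
       C1_curve {0..} \<sigma> \<and> \<sigma> 0 = \<xi>r \<and> filterlim \<sigma> at_infinity at_top \<and>
       (\<forall>t>0. (\<sigma> t - \<xi>r) \<bullet> nW < 0) \<and>
       0 < angle (tangent {0..} \<sigma> 0) e \<and> angle (tangent {0..} \<sigma> 0) e < pi / 2 \<and>
       D \<in> components (- (S \<union> W)) \<and>
       arc p \<and> pathstart p \<in> W \<and> pathfinish p \<in> S \<and> p ` {0<..<1} \<subseteq> D \<and>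
       P \<subseteq> sphere vH cH \<and>
       components (D - P) = {E, H} \<and> bounded E \<and> \<not> bounded H \<and> \<xi>r \<in> closure E \<and>
       S \<inter> closure H = ray (pathfinish p) e \<and>
       C1_closure (E \<union> H) \<psi> v \<and> (\<forall>\<xi>\<in>closure (E \<union> H). has_density \<pi> \<psi> v \<xi>) \<and>
       C2_potential_flow \<gamma> \<pi> E \<psi> v \<and>
       (\<forall>\<xi>\<in>E \<union> {\<xi>r}. pseudo_Mach \<gamma> \<pi> \<psi> v \<xi> < 1) \<and>
       (\<forall>\<xi>\<in>P. pseudo_Mach \<gamma> \<pi> \<psi> v \<xi> = 1) \<and>
       (\<forall>\<xi>\<in>H. v \<xi> = vH \<and> density \<pi> \<psi> v \<xi> = \<rho>H \<and> pseudo_Mach \<gamma> \<pi> \<psi> v \<xi> > 1) \<and>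
       (\<forall>\<xi>\<in>W. slip nW v \<xi>) \<and>
       admissible_shock \<pi> vI \<rho>I \<psi>I \<psi> v {0..} \<sigma> D)"

end

theory Submission
  imports Defs
begin

text \<open>
  Subtract from \<open>\<psi>\<close> the affine function tangent to it at the reflection point (or tip) \<open>\<xi>r\<close>. The
  difference \<open>u\<close> satisfies the maximum principle in \<open>E\<close>, and since the upstream potential is affine too,
  its value at a shock point is a positive multiple of the distance from the shock tangent at
  \<open>\<xi>r\<close>. A negative minimum of \<open>\<plusminus>u\<close> on the shock would need a normal parallel to the one at \<open>\<xi>r\<close> there,
  and then the jump conditions of normal shocks give the normal derivative of \<open>u\<close> the wrong sign;
  minima on the walls are excluded by the slip condition and Hopf's lemma. So \<open>\<plusminus>u\<close> is positive in
  \<open>E\<close> and vanishes to first order at \<open>\<xi>r\<close>. For a strong-type shock the linearised shock condition is an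
  oblique derivative condition for which a linear function is a barrier in the corner, and comparison
  with it gives \<open>u\<close> at least linear growth along the shock, a contradiction.
\<close>

section \<open>Second-order conditions in the plane\<close>

text \<open>The sign in \<open>\<plusminus>u\<close> is not free. On the opposite wall the upstream
  and the downstream velocity both satisfy the slip condition, so the normal derivative of
  \<open>u\<close> there is the constant \<open>(vI - vr) \<bullet> nB\<close>. The sign is the one
  for which this constant excludes minima on that wall, and the angle hypothesis says that it is
  nonzero. The price is that the sign may be \<open>-1\<close>; a minimum on the shock is then
  conceivable where the shock normal is opposite to the one at the reflection point, and the
  geometry of the sector has to exclude it. In the wedge flow the hyperbolic region replaces the
  opposite wall: \<open>u\<close> is affine there and grows along the wall, which fits the sign
  \<open>+1\<close>. Regularity shapes the rest. The gradient of \<psi> is only continuous up to the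
  boundary, so no second derivatives are available there: boundary derivatives come from limits
  along rays and from shifted copies of the shock. Every comparison is with a quadratic polynomial,
  to which the operator is applied at a single interior point, so the quasilinear equation need not
  be linearised.\<close>

lemma plane_inner: "(x::plane) \<bullet> y = x $ 1 * y $ 1 + x $ 2 * y $ 2"
  by (simp add: inner_vec_def sum_2)

lemma plane_eq_iff: "(x::plane) = y \<longleftrightarrow> x $ 1 = y $ 1 \<and> x $ 2 = y $ 2"
  by (simp add: vec_eq_iff forall_2)

lemma orthonormal_expansion:
  fixes a n x :: plane
  assumes "norm a = 1" "norm n = 1" "n \<bullet> a = 0"
  shows "x = (x \<bullet> a) *\<^sub>R a + (x \<bullet> n) *\<^sub>R n"
proof -
  have a: "a $ 1 * a $ 1 + a $ 2 * a $ 2 = 1" and n: "n $ 1 * n $ 1 + n $ 2 * n $ 2 = 1"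
    using assms(1,2) by (simp_all add: norm_eq_1 plane_inner)
  have an: "n $ 1 * a $ 1 + n $ 2 * a $ 2 = 0"
    using assms(3) by (simp add: plane_inner)
  \<comment> \<open>The entries of \<open>a a^T + n n^T = I\<close>: an orthogonal 2 by 2 matrix has
    orthonormal columns as well as orthonormal rows.\<close>
  have 1: "a $ 1 * a $ 1 + n $ 1 * n $ 1 = 1" "a $ 2 * a $ 2 + n $ 2 * n $ 2 = 1"
    "a $ 1 * a $ 2 + n $ 1 * n $ 2 = 0"
    using a n an by algebra+
  show ?thesis
    unfolding plane_eq_iff plane_inner using 1 by simp algebra
qed

lemma orthonormal_inner:
  fixes a n x y :: plane
  assumes "norm a = 1" "norm n = 1" "n \<bullet> a = 0"
  shows "x \<bullet> y = (x \<bullet> a) * (y \<bullet> a) + (x \<bullet> n) * (y \<bullet> n)"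
proof -
  have "x \<bullet> y = ((x \<bullet> a) *\<^sub>R a + (x \<bullet> n) *\<^sub>R n) \<bullet> y"
    using orthonormal_expansion[OF assms, of x] by simp
  also have "\<dots> = (x \<bullet> a) * (y \<bullet> a) + (x \<bullet> n) * (y \<bullet> n)"
    by (simp add: inner_add_left inner_scaleR_left inner_commute[of a y] inner_commute[of n y])
  finally show ?thesis .
qed

lemma unit_perp_unique:
  fixes m n t :: plane
  assumes "norm m = 1" "norm n = 1" "m \<bullet> t = 0" "n \<bullet> t = 0" "t \<noteq> 0"
  shows "m = n \<or> m = - n"
proof -
  let ?a = "t /\<^sub>R norm t"
  have a: "norm ?a = 1" "n \<bullet> ?a = 0" "m \<bullet> ?a = 0"
    using assms by auto
  have m: "m = (m \<bullet> n) *\<^sub>R n"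
    using orthonormal_expansion[OF a(1) assms(2) a(2), of m] a(3) by (simp only: scaleR_zero_left add_0)
  then have "\<bar>m \<bullet> n\<bar> = 1"
    using assms(1,2) by (metis mult.right_neutral norm_scaleR)
  then show ?thesis
    using m by (smt (verit) scaleR_one scaleR_minus_left)
qed

text \<open>This is \<open>c I - z z^T = (c - |z|^2) I + p p^T\<close>, where \<open>p\<close> is
  \<open>z\<close> turned by a right angle. For \<open>|z|^2 \<le> c\<close> the operator becomes a
  nonnegative combination of second directional derivatives, a form that can be read off at a
  minimum. In its use \<open>c\<close> is the square of the sound speed.\<close>

lemma frobenius_elliptic:
  fixes M :: "real^2^2" and z :: plane
  defines "p \<equiv> (vector [- (z $ 2), z $ 1] :: plane)"
  shows "frobenius (c *\<^sub>R mat 1 - outer_product z z) M =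
    (c - z \<bullet> z) * (axis 1 1 \<bullet> (M *v axis 1 1) + axis 2 1 \<bullet> (M *v axis 2 1)) + p \<bullet> (M *v p)"
  unfolding frobenius_def outer_product_def p_def
  by (simp add: sum_2 plane_inner matrix_vector_mult_def axis_def mat_def algebra_simps)

lemma second_derivative_at_min:
  fixes g g' :: "real \<Rightarrow> real"
  assumes d: "0 < \<delta>" and g: "\<And>s. \<bar>s\<bar> < \<delta> \<Longrightarrow> (g has_real_derivative g' s) (at s)"
    and g': "(g' has_real_derivative L) (at 0)"
    and min: "\<And>s. \<bar>s\<bar> < \<delta> \<Longrightarrow> g 0 \<le> g s"
  shows "0 \<le> L"
proof (rule ccontr)
  assume "\<not> 0 \<le> L"
  moreover have g0: "g' 0 = 0"
    by (rule DERIV_local_min[OF g d]) (use d min in auto)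
  ultimately obtain e where e: "0 < e" "\<And>h. 0 < h \<Longrightarrow> h < e \<Longrightarrow> g' h < 0"
    using DERIV_neg_dec_right[OF g'] by force
  define h where "h = min e \<delta> / 2"
  have h: "0 < h" "h < e" "h < \<delta>" using e d by (auto simp: h_def)
  have "g h < g 0"
  proof (rule DERIV_neg_imp_decreasing_open[OF h(1)])
    fix x assume "0 < x" "x < h"
    then show "\<exists>y. DERIV g x :> y \<and> y < 0"
      using g[of x] e(2)[of x] h by fastforce
  next
    show "continuous_on {0..h} g"
      by (rule DERIV_continuous_on[where D = g'], rule has_field_derivative_at_within, rule g)
        (use h in auto)
  qed
  then show False using min[of h] h by auto
qed

text \<open>One family serves all comparisons; its Hessian is the constant
  \<open>2 K n n^T + 2 \<kappa> I\<close>. Hopf's lemma takes \<open>b = n\<close>, a large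
  \<open>K\<close> and a negative \<kappa>, the corner between shock and wall takes
  \<open>K = 0\<close> and \<open>\<kappa> = 1\<close>, and vanishing parameters leave an affine
  function.\<close>

definition quadratic :: "plane \<Rightarrow> real \<Rightarrow> plane \<Rightarrow> real \<Rightarrow> plane \<Rightarrow> plane \<Rightarrow> real" where
  "quadratic b K n \<kappa> P \<xi> = b \<bullet> (\<xi> - P) + K * ((\<xi> - P) \<bullet> n)\<^sup>2 + \<kappa> * ((\<xi> - P) \<bullet> (\<xi> - P))"

definition quadratic_grad :: "plane \<Rightarrow> real \<Rightarrow> plane \<Rightarrow> real \<Rightarrow> plane \<Rightarrow> plane \<Rightarrow> plane" where
  "quadratic_grad b K n \<kappa> P \<xi> = b + (2 * K * ((\<xi> - P) \<bullet> n)) *\<^sub>R n + (2 * \<kappa>) *\<^sub>R (\<xi> - P)"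

lemma GDERIV_quadratic: "GDERIV (quadratic b K n \<kappa> P) \<xi> :> quadratic_grad b K n \<kappa> P \<xi>"
  unfolding gderiv_def quadratic_def quadratic_grad_def
  by (auto intro!: derivative_eq_intros ext simp: inner_simps power2_eq_square algebra_simps inner_commute)

lemma continuous_on_quadratic [continuous_intros]:
  "continuous_on S (quadratic b K n \<kappa> P)" "continuous_on S (quadratic_grad b K n \<kappa> P)"
  unfolding quadratic_def quadratic_grad_def by (intro continuous_intros)+

lemma GDERIV_along_line:
  fixes F :: "plane \<Rightarrow> real"
  assumes "GDERIV F (X + s *\<^sub>R q) :> f"
  shows "((\<lambda>s. F (X + s *\<^sub>R q)) has_real_derivative f \<bullet> q) (at s)"
proof -
  have "((\<lambda>s. F (X + s *\<^sub>R q)) has_derivative (\<lambda>h. (h *\<^sub>R q) \<bullet> f)) (at s)"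
    by (rule has_derivative_compose[where g = F and g' = "\<lambda>h. h \<bullet> f"])
      (auto intro!: derivative_eq_intros assms[unfolded gderiv_def])
  then show ?thesis
    by (simp add: has_field_derivative_def inner_commute mult.commute[of _ "f \<bullet> q"])
qed

text \<open>At a minimum the Hessian of the difference is nonnegative, so the operator with
  coefficients frozen at \<open>X\<close> is nonnegative on it. But it annihilates \<psi>, does not
  see affine functions, and applied to \<open>k\<close> times the quadratic it gives twice the
  positive expression in \<open>strict\<close>.\<close>

lemma elliptic_no_local_min:
  assumes C2: "C2_potential_flow \<gamma> \<pi> \<Omega> \<psi> v" and X: "ball X r \<subseteq> \<Omega>" "0 < r"
    and c: "c = local_sound_speed \<gamma> \<pi> \<psi> v X" and z: "z = pseudo_velocity v X"
    and L: "norm z < c"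
    and strict: "k * (K * (c\<^sup>2 * (n \<bullet> n) - (z \<bullet> n)\<^sup>2) + \<kappa> * (2 * c\<^sup>2 - z \<bullet> z)) > 0"
    and min: "\<And>\<xi>. \<xi> \<in> ball X r \<Longrightarrow>
        s * (\<psi> X - y \<bullet> X) - k * quadratic b K n \<kappa> P X \<le> s * (\<psi> \<xi> - y \<bullet> \<xi>) - k * quadratic b K n \<kappa> P \<xi>"
  shows False
proof -
  obtain D2 where D2: "\<And>\<xi>. \<xi> \<in> \<Omega> \<Longrightarrow> GDERIV \<psi> \<xi> :> v \<xi>"
    "\<And>\<xi>. \<xi> \<in> \<Omega> \<Longrightarrow> (v has_derivative (\<lambda>h. D2 \<xi> *v h)) (at \<xi>)"
    "\<And>\<xi>. \<xi> \<in> \<Omega> \<Longrightarrow> frobenius ((local_sound_speed \<gamma> \<pi> \<psi> v \<xi>)\<^sup>2 *\<^sub>R mat 1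
                - outer_product (pseudo_velocity v \<xi>) (pseudo_velocity v \<xi>)) (D2 \<xi>) = 0"
    using C2 unfolding C2_potential_flow_def by blast
  have XO: "X \<in> \<Omega>" using X by auto
  define F where "F \<xi> = s * (\<psi> \<xi> - y \<bullet> \<xi>) - k * quadratic b K n \<kappa> P \<xi>" for \<xi>
  define f where "f \<xi> = s *\<^sub>R (v \<xi> - y) - k *\<^sub>R quadratic_grad b K n \<kappa> P \<xi>" for \<xi>
  define M where "M = D2 X"
  have Fd: "GDERIV F \<xi> :> f \<xi>" if "\<xi> \<in> \<Omega>" for \<xi>
    unfolding F_def f_def gderiv_def
    using D2(1)[OF that] GDERIV_quadratic[of b K n \<kappa> P \<xi>] unfolding gderiv_def
    by (auto intro!: derivative_eq_intros ext simp: inner_simps inner_commute algebra_simps)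
  have fd: "(f has_derivative (\<lambda>h. s *\<^sub>R (M *v h) - k *\<^sub>R ((2 * K * (h \<bullet> n)) *\<^sub>R n + (2 * \<kappa>) *\<^sub>R h))) (at X)"
    unfolding f_def quadratic_grad_def M_def
    by (auto intro!: derivative_eq_intros D2(2)[OF XO] ext simp: algebra_simps)
  have q: "k * (2 * K * (h \<bullet> n)\<^sup>2 + 2 * \<kappa> * (h \<bullet> h)) \<le> s * (h \<bullet> (M *v h))" for h
  proof -
    \<comment> \<open>The summand 1 covers the direction \<open>h = 0\<close>.\<close>
    define d where "d = r / (norm h + 1)"
    have d: "0 < d" using X unfolding d_def by (auto intro!: divide_pos_pos add_nonneg_pos)
    have in_ball: "X + \<tau> *\<^sub>R h \<in> ball X r" if "\<bar>\<tau>\<bar> < d" for \<tau>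
    proof -
      have "\<bar>\<tau>\<bar> * norm h \<le> \<bar>\<tau>\<bar> * (norm h + 1)" by (simp add: mult_left_mono)
      also have "\<dots> < r" using that unfolding d_def by (simp add: pos_less_divide_eq add_nonneg_pos)
      finally show ?thesis by (simp add: dist_norm)
    qed
    have "0 \<le> (s *\<^sub>R (M *v h) - k *\<^sub>R ((2 * K * (h \<bullet> n)) *\<^sub>R n + (2 * \<kappa>) *\<^sub>R h)) \<bullet> h"
    proof (rule second_derivative_at_min[OF d, where g = "\<lambda>\<tau>. F (X + \<tau> *\<^sub>R h)" and g' = "\<lambda>\<tau>. f (X + \<tau> *\<^sub>R h) \<bullet> h"])
      fix \<tau> :: real assume \<tau>: "\<bar>\<tau>\<bar> < d"
      show "((\<lambda>\<tau>. F (X + \<tau> *\<^sub>R h)) has_real_derivative f (X + \<tau> *\<^sub>R h) \<bullet> h) (at \<tau>)"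
        by (rule GDERIV_along_line, rule Fd) (use in_ball[OF \<tau>] X in auto)
      show "F (X + 0 *\<^sub>R h) \<le> F (X + \<tau> *\<^sub>R h)"
        using min[OF in_ball[OF \<tau>]] by (simp add: F_def)
    next
      let ?L = "\<lambda>h. s *\<^sub>R (M *v h) - k *\<^sub>R ((2 * K * (h \<bullet> n)) *\<^sub>R n + (2 * \<kappa>) *\<^sub>R h)"
      have "((\<lambda>\<tau>. f (X + \<tau> *\<^sub>R h)) has_derivative (\<lambda>\<tau>. ?L (\<tau> *\<^sub>R h))) (at 0)"
        proof (rule has_derivative_compose[where g = f and g' = ?L and f = "\<lambda>\<tau>. X + \<tau> *\<^sub>R h"])
          show "((\<lambda>\<tau>. X + \<tau> *\<^sub>R h) has_derivative (\<lambda>\<tau>. \<tau> *\<^sub>R h)) (at 0)"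
            by (auto intro!: derivative_eq_intros)
          show "(f has_derivative ?L) (at (X + 0 *\<^sub>R h))"
            using fd by simp
        qed
      moreover have "?L (\<tau> *\<^sub>R h) = \<tau> *\<^sub>R ?L h" for \<tau>
        by (simp only: matrix_vector_mult_scaleR inner_scaleR_left scaleR_diff_right scaleR_add_right
            scaleR_scaleR mult_ac)
      ultimately have "((\<lambda>\<tau>. f (X + \<tau> *\<^sub>R h)) has_derivative (\<lambda>\<tau>. \<tau> *\<^sub>R ?L h)) (at 0)"
        by (simp only:)
      from has_derivative_inner_left[OF this, of h]
      show "((\<lambda>\<tau>. f (X + \<tau> *\<^sub>R h) \<bullet> h) has_real_derivative ?L h \<bullet> h) (at 0)"
        unfolding has_field_derivative_def inner_scaleR_left
        by (simp only: mult.commute[of _ "?L h \<bullet> h"])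
    qed
    then show ?thesis by (simp add: inner_simps power2_eq_square inner_commute algebra_simps)
  qed
  let ?p = "vector [- (z $ 2), z $ 1] :: plane"
  have "0 = s * frobenius (c\<^sup>2 *\<^sub>R mat 1 - outer_product z z) M"
    using D2(3)[OF XO] c z M_def by simp
  also have "\<dots> = (c\<^sup>2 - z \<bullet> z) * (s * (axis 1 1 \<bullet> (M *v axis 1 1)) + s * (axis 2 1 \<bullet> (M *v axis 2 1)))
      + s * (?p \<bullet> (M *v ?p))"
    unfolding frobenius_elliptic by (simp add: algebra_simps)
  \<comment> \<open>The inequality \<open>q\<close> is applied to the two coordinate directions and
    to \<open>?p\<close>; the weights are nonnegative by ellipticity.\<close>
  also have "\<dots> \<ge> (c\<^sup>2 - z \<bullet> z) * (k * (2 * K * (axis 1 1 \<bullet> n)\<^sup>2 + 2 * \<kappa> * (axis 1 1 \<bullet> (axis 1 1::plane)))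
       + k * (2 * K * (axis 2 1 \<bullet> n)\<^sup>2 + 2 * \<kappa> * (axis 2 1 \<bullet> (axis 2 1::plane))))
       + k * (2 * K * (?p \<bullet> n)\<^sup>2 + 2 * \<kappa> * (?p \<bullet> ?p))" (is "?lhs \<le> _")
  proof (intro add_mono mult_left_mono q)
    show "0 \<le> c\<^sup>2 - z \<bullet> z"
      using L by (metis diff_ge_0_iff_ge dot_square_norm less_imp_le norm_ge_zero power_mono)
  qed
  also have "?lhs = 2 * (k * (K * (c\<^sup>2 * (n \<bullet> n) - (z \<bullet> n)\<^sup>2) + \<kappa> * (2 * c\<^sup>2 - z \<bullet> z)))"
    by (simp add: plane_inner axis_def) algebra
  finally show False using strict by simp
qed

lemma tendsto_along_ray:
  fixes f :: "plane \<Rightarrow> 'a::topological_space"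
  assumes "continuous_on (closure \<Omega>) f" "X \<in> closure \<Omega>" "\<forall>\<^sub>F \<epsilon> in at_right 0. X + \<epsilon> *\<^sub>R q \<in> \<Omega>"
  shows "((\<lambda>\<epsilon>. f (X + \<epsilon> *\<^sub>R q)) \<longlongrightarrow> f X) (at_right 0)"
proof (rule continuous_on_tendsto_compose[OF assms(1) _ assms(2)])
  have "((\<lambda>\<epsilon>. X + \<epsilon> *\<^sub>R q) \<longlongrightarrow> X + 0 *\<^sub>R q) (at_right 0)"
    by (intro tendsto_intros)
  then show "((\<lambda>\<epsilon>. X + \<epsilon> *\<^sub>R q) \<longlongrightarrow> X) (at_right 0)" by simp
  show "\<forall>\<^sub>F \<epsilon> in at_right 0. X + \<epsilon> *\<^sub>R q \<in> closure \<Omega>"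
    using assms(3) by eventually_elim (use closure_subset in auto)
qed

text \<open>At a boundary point \<open>f X\<close> is only a limit of gradients. By continuity the
  derivative along the ray stays negative on a short open segment, and monotonicity there passes to
  the end point because \<open>F\<close> is continuous on the closure. This is how a boundary
  minimum restricts the limit gradient.\<close>

lemma C1_closure_descent:
  assumes C1: "C1_closure \<Omega> F f" and X: "X \<in> closure \<Omega>"
    and q: "\<forall>\<^sub>F \<epsilon> in at_right 0. X + \<epsilon> *\<^sub>R q \<in> \<Omega>" and neg: "f X \<bullet> q < 0"
  shows "\<forall>\<^sub>F \<epsilon> in at_right 0. F (X + \<epsilon> *\<^sub>R q) < F X"
proof -
  have cF: "continuous_on (closure \<Omega>) F" and cf: "continuous_on (closure \<Omega>) f"
    and F: "\<And>\<xi>. \<xi> \<in> \<Omega> \<Longrightarrow> GDERIV F \<xi> :> f \<xi>"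
    using C1 unfolding C1_closure_def by auto
  have "((\<lambda>\<epsilon>. f (X + \<epsilon> *\<^sub>R q) \<bullet> q) \<longlongrightarrow> f X \<bullet> q) (at_right 0)"
    by (intro tendsto_inner tendsto_const tendsto_along_ray[OF cf X q])
  from order_tendstoD(2)[OF this neg] q
  have "\<forall>\<^sub>F \<epsilon> in at_right 0. X + \<epsilon> *\<^sub>R q \<in> \<Omega> \<and> f (X + \<epsilon> *\<^sub>R q) \<bullet> q < 0"
    by eventually_elim simp
  then obtain d where d: "0 < d" "\<And>\<epsilon>. 0 < \<epsilon> \<Longrightarrow> \<epsilon> < d \<Longrightarrow> X + \<epsilon> *\<^sub>R q \<in> \<Omega>"
    "\<And>\<epsilon>. 0 < \<epsilon> \<Longrightarrow> \<epsilon> < d \<Longrightarrow> f (X + \<epsilon> *\<^sub>R q) \<bullet> q < 0"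
    unfolding eventually_at_right_field by auto
  have incl: "(\<lambda>\<epsilon>. X + \<epsilon> *\<^sub>R q) ` {0..<d} \<subseteq> closure \<Omega>"
  proof (rule image_subsetI)
    fix \<epsilon> assume "\<epsilon> \<in> {0..<d}"
    then show "X + \<epsilon> *\<^sub>R q \<in> closure \<Omega>"
      using d(2)[of \<epsilon>] X closure_subset by (cases "\<epsilon> = 0") auto
  qed
  have "F (X + \<epsilon> *\<^sub>R q) < F X" if \<epsilon>: "0 < \<epsilon>" "\<epsilon> < d" for \<epsilon>
  proof -
    have "F (X + \<epsilon> *\<^sub>R q) < F (X + 0 *\<^sub>R q)"
    proof (rule DERIV_neg_imp_decreasing_open[OF \<epsilon>(1), where f = "\<lambda>\<epsilon>. F (X + \<epsilon> *\<^sub>R q)"])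
      fix x assume x: "0 < x" "x < \<epsilon>"
      show "\<exists>y. DERIV (\<lambda>\<epsilon>. F (X + \<epsilon> *\<^sub>R q)) x :> y \<and> y < 0"
        by (rule exI[of _ "f (X + x *\<^sub>R q) \<bullet> q"], intro conjI GDERIV_along_line F d)
          (use x \<epsilon> in auto)
    next
      show "continuous_on {0..\<epsilon>} (\<lambda>\<epsilon>. F (X + \<epsilon> *\<^sub>R q))"
        by (rule continuous_on_compose2[OF cF, where f = "\<lambda>\<epsilon>. X + \<epsilon> *\<^sub>R q"])
          (use incl \<epsilon> in \<open>force intro!: continuous_intros\<close>)+
    qed
    then show ?thesis by simp
  qed
  then show ?thesis
    unfolding eventually_at_right_field using d(1) by auto
qed

section \<open>Polytropic gas and normal shocks\<close>

locale polytropic_gas =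
  fixes \<gamma> :: real and \<pi> :: "real \<Rightarrow> real"
  assumes gamma_ge_1: "\<gamma> \<ge> 1" and enthalpy: "is_enthalpy \<gamma> \<pi>"
begin

lemma sound_speed_squared: "0 < \<rho> \<Longrightarrow> (sound_speed \<gamma> \<rho>)\<^sup>2 = \<gamma> * \<rho> powr (\<gamma> - 1)"
proof -
  assume "0 < \<rho>"
  then have "deriv (pressure \<gamma>) \<rho> = \<gamma> * \<rho> powr (\<gamma> - 1)"
    unfolding pressure_def[abs_def] by (intro DERIV_imp_deriv has_real_derivative_powr)
  then show ?thesis
    using gamma_ge_1 by (simp add: sound_speed_def)
qed

lemma sound_speed_pos: "0 < \<rho> \<Longrightarrow> 0 < sound_speed \<gamma> \<rho>"
proof -
  assume "0 < \<rho>"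
  then have "deriv (pressure \<gamma>) \<rho> = \<gamma> * \<rho> powr (\<gamma> - 1)"
    unfolding pressure_def[abs_def] by (intro DERIV_imp_deriv has_real_derivative_powr)
  then show ?thesis
    using gamma_ge_1 \<open>0 < \<rho>\<close> by (simp add: sound_speed_def)
qed

lemma sound_speed_mono: "0 < \<rho> \<Longrightarrow> \<rho> \<le> \<rho>' \<Longrightarrow> (sound_speed \<gamma> \<rho>)\<^sup>2 \<le> (sound_speed \<gamma> \<rho>')\<^sup>2"
  using gamma_ge_1 by (auto simp: sound_speed_squared intro!: mult_left_mono powr_mono2)

lemma DERIV_enthalpy: "0 < \<rho> \<Longrightarrow> (\<pi> has_real_derivative (sound_speed \<gamma> \<rho>)\<^sup>2 / \<rho>) (at \<rho>)"
  using enthalpy unfolding is_enthalpy_def by blast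

lemma enthalpy_slope_pos: "0 < \<rho> \<Longrightarrow> 0 < (sound_speed \<gamma> \<rho>)\<^sup>2 / \<rho>"
  using sound_speed_pos[of \<rho>] by simp

lemma continuous_on_enthalpy: "continuous_on {0<..} \<pi>"
  by (rule DERIV_continuous_on, rule has_field_derivative_at_within, rule DERIV_enthalpy) simp

lemma enthalpy_less: "0 < \<rho> \<Longrightarrow> \<rho> < \<rho>' \<Longrightarrow> \<pi> \<rho> < \<pi> \<rho>'"
  by (rule DERIV_pos_imp_increasing) (auto intro!: exI DERIV_enthalpy enthalpy_slope_pos)

lemma inj_on_enthalpy: "inj_on \<pi> {0<..}"
  by (rule linorder_inj_onI) (auto dest: enthalpy_less)

lemma enthalpy_inv_enthalpy: "0 < \<rho> \<Longrightarrow> enthalpy_inv \<pi> (\<pi> \<rho>) = \<rho>"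
  unfolding enthalpy_inv_def using inj_on_enthalpy by (simp add: the_inv_into_f_f)

lemma DERIV_enthalpy_inv:
  assumes "0 < \<rho>"
  shows "(enthalpy_inv \<pi> has_real_derivative \<rho> / (sound_speed \<gamma> \<rho>)\<^sup>2) (at (\<pi> \<rho>))"
proof -
  have "(enthalpy_inv \<pi> has_real_derivative inverse ((sound_speed \<gamma> \<rho>)\<^sup>2 / \<rho>)) (at (\<pi> \<rho>))"
    unfolding has_field_derivative_def
    by (rule has_derivative_inverse_strong[OF _ _ continuous_on_enthalpy _
          DERIV_enthalpy[OF assms, unfolded has_field_derivative_def]])
      (use assms enthalpy_slope_pos[OF assms] in \<open>auto simp: enthalpy_inv_enthalpy fun_eq_iff\<close>)
  then show ?thesis by (simp add: inverse_eq_divide)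
qed

lemma continuous_on_enthalpy_inv: "continuous_on (\<pi> ` {0<..}) (enthalpy_inv \<pi>)"
  by (rule continuous_at_imp_continuous_on) (auto intro: DERIV_isCont DERIV_enthalpy_inv)

lemma enthalpy_inv_lipschitz:
  assumes "0 < \<rho>"
  obtains \<delta> C where "0 < \<delta>" "0 < C"
    "\<And>b b'. \<bar>b - \<pi> \<rho>\<bar> < \<delta> \<Longrightarrow> \<bar>b' - \<pi> \<rho>\<bar> < \<delta> \<Longrightarrow>
      0 < enthalpy_inv \<pi> b \<and> enthalpy_inv \<pi> b \<le> 2 * \<rho> \<and>
      \<bar>enthalpy_inv \<pi> b - enthalpy_inv \<pi> b'\<bar> \<le> C * \<bar>b - b'\<bar>"
proof -
  \<comment> \<open>By the intermediate value theorem every enthalpy within \<delta> of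
    \<open>\<pi> \<rho>\<close> belongs to a density in
    \<open>[\<rho> / 2, 2 \<rho>]\<close>.\<close>
  define \<delta> where "\<delta> = min (\<pi> \<rho> - \<pi> (\<rho> / 2)) (\<pi> (2 * \<rho>) - \<pi> \<rho>)"
  \<comment> \<open>A lower bound of the slope \<open>c^2 / x\<close> of \<pi> for \<open>x\<close>
    in \<open>[\<rho> / 2, 2 \<rho>]\<close>: the numerator increases with the density.\<close>
  define m where "m = (sound_speed \<gamma> (\<rho> / 2))\<^sup>2 / (2 * \<rho>)"
  have m: "0 < m" unfolding m_def using sound_speed_pos[of "\<rho> / 2"] assms by simp
  have \<delta>: "0 < \<delta>" unfolding \<delta>_def using assms enthalpy_less[of "\<rho> / 2" \<rho>] enthalpy_less[of \<rho> "2 * \<rho>"] by simp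
  have pre: "\<exists>\<rho>'\<in>{\<rho>/2..2*\<rho>}. b = \<pi> \<rho>'" if "\<bar>b - \<pi> \<rho>\<bar> < \<delta>" for b
  proof -
    have "continuous_on {\<rho>/2..2*\<rho>} \<pi>"
      by (rule continuous_on_subset[OF continuous_on_enthalpy]) (use assms in auto)
    then show ?thesis
      using IVT'[of \<pi> "\<rho>/2" b "2*\<rho>"] that assms unfolding \<delta>_def by force
  qed
  have lower: "m * (\<rho>\<^sub>2 - \<rho>\<^sub>1) \<le> \<pi> \<rho>\<^sub>2 - \<pi> \<rho>\<^sub>1" if "\<rho>/2 \<le> \<rho>\<^sub>1" "\<rho>\<^sub>1 < \<rho>\<^sub>2" "\<rho>\<^sub>2 \<le> 2 * \<rho>" for \<rho>\<^sub>1 \<rho>\<^sub>2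
  proof -
    have "\<exists>x>\<rho>\<^sub>1. x < \<rho>\<^sub>2 \<and> \<pi> \<rho>\<^sub>2 - \<pi> \<rho>\<^sub>1 = (\<rho>\<^sub>2 - \<rho>\<^sub>1) * ((sound_speed \<gamma> x)\<^sup>2 / x)"
      by (rule MVT2) (use that assms in \<open>auto intro!: DERIV_enthalpy\<close>)
    then obtain x where x: "\<rho>\<^sub>1 < x" "x < \<rho>\<^sub>2" "\<pi> \<rho>\<^sub>2 - \<pi> \<rho>\<^sub>1 = (\<rho>\<^sub>2 - \<rho>\<^sub>1) * ((sound_speed \<gamma> x)\<^sup>2 / x)"
      by blast
    have "m \<le> (sound_speed \<gamma> x)\<^sup>2 / x"
      unfolding m_def using x that assms sound_speed_mono[of "\<rho>/2" x] by (intro frac_le) auto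
    from mult_left_mono[OF this, of "\<rho>\<^sub>2 - \<rho>\<^sub>1"] show ?thesis
      unfolding x(3) using that(2) by (simp add: mult.commute)
  qed
  show ?thesis
  proof (rule that)
    show "0 < \<delta>" by (rule \<delta>)
    show "0 < 1 / m" using m by simp
    fix b b' assume "\<bar>b - \<pi> \<rho>\<bar> < \<delta>" "\<bar>b' - \<pi> \<rho>\<bar> < \<delta>"
    then obtain r r' where r: "r \<in> {\<rho>/2..2*\<rho>}" "b = \<pi> r" and r': "r' \<in> {\<rho>/2..2*\<rho>}" "b' = \<pi> r'"
      using pre by meson
    have "m * \<bar>r - r'\<bar> \<le> \<bar>\<pi> r - \<pi> r'\<bar>"
      using lower[of r r'] lower[of r' r] r r' by (cases r r' rule: linorder_cases) (auto simp: abs_if)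
    then have "\<bar>r - r'\<bar> \<le> 1 / m * \<bar>\<pi> r - \<pi> r'\<bar>"
      using m by (simp add: field_simps)
    then show "0 < enthalpy_inv \<pi> b \<and> enthalpy_inv \<pi> b \<le> 2 * \<rho> \<and>
      \<bar>enthalpy_inv \<pi> b - enthalpy_inv \<pi> b'\<bar> \<le> 1 / m * \<bar>b - b'\<bar>"
      using r r' assms by (simp add: enthalpy_inv_enthalpy)
  qed
qed

text \<open>Here \<open>d\<close> and \<open>e\<close> are the normal components of the
  pseudo-velocity upstream and downstream, and \<rho> is the downstream density. The last two
  equations are conservation of mass and the Bernoulli law; equal tangential components have
  cancelled in the latter.\<close>

definition normal_shock :: "real \<Rightarrow> real \<Rightarrow> real \<Rightarrow> real \<Rightarrow> bool" where
  "normal_shock \<rho>I d \<rho> e \<longleftrightarrow> 0 < \<rho>I \<and> 0 < \<rho> \<and> 0 < e \<and> e < d \<and> \<rho>I * d = \<rho> * e \<and>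
     \<pi> \<rho> - \<pi> \<rho>I = (d\<^sup>2 - e\<^sup>2) / 2"

text \<open>
  In the variable \<open>x = 1 - (\<rho>I / \<rho>)\<^sup>2\<close> the enthalpy jump is \<open>d\<^sup>2 x / 2\<close>; its slope
  with respect to \<open>x\<close> is half of \<open>(sound_speed \<gamma> s)\<^sup>2 s\<^sup>2 / \<rho>I\<^sup>2\<close>, which increases with the density \<open>s\<close>.
\<close>

lemma enthalpy_slope:
  assumes "0 < \<rho>I" "0 < \<rho>" "\<rho> < \<rho>'"
  obtains s where "\<rho> < s" "s < \<rho>'"
    "\<pi> \<rho>' - \<pi> \<rho> = ((\<rho>I / \<rho>)\<^sup>2 - (\<rho>I / \<rho>')\<^sup>2) * ((sound_speed \<gamma> s)\<^sup>2 * s\<^sup>2 / \<rho>I\<^sup>2 / 2)"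
proof -
  have "\<exists>c. \<rho> < c \<and> c < \<rho>' \<and> (\<pi> \<rho>' - \<pi> \<rho>) * (2 * \<rho>I\<^sup>2 / c ^ 3) =
     (- ((\<rho>I / \<rho>')\<^sup>2) - - ((\<rho>I / \<rho>)\<^sup>2)) * ((sound_speed \<gamma> c)\<^sup>2 / c)"
  proof (rule GMVT'[OF assms(3)])
    fix z assume "\<rho> \<le> z" "z \<le> \<rho>'"
    then show "isCont \<pi> z" using assms DERIV_isCont[OF DERIV_enthalpy] by simp
    show "isCont (\<lambda>z. - ((\<rho>I / z)\<^sup>2)) z" using \<open>\<rho> \<le> z\<close> assms by (intro continuous_intros) auto
  next
    fix z assume "\<rho> < z" "z < \<rho>'"
    then show "DERIV (\<lambda>z. - ((\<rho>I / z)\<^sup>2)) z :> 2 * \<rho>I\<^sup>2 / z ^ 3"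
      using assms by (auto intro!: derivative_eq_intros simp: field_simps power2_eq_square power3_eq_cube)
    show "DERIV \<pi> z :> (sound_speed \<gamma> z)\<^sup>2 / z" using \<open>\<rho> < z\<close> assms by (intro DERIV_enthalpy) auto
  qed
  then obtain s where s: "\<rho> < s" "s < \<rho>'"
    "(\<pi> \<rho>' - \<pi> \<rho>) * (2 * \<rho>I\<^sup>2 / s ^ 3) = ((\<rho>I / \<rho>)\<^sup>2 - (\<rho>I / \<rho>')\<^sup>2) * ((sound_speed \<gamma> s)\<^sup>2 / s)"
    by auto
  have "0 < s" using s assms by auto
  then have "\<pi> \<rho>' - \<pi> \<rho> = ((\<rho>I / \<rho>)\<^sup>2 - (\<rho>I / \<rho>')\<^sup>2) * ((sound_speed \<gamma> s)\<^sup>2 * s\<^sup>2 / \<rho>I\<^sup>2 / 2)"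
    using s(3) assms(1) by (simp add: divide_simps power2_eq_square power3_eq_cube del: mult_eq_0_iff) (simp add: algebra_simps)?
  then show ?thesis using that s by blast
qed

lemma normal_shock_density: "normal_shock \<rho>I d \<rho> e \<Longrightarrow> \<rho>I < \<rho>"
proof (rule ccontr)
  assume a: "normal_shock \<rho>I d \<rho> e" "\<not> \<rho>I < \<rho>"
  then have "\<rho> * e \<le> \<rho>I * e"
    unfolding normal_shock_def by (intro mult_right_mono) auto
  also have "\<dots> < \<rho>I * d"
    using a unfolding normal_shock_def by (intro mult_strict_left_mono) auto
  finally show False using a unfolding normal_shock_def by linarith
qed

text \<open>Mass conservation gives \<open>e = (\<rho>I / \<rho>) d\<close>, so the enthalpy jump is
  \<open>x d^2 / 2\<close> with \<open>x = 1 - (\<rho>I / \<rho>)^2\<close>. Thus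
  \<open>d^2 / 2\<close> is a chord slope of the enthalpy as a function of \<open>x\<close>, and it
  equals the slope at some intermediate density.\<close>

lemma normal_shock_speed:
  assumes "normal_shock \<rho>I d \<rho> e"
  obtains s where "\<rho>I < s" "s < \<rho>" "d\<^sup>2 = (sound_speed \<gamma> s)\<^sup>2 * s\<^sup>2 / \<rho>I\<^sup>2"
    "\<pi> \<rho> - \<pi> \<rho>I = (1 - (\<rho>I / \<rho>)\<^sup>2) * (d\<^sup>2 / 2)"
proof -
  have a: "0 < \<rho>I" "0 < \<rho>" "0 < e" "e < d" "\<rho>I * d = \<rho> * e" "\<pi> \<rho> - \<pi> \<rho>I = (d\<^sup>2 - e\<^sup>2) / 2"
    using assms unfolding normal_shock_def by auto
  have lt: "\<rho>I < \<rho>" using assms by (rule normal_shock_density)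
  obtain s where s: "\<rho>I < s" "s < \<rho>"
    "\<pi> \<rho> - \<pi> \<rho>I = ((\<rho>I / \<rho>I)\<^sup>2 - (\<rho>I / \<rho>)\<^sup>2) * ((sound_speed \<gamma> s)\<^sup>2 * s\<^sup>2 / \<rho>I\<^sup>2 / 2)"
    using enthalpy_slope[OF a(1) a(1) lt] by blast
  have e: "e = \<rho>I / \<rho> * d" using a by (simp add: field_simps)
  have 1: "\<pi> \<rho> - \<pi> \<rho>I = (1 - (\<rho>I / \<rho>)\<^sup>2) * (d\<^sup>2 / 2)"
    unfolding a(6) e power_mult_distrib by (simp add: algebra_simps)
  have "(\<rho>I / \<rho>)\<^sup>2 < 1" using a lt by (simp add: power_less_one_iff)
  moreover have "(1 - (\<rho>I / \<rho>)\<^sup>2) * (d\<^sup>2 / 2) =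
      (1 - (\<rho>I / \<rho>)\<^sup>2) * ((sound_speed \<gamma> s)\<^sup>2 * s\<^sup>2 / \<rho>I\<^sup>2 / 2)"
    using s(3) 1 a(1) by simp
  ultimately have "d\<^sup>2 / 2 = (sound_speed \<gamma> s)\<^sup>2 * s\<^sup>2 / \<rho>I\<^sup>2 / 2"
    by (metis less_irrefl mult_left_cancel right_minus_eq)
  then show ?thesis using that[OF s(1,2) _ 1] by simp
qed

lemma mass_flux_less:
  assumes "0 < s" "s < s'"
  shows "(sound_speed \<gamma> s)\<^sup>2 * s\<^sup>2 < (sound_speed \<gamma> s')\<^sup>2 * s'\<^sup>2"
  using assms sound_speed_mono[of s s'] sound_speed_pos[of s]
  by (intro mult_le_less_imp_less) (auto intro: power_strict_mono)

text \<open>The squared mass flux through the shock equals \<open>c^2 s^2\<close> at a density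
  \<open>s\<close> below \<rho>, and this quantity increases with the density.\<close>

lemma normal_shock_subsonic:
  assumes "normal_shock \<rho>I d \<rho> e"
  shows "e\<^sup>2 < (sound_speed \<gamma> \<rho>)\<^sup>2"
proof -
  have a: "0 < \<rho>I" "0 < \<rho>" "\<rho>I * d = \<rho> * e"
    using assms unfolding normal_shock_def by auto
  obtain s where s: "\<rho>I < s" "s < \<rho>" "d\<^sup>2 = (sound_speed \<gamma> s)\<^sup>2 * s\<^sup>2 / \<rho>I\<^sup>2"
    using normal_shock_speed[OF assms] by blast
  have "\<rho>\<^sup>2 * e\<^sup>2 = \<rho>I\<^sup>2 * d\<^sup>2" using a(3) by (metis power_mult_distrib)
  also have "\<dots> = (sound_speed \<gamma> s)\<^sup>2 * s\<^sup>2" unfolding s(3) using a(1) by simp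
  also have "\<dots> < \<rho>\<^sup>2 * (sound_speed \<gamma> \<rho>)\<^sup>2"
    using mass_flux_less[of s \<rho>] s a(1) by (simp add: mult.commute)
  finally show ?thesis using a by simp
qed

text \<open>The enthalpy is a strictly convex function of \<open>x = 1 - (\<rho>I / s)^2\<close>, so
  its chord from \<rho>I to \<rho>' is steeper than the one to \<rho>; the slopes are
  \<open>d'^2 / 2\<close> and \<open>d^2 / 2\<close>. The strength
  \<open>d - e = d (1 - \<rho>I / \<rho>)\<close> then has two increasing factors.\<close>

lemma normal_shock_mono_density:
  assumes 1: "normal_shock \<rho>I d \<rho> e" and 2: "normal_shock \<rho>I d' \<rho>' e'" and lt: "\<rho> < \<rho>'"
  shows "d < d'" "d - e < d' - e'"
proof -
  have a: "0 < \<rho>I" "0 < \<rho>" "0 < e" "e < d" "\<rho>I * d = \<rho> * e" and a': "0 < \<rho>'" "0 < e'" "e' < d'" "\<rho>I * d' = \<rho>' * e'"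
    using 1 2 unfolding normal_shock_def by auto
  have \<rho>I: "\<rho>I < \<rho>" using 1 by (rule normal_shock_density)
  obtain s where s: "\<rho>I < s" "s < \<rho>" "d\<^sup>2 = (sound_speed \<gamma> s)\<^sup>2 * s\<^sup>2 / \<rho>I\<^sup>2"
    and p: "\<pi> \<rho> - \<pi> \<rho>I = (1 - (\<rho>I / \<rho>)\<^sup>2) * (d\<^sup>2 / 2)"
    using normal_shock_speed[OF 1] by blast
  have p': "\<pi> \<rho>' - \<pi> \<rho>I = (1 - (\<rho>I / \<rho>')\<^sup>2) * (d'\<^sup>2 / 2)"
    using normal_shock_speed[OF 2] by blast
  obtain s' where s': "\<rho> < s'" "s' < \<rho>'"
    "\<pi> \<rho>' - \<pi> \<rho> = ((\<rho>I / \<rho>)\<^sup>2 - (\<rho>I / \<rho>')\<^sup>2) * ((sound_speed \<gamma> s')\<^sup>2 * s'\<^sup>2 / \<rho>I\<^sup>2 / 2)"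
    using enthalpy_slope[OF a(1,2) lt] by blast
  have x: "0 < (\<rho>I / \<rho>)\<^sup>2 - (\<rho>I / \<rho>')\<^sup>2" "0 < 1 - (\<rho>I / \<rho>')\<^sup>2"
    using a a' lt \<rho>I by (auto intro!: power_strict_mono divide_strict_left_mono simp: power_less_one_iff)
  have "d\<^sup>2 / 2 < (sound_speed \<gamma> s')\<^sup>2 * s'\<^sup>2 / \<rho>I\<^sup>2 / 2"
    unfolding s(3) using mass_flux_less[of s s'] s s' a(1) by (simp add: divide_strict_right_mono)
  then have "((\<rho>I / \<rho>)\<^sup>2 - (\<rho>I / \<rho>')\<^sup>2) * (d\<^sup>2 / 2) < \<pi> \<rho>' - \<pi> \<rho>"
    unfolding s'(3) using x(1) by (rule mult_strict_left_mono)
  then have "(1 - (\<rho>I / \<rho>')\<^sup>2) * (d\<^sup>2 / 2) < (1 - (\<rho>I / \<rho>')\<^sup>2) * (d'\<^sup>2 / 2)"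
    unfolding p'[symmetric] using p by (simp add: left_diff_distrib)
  then have "d\<^sup>2 < d'\<^sup>2" using x(2) by (simp add: mult_less_cancel_left_pos)
  then show d: "d < d'" using a' by (simp add: power2_less_imp_less)
  have "d - e = d * (1 - \<rho>I / \<rho>)" "d' - e' = d' * (1 - \<rho>I / \<rho>')"
    using a a' by (simp_all add: field_simps)
  moreover have "d * (1 - \<rho>I / \<rho>) < d' * (1 - \<rho>I / \<rho>')"
    using a a' lt \<rho>I d by (intro mult_strict_mono diff_strict_left_mono divide_strict_left_mono) auto
  ultimately show "d - e < d' - e'" by simp
qed

text \<open>The speed is strictly increasing in the density, so it determines the density order: a
  smaller \<rho> gives a weaker shock, a larger one contradicts \<open>d < d'\<close>, and equal
  densities would force equal speeds. This compares two shock points with the same normal.\<close>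

lemma normal_shock_strength_less:
  assumes 1: "normal_shock \<rho>I d \<rho> e" and 2: "normal_shock \<rho>I d' \<rho>' e'" and lt: "d < d'"
  shows "d - e < d' - e'"
proof (cases \<rho> \<rho>' rule: linorder_cases)
  case less
  then show ?thesis using normal_shock_mono_density[OF 1 2] by simp
next
  case greater
  then show ?thesis using normal_shock_mono_density[OF 2 1] lt by simp
next
  case equal
  have "\<pi> \<rho> - \<pi> \<rho>I = (1 - (\<rho>I / \<rho>)\<^sup>2) * (d\<^sup>2 / 2)"
    using normal_shock_speed[OF 1] by blast
  moreover have "\<pi> \<rho> - \<pi> \<rho>I = (1 - (\<rho>I / \<rho>)\<^sup>2) * (d'\<^sup>2 / 2)"
    using normal_shock_speed[OF 2] equal by blast
  moreover have "(\<rho>I / \<rho>)\<^sup>2 < 1"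
    using 1 normal_shock_density[OF 1] unfolding normal_shock_def by (simp add: power_less_one_iff)
  ultimately have "d\<^sup>2 = d'\<^sup>2" by simp
  then show ?thesis using lt 1 2 unfolding normal_shock_def by (auto simp: power2_eq_iff)
qed

lemma normal_shock_unique:
  assumes 1: "normal_shock \<rho>I d \<rho> e" and 2: "normal_shock \<rho>I d \<rho>' e'"
  shows "e = e'"
proof -
  have "\<rho> = \<rho>'"
    using normal_shock_mono_density(1)[OF 1 2] normal_shock_mono_density(1)[OF 2 1]
    by (cases \<rho> \<rho>' rule: linorder_cases) auto
  then show ?thesis using 1 2 unfolding normal_shock_def by auto
qed

end

section \<open>Maximum principle and Hopf lemma\<close>

lemma C1_closure_minus_quadratic:
  assumes "C1_closure \<Omega> \<psi> v"
  shows "C1_closure \<Omega> (\<lambda>\<xi>. s * (\<psi> \<xi> - y \<bullet> \<xi>) - m - k * quadratic b K n \<kappa> P \<xi>)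
    (\<lambda>\<xi>. s *\<^sub>R (v \<xi> - y) - k *\<^sub>R quadratic_grad b K n \<kappa> P \<xi>)"
  unfolding C1_closure_def
proof (intro conjI ballI)
  show "continuous_on (closure \<Omega>) (\<lambda>\<xi>. s * (\<psi> \<xi> - y \<bullet> \<xi>) - m - k * quadratic b K n \<kappa> P \<xi>)"
    using assms unfolding C1_closure_def by (intro continuous_intros) auto
  show "continuous_on (closure \<Omega>) (\<lambda>\<xi>. s *\<^sub>R (v \<xi> - y) - k *\<^sub>R quadratic_grad b K n \<kappa> P \<xi>)"
    using assms unfolding C1_closure_def by (intro continuous_intros) auto
  fix \<xi> assume "\<xi> \<in> \<Omega>"
  then have "GDERIV \<psi> \<xi> :> v \<xi>" using assms unfolding C1_closure_def by blast
  then show "GDERIV (\<lambda>\<xi>. s * (\<psi> \<xi> - y \<bullet> \<xi>) - m - k * quadratic b K n \<kappa> P \<xi>) \<xi>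
      :> s *\<^sub>R (v \<xi> - y) - k *\<^sub>R quadratic_grad b K n \<kappa> P \<xi>"
    using GDERIV_quadratic[of b K n \<kappa> P \<xi>] unfolding gderiv_def
    by (auto intro!: derivative_eq_intros ext simp: inner_diff_right inner_commute algebra_simps)
qed

lemma C1_closure_subset: "C1_closure \<Omega> \<psi> v \<Longrightarrow> \<Omega>' \<subseteq> \<Omega> \<Longrightarrow> C1_closure \<Omega>' \<psi> v"
  unfolding C1_closure_def by (meson closure_mono continuous_on_subset subsetD)

lemma eventually_ray_in_open:
  fixes P q :: "'a::real_normed_vector"
  assumes "open \<Omega>" "P \<in> \<Omega>"
  shows "\<forall>\<^sub>F \<epsilon> in at_right 0. P + \<epsilon> *\<^sub>R q \<in> \<Omega>"
proof -
  have "((\<lambda>\<epsilon>::real. P + \<epsilon> *\<^sub>R q) \<longlongrightarrow> P + 0 *\<^sub>R q) (at_right 0)"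
    by (intro tendsto_intros)
  then show ?thesis using topological_tendstoD assms by fastforce
qed

lemma eventually_at_right_0_less: "0 < r \<Longrightarrow> \<forall>\<^sub>F \<epsilon>::real in at_right 0. 0 < \<epsilon> \<and> \<epsilon> < r"
  unfolding eventually_at_right_field by blast

locale elliptic_flow = polytropic_gas +
  fixes E :: "plane set" and \<psi> :: "plane \<Rightarrow> real" and v :: "plane \<Rightarrow> plane"
  assumes open_E: "open E" and C1: "C1_closure E \<psi> v"
    and has_density: "\<And>\<xi>. \<xi> \<in> closure E \<Longrightarrow> has_density \<pi> \<psi> v \<xi>"
    and C2: "C2_potential_flow \<gamma> \<pi> E \<psi> v"
    and subsonic: "\<And>\<xi>. \<xi> \<in> E \<Longrightarrow> pseudo_Mach \<gamma> \<pi> \<psi> v \<xi> < 1"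
begin

abbreviation "c \<equiv> local_sound_speed \<gamma> \<pi> \<psi> v"
abbreviation "z \<equiv> pseudo_velocity v"

lemma continuous_psi: "continuous_on (closure E) \<psi>" and continuous_v: "continuous_on (closure E) v"
  using C1 unfolding C1_closure_def by auto

lemma continuous_z: "continuous_on (closure E) z"
  unfolding pseudo_velocity_def by (intro continuous_intros continuous_v)

lemma density_pos:
  assumes "has_density \<pi> \<psi> v \<xi>"
  shows "0 < density \<pi> \<psi> v \<xi>" "\<pi> (density \<pi> \<psi> v \<xi>) = bernoulli \<psi> v \<xi>"
  using assms unfolding has_density_def density_def by (auto simp: enthalpy_inv_enthalpy)

lemma continuous_density: "continuous_on (closure E) (density \<pi> \<psi> v)"
  unfolding density_def
proof (rule continuous_on_compose2[OF continuous_on_enthalpy_inv])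
  show "continuous_on (closure E) (bernoulli \<psi> v)"
    unfolding bernoulli_def pseudo_potential_def
    by (intro continuous_intros continuous_z continuous_psi) auto
  show "bernoulli \<psi> v ` closure E \<subseteq> \<pi> ` {0<..}"
    using has_density unfolding has_density_def by auto
qed

lemma sound_speed_sq: "\<xi> \<in> closure E \<Longrightarrow> (c \<xi>)\<^sup>2 = \<gamma> * density \<pi> \<psi> v \<xi> powr (\<gamma> - 1)"
  unfolding local_sound_speed_def by (simp add: sound_speed_squared density_pos has_density)

lemma continuous_c2: "continuous_on (closure E) (\<lambda>\<xi>. (c \<xi>)\<^sup>2)"
proof -
  have "continuous_on (closure E) (\<lambda>\<xi>. \<gamma> * density \<pi> \<psi> v \<xi> powr (\<gamma> - 1))"
    using density_pos(1)[OF has_density] by (intro continuous_intros continuous_density) force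
  then show ?thesis by (rule continuous_on_eq) (simp add: sound_speed_sq)
qed

lemma c_pos: "\<xi> \<in> closure E \<Longrightarrow> 0 < c \<xi>"
  unfolding local_sound_speed_def by (simp add: sound_speed_pos density_pos has_density)

lemma z_less_c: "\<xi> \<in> closure E \<Longrightarrow> pseudo_Mach \<gamma> \<pi> \<psi> v \<xi> < 1 \<Longrightarrow> norm (z \<xi>) < c \<xi>"
  using c_pos[of \<xi>] unfolding pseudo_Mach_def by (simp add: pos_divide_less_eq)

lemma z_less_c_E: "\<xi> \<in> E \<Longrightarrow> norm (z \<xi>) < c \<xi>"
  using z_less_c[of \<xi>] subsonic closure_subset by auto

text \<open>
  Ellipticity is only used in the normal direction at \<open>P\<close>, so the flow may be sonic there.
  The parameter \<open>\<kappa>'\<close> admits both boundaries touched by their tangent line and interior circles.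
\<close>

lemma hopf:
  fixes P n y :: plane and s m :: real
  defines "U \<equiv> \<lambda>\<xi>. s * (\<psi> \<xi> - y \<bullet> \<xi>) - m"
  assumes \<Omega>: "open \<Omega>" "\<Omega> \<subseteq> E" and P: "P \<in> closure \<Omega>" "U P = 0"
    and pos: "\<And>\<xi>. \<xi> \<in> \<Omega> \<Longrightarrow> 0 < U \<xi>"
    and n: "norm n = 1" and trans: "(z P \<bullet> n)\<^sup>2 < (c P)\<^sup>2"
    and r': "0 < r'" and b: "0 < b" "0 \<le> \<kappa>'"
    and fr: "\<And>\<xi>. \<xi> \<in> frontier \<Omega> \<Longrightarrow> dist P \<xi> < r' \<Longrightarrow>
        b * ((\<xi> - P) \<bullet> n - \<kappa>' * ((\<xi> - P) \<bullet> (\<xi> - P))) \<le> U \<xi>"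
    and inward: "\<forall>\<^sub>F \<epsilon> in at_right 0. P + \<epsilon> *\<^sub>R n \<in> \<Omega>"
  shows "0 < s * ((v P - y) \<bullet> n)"
proof -
  have cl: "closure \<Omega> \<subseteq> closure E" using \<Omega> by (simp add: closure_mono)
  have nn: "n \<bullet> n = 1" using n by (simp add: norm_eq_1)
  have cU: "continuous_on (closure \<Omega>) U"
    unfolding U_def by (intro continuous_intros continuous_on_subset[OF continuous_psi cl])
  have U_nonneg: "0 \<le> U \<xi>" if "\<xi> \<in> closure \<Omega>" for \<xi>
    by (rule continuous_ge_on_closure[OF cU that]) (use pos in \<open>auto intro: less_imp_le\<close>)
  \<comment> \<open>The coefficient of the operator in the direction \<open>n\<close>. It is
    positive at \<open>P\<close> by \<open>trans\<close>, hence at least \<open>m1\<close> nearby,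
    whether or not the other coefficients degenerate.\<close>
  define A where "A \<xi> = (c \<xi>)\<^sup>2 - (z \<xi> \<bullet> n)\<^sup>2" for \<xi>
  define m1 where "m1 = A P / 2"
  define C where "C = (c P)\<^sup>2 + 1"
  have m1: "0 < m1" and C: "0 < C" using trans unfolding m1_def A_def C_def by (auto simp: add_nonneg_pos)
  have PE: "P \<in> closure E" using P cl by auto
  have "continuous_on (closure E) A"
    unfolding A_def by (intro continuous_intros continuous_c2 continuous_z)
  then obtain r1 where r1: "0 < r1" "\<And>\<xi>. \<xi> \<in> closure E \<Longrightarrow> dist \<xi> P < r1 \<Longrightarrow> dist (A \<xi>) (A P) < m1"
    using PE m1 unfolding continuous_on_iff by meson
  obtain r2 where r2: "0 < r2" "\<And>\<xi>. \<xi> \<in> closure E \<Longrightarrow> dist \<xi> P < r2 \<Longrightarrow> dist ((c \<xi>)\<^sup>2) ((c P)\<^sup>2) < 1"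
    using PE continuous_c2 unfolding continuous_on_iff by (meson zero_less_one)
  \<comment> \<open>With \<open>K H^2 \<le> |H|\<close>, ensured by the choice of \<open>r\<close>,
    a \<kappa> above \<open>2 \<kappa>'\<close> makes the comparison function positive only where
    \<open>H > \<kappa>' |\<xi> - P|^2\<close>, which is where \<open>fr\<close> bounds
    \<open>U\<close> from below by something positive. \<open>K\<close> is so large that the normal
    coefficient outweighs the term with \<kappa>, which makes the comparison function a strict
    subsolution near \<open>P\<close>.\<close>
  define \<kappa> where "\<kappa> = 2 * \<kappa>' + 1"
  define K where "K = 2 * \<kappa> * C / m1 + 1"
  have \<kappa>: "0 < \<kappa>" using b by (simp add: \<kappa>_def)
  have K: "0 < K" "2 * \<kappa> * C < K * m1"
    using \<kappa> C m1 by (auto simp: K_def field_simps intro!: add_pos_pos)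
  define r where "r = min (min r' (min r1 r2)) (1 / K) / 2"
  have r: "0 < r" "r < r'" "r < r1" "r < r2" "K * r \<le> 1"
  proof -
    have "r \<le> 1 / K / 2" unfolding r_def by (intro divide_right_mono min.cobounded2) simp
    then have "K * r \<le> K * (1 / K / 2)" using K(1) by (intro mult_left_mono) auto
    then show "K * r \<le> 1" using K(1) by simp
  qed (use r' r1(1) r2(1) K(1) in \<open>auto simp: r_def min_def\<close>)
  let ?\<phi> = "quadratic n K n (- \<kappa>) P"
  let ?H = "\<lambda>\<xi>. (\<xi> - P) \<bullet> n"
  let ?q = "\<lambda>\<xi>. (\<xi> - P) \<bullet> (\<xi> - P)"
  have \<phi>_eq: "?\<phi> \<xi> = ?H \<xi> + K * (?H \<xi>)\<^sup>2 - \<kappa> * ?q \<xi>" for \<xi>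
    by (simp add: quadratic_def inner_commute)
  have \<phi>_bound: "(?H \<xi> \<le> 0 \<and> ?\<phi> \<xi> \<le> - \<kappa> * ?q \<xi>) \<or>
     (0 < ?H \<xi> \<and> ?\<phi> \<xi> \<le> 2 * (?H \<xi> - \<kappa>' * ?q \<xi>) - ?q \<xi>)" if d: "dist P \<xi> \<le> r" for \<xi>
  proof -
    have "\<bar>?H \<xi>\<bar> \<le> norm (\<xi> - P)" using Cauchy_Schwarz_ineq2[of "\<xi> - P" n] n by simp
    also have "\<dots> \<le> r" using d by (simp add: dist_norm norm_minus_commute)
    finally have "K * \<bar>?H \<xi>\<bar> \<le> 1"
      using K(1) r(5) by (meson mult_left_mono less_imp_le order_trans)
    then have "K * \<bar>?H \<xi>\<bar> * \<bar>?H \<xi>\<bar> \<le> 1 * \<bar>?H \<xi>\<bar>" by (rule mult_right_mono) simp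
    then have "K * (?H \<xi>)\<^sup>2 \<le> \<bar>?H \<xi>\<bar>"
      by (simp add: power2_eq_square mult.assoc flip: abs_mult)
    moreover have "\<kappa> * ?q \<xi> = 2 * (\<kappa>' * ?q \<xi>) + ?q \<xi>"
      unfolding \<kappa>_def by (simp add: distrib_right)
    moreover note \<phi>_eq[of \<xi>] right_diff_distrib[of 2 "?H \<xi>" "\<kappa>' * ?q \<xi>"]
    ultimately have "?H \<xi> \<le> 0 \<Longrightarrow> ?\<phi> \<xi> \<le> - \<kappa> * ?q \<xi>"
      "0 < ?H \<xi> \<Longrightarrow> ?\<phi> \<xi> \<le> 2 * (?H \<xi> - \<kappa>' * ?q \<xi>) - ?q \<xi>"
      by - linarith+
    then show ?thesis by linarith
  qed
  \<comment> \<open>On the sphere the comparison matters only where the comparison function is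
    nonnegative. This cuts off the frontier points at which \<open>U\<close> may vanish, so
    \<open>U\<close> has a positive minimum on the compact set \<open>T\<close>.\<close>
  define T where "T = {\<xi> \<in> closure \<Omega>. dist P \<xi> = r \<and> 0 \<le> ?\<phi> \<xi>}"
  have "T = closure \<Omega> \<inter> sphere P r \<inter> ?\<phi> -` {0..}"
    unfolding T_def by auto
  moreover have "closed (closure \<Omega> \<inter> sphere P r \<inter> ?\<phi> -` {0..})"
    by (rule continuous_closed_preimage) (auto intro: continuous_on_quadratic)
  ultimately have "compact T"
    by (metis bounded_subset bounded_sphere compact_eq_bounded_closed inf.cobounded1 inf.cobounded2 order_trans)
  have posT: "0 < U \<xi>" if "\<xi> \<in> T" for \<xi>
  proof (cases "\<xi> \<in> \<Omega>")
    case False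
    then have fr': "\<xi> \<in> frontier \<Omega>" using that \<Omega>(1) unfolding T_def frontier_def by (simp add: interior_open)
    have q: "?q \<xi> = r\<^sup>2" using that unfolding T_def
      by (simp add: dist_norm norm_minus_commute power2_norm_eq_inner[symmetric])
    then have "0 < \<kappa> * ?q \<xi>" using \<kappa> r by simp
    then have "r\<^sup>2 \<le> 2 * (?H \<xi> - \<kappa>' * ?q \<xi>)"
      using \<phi>_bound[of \<xi>] that q unfolding T_def by auto
    then have "0 < ?H \<xi> - \<kappa>' * ?q \<xi>" using r(1) by (smt (verit) zero_less_power)
    then show ?thesis using fr[OF fr'] that r b unfolding T_def by (smt (verit) mem_Collect_eq mult_pos_pos)
  qed (use pos in auto)
  obtain mT where mT: "0 < mT" "\<And>\<xi>. \<xi> \<in> T \<Longrightarrow> mT \<le> U \<xi>"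
  proof (cases "T = {}")
    case False
    have "continuous_on T U" by (rule continuous_on_subset[OF cU]) (auto simp: T_def)
    then obtain x where "x \<in> T" "\<forall>\<xi>\<in>T. U x \<le> U \<xi>"
      using continuous_attains_inf[OF \<open>compact T\<close> False] by blast
    then show ?thesis using that posT by blast
  qed (use that[of 1] in auto)
  \<comment> \<open>The bound \<open>b / 2\<close> serves on the frontier, where the comparison
    function is at most \<open>2 (H - \<kappa>' |\<xi> - P|^2)\<close>; the other bound serves on
    the sphere, where it is at most \<open>2 r\<close>.\<close>
  define k where "k = min (b / 2) (mT / (2 * r))"
  have k: "0 < k" "k \<le> b / 2" "k * (2 * r) \<le> mT"
    using b mT r unfolding k_def by (auto simp: min_def field_simps)
  have barrier: "k * ?\<phi> \<xi> \<le> U \<xi>" if "\<xi> \<in> closure \<Omega> \<inter> cball P r" for \<xi>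
  proof (rule ccontr)
    assume neg: "\<not> k * ?\<phi> \<xi> \<le> U \<xi>"
    have "compact (closure \<Omega> \<inter> cball P r)" by (simp add: closed_Int_compact)
    moreover have "continuous_on (closure \<Omega> \<inter> cball P r) (\<lambda>\<xi>. U \<xi> - k * ?\<phi> \<xi>)"
      by (intro continuous_intros continuous_on_subset[OF cU]) auto
    moreover have "closure \<Omega> \<inter> cball P r \<noteq> {}" using that by blast
    ultimately obtain X where X': "X \<in> closure \<Omega> \<inter> cball P r"
      and min': "\<forall>\<xi>\<in>closure \<Omega> \<inter> cball P r. U X - k * ?\<phi> X \<le> U \<xi> - k * ?\<phi> \<xi>"
      using continuous_attains_inf[of "closure \<Omega> \<inter> cball P r" "\<lambda>\<xi>. U \<xi> - k * ?\<phi> \<xi>"] by blast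
    have X: "X \<in> closure \<Omega>" "dist P X \<le> r" using X' by auto
    have min: "U X - k * ?\<phi> X \<le> U \<xi> - k * ?\<phi> \<xi>" if "\<xi> \<in> closure \<Omega>" "dist P \<xi> \<le> r" for \<xi>
      using min' that by simp
    have UX: "U X < k * ?\<phi> X" using min[of \<xi>] that neg by auto
    have \<phi>X: "0 < ?\<phi> X" using UX U_nonneg[OF X(1)] k(1) by (smt (verit) mult_nonneg_nonpos)
    have HX: "0 < ?H X" "?\<phi> X \<le> 2 * (?H X - \<kappa>' * ?q X) - ?q X"
      using \<phi>_bound[OF X(2)] \<phi>X \<kappa> by (auto simp: mult_nonneg_nonneg) (smt (verit) inner_ge_zero mult_nonneg_nonneg)+
    consider "dist P X = r" | "dist P X < r" "X \<in> frontier \<Omega>" | "dist P X < r" "X \<in> \<Omega>"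
      using X \<Omega>(1) unfolding frontier_def by (cases "dist P X = r"; cases "X \<in> \<Omega>") (auto simp: interior_open)
    then show False
    proof cases
      case 1
      have "?H X \<le> norm (X - P)" using Cauchy_Schwarz_ineq2[of "X - P" n] n by simp
      then have "?\<phi> X \<le> 2 * r"
        using HX(2) 1 b inner_ge_zero[of "X - P"]
        by (smt (verit) dist_norm norm_minus_commute mult_nonneg_nonneg)
      then have "k * ?\<phi> X \<le> mT" using k by (smt (verit) mult_left_mono)
      moreover have "X \<in> T" unfolding T_def using 1 X \<phi>X by simp
      ultimately show False using mT(2) UX by fastforce
    next
      case 2
      have h: "?\<phi> X \<le> 2 * (?H X - \<kappa>' * ?q X)"
        using HX(2) inner_ge_zero[of "X - P"] by linarith
      then have "k * ?\<phi> X \<le> k * (2 * (?H X - \<kappa>' * ?q X))"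
        using k(1) by (intro mult_left_mono) auto
      also have "\<dots> = 2 * k * (?H X - \<kappa>' * ?q X)" by simp
      also have "\<dots> \<le> b * (?H X - \<kappa>' * ?q X)"
        using k(2) h \<phi>X by (intro mult_right_mono) auto
      also have "\<dots> \<le> U X" using fr 2 r by auto
      finally show False using UX by simp
    next
      case 3
      have "open (\<Omega> \<inter> ball P r)" "X \<in> \<Omega> \<inter> ball P r" using 3 \<Omega>(1) by auto
      then obtain e where e: "0 < e" "ball X e \<subseteq> \<Omega> \<inter> ball P r"
        unfolding open_contains_ball by blast
      have XE: "X \<in> closure E" using X cl by auto
      have "dist (A X) (A P) < m1" "dist ((c X)\<^sup>2) ((c P)\<^sup>2) < 1"
        using r1(2)[OF XE] r2(2)[OF XE] X(2) r by (auto simp: dist_commute)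
      then have AX: "m1 < A X" and cX: "(c X)\<^sup>2 < C"
        unfolding m1_def C_def dist_real_def abs_diff_less_iff by linarith+
      have "2 * (c X)\<^sup>2 - z X \<bullet> z X \<le> 2 * C"
        using cX inner_ge_zero[of "z X"] by linarith
      then have "\<kappa> * (2 * (c X)\<^sup>2 - z X \<bullet> z X) \<le> \<kappa> * (2 * C)"
        using \<kappa> by (intro mult_left_mono) auto
      also have "\<dots> < K * m1" using K(2) by simp
      also have "\<dots> \<le> K * A X" using AX K(1) by simp
      finally have "0 < k * (K * ((c X)\<^sup>2 * (n \<bullet> n) - (z X \<bullet> n)\<^sup>2) + (- \<kappa>) * (2 * (c X)\<^sup>2 - z X \<bullet> z X))"
        using k(1) by (simp add: A_def nn)
      moreover have "s * (\<psi> X - y \<bullet> X) - k * ?\<phi> X \<le> s * (\<psi> \<xi> - y \<bullet> \<xi>) - k * ?\<phi> \<xi>"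
        if "\<xi> \<in> ball X e" for \<xi>
      proof -
        have "\<xi> \<in> \<Omega>" "dist P \<xi> \<le> r" using that e(2) by auto
        then show ?thesis using min[of \<xi>] closure_subset[of \<Omega>] unfolding U_def by fastforce
      qed
      moreover have "norm (z X) < c X" using 3 \<Omega> z_less_c_E by auto
      moreover have "ball X e \<subseteq> E" using e \<Omega> by auto
      ultimately show False
        using elliptic_no_local_min[OF C2 _ e(1) refl refl] by metis
    qed
  qed
  show ?thesis
  proof (rule ccontr)
    assume neg: "\<not> ?thesis"
    \<comment> \<open>Subtracting a linear function of slope \<open>k / 4\<close> turns a derivative
      that is merely nonpositive into a negative one. Then \<open>U < k \<epsilon> / 4\<close> along
      the inward ray, whereas the barrier gives at least \<open>k \<epsilon> / 2\<close>.\<close>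
    let ?f = "\<lambda>\<xi>. s *\<^sub>R (v \<xi> - y) - (k / 4) *\<^sub>R quadratic_grad n 0 n 0 P \<xi>"
    have "?f P \<bullet> n < 0"
      using neg k(1) by (simp add: quadratic_grad_def inner_diff_left nn)
    then have "\<forall>\<^sub>F \<epsilon> in at_right 0. s * (\<psi> (P + \<epsilon> *\<^sub>R n) - y \<bullet> (P + \<epsilon> *\<^sub>R n)) - m - k / 4 * quadratic n 0 n 0 P (P + \<epsilon> *\<^sub>R n)
        < s * (\<psi> P - y \<bullet> P) - m - k / 4 * quadratic n 0 n 0 P P"
      by (intro C1_closure_descent[OF C1_closure_minus_quadratic[OF C1_closure_subset[OF C1 \<Omega>(2)]] P(1) inward])
    then have 1: "\<forall>\<^sub>F \<epsilon> in at_right 0. U (P + \<epsilon> *\<^sub>R n) < k / 4 * \<epsilon>"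
      by (rule eventually_mono) (use P(2) in \<open>simp add: U_def quadratic_def nn\<close>)
    have 2: "\<forall>\<^sub>F \<epsilon> in at_right 0. 0 < \<epsilon> \<and> \<epsilon> < min r (1 / (2 * \<kappa>))"
      by (rule eventually_at_right_0_less) (use r(1) \<kappa> in simp)
    have "\<forall>\<^sub>F \<epsilon>::real in at_right 0. False"
      using 1 2 inward
    proof eventually_elim
      case (elim \<epsilon>)
      have "P + \<epsilon> *\<^sub>R n \<in> closure \<Omega> \<inter> cball P r"
        using elim closure_subset n by (auto simp: dist_norm)
      from barrier[OF this] have "k * (\<epsilon> + K * \<epsilon>\<^sup>2 - \<kappa> * \<epsilon>\<^sup>2) \<le> U (P + \<epsilon> *\<^sub>R n)"
        by (simp add: \<phi>_eq nn power2_eq_square)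
      moreover have "\<epsilon> / 2 \<le> \<epsilon> + K * \<epsilon>\<^sup>2 - \<kappa> * \<epsilon>\<^sup>2"
      proof -
        have "\<kappa> * \<epsilon> \<le> 1 / 2" using elim \<kappa> by (simp add: field_simps)
        then have "\<kappa> * \<epsilon> * \<epsilon> \<le> 1 / 2 * \<epsilon>" using elim by (intro mult_right_mono) auto
        moreover have "0 \<le> K * \<epsilon>\<^sup>2" using K by simp
        ultimately show ?thesis by (simp add: power2_eq_square)
      qed
      ultimately have "k * (\<epsilon> / 2) \<le> U (P + \<epsilon> *\<^sub>R n)"
        using k(1) by (smt (verit) mult_left_mono)
      moreover have "0 < k * \<epsilon>" using k(1) elim(2) by simp
      ultimately show False using elim(1) by simp
    qed
    then show False by simp
  qed
qed

text \<open>A ball on which \<open>U\<close> is positive touches the zero set at a point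
  \<open>P\<close> of \<open>C\<close>. Hopf's lemma gives \<open>U\<close> a nonzero derivative at
  \<open>P\<close>, so \<open>U\<close> would be negative on the far side of
  \<open>P\<close>.\<close>

lemma strong_minimum_principle:
  fixes y :: plane and s m :: real
  defines "U \<equiv> \<lambda>\<xi>. s * (\<psi> \<xi> - y \<bullet> \<xi>) - m"
  assumes C: "open C" "connected C" "C \<subseteq> E" and nonneg: "\<And>\<xi>. \<xi> \<in> C \<Longrightarrow> 0 \<le> U \<xi>"
    and X: "X \<in> C" "U X = 0" and \<xi>: "\<xi> \<in> C"
  shows "U \<xi> = 0"
proof (rule ccontr)
  assume "U \<xi> \<noteq> 0"
  define Z where "Z = {\<xi> \<in> C. U \<xi> = 0}"
  have cU: "continuous_on C U"
    unfolding U_def using C closure_subset[of E]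
    by (intro continuous_intros continuous_on_subset[OF continuous_psi]) auto
  have "C \<inter> frontier Z \<noteq> {}"
    using connected_Int_frontier[OF C(2), of Z] X \<xi> \<open>U \<xi> \<noteq> 0\<close> unfolding Z_def by auto
  then obtain P0 where P0: "P0 \<in> C" "P0 \<in> frontier Z" by auto
  have UP0: "U P0 = 0"
  proof -
    obtain x where "\<And>n. x n \<in> Z" "x \<longlonglongrightarrow> P0"
      using P0(2) unfolding frontier_def Diff_iff closure_sequential by blast
    then have "(\<lambda>n. U (x n)) \<longlonglongrightarrow> U P0"
      by (intro continuous_on_tendsto_compose[OF cU _ P0(1)]) (auto simp: Z_def)
    moreover have "(\<lambda>n. U (x n)) = (\<lambda>_. 0)" using \<open>\<And>n. x n \<in> Z\<close> unfolding Z_def by auto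
    ultimately show ?thesis using LIMSEQ_unique tendsto_const by metis
  qed
  obtain \<epsilon> where \<epsilon>: "0 < \<epsilon>" "ball P0 \<epsilon> \<subseteq> C" using C(1) P0(1) open_contains_ball by blast
  have "\<not> ball P0 (\<epsilon> / 2) \<subseteq> Z"
    using P0(2) half_gt_zero[OF \<epsilon>(1)] unfolding frontier_def Diff_iff mem_interior by blast
  \<comment> \<open>Within half the distance, the closed ball about \<open>x0\<close> through
    \<open>P0\<close> still lies in \<open>C\<close>, so the zero nearest to \<open>x0\<close> is
    found inside \<open>C\<close>.\<close>
  then obtain x0 where x0: "dist P0 x0 < \<epsilon> / 2" "x0 \<notin> Z" by (meson mem_ball subsetI)
  have sub: "cball x0 (dist x0 P0) \<subseteq> C"
  proof
    fix x assume "x \<in> cball x0 (dist x0 P0)"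
    then have "dist P0 x < \<epsilon>" using x0 dist_triangle[of P0 x x0] by (simp add: dist_commute)
    then show "x \<in> C" using \<epsilon> by auto
  qed
  define Q where "Q = cball x0 (dist x0 P0) \<inter> U -` {0}"
  have "closed Q" unfolding Q_def
    by (rule continuous_closed_preimage[OF continuous_on_subset[OF cU sub]]) auto
  moreover have "P0 \<in> Q" unfolding Q_def using UP0 by simp
  ultimately obtain P where P: "P \<in> Q" "\<And>x. x \<in> Q \<Longrightarrow> dist x0 P \<le> dist x0 x"
    using distance_attains_inf[of Q x0] by auto
  define R where "R = dist x0 P"
  have PC: "P \<in> C" "U P = 0" using P sub unfolding Q_def by auto
  have "x0 \<noteq> P" using x0(2) PC unfolding Z_def by auto
  then have R: "0 < R" "R \<le> dist x0 P0" using P(1) unfolding R_def Q_def by auto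
  have ball: "ball x0 R \<subseteq> C" using sub R by (meson ball_subset_cball order_trans subset_cball)
  define n where "n = (x0 - P) /\<^sub>R R"
  have n: "norm n = 1" using R unfolding n_def R_def by (simp add: dist_norm)
  have x0P: "x0 = P + R *\<^sub>R n" using R unfolding n_def by simp
  have posball: "0 < U \<xi>" if "\<xi> \<in> ball x0 R" for \<xi>
  proof -
    have "\<xi> \<notin> Q" using P(2)[of \<xi>] that unfolding R_def by auto
    then show ?thesis using that R nonneg[of \<xi>] ball unfolding Q_def by fastforce
  qed
  have "0 < s * ((v P - y) \<bullet> n)"
  \<comment> \<open>With this \<open>\<kappa>'\<close> the frontier condition is exact: on the
    circle of radius \<open>R\<close> through \<open>P\<close> the height above the tangent line at
    \<open>P\<close> equals \<open>|\<xi> - P|^2 / (2 R)\<close>.\<close>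
  proof (rule hopf[where \<Omega> = "ball x0 R" and m = m and r' = 1 and b = 1 and \<kappa>' = "1 / (2 * R)"])
    show "ball x0 R \<subseteq> E" using ball C by auto
    show "P \<in> closure (ball x0 R)" using R by (simp add: R_def)
    show "s * (\<psi> P - y \<bullet> P) - m = 0" using PC unfolding U_def by simp
    show "0 < s * (\<psi> \<xi> - y \<bullet> \<xi>) - m" if "\<xi> \<in> ball x0 R" for \<xi>
      using posball[OF that] unfolding U_def .
    have "\<bar>z P \<bullet> n\<bar> \<le> norm (z P)" using Cauchy_Schwarz_ineq2[of "z P" n] n by simp
    also have "\<dots> < c P" using z_less_c_E PC C by auto
    finally show "(z P \<bullet> n)\<^sup>2 < (c P)\<^sup>2" by (metis abs_ge_zero power2_abs power_strict_mono zero_less_numeral)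
    show "1 * ((\<xi> - P) \<bullet> n - 1 / (2 * R) * ((\<xi> - P) \<bullet> (\<xi> - P))) \<le> s * (\<psi> \<xi> - y \<bullet> \<xi>) - m"
      if "\<xi> \<in> frontier (ball x0 R)" for \<xi>
    proof -
      have \<xi>: "dist x0 \<xi> = R" using that R by simp
      have "0 \<le> U \<xi>" by (rule nonneg) (use sub R \<xi> in auto)
      moreover have "(\<xi> - P) \<bullet> n - 1 / (2 * R) * ((\<xi> - P) \<bullet> (\<xi> - P)) = 0"
      proof -
        have "R\<^sup>2 = (\<xi> - P - R *\<^sub>R n) \<bullet> (\<xi> - P - R *\<^sub>R n)"
          using \<xi> unfolding x0P dist_norm by (metis norm_minus_commute diff_diff_eq power2_norm_eq_inner)
        also have "\<dots> = (\<xi> - P) \<bullet> (\<xi> - P) - 2 * R * ((\<xi> - P) \<bullet> n) + R\<^sup>2 * (n \<bullet> n)"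
          unfolding inner_diff_left[of "\<xi> - P"] inner_diff_right[of _ "\<xi> - P"]
          by (simp add: inner_commute power2_eq_square)
        finally show ?thesis using n R by (simp add: norm_eq_1 field_simps)
      qed
      ultimately show ?thesis unfolding U_def by simp
    qed
    from eventually_at_right_0_less[OF R(1)] show "\<forall>\<^sub>F \<epsilon> in at_right 0. P + \<epsilon> *\<^sub>R n \<in> ball x0 R"
    proof eventually_elim
      case (elim \<epsilon>)
      have "dist x0 (P + \<epsilon> *\<^sub>R n) = norm ((R - \<epsilon>) *\<^sub>R n)" unfolding x0P dist_norm by (simp add: algebra_simps)
      then show ?case using elim n by simp
    qed
  qed (use R n in auto)
  then have "(s *\<^sub>R (v P - y) - 0 *\<^sub>R quadratic_grad n 0 n 0 P P) \<bullet> (- n) < 0"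
    by (simp add: inner_diff_left)
  from C1_closure_descent[where X = P and q = "- n",
      OF C1_closure_minus_quadratic[OF C1, where s = s and y = y and m = m and k = 0] _ _ this]
  have "\<forall>\<^sub>F \<epsilon> in at_right 0. U (P + \<epsilon> *\<^sub>R (- n)) < U P"
    using PC C eventually_ray_in_open[OF open_E, of P "- n"] closure_subset[of E] unfolding U_def by fastforce
  moreover have "\<forall>\<^sub>F \<epsilon> in at_right 0. P + \<epsilon> *\<^sub>R (- n) \<in> C"
    by (rule eventually_ray_in_open[OF C(1) PC(1)])
  ultimately have "\<forall>\<^sub>F \<epsilon>::real in at_right 0. False"
    by eventually_elim (use nonneg PC in fastforce)
  then show False by simp
qed

end

section \<open>Boundary curves\<close>

lemma C1_curve_derivative:
  assumes "C1_curve J \<sigma>" "t \<in> J"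
  shows "(\<sigma> has_vector_derivative tangent J \<sigma> t) (at t within J)"
  using assms unfolding C1_curve_def by (simp add: vector_derivative_works[symmetric])

lemma C1_curve_continuous: "C1_curve J \<sigma> \<Longrightarrow> continuous_on J \<sigma>"
  unfolding C1_curve_def by (simp add: differentiable_imp_continuous_on differentiable_on_def)

text \<open>The estimate compares two arbitrary points near \<open>t0\<close>, not only one point
  with \<open>\<sigma> t0\<close>: all short chords are nearly parallel to the tangent at
  \<open>t0\<close>. It is the mean value inequality for \<open>\<sigma>\<close> minus its linear
  part.\<close>

lemma C1_curve_strictly_differentiable:
  assumes C1: "C1_curve J \<sigma>" and J: "convex J" and t0: "t0 \<in> J" and \<eta>: "0 < \<eta>"
  obtains \<delta> where "0 < \<delta>"
    "\<And>t t'. \<lbrakk>t \<in> J; t' \<in> J; \<bar>t - t0\<bar> < \<delta>; \<bar>t' - t0\<bar> < \<delta>\<rbrakk> \<Longrightarrow>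
       norm (\<sigma> t' - \<sigma> t - (t' - t) *\<^sub>R tangent J \<sigma> t0) \<le> \<eta> * \<bar>t' - t\<bar>"
proof -
  let ?w = "tangent J \<sigma> t0"
  have "continuous_on J (tangent J \<sigma>)" using C1 unfolding C1_curve_def by auto
  then obtain \<delta> where \<delta>: "0 < \<delta>" "\<And>t. t \<in> J \<Longrightarrow> dist t t0 < \<delta> \<Longrightarrow> dist (tangent J \<sigma> t) ?w < \<eta>"
    using t0 \<eta> unfolding continuous_on_iff by meson
  let ?S = "J \<inter> ball t0 \<delta>"
  have S: "convex ?S" using J by (intro convex_Int) auto
  have "norm (\<sigma> t' - \<sigma> t - (t' - t) *\<^sub>R ?w) \<le> \<eta> * \<bar>t' - t\<bar>"
    if t: "t \<in> J" "t' \<in> J" "\<bar>t - t0\<bar> < \<delta>" "\<bar>t' - t0\<bar> < \<delta>" for t t'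
  proof -
    have "norm ((\<sigma> t' - t' *\<^sub>R ?w) - (\<sigma> t - t *\<^sub>R ?w)) \<le> \<eta> * norm (t' - t)"
    proof (rule differentiable_bound[OF S, where f' = "\<lambda>x h. h *\<^sub>R (tangent J \<sigma> x - ?w)"])
      fix x assume x: "x \<in> ?S"
      have "(\<sigma> has_derivative (\<lambda>h. h *\<^sub>R tangent J \<sigma> x)) (at x within ?S)"
        using has_derivative_subset[OF C1_curve_derivative[OF C1, of x, unfolded has_vector_derivative_def]] x by blast
      then show "((\<lambda>x. \<sigma> x - x *\<^sub>R ?w) has_derivative (\<lambda>h. h *\<^sub>R (tangent J \<sigma> x - ?w))) (at x within ?S)"
        by (auto intro!: derivative_eq_intros simp: scaleR_diff_right)
      have "norm (tangent J \<sigma> x - ?w) \<le> \<eta>"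
      proof -
        have "dist x t0 < \<delta>" using x by (simp add: dist_commute)
        then show ?thesis using \<delta>(2)[of x] x by (simp add: dist_norm)
      qed
      then show "onorm (\<lambda>h. h *\<^sub>R (tangent J \<sigma> x - ?w)) \<le> \<eta>"
        by (intro onorm_le) (use mult_left_mono in \<open>fastforce simp: mult.commute[of \<eta>]\<close>)
    qed (use t in \<open>auto simp: dist_real_def\<close>)
    then show ?thesis by (simp add: algebra_simps)
  qed
  then show ?thesis using that \<delta>(1) by blast
qed

text \<open>Continuity of the inverse of \<sigma>: the curve does not return to a neighbourhood of
  an earlier point. Injectivity alone does not give this on the noncompact parameter range of the
  wedge shock.\<close>

definition proper_curve :: "real set \<Rightarrow> (real \<Rightarrow> plane) \<Rightarrow> bool" where
  "proper_curve J \<sigma> \<longleftrightarrow> (\<forall>t0\<in>J. \<forall>\<delta>>0. \<exists>\<epsilon>>0. \<forall>t\<in>J. \<delta> \<le> \<bar>t - t0\<bar> \<longrightarrow> \<epsilon> \<le> dist (\<sigma> t0) (\<sigma> t))"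

text \<open>Bounded pieces of the curve have bounded parameter sets, so near any point only a
  compact parameter set matters and \<sigma> is a closed map. The image of the parameters at
  distance at least \<delta> from \<open>t0\<close> is then closed and, by injectivity, misses
  \<open>\<sigma> t0\<close>.\<close>

lemma proper_curveI:
  assumes C1: "C1_curve J \<sigma>" and J: "closed J" and bdd: "\<And>R. bounded {t \<in> J. norm (\<sigma> t) \<le> R}"
  shows "proper_curve J \<sigma>" "closed (\<sigma> ` J)"
proof -
  have cont: "continuous_on J \<sigma>" using C1 by (rule C1_curve_continuous)
  have *: "closed (\<sigma> ` K)" if K: "K \<subseteq> J" "closed K" for K
  proof -
    have "\<exists>e>0. ball x e \<subseteq> - (\<sigma> ` K)" if x: "x \<notin> \<sigma> ` K" for x
    proof -
      let ?T = "K \<inter> closure {t \<in> J. norm (\<sigma> t) \<le> norm x + 1}"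
      have "compact ?T" using K bdd by (auto simp: compact_eq_bounded_closed bounded_Int)
      then have "compact (\<sigma> ` ?T)"
        by (rule compact_continuous_image[rotated]) (use K in \<open>auto intro: continuous_on_subset[OF cont]\<close>)
      then have "open (- \<sigma> ` ?T)" by (simp add: compact_imp_closed open_Compl)
      then obtain e where e: "0 < e" "ball x e \<subseteq> - \<sigma> ` ?T"
        using x unfolding open_contains_ball by blast
      have "ball x (min e 1) \<subseteq> - (\<sigma> ` K)"
      proof
        fix y assume y: "y \<in> ball x (min e 1)"
        show "y \<in> - \<sigma> ` K"
        proof
          assume "y \<in> \<sigma> ` K"
          then obtain t where t: "t \<in> K" "y = \<sigma> t" by auto
          have "norm (\<sigma> t) \<le> norm x + 1"
            using y t norm_triangle_ineq2[of y x] by (simp add: dist_norm norm_minus_commute)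
          then have "t \<in> ?T" using t K closure_subset[of "{t \<in> J. norm (\<sigma> t) \<le> norm x + 1}"] by auto
          then show False using e(2) y t by auto
        qed
      qed
      then show ?thesis using e(1) by (intro exI[of _ "min e 1"]) auto
    qed
    then show ?thesis unfolding closed_def open_contains_ball by blast
  qed
  show "closed (\<sigma> ` J)" by (rule *) (use J in auto)
  show "proper_curve J \<sigma>" unfolding proper_curve_def
  proof (intro ballI allI impI)
    fix t0 \<delta> :: real assume t0: "t0 \<in> J" and \<delta>: "0 < \<delta>"
    let ?K = "J - ball t0 \<delta>"
    have "closed (\<sigma> ` ?K)" by (rule *) (use J in \<open>auto simp: closed_Diff\<close>)
    moreover have "\<sigma> t0 \<notin> \<sigma> ` ?K"
      using C1 t0 \<delta> unfolding C1_curve_def inj_on_def by force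
    ultimately obtain \<epsilon> where \<epsilon>: "0 < \<epsilon>" "ball (\<sigma> t0) \<epsilon> \<subseteq> - \<sigma> ` ?K"
      by (metis ComplI open_Compl open_contains_ball)
    have "\<epsilon> \<le> dist (\<sigma> t0) (\<sigma> t)" if "t \<in> J" "\<delta> \<le> \<bar>t - t0\<bar>" for t
    proof (rule ccontr)
      assume "\<not> ?thesis"
      then have "\<sigma> t \<in> ball (\<sigma> t0) \<epsilon>" by simp
      moreover have "t \<in> ?K" using that by (simp add: dist_real_def abs_minus_commute)
      ultimately show False using \<epsilon>(2) by blast
    qed
    then show "\<exists>\<epsilon>>0. \<forall>t\<in>J. \<delta> \<le> \<bar>t - t0\<bar> \<longrightarrow> \<epsilon> \<le> dist (\<sigma> t0) (\<sigma> t)" using \<epsilon>(1) by blast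
  qed
qed

lemma connected_subset_if_disjoint_frontier:
  assumes "connected C" "C \<inter> \<Omega> \<noteq> {}" "C \<inter> frontier \<Omega> = {}"
  shows "C \<subseteq> \<Omega>"
  using connected_Int_frontier[of C \<Omega>] assms by blast

text \<open>The tube is connected and meets \<Omega>, so only the frontier could stop it. The set
  \<open>Z\<close> is too far away, and the curve is not hit again: short chords are nearly parallel
  to the tangent at \<open>t0\<close>, while the displacement \<open>s *\<^sub>R m\<close> is
  orthogonal to it.\<close>

lemma curve_tube:
  assumes C1: "C1_curve J \<sigma>" and J: "convex J" and proper: "proper_curve J \<sigma>" and t0: "t0 \<in> interior J"
    and Z: "closed Z" "\<sigma> t0 \<notin> Z" and fr: "frontier \<Omega> \<subseteq> \<sigma> ` J \<union> Z"
    and m: "m \<bullet> tangent J \<sigma> t0 = 0" "m \<noteq> 0" and ev: "\<forall>\<^sub>F s in at_right 0. \<sigma> t0 + s *\<^sub>R m \<in> \<Omega>"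
  obtains \<delta> where "0 < \<delta>" "\<And>t s. \<lbrakk>\<bar>t - t0\<bar> < \<delta>; 0 < s; s < \<delta>\<rbrakk> \<Longrightarrow> t \<in> J \<and> \<sigma> t + s *\<^sub>R m \<in> \<Omega>"
proof -
  let ?w = "tangent J \<sigma> t0"
  have t0J: "t0 \<in> J" using t0 interior_subset by auto
  then have w: "0 < norm ?w" using C1 unfolding C1_curve_def by simp
  obtain \<delta>1 where \<delta>1: "0 < \<delta>1"
    "\<And>t t'. \<lbrakk>t \<in> J; t' \<in> J; \<bar>t - t0\<bar> < \<delta>1; \<bar>t' - t0\<bar> < \<delta>1\<rbrakk> \<Longrightarrow>
       norm (\<sigma> t' - \<sigma> t - (t' - t) *\<^sub>R ?w) \<le> norm ?w / 2 * \<bar>t' - t\<bar>"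
    using C1_curve_strictly_differentiable[OF C1 J t0J, of "norm ?w / 2"] w by auto
  obtain \<epsilon>1 where \<epsilon>1: "0 < \<epsilon>1" "\<And>t. t \<in> J \<Longrightarrow> \<delta>1 \<le> \<bar>t - t0\<bar> \<Longrightarrow> \<epsilon>1 \<le> dist (\<sigma> t0) (\<sigma> t)"
    using proper t0J \<delta>1(1) unfolding proper_curve_def by meson
  obtain \<epsilon>2 where \<epsilon>2: "0 < \<epsilon>2" "ball (\<sigma> t0) \<epsilon>2 \<subseteq> - Z"
    using Z by (metis ComplI open_Compl open_contains_ball)
  obtain \<delta>2 where \<delta>2: "0 < \<delta>2" "ball t0 \<delta>2 \<subseteq> J"
    using t0 unfolding mem_interior by auto
  obtain \<delta>3 where \<delta>3: "0 < \<delta>3" "\<And>s. 0 < s \<Longrightarrow> s < \<delta>3 \<Longrightarrow> \<sigma> t0 + s *\<^sub>R m \<in> \<Omega>"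
    using ev unfolding eventually_at_right_field by auto
  \<comment> \<open>Points of the tube with both parameters below \<delta> lie within
    \<open>\<delta> * B\<close> of \<open>\<sigma> t0\<close>: the curve contributes at most
    \<open>2 * norm ?w * \<delta>\<close>, the shift at most
    \<open>norm m * \<delta>\<close>.\<close>
  define B where "B = 2 * norm ?w + norm m + 1"
  have B: "0 < B" unfolding B_def by (intro add_nonneg_pos) auto
  define \<delta> where "\<delta> = min (min \<delta>1 \<delta>2) (min \<delta>3 (min \<epsilon>1 \<epsilon>2 / B))"
  have \<delta>: "0 < \<delta>" "\<delta> \<le> \<delta>1" "\<delta> \<le> \<delta>2" "\<delta> \<le> \<delta>3" "\<delta> * B \<le> min \<epsilon>1 \<epsilon>2"
  proof -
    have "\<delta> \<le> min \<epsilon>1 \<epsilon>2 / B" unfolding \<delta>_def by simp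
    then show "\<delta> * B \<le> min \<epsilon>1 \<epsilon>2" using B by (simp add: pos_le_divide_eq)
  qed (use \<delta>1(1) \<delta>2(1) \<delta>3(1) \<epsilon>1(1) \<epsilon>2(1) B in \<open>auto simp: \<delta>_def\<close>)
  have inJ: "t \<in> J" if "\<bar>t - t0\<bar> < \<delta>" for t
    using \<delta>2(2) that \<delta>(3) by (auto simp: dist_real_def)
  have close: "dist (\<sigma> t0) (\<sigma> t + s *\<^sub>R m) < min \<epsilon>1 \<epsilon>2" if "\<bar>t - t0\<bar> < \<delta>" "0 < s" "s < \<delta>" for t s
  proof -
    have "norm (\<sigma> t - \<sigma> t0 - (t - t0) *\<^sub>R ?w) \<le> norm ?w / 2 * \<bar>t - t0\<bar>"
      using \<delta>1(2)[of t0 t] inJ[OF that(1)] t0J that \<delta> \<delta>1(1) by auto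
    moreover have "norm (\<sigma> t - \<sigma> t0) \<le> norm ((t - t0) *\<^sub>R ?w) + norm (\<sigma> t - \<sigma> t0 - (t - t0) *\<^sub>R ?w)"
      by (rule norm_triangle_sub)
    moreover have "norm ((t - t0) *\<^sub>R ?w) = norm ?w * \<bar>t - t0\<bar>" "0 \<le> norm ?w * \<bar>t - t0\<bar>"
      by simp_all
    ultimately have "norm (\<sigma> t - \<sigma> t0) \<le> 2 * norm ?w * \<bar>t - t0\<bar>" by linarith
    also have "\<dots> \<le> 2 * norm ?w * \<delta>" using that by (intro mult_left_mono) auto
    finally have "norm (\<sigma> t + s *\<^sub>R m - \<sigma> t0) \<le> 2 * norm ?w * \<delta> + s * norm m"
      using norm_triangle_ineq[of "\<sigma> t - \<sigma> t0" "s *\<^sub>R m"] that by (simp add: algebra_simps)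
    also have "\<dots> \<le> 2 * norm ?w * \<delta> + \<delta> * norm m"
      using that by (intro add_left_mono mult_right_mono) auto
    also have "\<dots> < \<delta> * B" unfolding B_def using \<delta>(1) by (simp add: algebra_simps)
    finally show ?thesis using \<delta>(5) by (simp add: dist_norm norm_minus_commute)
  qed
  let ?R = "(\<lambda>(t, s). \<sigma> t + s *\<^sub>R m) ` ({t0 - \<delta><..<t0 + \<delta>} \<times> {0<..<\<delta>})"
  have "?R \<subseteq> \<Omega>"
  proof (rule connected_subset_if_disjoint_frontier)
    have "continuous_on ({t0 - \<delta><..<t0 + \<delta>} \<times> {0<..<\<delta>}) (\<lambda>(t, s). \<sigma> t + s *\<^sub>R m)"
      unfolding case_prod_beta
      by (intro continuous_intros continuous_on_compose2[OF C1_curve_continuous[OF C1], where f = fst])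
        (auto intro!: inJ)
    then show "connected ?R"
      by (rule connected_continuous_image) (intro convex_connected convex_Times convex_real_interval)
    have "\<sigma> t0 + (\<delta> / 2) *\<^sub>R m \<in> \<Omega>" using \<delta>3(2)[of "\<delta> / 2"] \<delta> by simp
    moreover have "\<sigma> t0 + (\<delta> / 2) *\<^sub>R m \<in> ?R"
      using \<delta>(1) by (intro image_eqI[of _ _ "(t0, \<delta> / 2)"]) auto
    ultimately show "?R \<inter> \<Omega> \<noteq> {}" by blast
    have "\<sigma> t + s *\<^sub>R m \<notin> frontier \<Omega>" if ts: "\<bar>t - t0\<bar> < \<delta>" "0 < s" "s < \<delta>" for t s
    proof
      assume "\<sigma> t + s *\<^sub>R m \<in> frontier \<Omega>"
      moreover have "\<sigma> t + s *\<^sub>R m \<notin> Z" using close[OF ts] \<epsilon>2(2) by auto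
      ultimately obtain t' where t': "t' \<in> J" "\<sigma> t + s *\<^sub>R m = \<sigma> t'" using fr by auto
      have "\<bar>t' - t0\<bar> < \<delta>1" using close[OF ts] \<epsilon>1(2)[OF t'(1)] t'(2) by force
      then have "norm (\<sigma> t' - \<sigma> t - (t' - t) *\<^sub>R ?w) \<le> norm ?w / 2 * \<bar>t' - t\<bar>"
        using \<delta>1(2)[of t t'] inJ[OF ts(1)] t' ts \<delta> by auto
      then have n: "norm (s *\<^sub>R m - (t' - t) *\<^sub>R ?w) \<le> norm ?w / 2 * \<bar>t' - t\<bar>"
        using t'(2) by (metis add_diff_cancel_left')
      have "\<bar>(s *\<^sub>R m - (t' - t) *\<^sub>R ?w) \<bullet> ?w\<bar> \<le> norm ?w / 2 * \<bar>t' - t\<bar> * norm ?w"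
        by (rule order_trans[OF Cauchy_Schwarz_ineq2 mult_right_mono[OF n]]) simp
      moreover have "(s *\<^sub>R m - (t' - t) *\<^sub>R ?w) \<bullet> ?w = - ((t' - t) * (norm ?w * norm ?w))"
        using m(1) by (simp add: inner_diff_left norm_eq_sqrt_inner)
      ultimately have "\<bar>t' - t\<bar> * (norm ?w * norm ?w) \<le> \<bar>t' - t\<bar> * (norm ?w * norm ?w) / 2"
        by (simp add: abs_mult mult_ac)
      then have "\<bar>t' - t\<bar> * (norm ?w * norm ?w) \<le> 0" by simp
      then have "t' = t" using w by (simp add: mult_le_0_iff)
      then show False using t'(2) ts m(2) by simp
    qed
    then show "?R \<inter> frontier \<Omega> = {}" by (force simp: abs_less_iff)
  qed
  then have "t \<in> J \<and> \<sigma> t + s *\<^sub>R m \<in> \<Omega>" if "\<bar>t - t0\<bar> < \<delta>" "0 < s" "s < \<delta>" for t s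
    using that inJ by (force simp: abs_less_iff)
  then show ?thesis using that \<delta>(1) by blast
qed

text \<open>
  The boundary values of \<open>F\<close> are differentiated by shifting the curve into \<open>\<Omega>\<close>: \<open>F\<close> itself
  is only assumed differentiable in the open set.
\<close>

lemma C1_closure_along_boundary_curve:
  assumes C1F: "C1_closure \<Omega> F f" and C1: "C1_curve J \<sigma>" and J: "convex J" and proper: "proper_curve J \<sigma>"
    and t0: "t0 \<in> interior J"
    and Z: "closed Z" "\<sigma> t0 \<notin> Z" and fr: "frontier \<Omega> \<subseteq> \<sigma> ` J \<union> Z"
    and m: "m \<bullet> tangent J \<sigma> t0 = 0" "m \<noteq> 0" and ev: "\<forall>\<^sub>F s in at_right 0. \<sigma> t0 + s *\<^sub>R m \<in> \<Omega>"
  shows "((\<lambda>t. F (\<sigma> t)) has_real_derivative f (\<sigma> t0) \<bullet> tangent J \<sigma> t0) (at t0)"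
proof -
  obtain \<delta>0 where \<delta>0: "0 < \<delta>0"
    "\<And>t s. \<lbrakk>\<bar>t - t0\<bar> < \<delta>0; 0 < s; s < \<delta>0\<rbrakk> \<Longrightarrow> t \<in> J \<and> \<sigma> t + s *\<^sub>R m \<in> \<Omega>"
    by (rule curve_tube[OF C1 J proper t0 Z fr m ev]) blast
  have inJ: "t \<in> J" if "\<bar>t - t0\<bar> < \<delta>0" for t
    using \<delta>0(2)[OF that, of "\<delta>0 / 2"] \<delta>0(1) by simp
  have cF: "continuous_on (closure \<Omega>) F" and cf: "continuous_on (closure \<Omega>) f"
    and F: "\<And>\<xi>. \<xi> \<in> \<Omega> \<Longrightarrow> GDERIV F \<xi> :> f \<xi>"
    using C1F unfolding C1_closure_def by auto
  define T where "T = tangent J \<sigma>"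
  let ?L = "f (\<sigma> t0) \<bullet> T t0"
  have \<sigma>': "(\<sigma> has_vector_derivative T t) (at t)" if "\<bar>t - t0\<bar> < \<delta>0" for t
  proof -
    have "ball t0 \<delta>0 \<subseteq> J"
      using inJ by (auto simp: dist_real_def abs_minus_commute)
    moreover have "t \<in> ball t0 \<delta>0" using that by (simp add: dist_real_def abs_minus_commute)
    ultimately have at: "at t within J = at t"
      by (meson at_within_interior interiorI open_ball)
    have "(\<sigma> has_vector_derivative T t) (at t within J)"
      unfolding T_def by (rule C1_curve_derivative[OF C1 inJ[OF that]])
    then show ?thesis unfolding at .
  qed
  have cl: "\<sigma> t \<in> closure \<Omega>" if t: "\<bar>t - t0\<bar> < \<delta>0" for t
  proof -
    have "((\<lambda>s. \<sigma> t + s *\<^sub>R m) \<longlongrightarrow> \<sigma> t + 0 *\<^sub>R m) (at_right 0)" by (intro tendsto_intros)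
    moreover have "\<forall>\<^sub>F s in at_right 0. \<sigma> t + s *\<^sub>R m \<in> closure \<Omega>"
      using eventually_at_right_0_less[OF \<delta>0(1)]
      by eventually_elim (use \<delta>0(2)[OF t] closure_subset in auto)
    ultimately show ?thesis
      using Lim_in_closed_set[OF closed_closure _ trivial_limit_at_right_real] by fastforce
  qed
  have c\<sigma>: "isCont \<sigma> t" if "\<bar>t - t0\<bar> < \<delta>0" for t
    using \<sigma>'[OF that] has_vector_derivative_continuous by blast
  have "\<exists>d>0. \<forall>t. \<bar>t - t0\<bar> < d \<longrightarrow> \<bar>F (\<sigma> t) - F (\<sigma> t0) - ?L * (t - t0)\<bar> \<le> e * \<bar>t - t0\<bar>" if e: "0 < e" for e
  proof -
    \<comment> \<open>The derivative along the curve shifted by \<open>snd p\<close>. It is jointly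
      continuous down to shift 0, which yields one error bound for all small shifts; the limit of
      vanishing shift is then taken in the increment estimate, not in the derivative.\<close>
    let ?g = "\<lambda>p. f (\<sigma> (fst p) + snd p *\<^sub>R m) \<bullet> T (fst p)"
    let ?D = "{t0 - \<delta>0<..<t0 + \<delta>0} \<times> {0..<\<delta>0}"
    have "continuous_on ?D (\<lambda>p. f (\<sigma> (fst p) + snd p *\<^sub>R m))"
    proof (rule continuous_on_compose2[OF cf, where f = "\<lambda>p. \<sigma> (fst p) + snd p *\<^sub>R m"])
      have "continuous_on ?D (\<lambda>p. \<sigma> (fst p))"
        by (rule continuous_on_compose2[OF C1_curve_continuous[OF C1], where f = fst])
          (auto intro!: inJ continuous_intros)
      then show "continuous_on ?D (\<lambda>p. \<sigma> (fst p) + snd p *\<^sub>R m)"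
        by (intro continuous_on_add continuous_on_scaleR continuous_on_const continuous_on_snd continuous_on_id)
      show "(\<lambda>p. \<sigma> (fst p) + snd p *\<^sub>R m) ` ?D \<subseteq> closure \<Omega>"
      proof (rule image_subsetI)
        fix p assume p: "p \<in> ?D"
        show "\<sigma> (fst p) + snd p *\<^sub>R m \<in> closure \<Omega>"
        proof (cases "snd p = 0")
          case True then show ?thesis using cl[of "fst p"] p by auto
        next
          case False
          then have "\<sigma> (fst p) + snd p *\<^sub>R m \<in> \<Omega>" using \<delta>0(2)[of "fst p" "snd p"] p by auto
          then show ?thesis using closure_subset by blast
        qed
      qed
    qed
    moreover have "continuous_on ?D (\<lambda>p. T (fst p))"
    proof (rule continuous_on_compose2[where f = fst and g = T and t = J])
      show "continuous_on J T" using C1 unfolding C1_curve_def T_def by auto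
    qed (auto intro!: continuous_intros inJ)
    ultimately have "continuous_on ?D ?g" by (rule continuous_on_inner)
    moreover have "(t0, 0) \<in> ?D" using \<delta>0(1) by simp
    ultimately obtain d where d: "0 < d" "\<And>p. p \<in> ?D \<Longrightarrow> dist p (t0, 0) < d \<Longrightarrow> dist (?g p) (?g (t0, 0)) < e"
      using e unfolding continuous_on_iff by meson
    define d' where "d' = min \<delta>0 (d / 2)"
    have d': "0 < d'" "d' \<le> \<delta>0" "d' \<le> d / 2" using d \<delta>0 by (auto simp: d'_def)
    have g: "\<bar>f (\<sigma> t + s *\<^sub>R m) \<bullet> T t - ?L\<bar> \<le> e" if "\<bar>t - t0\<bar> < d'" "0 < s" "s < d'" for t s
    proof -
      have "dist (t, s) (t0, 0) \<le> \<bar>t - t0\<bar> + \<bar>s\<bar>"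
        using sqrt_sum_squares_le_sum_abs[of "t - t0" s] by (simp add: dist_Pair_Pair dist_real_def)
      also have "\<dots> < d" using that d' by auto
      finally have "dist (?g (t, s)) (?g (t0, 0)) < e"
        using d(2)[of "(t, s)"] that d' by (auto simp: abs_less_iff)
      then show ?thesis by (simp add: dist_real_def)
    qed
    have *: "\<bar>F (\<sigma> t + s *\<^sub>R m) - F (\<sigma> t0 + s *\<^sub>R m) - ?L * (t - t0)\<bar> \<le> e * \<bar>t - t0\<bar>"
      if t: "\<bar>t - t0\<bar> < d'" and s: "0 < s" "s < d'" for t s
    proof -
      let ?h = "\<lambda>t. F (\<sigma> t + s *\<^sub>R m) - ?L * t"
      let ?h' = "\<lambda>t. f (\<sigma> t + s *\<^sub>R m) \<bullet> T t - ?L"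
      let ?S = "ball t0 d'"
      have "norm (?h t - ?h t0) \<le> e * norm (t - t0)"
      proof (rule field_differentiable_bound[where S = ?S and f' = ?h'])
        fix x assume "x \<in> ?S"
        then have x: "\<bar>x - t0\<bar> < d'" by (simp add: dist_real_def abs_minus_commute)
        have "((\<lambda>t. F (\<sigma> t + s *\<^sub>R m)) has_derivative (\<lambda>h. (h *\<^sub>R T x) \<bullet> f (\<sigma> x + s *\<^sub>R m))) (at x)"
        proof (rule has_derivative_compose[where f = "\<lambda>t. \<sigma> t + s *\<^sub>R m" and g = F and g' = "\<lambda>h. h \<bullet> f (\<sigma> x + s *\<^sub>R m)"])
          show "((\<lambda>t. \<sigma> t + s *\<^sub>R m) has_derivative (\<lambda>h. h *\<^sub>R T x)) (at x)"
            using \<sigma>'[of x] x d'(2) unfolding has_vector_derivative_def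
            by (auto intro!: derivative_eq_intros)
          show "(F has_derivative (\<lambda>h. h \<bullet> f (\<sigma> x + s *\<^sub>R m))) (at (\<sigma> x + s *\<^sub>R m))"
            using F \<delta>0(2)[of x s] x s d'(2) unfolding gderiv_def by auto
        qed
        then have "((\<lambda>t. F (\<sigma> t + s *\<^sub>R m)) has_real_derivative f (\<sigma> x + s *\<^sub>R m) \<bullet> T x) (at x)"
          unfolding has_field_derivative_def inner_scaleR_left inner_commute[of "T x"]
          by (simp only: mult.commute[of _ "f (\<sigma> x + s *\<^sub>R m) \<bullet> T x"])
        then show "(?h has_field_derivative ?h' x) (at x within ?S)"
          by (intro DERIV_diff) (auto intro!: derivative_eq_intros intro: has_field_derivative_at_within)
        show "norm (?h' x) \<le> e" using g[OF x s] by simp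
      qed (use t d' in \<open>auto simp: dist_real_def abs_minus_commute\<close>)
      then show ?thesis by (simp add: algebra_simps)
    qed
    have "\<bar>F (\<sigma> t) - F (\<sigma> t0) - ?L * (t - t0)\<bar> \<le> e * \<bar>t - t0\<bar>" if t: "\<bar>t - t0\<bar> < d'" for t
    proof (rule tendsto_upperbound[OF _ _ trivial_limit_at_right_real[of 0]])
      have lim: "((\<lambda>s. F (\<sigma> t + s *\<^sub>R m)) \<longlongrightarrow> F (\<sigma> t)) (at_right 0)" if t: "\<bar>t - t0\<bar> < d'" for t
      proof (rule tendsto_along_ray[OF cF])
        show "\<sigma> t \<in> closure \<Omega>" using cl t d' by auto
        show "\<forall>\<^sub>F s in at_right 0. \<sigma> t + s *\<^sub>R m \<in> \<Omega>"
          using eventually_at_right_0_less[OF \<delta>0(1)]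
          by eventually_elim (use \<delta>0(2)[of t] t d' in auto)
      qed
      show "((\<lambda>s. \<bar>F (\<sigma> t + s *\<^sub>R m) - F (\<sigma> t0 + s *\<^sub>R m) - ?L * (t - t0)\<bar>) \<longlongrightarrow>
          \<bar>F (\<sigma> t) - F (\<sigma> t0) - ?L * (t - t0)\<bar>) (at_right 0)"
        by (intro tendsto_intros lim t) (use d' in simp)
      show "\<forall>\<^sub>F s in at_right 0. \<bar>F (\<sigma> t + s *\<^sub>R m) - F (\<sigma> t0 + s *\<^sub>R m) - ?L * (t - t0)\<bar> \<le> e * \<bar>t - t0\<bar>"
        using eventually_at_right_0_less[OF d'(1)] by eventually_elim (use *[OF t] in auto)
    qed
    then show ?thesis using d'(1) by blast
  qed
  then show ?thesis
    unfolding has_field_derivative_def has_derivative_at_alt T_def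
    by (auto intro!: bounded_linear_mult_right)
qed

section \<open>Flow behind a shock with constant upstream state\<close>

lemma continuous_on_zero_closure:
  fixes f :: "real \<Rightarrow> real"
  assumes "continuous_on J f" "S \<subseteq> J" "J \<subseteq> closure S" "\<And>t. t \<in> S \<Longrightarrow> f t = 0" "t \<in> J"
  shows "f t = 0"
proof -
  have "t \<in> closure S" using assms(3,5) by blast
  then obtain x where x: "\<And>k. x k \<in> S" "x \<longlonglongrightarrow> t"
    unfolding closure_sequential by blast
  have "\<forall>\<^sub>F k in sequentially. x k \<in> J"
    by (rule always_eventually) (use x(1) assms(2) in blast)
  then have "(\<lambda>k. f (x k)) \<longlonglongrightarrow> f t"
    by (rule continuous_on_tendsto_compose[OF assms(1) x(2) assms(5)])
  moreover have "(\<lambda>k. f (x k)) = (\<lambda>_. 0)" using x(1) assms(4) by auto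
  ultimately show ?thesis using LIMSEQ_unique tendsto_const by metis
qed

text \<open>Common ground of the two problems: \<open>J\<close> is \<open>{0..1}\<close> for the
  reflection and \<open>{0..}\<close> for the wedge. \<open>Z\<close> contains the rest of the
  boundary, that is, the walls and for the wedge also the sonic arc; at shock points on
  \<open>Z\<close> no tube is available, and \<open>dense\<close> lets identities reach them by
  continuity. For the wedge \<Omega> is the union of the elliptic and the hyperbolic region, so the
  sonic arc is part of its frontier.\<close>

locale shock_flow = polytropic_gas +
  fixes \<Omega> :: "plane set" and \<psi> :: "plane \<Rightarrow> real" and v :: "plane \<Rightarrow> plane"
    and J :: "real set" and \<sigma> n :: "real \<Rightarrow> plane"
    and vI :: plane and \<rho>I :: real and \<psi>I :: "plane \<Rightarrow> real" and Z :: "plane set"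
  assumes C1_flow: "C1_closure \<Omega> \<psi> v"
    and flow_density: "\<And>\<xi>. \<xi> \<in> closure \<Omega> \<Longrightarrow> has_density \<pi> \<psi> v \<xi>"
    and J: "convex J" "0 \<in> J" and curve: "C1_curve J \<sigma>" and proper: "proper_curve J \<sigma>"
    and dense: "J \<subseteq> closure {t \<in> interior J. \<sigma> t \<notin> Z}"
    and const: "constant_state \<pi> vI \<rho>I \<psi>I"
    and n: "\<And>t. t \<in> J \<Longrightarrow> norm (n t) = 1" "\<And>t. t \<in> J \<Longrightarrow> n t \<bullet> tangent J \<sigma> t = 0"
    and n_into: "\<And>t. t \<in> interior J \<Longrightarrow> \<forall>\<^sub>F s in at_right 0. \<sigma> t + s *\<^sub>R n t \<in> \<Omega>"
    and shock: "\<And>t. t \<in> J \<Longrightarrow> shock_at \<pi> vI \<rho>I \<psi>I \<psi> v (n t) (\<sigma> t)"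
    and admissible: "\<And>t. t \<in> J \<Longrightarrow> admissible_at vI v (n t) (\<sigma> t)"
    and Z: "closed Z" and frontier: "frontier \<Omega> \<subseteq> \<sigma> ` J \<union> Z"
begin

abbreviation "T \<equiv> tangent J \<sigma>"
abbreviation "\<xi>r \<equiv> \<sigma> 0"
abbreviation "vr \<equiv> v (\<sigma> 0)"
abbreviation "nr \<equiv> n 0"
text \<open>\<open>G\<close> is the shock strength, \<open>H\<close> the signed distance from the
  shock tangent at the reflection point, counted in the direction of the normal there, and
  \<open>U s\<close> is \<open>s\<close> times \<psi> minus its tangent affine function at that
  point.\<close>

definition "G t = (vI - v (\<sigma> t)) \<bullet> n t"
definition "H t = (\<sigma> t - \<xi>r) \<bullet> nr"
definition "U s \<xi> = s * (\<psi> \<xi> - vr \<bullet> \<xi>) - s * (\<psi> \<xi>r - vr \<bullet> \<xi>r)"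

lemma T_nonzero: "t \<in> J \<Longrightarrow> T t \<noteq> 0" and continuous_T: "continuous_on J T"
  using curve unfolding C1_curve_def by auto

lemma shock_in_closure_interior: "t \<in> interior J \<Longrightarrow> \<sigma> t \<in> closure \<Omega>"
proof -
  assume "t \<in> interior J"
  then have "\<forall>\<^sub>F s in at_right 0. \<sigma> t + s *\<^sub>R n t \<in> closure \<Omega>"
    by (rule eventually_mono[OF n_into]) (use closure_subset in auto)
  moreover have "((\<lambda>s. \<sigma> t + s *\<^sub>R n t) \<longlongrightarrow> \<sigma> t + 0 *\<^sub>R n t) (at_right 0)" by (intro tendsto_intros)
  ultimately have "\<sigma> t + 0 *\<^sub>R n t \<in> closure \<Omega>"
    by (rule Lim_in_closed_set[OF closed_closure _ trivial_limit_at_right_real])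
  then show ?thesis by simp
qed

lemma shock_in_closure: assumes "t \<in> J" shows "\<sigma> t \<in> closure \<Omega>"
proof -
  have "t \<in> closure {t \<in> interior J. \<sigma> t \<notin> Z}" using dense assms by blast
  then obtain x where x: "\<And>k. x k \<in> {t \<in> interior J. \<sigma> t \<notin> Z}" "x \<longlonglongrightarrow> t"
    unfolding closure_sequential by blast
  have "\<forall>\<^sub>F k in sequentially. x k \<in> J"
    by (rule always_eventually) (use x(1) interior_subset[of J] in blast)
  then have lim: "(\<lambda>k. \<sigma> (x k)) \<longlonglongrightarrow> \<sigma> t"
    by (rule continuous_on_tendsto_compose[OF C1_curve_continuous[OF curve] x(2) assms])
  have "\<sigma> (x k) \<in> closure \<Omega>" for k using x(1) shock_in_closure_interior by auto
  then show ?thesis by (rule closed_sequentially[OF closed_closure _ lim])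
qed

lemma along_shock:
  assumes "C1_closure \<Omega> F f" "t \<in> interior J" "\<sigma> t \<notin> Z"
  shows "((\<lambda>t. F (\<sigma> t)) has_real_derivative f (\<sigma> t) \<bullet> T t) (at t)"
proof -
  have "t \<in> J" using assms(2) interior_subset by auto
  then have "n t \<noteq> 0" "n t \<bullet> T t = 0" using n[of t] by auto
  then show ?thesis
    using C1_closure_along_boundary_curve[OF assms(1) curve J(1) proper assms(2) Z assms(3) frontier _ _ n_into[OF assms(2)]]
    by blast
qed

lemma psi_shock: "t \<in> J \<Longrightarrow> \<psi> (\<sigma> t) = \<psi>I 0 + vI \<bullet> \<sigma> t"
  using shock[of t] const unfolding shock_at_def constant_state_def by metis

text \<open>The identity \<open>\<psi> = \<psi>I\<close> is differentiated along the shock at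
  parameters off \<open>Z\<close>; these are dense, and both factors are continuous up to the end
  points.\<close>

lemma velocity_jump_tangential: assumes "t \<in> J" shows "(v (\<sigma> t) - vI) \<bullet> T t = 0"
proof -
  have cl: "\<sigma> ` J \<subseteq> closure \<Omega>" using shock_in_closure by auto
  have cv: "continuous_on (closure \<Omega>) v" using C1_flow unfolding C1_closure_def by auto
  have "continuous_on J (\<lambda>t. v (\<sigma> t))"
    by (rule continuous_on_compose2[OF cv C1_curve_continuous[OF curve] cl])
  then have "continuous_on J (\<lambda>t. (v (\<sigma> t) - vI) \<bullet> T t)"
    by (intro continuous_on_inner continuous_on_diff continuous_on_const continuous_T)
  then show ?thesis
  proof (rule continuous_on_zero_closure[OF _ _ dense _ assms])
    show "{t \<in> interior J. \<sigma> t \<notin> Z} \<subseteq> J" using interior_subset by auto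
    fix t assume "t \<in> {t \<in> interior J. \<sigma> t \<notin> Z}"
    then have t: "t \<in> interior J" "\<sigma> t \<notin> Z" by auto
    have "C1_closure \<Omega> (\<lambda>\<xi>. 1 * (\<psi> \<xi> - vI \<bullet> \<xi>) - 0 - 0 * quadratic 0 0 0 0 0 \<xi>)
       (\<lambda>\<xi>. 1 *\<^sub>R (v \<xi> - vI) - 0 *\<^sub>R quadratic_grad 0 0 0 0 0 \<xi>)"
      by (rule C1_closure_minus_quadratic[OF C1_flow])
    from along_shock[OF this t]
    have der: "((\<lambda>t. \<psi> (\<sigma> t) - vI \<bullet> \<sigma> t) has_real_derivative (v (\<sigma> t) - vI) \<bullet> T t) (at t)" by simp
    obtain d where d: "0 < d" "ball t d \<subseteq> J" using t(1) unfolding mem_interior by auto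
    then have "\<forall>y. \<bar>t - y\<bar> < d \<longrightarrow> \<psi> (\<sigma> t) - vI \<bullet> \<sigma> t = \<psi> (\<sigma> y) - vI \<bullet> \<sigma> y"
      using psi_shock t(1) interior_subset by (auto simp: subset_eq dist_real_def)
    then show "(v (\<sigma> t) - vI) \<bullet> T t = 0" by (rule DERIV_local_const[OF der d(1)])
  qed
qed

lemma G_pos: "t \<in> J \<Longrightarrow> 0 < G t"
  using admissible[of t] unfolding admissible_at_def G_def by (simp add: inner_diff_left)

lemma velocity_shock: assumes "t \<in> J" shows "v (\<sigma> t) = vI - G t *\<^sub>R n t"
proof -
  let ?a = "T t /\<^sub>R norm (T t)"
  have "norm ?a = 1" "n t \<bullet> ?a = 0" using T_nonzero[OF assms] n(2)[OF assms] by auto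
  from orthonormal_expansion[OF this(1) n(1)[OF assms] this(2), of "vI - v (\<sigma> t)"]
  have "vI - v (\<sigma> t) = ((vI - v (\<sigma> t)) \<bullet> ?a) *\<^sub>R ?a + G t *\<^sub>R n t" unfolding G_def .
  moreover have "(vI - v (\<sigma> t)) \<bullet> ?a = 0"
    using velocity_jump_tangential[OF assms] by (simp add: inner_diff_left)
  ultimately have "vI - v (\<sigma> t) = G t *\<^sub>R n t" by (simp only: scaleR_zero_left add_0)
  then show ?thesis by (simp add: algebra_simps)
qed

text \<open>Since the velocity jump is normal, both pseudo-velocities have the same tangential
  component, which drops out of the difference of the two Bernoulli laws.\<close>

lemma normal_shock:
  assumes "t \<in> J"
  shows "normal_shock \<rho>I ((vI - \<sigma> t) \<bullet> n t) (density \<pi> \<psi> v (\<sigma> t)) ((v (\<sigma> t) - \<sigma> t) \<bullet> n t)"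
proof -
  let ?\<rho> = "density \<pi> \<psi> v (\<sigma> t)" and ?\<xi> = "\<sigma> t"
  have hd: "has_density \<pi> \<psi> v ?\<xi>" using flow_density shock_in_closure assms by auto
  then have \<rho>: "0 < ?\<rho>" "\<pi> ?\<rho> = bernoulli \<psi> v ?\<xi>"
    unfolding has_density_def density_def by (auto simp: enthalpy_inv_enthalpy)
  have c: "0 < \<rho>I" "bernoulli \<psi>I (\<lambda>_. vI) ?\<xi> = \<pi> \<rho>I" using const unfolding constant_state_def by auto
  have nn: "n t \<bullet> n t = 1" using n(1)[OF assms] by (simp add: norm_eq_1)
  have jump: "vI - ?\<xi> = (v ?\<xi> - ?\<xi>) + G t *\<^sub>R n t" using velocity_shock[OF assms] by simp
  have "\<psi> ?\<xi> = \<psi>I ?\<xi>" using shock[OF assms] unfolding shock_at_def by simp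
  then have "\<pi> ?\<rho> - \<pi> \<rho>I = ((vI - ?\<xi>) \<bullet> (vI - ?\<xi>) - (v ?\<xi> - ?\<xi>) \<bullet> (v ?\<xi> - ?\<xi>)) / 2"
    unfolding \<rho>(2) c(2)[symmetric] bernoulli_def pseudo_potential_def pseudo_velocity_def power2_norm_eq_inner
    by (simp add: field_simps)
  also have "\<dots> = (((vI - ?\<xi>) \<bullet> n t)\<^sup>2 - ((v ?\<xi> - ?\<xi>) \<bullet> n t)\<^sup>2) / 2"
    unfolding jump inner_add_left inner_add_right using nn
    by (simp add: power2_eq_square inner_commute algebra_simps del: inner_diff_left inner_diff_right)
  finally show ?thesis
    using \<rho>(1) c(1) shock[OF assms] admissible[OF assms]
    unfolding normal_shock_def shock_at_def admissible_at_def by auto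
qed

lemma G_eq: "t \<in> J \<Longrightarrow> G t = (vI - \<sigma> t) \<bullet> n t - (v (\<sigma> t) - \<sigma> t) \<bullet> n t"
  unfolding G_def by (simp add: inner_diff_left)

text \<open>On the shock \<psi> equals an affine function with gradient \<open>vI\<close>, and
  \<open>vI - vr\<close> is normal to the shock at the reflection point. The shock values of
  \<open>U\<close> therefore carry only the geometry of the curve.\<close>

lemma U_shock: "t \<in> J \<Longrightarrow> U s (\<sigma> t) = s * (G 0 * H t)"
proof -
  assume t: "t \<in> J"
  have "vI - vr = G 0 *\<^sub>R nr" using velocity_shock[OF J(2)] by simp
  then have "(vI - vr) \<bullet> (\<sigma> t - \<xi>r) = G 0 * H t" unfolding H_def by (simp add: inner_commute)
  then have "(\<psi> (\<sigma> t) - vr \<bullet> \<sigma> t) - (\<psi> \<xi>r - vr \<bullet> \<xi>r) = G 0 * H t"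
    unfolding psi_shock[OF t] psi_shock[OF J(2)]
    by (simp add: inner_diff_left inner_diff_right)
  then show ?thesis
    unfolding U_def by (metis right_diff_distrib)
qed

lemma C1_U: "C1_closure \<Omega> (U s) (\<lambda>\<xi>. s *\<^sub>R (v \<xi> - vr))"
proof -
  have "C1_closure \<Omega> (\<lambda>\<xi>. s * (\<psi> \<xi> - vr \<bullet> \<xi>) - s * (\<psi> \<xi>r - vr \<bullet> \<xi>r) - 0 * quadratic 0 0 0 0 0 \<xi>)
       (\<lambda>\<xi>. s *\<^sub>R (v \<xi> - vr) - 0 *\<^sub>R quadratic_grad 0 0 0 0 0 \<xi>)"
    by (rule C1_closure_minus_quadratic[OF C1_flow])
  then show ?thesis unfolding U_def by simp
qed

lemma normal_cases: "t \<in> J \<Longrightarrow> T t \<bullet> nr = 0 \<Longrightarrow> n t = nr \<or> n t = - nr"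
  using unit_perp_unique[of "n t" nr "T t"] n J(2) T_nonzero by (simp add: inner_commute)

text \<open>With the same normal, a displacement of height \<open>H t\<close> changes the upstream
  normal speed by \<open>- H t\<close>, and the faster normal shock is the stronger one.\<close>

lemma same_normal:
  assumes t: "t \<in> J" and eq: "n t = nr"
  shows "v (\<sigma> t) - vr = (G 0 - G t) *\<^sub>R nr"
    "H t < 0 \<Longrightarrow> G 0 < G t" "0 < H t \<Longrightarrow> G t < G 0" "H t = 0 \<Longrightarrow> G t = G 0"
proof -
  show "v (\<sigma> t) - vr = (G 0 - G t) *\<^sub>R nr"
    using velocity_shock[OF t] velocity_shock[OF J(2)] eq by (simp add: algebra_simps)
  have d: "(vI - \<sigma> t) \<bullet> nr = (vI - \<xi>r) \<bullet> nr - H t"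
    unfolding H_def by (simp add: inner_diff_left)
  note ns = normal_shock[OF t, unfolded eq] normal_shock[OF J(2)]
  show "H t < 0 \<Longrightarrow> G 0 < G t" "0 < H t \<Longrightarrow> G t < G 0"
    using normal_shock_strength_less[OF ns(2,1)] normal_shock_strength_less[OF ns] d
    unfolding G_eq[OF t, unfolded eq] G_eq[OF J(2)] by auto
  show "H t = 0 \<Longrightarrow> G t = G 0"
    using normal_shock_unique[OF ns(1), of "density \<pi> \<psi> v \<xi>r" "(vr - \<xi>r) \<bullet> nr"] ns(2) d
    unfolding G_eq[OF t, unfolded eq] G_eq[OF J(2)] by auto
qed

text \<open>Both shock lines face the same velocity \<open>vI\<close> from opposite sides: adding
  the two positive upstream normal speeds cancels \<open>vI\<close> and leaves
  \<open>H t\<close>.\<close>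

lemma opposite_normal:
  assumes t: "t \<in> J" and eq: "n t = - nr"
  shows "v (\<sigma> t) - vr = (G 0 + G t) *\<^sub>R nr" "0 < H t"
proof -
  show "v (\<sigma> t) - vr = (G 0 + G t) *\<^sub>R nr"
    using velocity_shock[OF t] velocity_shock[OF J(2)] eq by (simp add: algebra_simps)
  have "0 < (vI - \<sigma> t) \<bullet> n t" "0 < (vI - \<xi>r) \<bullet> nr"
    using normal_shock[OF t] normal_shock[OF J(2)] unfolding normal_shock_def by auto
  then show "0 < H t" unfolding eq H_def by (simp add: inner_diff_left)
qed

lemma critical_at_local_min:
  assumes t: "t \<in> interior J" and s: "s \<noteq> 0" and e: "0 < e"
    and min: "\<And>t'. t' \<in> J \<Longrightarrow> \<bar>t - t'\<bar> < e \<Longrightarrow> U s (\<sigma> t) \<le> U s (\<sigma> t')"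
  shows "T t \<bullet> nr = 0"
proof -
  have tJ: "t \<in> J" using t interior_subset by auto
  obtain d where d: "0 < d" "ball t d \<subseteq> J" using t unfolding mem_interior by auto
  have "(\<sigma> has_vector_derivative T t) (at t)"
    using C1_curve_derivative[OF curve tJ] at_within_interior[OF t] by metis
  then have "((\<lambda>t. s * (G 0 * ((\<sigma> t - \<xi>r) \<bullet> nr))) has_real_derivative s * (G 0 * (T t \<bullet> nr))) (at t)"
    unfolding has_vector_derivative_def has_field_derivative_def
    by (auto intro!: derivative_eq_intros simp: fun_eq_iff)
  then have "s * (G 0 * (T t \<bullet> nr)) = 0"
  proof (rule DERIV_local_min)
    show "0 < min d e" using d e by simp
    show "\<forall>y. \<bar>t - y\<bar> < min d e \<longrightarrow> s * (G 0 * ((\<sigma> t - \<xi>r) \<bullet> nr)) \<le> s * (G 0 * ((\<sigma> y - \<xi>r) \<bullet> nr))"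
    proof (intro allI impI)
      fix y assume y: "\<bar>t - y\<bar> < min d e"
      then have "y \<in> J" using d(2) by (auto simp: dist_real_def)
      then show "s * (G 0 * ((\<sigma> t - \<xi>r) \<bullet> nr)) \<le> s * (G 0 * ((\<sigma> y - \<xi>r) \<bullet> nr))"
        using min[of y] y U_shock[OF tJ] U_shock[of y] unfolding H_def by simp
    qed
  qed
  then show ?thesis using s G_pos[OF J(2)] by simp
qed

text \<open>Minimality along the shock makes the normal \<open>nr\<close> or \<open>- nr\<close>.
  For \<open>nr\<close>, a negative value means \<open>s * H t < 0\<close>, so by monotonicity of
  the strength \<open>U s\<close> decreases along the normal into the flow, against minimality. The
  remaining case has to be excluded by global geometry.\<close>

lemma negative_min_on_shock:
  assumes t: "t \<in> interior J" and s: "s = 1 \<or> s = - 1"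
    and min: "\<And>\<xi>. \<xi> \<in> closure \<Omega> \<Longrightarrow> U s (\<sigma> t) \<le> U s \<xi>" and neg: "U s (\<sigma> t) < 0"
  shows "s = - 1" "n t = - nr" "0 < H t"
proof -
  have tJ: "t \<in> J" using t interior_subset by auto
  have "T t \<bullet> nr = 0"
    by (rule critical_at_local_min[OF t, of s 1]) (use s min shock_in_closure in auto)
  have G0: "0 < G 0" by (rule G_pos[OF J(2)])
  have "n t \<noteq> nr"
  proof
    assume eq: "n t = nr"
    have "G 0 * (s * H t) < 0" using neg U_shock[OF tJ, of s] by (simp add: mult_ac)
    then have "s * H t < 0" using G0 by (simp add: mult_less_0_iff)
    then have "s * (G 0 - G t) < 0" using same_normal(2,3)[OF tJ eq] s by auto
    moreover have "nr \<bullet> nr = 1" using n(1)[OF J(2)] by (simp add: norm_eq_1)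
    ultimately have "(s *\<^sub>R (v (\<sigma> t) - vr)) \<bullet> n t < 0"
      unfolding same_normal(1)[OF tJ eq] eq by simp
    from C1_closure_descent[OF C1_U shock_in_closure[OF tJ] n_into[OF t] this] n_into[OF t]
    have "\<forall>\<^sub>F s in at_right (0::real). False"
      by eventually_elim (use min closure_subset in fastforce)
    then show False by simp
  qed
  then show eq: "n t = - nr" using normal_cases[OF tJ \<open>T t \<bullet> nr = 0\<close>] by auto
  then show "0 < H t" using opposite_normal[OF tJ] by simp
  then show "s = - 1" using neg U_shock[OF tJ, of s] s mult_pos_pos[OF G0] by force
qed

end

section \<open>The shock condition \<open>g\<close> linearised at the reflection point\<close>

context shock_flow
begin

abbreviation "g \<equiv> shock_g \<pi> vI \<rho>I \<psi>I"
abbreviation "\<beta> w \<xi> \<equiv> - \<psi>I \<xi> + w \<bullet> \<xi> - (norm w)\<^sup>2 / 2"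

lemma affine_psiI: "\<psi>I \<xi> = \<psi>I 0 + vI \<bullet> \<xi>"
  using const unfolding constant_state_def by blast

lemma bernoulli_shock: "t \<in> J \<Longrightarrow> bernoulli \<psi> v (\<sigma> t) = \<beta> (v (\<sigma> t)) (\<sigma> t)"
  using psi_shock[of t] affine_psiI[of "\<sigma> t"]
  unfolding bernoulli_def pseudo_potential_def pseudo_velocity_def power2_norm_eq_inner
  by (simp add: inner_diff_left inner_diff_right inner_commute field_simps)

lemma density_shock:
  assumes "t \<in> J"
  shows "0 < density \<pi> \<psi> v (\<sigma> t)" "\<pi> (density \<pi> \<psi> v (\<sigma> t)) = \<beta> (v (\<sigma> t)) (\<sigma> t)"
proof -
  have "has_density \<pi> \<psi> v (\<sigma> t)" using flow_density shock_in_closure assms by auto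
  then show "0 < density \<pi> \<psi> v (\<sigma> t)" "\<pi> (density \<pi> \<psi> v (\<sigma> t)) = \<beta> (v (\<sigma> t)) (\<sigma> t)"
    unfolding has_density_def density_def bernoulli_shock[OF assms, symmetric]
    by (auto simp: enthalpy_inv_enthalpy)
qed

lemma unit_jump: "t \<in> J \<Longrightarrow> (vI - v (\<sigma> t)) /\<^sub>R norm (vI - v (\<sigma> t)) = n t"
  using velocity_shock[of t] G_pos[of t] n(1)[of t] by simp

lemma shock_g_zero: assumes "t \<in> J" shows "g (v (\<sigma> t)) (\<sigma> t) = 0"
proof -
  have "enthalpy_inv \<pi> (\<beta> (v (\<sigma> t)) (\<sigma> t)) = density \<pi> \<psi> v (\<sigma> t)"
    unfolding density_def bernoulli_shock[OF assms] ..
  then show ?thesis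
    using shock[OF assms] unfolding shock_g_def unit_jump[OF assms] shock_at_def
    by (simp add: inner_diff_left)
qed

text \<open>
  For fixed \<open>w\<close> the function \<open>shock_g\<close> depends on \<open>\<xi>\<close> only through \<open>(vI - w) \<bullet> \<xi>\<close>.
\<close>

lemma shock_g_lipschitz:
  obtains \<delta> C where "0 < \<delta>" "0 < C"
    "\<And>w \<xi>. norm (w - vr) < \<delta> \<Longrightarrow> norm (\<xi> - \<xi>r) < \<delta> \<Longrightarrow>
       \<bar>g w \<xi> - g w \<xi>r\<bar> \<le> C * \<bar>(vI - w) \<bullet> (\<xi> - \<xi>r)\<bar>"
proof -
  define \<rho> where "\<rho> = density \<pi> \<psi> v \<xi>r"
  have \<rho>: "0 < \<rho>" "\<pi> \<rho> = \<beta> vr \<xi>r" using density_shock[OF J(2)] by (simp_all add: \<rho>_def)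
  obtain \<epsilon> L where L: "0 < \<epsilon>" "0 < L"
    "\<And>b b'. \<bar>b - \<pi> \<rho>\<bar> < \<epsilon> \<Longrightarrow> \<bar>b' - \<pi> \<rho>\<bar> < \<epsilon> \<Longrightarrow>
      0 < enthalpy_inv \<pi> b \<and> enthalpy_inv \<pi> b \<le> 2 * \<rho> \<and>
      \<bar>enthalpy_inv \<pi> b - enthalpy_inv \<pi> b'\<bar> \<le> L * \<bar>b - b'\<bar>"
    by (rule enthalpy_inv_lipschitz[OF \<rho>(1)]) blast
  have G0: "0 < G 0" by (rule G_pos[OF J(2)])
  have nG: "norm (vI - vr) = G 0"
    using velocity_shock[OF J(2)] G0 n(1)[OF J(2)] by simp
  let ?b = "\<lambda>p. \<beta> (fst p) (snd p)"
  have "?b = (\<lambda>p. - (\<psi>I 0 + vI \<bullet> snd p) + fst p \<bullet> snd p - (norm (fst p))\<^sup>2 / 2)"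
    using affine_psiI by (metis (no_types))
  then have "continuous_on UNIV ?b"
    by (simp only:) (intro continuous_intros; simp)
  then have "isCont ?b (vr, \<xi>r)" by (simp add: continuous_on_eq_continuous_at)
  then obtain \<delta>1 where \<delta>1: "0 < \<delta>1" "\<And>p. dist p (vr, \<xi>r) < \<delta>1 \<Longrightarrow> dist (?b p) (?b (vr, \<xi>r)) < \<epsilon>"
    unfolding continuous_at_eps_delta using L(1) by meson
  define \<delta> where "\<delta> = min 1 (min (\<delta>1 / 2) (G 0 / 2))"
  have \<delta>: "0 < \<delta>" "\<delta> \<le> 1" "\<delta> \<le> \<delta>1 / 2" "\<delta> \<le> G 0 / 2"
    using \<delta>1(1) G0 by (auto simp: \<delta>_def)
  have \<rho>I: "0 < \<rho>I" using const unfolding constant_state_def by simp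
  \<comment> \<open>The first summand is for the change of the density, multiplied by a bound of
    \<open>w - \<xi>\<close>; the second is for the change of position at fixed density, where the
    bound \<open>2 / G 0\<close> converts the displacement along the unit normal into the product
    with \<open>vI - w\<close>.\<close>
  define C where "C = L * (norm (vr - \<xi>r) + 2) + (2 * \<rho> + \<rho>I) * (2 / G 0)"
  have C: "0 < C" unfolding C_def using L(2) \<rho>(1) \<rho>I G0
    by (intro add_pos_pos mult_pos_pos divide_pos_pos add_nonneg_pos) simp_all
  have "\<bar>g w \<xi> - g w \<xi>r\<bar> \<le> C * \<bar>(vI - w) \<bullet> (\<xi> - \<xi>r)\<bar>"
    if w: "norm (w - vr) < \<delta>" and \<xi>: "norm (\<xi> - \<xi>r) < \<delta>" for w \<xi>
  proof -
    let ?N = "(vI - w) /\<^sub>R norm (vI - w)"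
    let ?R = "enthalpy_inv \<pi> (\<beta> w \<xi>)" and ?R' = "enthalpy_inv \<pi> (\<beta> w \<xi>r)"
    let ?D = "(vI - w) \<bullet> (\<xi> - \<xi>r)"
    have "norm (vI - vr) \<le> norm (vI - w) + norm (w - vr)"
      using norm_triangle_ineq[of "vI - w" "w - vr"] by simp
    then have nw: "G 0 / 2 \<le> norm (vI - w)" using nG w \<delta>(4) by linarith
    have close: "\<bar>\<beta> w x - \<pi> \<rho>\<bar> < \<epsilon>" if "norm (x - \<xi>r) < \<delta>" for x
    proof -
      have "dist (w, x) (vr, \<xi>r) \<le> norm (w - vr) + norm (x - \<xi>r)"
        using norm_Pair_le[of "w - vr" "x - \<xi>r"] by (simp add: dist_norm)
      also have "\<dots> < \<delta>1" using w that \<delta>(3) by linarith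
      finally show ?thesis using \<delta>1(2)[of "(w, x)"] \<rho>(2) by (simp add: dist_real_def)
    qed
    have R: "\<bar>?R - ?R'\<bar> \<le> L * \<bar>?D\<bar>" "0 < ?R'" "?R' \<le> 2 * \<rho>"
    proof -
      have "\<beta> w \<xi> - \<beta> w \<xi>r = - ?D"
        unfolding affine_psiI[of \<xi>] affine_psiI[of \<xi>r] by (simp add: inner_diff_left inner_diff_right)
      then have "\<bar>\<beta> w \<xi> - \<beta> w \<xi>r\<bar> = \<bar>?D\<bar>" by simp
      then show "\<bar>?R - ?R'\<bar> \<le> L * \<bar>?D\<bar>" using L(3)[OF close[OF \<xi>] close[of \<xi>r]] \<delta>(1) by simp
      show "0 < ?R'" "?R' \<le> 2 * \<rho>" using L(3)[OF close[of \<xi>r] close[of \<xi>r]] \<delta>(1) by auto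
    qed
    have N: "norm ?N \<le> 1" unfolding sgn_div_norm[symmetric] norm_sgn by simp
    have zN: "\<bar>(w - \<xi>) \<bullet> ?N\<bar> \<le> norm (vr - \<xi>r) + 2"
    proof -
      have "\<bar>(w - \<xi>) \<bullet> ?N\<bar> \<le> norm (w - \<xi>) * norm ?N" by (rule Cauchy_Schwarz_ineq2)
      also have "\<dots> \<le> norm (w - \<xi>) * 1" by (intro mult_left_mono N) simp
      also have "norm (w - \<xi>) * 1 \<le> norm (w - vr) + (norm (vr - \<xi>r) + norm (\<xi> - \<xi>r))"
      proof -
        have "norm (w - \<xi>) = norm ((w - vr) + ((vr - \<xi>r) - (\<xi> - \<xi>r)))" by simp
        then show ?thesis
          using norm_triangle_ineq[of "w - vr" "(vr - \<xi>r) - (\<xi> - \<xi>r)"] norm_triangle_ineq4[of "vr - \<xi>r" "\<xi> - \<xi>r"]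
          by linarith
      qed
      finally show ?thesis using w \<xi> \<delta>(2) by linarith
    qed
    have xN: "\<bar>(\<xi> - \<xi>r) \<bullet> ?N\<bar> \<le> 2 / G 0 * \<bar>?D\<bar>"
    proof -
      have "(\<xi> - \<xi>r) \<bullet> ?N = ?D / norm (vI - w)" by (simp add: inner_commute divide_inverse mult.commute)
      also have "\<bar>\<dots>\<bar> = \<bar>?D\<bar> / norm (vI - w)" by simp
      also have "\<dots> \<le> \<bar>?D\<bar> / (G 0 / 2)" using nw G0 by (intro frac_le) auto
      finally show ?thesis by (simp add: mult.commute)
    qed
    \<comment> \<open>Normal components only. Moving from \<xi> to \<xi>r adds the same
      \<open>x\<close> to the normal speeds on both sides, so the difference splits into a density
      term and a term linear in \<open>x\<close>.\<close>
    define a x y where "a = (w - \<xi>) \<bullet> ?N" and "x = (\<xi> - \<xi>r) \<bullet> ?N" and "y = (vI - \<xi>) \<bullet> ?N"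
    have "(w - \<xi>r) \<bullet> ?N = a + x" "(vI - \<xi>r) \<bullet> ?N = y + x"
      unfolding a_def x_def y_def inner_add_left[symmetric] by simp_all
    then have "g w \<xi>r = ?R' * (a + x) - \<rho>I * (y + x)" "g w \<xi> = ?R * a - \<rho>I * y"
      unfolding shock_g_def inner_diff_left[of "_ *\<^sub>R _"] inner_scaleR_left
      by (simp_all only: a_def[symmetric] y_def[symmetric])
    then have "g w \<xi> - g w \<xi>r = (?R - ?R') * a - (?R' - \<rho>I) * x"
      by (simp only: left_diff_distrib distrib_left)
    then have "\<bar>g w \<xi> - g w \<xi>r\<bar> \<le> \<bar>?R - ?R'\<bar> * \<bar>a\<bar> + \<bar>?R' - \<rho>I\<bar> * \<bar>x\<bar>"
      using abs_triangle_ineq4[of "(?R - ?R') * a" "(?R' - \<rho>I) * x"] by (simp only: abs_mult)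
    also have "\<bar>?R - ?R'\<bar> * \<bar>a\<bar> \<le> (L * \<bar>?D\<bar>) * (norm (vr - \<xi>r) + 2)"
      by (rule mult_mono[OF R(1) zN[folded a_def]]) (use L(2) in simp_all)
    also have "\<bar>?R' - \<rho>I\<bar> * \<bar>x\<bar> \<le> (2 * \<rho> + \<rho>I) * (2 / G 0 * \<bar>?D\<bar>)"
    proof (rule mult_mono[OF _ xN[folded x_def]])
      show "\<bar>?R' - \<rho>I\<bar> \<le> 2 * \<rho> + \<rho>I" using R(2,3) \<rho>I by linarith
    qed (use \<rho>(1) \<rho>I in simp_all)
    finally have "\<bar>g w \<xi> - g w \<xi>r\<bar> \<le> (L * \<bar>?D\<bar>) * (norm (vr - \<xi>r) + 2) + (2 * \<rho> + \<rho>I) * (2 / G 0 * \<bar>?D\<bar>)"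
      by simp
    also have "\<dots> = C * \<bar>?D\<bar>" unfolding C_def by (simp only: distrib_right distrib_left mult_ac)
    finally show ?thesis .
  qed
  then show ?thesis using that \<delta>(1) C by blast
qed

text \<open>On the line through \<open>vr\<close> in direction \<open>nr\<close> the unit vector
  along \<open>vI - w\<close> does not change, so \<open>g\<close> is a one-dimensional mass flux
  difference. Its derivative is \<open>\<rho> (1 - e^2 / c^2)\<close>, positive because the normal
  component behind a shock is subsonic.\<close>

lemma shock_g_gradient_normal:
  assumes "GDERIV (\<lambda>w. g w \<xi>r) vr :> gv"
  shows "0 < gv \<bullet> nr"
proof -
  define \<rho> where "\<rho> = density \<pi> \<psi> v \<xi>r"
  define e where "e = (vr - \<xi>r) \<bullet> nr"
  have \<rho>: "0 < \<rho>" "\<pi> \<rho> = \<beta> vr \<xi>r" using density_shock[OF J(2)] by (simp_all add: \<rho>_def)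
  have nn: "nr \<bullet> nr = 1" using n(1)[OF J(2)] by (simp add: norm_eq_1)
  have G0: "0 < G 0" by (rule G_pos[OF J(2)])
  let ?b = "\<lambda>s. \<beta> (vr + s *\<^sub>R nr) \<xi>r"
  let ?g = "\<lambda>s. enthalpy_inv \<pi> (?b s) * (e + s) - \<rho>I * ((vI - \<xi>r) \<bullet> nr)"
  have b: "(?b has_real_derivative - e) (at 0)"
  proof -
    have "?b s = (- \<psi>I \<xi>r + vr \<bullet> \<xi>r - vr \<bullet> vr / 2) - e * s - s\<^sup>2 / 2" for s
      unfolding power2_norm_eq_inner e_def
      by (simp add: inner_add_left inner_add_right inner_diff_left inner_diff_right nn inner_commute power2_eq_square field_simps)
    then have eq: "?b = (\<lambda>s. (- \<psi>I \<xi>r + vr \<bullet> \<xi>r - vr \<bullet> vr / 2) - e * s - s\<^sup>2 / 2)" by (rule ext)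
    show ?thesis unfolding eq by (auto intro!: derivative_eq_intros)
  qed
  have "((\<lambda>s. enthalpy_inv \<pi> (?b s)) has_real_derivative \<rho> / (sound_speed \<gamma> \<rho>)\<^sup>2 * (- e)) (at 0)"
    by (rule DERIV_chain2[OF _ b]) (use DERIV_enthalpy_inv[OF \<rho>(1)] \<rho>(2) in simp)
  then have "(?g has_real_derivative \<rho> / (sound_speed \<gamma> \<rho>)\<^sup>2 * (- e) * (e + 0) + enthalpy_inv \<pi> (?b 0) * 1) (at 0)"
    by (auto intro!: derivative_eq_intros)
  moreover have "enthalpy_inv \<pi> (?b 0) = \<rho>"
    using enthalpy_inv_enthalpy[OF \<rho>(1)] \<rho>(2) by simp
  ultimately have 1: "(?g has_real_derivative \<rho> * (1 - e\<^sup>2 / (sound_speed \<gamma> \<rho>)\<^sup>2)) (at 0)"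
    by (simp add: power2_eq_square algebra_simps)
  have "((\<lambda>s. g (vr + s *\<^sub>R nr) \<xi>r) has_real_derivative gv \<bullet> nr) (at 0)"
    by (rule GDERIV_along_line) (use assms in simp)
  moreover have "g (vr + s *\<^sub>R nr) \<xi>r = ?g s" if "s \<in> {-G 0<..<G 0}" for s
  proof -
    have "vI - (vr + s *\<^sub>R nr) = (G 0 - s) *\<^sub>R nr"
      using velocity_shock[OF J(2)] by (simp add: algebra_simps)
    then have "(vI - (vr + s *\<^sub>R nr)) /\<^sub>R norm (vI - (vr + s *\<^sub>R nr)) = nr"
      using that n(1)[OF J(2)] by simp
    moreover have "(vr + s *\<^sub>R nr - \<xi>r) \<bullet> nr = e + s"
      unfolding e_def by (simp add: inner_diff_left inner_add_left nn)
    ultimately show ?thesis unfolding shock_g_def inner_diff_left[of "_ *\<^sub>R _"] inner_scaleR_left by simp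
  qed
  ultimately have "(?g has_real_derivative gv \<bullet> nr) (at 0)"
    by (intro has_field_derivative_transform_within_open[of "\<lambda>s. g (vr + s *\<^sub>R nr) \<xi>r" _ 0 "{-G 0<..<G 0}" ?g]) (use G0 in auto)
  from DERIV_unique[OF this 1] have "gv \<bullet> nr = \<rho> * (1 - e\<^sup>2 / (sound_speed \<gamma> \<rho>)\<^sup>2)" .
  moreover have "e\<^sup>2 < (sound_speed \<gamma> \<rho>)\<^sup>2"
    using normal_shock_subsonic[OF normal_shock[OF J(2)]] unfolding e_def \<rho>_def .
  then have "e\<^sup>2 / (sound_speed \<gamma> \<rho>)\<^sup>2 < 1"
    by (subst pos_divide_less_eq) (auto intro: le_less_trans[OF zero_le_power2])
  ultimately show ?thesis using \<rho>(1) by simp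
qed

end

section \<open>The corner between shock and wall\<close>

text \<open>A neighbourhood of radius \<open>r0\<close> of the reflection point or wedge tip, in a
  form that fits both problems. The unit vector \<open>e\<close> points along the wall into the flow
  boundary: towards the corner for the reflection, away from the tip for the wedge.\<close>

locale corner_flow = shock_flow \<gamma> \<pi> \<Omega> \<psi> v J \<sigma> n vI \<rho>I \<psi>I Z + elliptic_flow \<gamma> \<pi> E \<psi> v
  for \<gamma> \<pi> \<Omega> \<psi> v J \<sigma> n vI \<rho>I \<psi>I Z E +
  fixes e nW :: plane and s r0 :: real
  assumes frame: "norm e = 1" "norm nW = 1" "nW \<bullet> e = 0"
    and E_sub: "E \<subseteq> \<Omega>" and r0: "0 < r0" "\<Omega> \<inter> ball (\<sigma> 0) r0 \<subseteq> E"
    and frontier_near: "\<And>\<xi>. \<xi> \<in> frontier E \<Longrightarrow> dist (\<sigma> 0) \<xi> < r0 \<Longrightarrow>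
        \<xi> \<in> \<sigma> ` J \<or> (\<exists>l\<ge>0. \<xi> = \<sigma> 0 + l *\<^sub>R e)"
    and wall_slip: "\<And>l. 0 < l \<Longrightarrow> l < r0 \<Longrightarrow> \<sigma> 0 + l *\<^sub>R e \<in> closure E \<Longrightarrow> (v (\<sigma> 0 + l *\<^sub>R e) - \<sigma> 0) \<bullet> nW = 0"
    and wall_side: "\<And>l. 0 < l \<Longrightarrow> l < r0 \<Longrightarrow> \<sigma> 0 + l *\<^sub>R e \<in> closure E \<Longrightarrow>
        \<exists>\<rho>>0. ball (\<sigma> 0 + l *\<^sub>R e) \<rho> \<inter> {x. (x - \<sigma> 0) \<bullet> nW < 0} \<subseteq> E \<and>
          frontier E \<inter> ball (\<sigma> 0 + l *\<^sub>R e) \<rho> \<subseteq> {x. (x - \<sigma> 0) \<bullet> nW = 0}"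
    and shock_near: "\<And>t. t \<in> J \<Longrightarrow> t \<noteq> 0 \<Longrightarrow> dist (\<sigma> 0) (\<sigma> t) < r0 \<Longrightarrow>
        t \<in> interior J \<and> \<sigma> t \<notin> Z \<and> (\<forall>l\<ge>0. \<sigma> t \<noteq> \<sigma> 0 + l *\<^sub>R e)"
    and start: "\<exists>d>0. {0..d} \<subseteq> J"
    and slip_r: "(v (\<sigma> 0) - \<sigma> 0) \<bullet> nW = 0"
    and directions: "0 < n 0 \<bullet> e" "0 < tangent J \<sigma> 0 \<bullet> e" "tangent J \<sigma> 0 \<bullet> nW \<le> 0"
    and s: "s = 1 \<or> s = - 1"
    and U_pos: "\<And>\<xi>. \<xi> \<in> E \<Longrightarrow>
        0 < s * (\<psi> \<xi> - v (\<sigma> 0) \<bullet> \<xi>) - s * (\<psi> (\<sigma> 0) - v (\<sigma> 0) \<bullet> \<sigma> 0)"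
    and strong: "strong_type \<pi> vI \<rho>I \<psi>I v (\<sigma> 0)"
begin

lemma continuous_U: "continuous_on (closure E) (U s)"
  unfolding U_def by (intro continuous_intros continuous_psi)

lemma U_nonneg: "\<xi> \<in> closure E \<Longrightarrow> 0 \<le> U s \<xi>"
  using continuous_ge_on_closure[OF continuous_U] U_pos unfolding U_def by (metis less_imp_le)

lemma closure_near: "\<xi> \<in> closure \<Omega> \<Longrightarrow> dist \<xi>r \<xi> < r0 \<Longrightarrow> \<xi> \<in> closure E"
  using open_Int_closure_subset[OF open_ball, of \<xi>r r0 \<Omega>] closure_mono[OF r0(2)] by (auto simp: Int_commute)

text \<open>At a zero Hopf's lemma would give a positive inward derivative, but \<open>v\<close>
  there and \<open>vr\<close> both satisfy the slip condition on the same wall, so the normal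
  derivative of \<open>U\<close> vanishes.\<close>

lemma wall_positive:
  assumes l: "0 < l" "l < r0" and X: "\<xi>r + l *\<^sub>R e \<in> closure E"
  shows "0 < U s (\<xi>r + l *\<^sub>R e)"
proof (rule ccontr)
  let ?X = "\<xi>r + l *\<^sub>R e"
  assume "\<not> ?thesis"
  then have U0: "U s ?X = 0" using U_nonneg[OF X] by simp
  obtain \<rho> where \<rho>: "0 < \<rho>" "ball ?X \<rho> \<inter> {x. (x - \<xi>r) \<bullet> nW < 0} \<subseteq> E"
    "frontier E \<inter> ball ?X \<rho> \<subseteq> {x. (x - \<xi>r) \<bullet> nW = 0}"
    using wall_side[OF l X] by blast
  have vX: "(v ?X - \<xi>r) \<bullet> nW = 0" by (rule wall_slip[OF l X])
  have eW: "e \<bullet> nW = 0" using frame by (simp add: inner_commute)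
  have "0 < s * ((v ?X - vr) \<bullet> (- nW))"
  proof (rule hopf[where \<Omega> = E and r' = \<rho> and b = 1 and \<kappa>' = 0 and m = "s * (\<psi> \<xi>r - vr \<bullet> \<xi>r)"])
    show "s * (\<psi> ?X - vr \<bullet> ?X) - s * (\<psi> \<xi>r - vr \<bullet> \<xi>r) = 0" using U0 unfolding U_def .
    show "norm (- nW) = 1" using frame by simp
    have "z ?X \<bullet> nW = 0"
      using vX unfolding pseudo_velocity_def by (simp add: inner_diff_left inner_add_left eW)
    then show "(z ?X \<bullet> - nW)\<^sup>2 < (c ?X)\<^sup>2" using c_pos[OF X] by simp
    fix \<xi> assume \<xi>: "\<xi> \<in> frontier E" "dist ?X \<xi> < \<rho>"
    then have "(\<xi> - \<xi>r) \<bullet> nW = 0" using \<rho>(3) by auto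
    then have "(\<xi> - ?X) \<bullet> nW = 0" by (simp add: inner_diff_left inner_add_left eW)
    moreover have "0 \<le> U s \<xi>" using \<xi>(1) U_nonneg unfolding frontier_def by auto
    ultimately show "1 * ((\<xi> - ?X) \<bullet> - nW - 0 * ((\<xi> - ?X) \<bullet> (\<xi> - ?X)))
       \<le> s * (\<psi> \<xi> - vr \<bullet> \<xi>) - s * (\<psi> \<xi>r - vr \<bullet> \<xi>r)" unfolding U_def by simp
  next
    show "\<forall>\<^sub>F \<epsilon> in at_right 0. ?X + \<epsilon> *\<^sub>R - nW \<in> E"
      using eventually_at_right_0_less[OF \<rho>(1)]
    proof eventually_elim
      case (elim \<epsilon>)
      have "(?X + \<epsilon> *\<^sub>R - nW - \<xi>r) \<bullet> nW = - \<epsilon>"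
        using frame(2) by (simp add: inner_diff_left eW norm_eq_1)
      moreover have "dist ?X (?X + \<epsilon> *\<^sub>R - nW) < \<rho>"
        using elim frame(2) by (simp add: dist_norm)
      ultimately show ?case using \<rho>(2) elim by (auto simp: subset_eq)
    qed
  qed (use open_E X U_pos \<rho> in auto)
  moreover have "(v ?X - vr) \<bullet> nW = 0" using vX slip_r by (simp add: inner_diff_left)
  ultimately show False by simp
qed

lemma shock_near_E:
  assumes t: "t \<in> J" "t \<noteq> 0" "dist \<xi>r (\<sigma> t) < r0"
  shows "\<sigma> t \<in> closure E" "\<forall>\<^sub>F \<epsilon> in at_right 0. \<sigma> t + \<epsilon> *\<^sub>R n t \<in> E"
proof -
  show "\<sigma> t \<in> closure E" using closure_near[OF shock_in_closure] t by auto
  have "\<forall>\<^sub>F \<epsilon> in at_right 0. \<sigma> t + \<epsilon> *\<^sub>R n t \<in> ball \<xi>r r0"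
    by (rule eventually_ray_in_open) (use t in auto)
  moreover have "\<forall>\<^sub>F \<epsilon> in at_right 0. \<sigma> t + \<epsilon> *\<^sub>R n t \<in> \<Omega>"
    using n_into shock_near[OF t] by blast
  ultimately show "\<forall>\<^sub>F \<epsilon> in at_right 0. \<sigma> t + \<epsilon> *\<^sub>R n t \<in> E"
    by eventually_elim (use r0(2) in blast)
qed

text \<open>A zero is a minimum along the shock with \<open>H t = 0\<close>. The normal must then be
  \<open>nr\<close>, because the opposite normal needs positive height; equal height gives equal
  strength, hence the velocity \<open>vr\<close>. The gradient of \<open>U\<close> would vanish,
  contrary to Hopf's lemma.\<close>

lemma shock_positive:
  assumes t: "t \<in> J" "t \<noteq> 0" "dist \<xi>r (\<sigma> t) < r0"
  shows "0 < U s (\<sigma> t)"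
proof (rule ccontr)
  let ?X = "\<sigma> t"
  assume "\<not> ?thesis"
  then have U0: "U s ?X = 0" using U_nonneg[OF shock_near_E(1)[OF t]] by simp
  have ti: "t \<in> interior J" and wall: "\<And>l. 0 \<le> l \<Longrightarrow> ?X \<noteq> \<xi>r + l *\<^sub>R e"
    using shock_near[OF t] by auto
  have G0: "0 < G 0" by (rule G_pos[OF J(2)])
  have H0: "H t = 0" using U0 U_shock[OF t(1), of s] G0 s by auto
  have "isCont \<sigma> t"
    using C1_curve_continuous[OF curve] ti continuous_on_interior by blast
  then have "\<exists>d>0. \<forall>t'. dist t' t < d \<longrightarrow> dist (\<sigma> t') (\<sigma> t) < r0 - dist \<xi>r (\<sigma> t)"
    unfolding continuous_at_eps_delta using t(3) by simp
  then obtain d where d: "0 < d" "\<And>t'. dist t' t < d \<Longrightarrow> dist (\<sigma> t') (\<sigma> t) < r0 - dist \<xi>r (\<sigma> t)"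
    by blast
  have "T t \<bullet> nr = 0"
  proof (rule critical_at_local_min[OF ti _ d(1), of s])
    fix t' assume "t' \<in> J" "\<bar>t - t'\<bar> < d"
    then have "dist \<xi>r (\<sigma> t') < r0"
      using d(2)[of t'] dist_triangle[of \<xi>r "\<sigma> t'" "\<sigma> t"] by (simp add: dist_real_def dist_commute abs_minus_commute)
    then show "U s ?X \<le> U s (\<sigma> t')"
      using U0 U_nonneg closure_near shock_in_closure \<open>t' \<in> J\<close> by auto
  qed (use s in auto)
  then have eq: "n t = nr" using normal_cases[OF t(1)] opposite_normal(2)[OF t(1)] H0 by force
  have vX: "v ?X = vr" using same_normal(1)[OF t(1) eq] same_normal(4)[OF t(1) eq H0] by simp
  have "closed ((\<lambda>l. \<xi>r + l *\<^sub>R e) ` {0..})"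
  proof -
    have "(\<lambda>l. \<xi>r + l *\<^sub>R e) ` {0..} = (+) \<xi>r ` ((\<lambda>l. l *\<^sub>R e) ` {0..})" by (simp add: image_image)
    moreover have "closed ((\<lambda>l. l *\<^sub>R e) ` {0..})"
      by (rule closed_injective_linear_image) (use frame(1) in \<open>auto simp: linear_iff algebra_simps inj_on_def intro!: linearI injI\<close>)
    ultimately show ?thesis by (simp add: closed_translation)
  qed
  then obtain \<rho> where \<rho>: "0 < \<rho>" "ball ?X \<rho> \<subseteq> - (\<lambda>l. \<xi>r + l *\<^sub>R e) ` {0..}"
    using wall by (metis (no_types, lifting) ComplI atLeast_iff imageE open_Compl open_contains_ball)
  have "0 < s * ((v ?X - vr) \<bullet> nr)"
  proof (rule hopf[where \<Omega> = E and r' = "min \<rho> (r0 - dist \<xi>r ?X)" and b = "G 0" and \<kappa>' = 0 and m = "s * (\<psi> \<xi>r - vr \<bullet> \<xi>r)"])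
    show "s * (\<psi> ?X - vr \<bullet> ?X) - s * (\<psi> \<xi>r - vr \<bullet> \<xi>r) = 0" using U0 unfolding U_def .
    show "?X \<in> closure E" by (rule shock_near_E(1)[OF t])
    show "(z ?X \<bullet> nr)\<^sup>2 < (c ?X)\<^sup>2"
      using normal_shock_subsonic[OF normal_shock[OF t(1)]]
      unfolding eq pseudo_velocity_def local_sound_speed_def .
    show "\<forall>\<^sub>F \<epsilon> in at_right 0. ?X + \<epsilon> *\<^sub>R nr \<in> E" using shock_near_E(2)[OF t] unfolding eq .
    fix \<xi> assume \<xi>: "\<xi> \<in> frontier E" "dist ?X \<xi> < min \<rho> (r0 - dist \<xi>r ?X)"
    then have dist: "dist \<xi>r \<xi> < r0" using dist_triangle[of \<xi>r \<xi> ?X] by simp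
    have "\<xi> \<in> ball ?X \<rho>" using \<xi> by simp
    then have "\<xi> \<notin> (\<lambda>l. \<xi>r + l *\<^sub>R e) ` {0..}" using \<rho>(2) by blast
    then obtain t' where t': "t' \<in> J" "\<xi> = \<sigma> t'" using frontier_near[OF \<xi>(1) dist] by auto
    have "0 \<le> U s \<xi>" using \<xi>(1) U_nonneg unfolding frontier_def by auto
    then have "0 \<le> s * (G 0 * H t')" using U_shock[OF t'(1)] t'(2) by simp
    \<comment> \<open>For \<open>s = - 1\<close> nonnegativity of \<open>U\<close> forces
      \<open>H t' \<le> 0\<close>. So for both signs \<open>U\<close> lies above a multiple of the
      height over the tangent line, which is the frontier condition of \<open>hopf\<close>.\<close>
    then have "G 0 * H t' \<le> s * (G 0 * H t')" using s by auto
    moreover have "(\<xi> - ?X) \<bullet> nr = H t'"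
      using H0 unfolding t'(2) H_def by (simp add: inner_diff_left)
    ultimately show "G 0 * ((\<xi> - ?X) \<bullet> nr - 0 * ((\<xi> - ?X) \<bullet> (\<xi> - ?X)))
       \<le> s * (\<psi> \<xi> - vr \<bullet> \<xi>) - s * (\<psi> \<xi>r - vr \<bullet> \<xi>r)"
      using U_shock[OF t'(1), of s] unfolding t'(2) U_def by simp
  qed (use open_E U_pos \<rho> G0 t n(1)[OF J(2)] in auto)
  then show False using vX by simp
qed

text \<open>
  Strong type means that the oblique derivative vector \<open>gv\<close> on the shock has a positive component
  along the wall. Hence there is a barrier that is linear up to a small quadratic term, and it
  forces linear growth of \<open>U\<close> along the shock, where \<open>U\<close> vanishes to first order.
\<close>

theorem strong_corner_impossible: False
proof -
  obtain gv where gv: "GDERIV (\<lambda>w. g w \<xi>r) vr :> gv" "0 < gv \<bullet> z \<xi>r"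
    using strong unfolding strong_type_def by blast
  have \<xi>r_cl: "\<xi>r \<in> closure E" using closure_near[OF shock_in_closure[OF J(2)]] r0(1) by simp
  have gvn: "0 < gv \<bullet> nr" by (rule shock_g_gradient_normal[OF gv(1)])
  \<comment> \<open>By the slip condition \<open>z\<close> at the reflection point is a multiple of
    \<open>e\<close>, and admissibility makes the factor positive; strong type thus becomes a sign
    of \<open>gv\<close> along the wall.\<close>
  have gve: "0 < gv \<bullet> e"
  proof -
    have zr: "z \<xi>r = (z \<xi>r \<bullet> e) *\<^sub>R e"
      using orthonormal_expansion[OF frame(1,2) frame(3), of "z \<xi>r"] slip_r
      unfolding pseudo_velocity_def by (simp only: scaleR_zero_left add_0_right)
    then have "z \<xi>r \<bullet> nr = (z \<xi>r \<bullet> e) * (nr \<bullet> e)" by (metis inner_scaleR_left inner_commute)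
    moreover have "0 < z \<xi>r \<bullet> nr"
      using admissible[OF J(2)] unfolding admissible_at_def pseudo_velocity_def by simp
    ultimately have "0 < z \<xi>r \<bullet> e" using directions(1) by (simp add: zero_less_mult_iff)
    moreover have "gv \<bullet> z \<xi>r = (z \<xi>r \<bullet> e) * (gv \<bullet> e)" by (subst zr) simp
    ultimately show ?thesis using gv(2) by (simp add: zero_less_mult_iff)
  qed
  \<comment> \<open>The direction \<open>q\<close> is \<open>e\<close> tilted into the fluid. The
    tilt gives the barrier a derivative of definite sign across the wall, and it is small enough to
    keep at least half of \<open>gv \<bullet> e\<close>.\<close>
  define \<delta> where "\<delta> = (gv \<bullet> e) / (2 * (\<bar>gv \<bullet> nW\<bar> + 1))"
  define q where "q = e - \<delta> *\<^sub>R nW"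
  have \<delta>: "0 < \<delta>" using gve unfolding \<delta>_def by (auto intro!: divide_pos_pos)
  have gvq: "0 < gv \<bullet> q"
  proof -
    have "\<delta> * (gv \<bullet> nW) \<le> \<delta> * (\<bar>gv \<bullet> nW\<bar> + 1)" using \<delta> by (intro mult_left_mono) auto
    also have "\<dots> = (gv \<bullet> e) / 2" unfolding \<delta>_def by (simp add: field_simps)
    finally show ?thesis using gve unfolding q_def by (simp add: inner_diff_right)
  qed
  have qnW: "q \<bullet> nW = - \<delta>"
    using frame unfolding q_def by (simp add: inner_diff_left norm_eq_1 inner_commute[of e nW])
  have qT: "0 < q \<bullet> T 0"
  proof -
    have "\<delta> * (T 0 \<bullet> nW) \<le> 0" using \<delta> directions(3) by (simp add: mult_nonneg_nonpos)
    then show ?thesis using directions(2) unfolding q_def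
      by (simp add: inner_diff_left inner_commute[of e "T 0"] inner_commute[of nW "T 0"])
  qed
  \<comment> \<open>For \<open>|\<xi> - \<xi>r| \<le> 1\<close> this bounds the gradient
    \<open>q + 2 (\<xi> - \<xi>r)\<close> of the barrier, and \<open>B |\<xi> - \<xi>r|\<close>
    bounds its value.\<close>
  define B where "B = norm q + 2"
  have B: "2 \<le> B" unfolding B_def by simp
  \<comment> \<open>A common positive lower bound for \<open>gv\<close> in the direction of the
    barrier gradient and of all nearby shock normals; the factor one half leaves room for their
    variation.\<close>
  define \<beta> where "\<beta> = min (gv \<bullet> q) (gv \<bullet> nr) / 2"
  have \<beta>: "0 < \<beta>" "\<beta> < gv \<bullet> q" "\<beta> < gv \<bullet> nr" using gvq gvn by (auto simp: \<beta>_def min_def)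
  obtain \<delta>L CL where L: "0 < \<delta>L" "0 < CL"
    "\<And>w \<xi>. norm (w - vr) < \<delta>L \<Longrightarrow> norm (\<xi> - \<xi>r) < \<delta>L \<Longrightarrow>
       \<bar>g w \<xi> - g w \<xi>r\<bar> \<le> CL * \<bar>(vI - w) \<bullet> (\<xi> - \<xi>r)\<bar>"
    by (rule shock_g_lipschitz) blast
  \<comment> \<open>The linearisation error of \<open>g\<close>, bounded by
    \<open>\<eta> B (k + \<mu>)\<close>, may consume a quarter of the lower bound
    \<open>\<beta> (k + \<mu>)\<close> obtained below; the displacement of the shock point consumes
    another quarter through the last entry in \<open>r\<close>.\<close>
  define \<eta> where "\<eta> = \<beta> / (4 * B)"
  have \<eta>: "0 < \<eta>" "\<eta> * B = \<beta> / 4" using \<beta>(1) B by (auto simp: \<eta>_def)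
  obtain \<delta>g where \<delta>g: "0 < \<delta>g"
    "\<And>w. norm (w - vr) < \<delta>g \<Longrightarrow> \<bar>g w \<xi>r - gv \<bullet> (w - vr)\<bar> \<le> \<eta> * norm (w - vr)"
  proof -
    have "\<exists>d>0. \<forall>w. norm (w - vr) < d \<longrightarrow>
        norm (g w \<xi>r - g vr \<xi>r - (w - vr) \<bullet> gv) \<le> \<eta> * norm (w - vr)"
      using gv(1) \<eta>(1) unfolding gderiv_def has_derivative_at_alt by blast
    then show ?thesis using that shock_g_zero[OF J(2)] by (auto simp: inner_commute)
  qed
  have nG: "norm (vI - vr) = G 0" "vI - vr = G 0 *\<^sub>R nr"
    using velocity_shock[OF J(2)] G_pos[OF J(2)] n(1)[OF J(2)] by simp_all
  obtain \<delta>N where \<delta>N: "0 < \<delta>N"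
    "\<And>w. norm (w - vr) < \<delta>N \<Longrightarrow> \<beta> < gv \<bullet> ((vI - w) /\<^sub>R norm (vI - w))"
  proof -
    have "isCont (\<lambda>w. gv \<bullet> ((vI - w) /\<^sub>R norm (vI - w))) vr"
      using nG G_pos[OF J(2)] by (intro continuous_intros) auto
    moreover have "\<beta> < gv \<bullet> ((vI - vr) /\<^sub>R norm (vI - vr))"
      using \<beta>(3) unit_jump[OF J(2)] by simp
    ultimately obtain d where "0 < d" and d: "\<And>w. dist w vr < d \<Longrightarrow>
        dist (gv \<bullet> ((vI - w) /\<^sub>R norm (vI - w))) (gv \<bullet> ((vI - vr) /\<^sub>R norm (vI - vr)))
          < gv \<bullet> ((vI - vr) /\<^sub>R norm (vI - vr)) - \<beta>"
      unfolding continuous_at_eps_delta by (meson diff_gt_0_iff_gt)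
    have "\<beta> < gv \<bullet> ((vI - w) /\<^sub>R norm (vI - w))" if "norm (w - vr) < d" for w
      using d[of w] that unfolding dist_norm[of w] dist_real_def by linarith
    then show ?thesis using that \<open>0 < d\<close> by blast
  qed
  define \<delta>v where "\<delta>v = min \<delta>L (min \<delta>g \<delta>N)"
  have \<delta>v: "0 < \<delta>v" using L \<delta>g \<delta>N by (simp add: \<delta>v_def)
  obtain r1 where r1: "0 < r1" "\<And>\<xi>. \<xi> \<in> closure E \<Longrightarrow> dist \<xi> \<xi>r < r1 \<Longrightarrow> dist (v \<xi>) vr < \<delta>v"
    using continuous_v \<xi>r_cl \<delta>v unfolding continuous_on_iff by meson
  define r where "r = Min {r0, r1, \<delta>L, 1, (gv \<bullet> q - \<beta>) / (2 * norm gv + 1), \<beta> / (8 * CL * B)} / 2"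
  have pos: "0 < (gv \<bullet> q - \<beta>) / (2 * norm gv + 1)" "0 < \<beta> / (8 * CL * B)"
  proof -
    show "0 < (gv \<bullet> q - \<beta>) / (2 * norm gv + 1)"
      using \<beta>(2) by (intro divide_pos_pos add_nonneg_pos) auto
    show "0 < \<beta> / (8 * CL * B)" using \<beta>(1) L(2) B by (intro divide_pos_pos mult_pos_pos) auto
  qed
  have r: "0 < r" "r < r0" "r < r1" "r < \<delta>L" "r < 1"
    "r \<le> (gv \<bullet> q - \<beta>) / (2 * norm gv + 1)" "r \<le> \<beta> / (8 * CL * B)"
  proof -
    let ?M = "Min {r0, r1, \<delta>L, 1, (gv \<bullet> q - \<beta>) / (2 * norm gv + 1), \<beta> / (8 * CL * B)}"
    have M: "0 < ?M" by (subst Min_gr_iff) (use r0(1) r1(1) L(1) pos in auto)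
    have "?M \<le> x" if "x \<in> {r0, r1, \<delta>L, 1, (gv \<bullet> q - \<beta>) / (2 * norm gv + 1), \<beta> / (8 * CL * B)}" for x
      by (rule Min_le) (use that in auto)
    then have "?M \<le> r0" "?M \<le> r1" "?M \<le> \<delta>L" "?M \<le> 1" "?M \<le> (gv \<bullet> q - \<beta>) / (2 * norm gv + 1)"
      "?M \<le> \<beta> / (8 * CL * B)" by blast+
    then show "0 < r" "r < r0" "r < r1" "r < \<delta>L" "r < 1"
      "r \<le> (gv \<bullet> q - \<beta>) / (2 * norm gv + 1)" "r \<le> \<beta> / (8 * CL * B)"
      using M unfolding r_def by linarith+
  qed
  \<comment> \<open>The term \<open>|\<xi> - \<xi>r|^2\<close> makes the barrier a strict
    subsolution: the operator gives \<open>2 (2 c^2 - |z|^2)\<close> on it, which is positive where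
    the flow is elliptic.\<close>
  let ?\<phi> = "quadratic q 0 q 1 \<xi>r"
  let ?D\<phi> = "quadratic_grad q 0 q 1 \<xi>r"
  have \<phi>_eq: "?\<phi> \<xi> = q \<bullet> (\<xi> - \<xi>r) + (\<xi> - \<xi>r) \<bullet> (\<xi> - \<xi>r)" and D\<phi>_eq: "?D\<phi> \<xi> = q + 2 *\<^sub>R (\<xi> - \<xi>r)" for \<xi>
    by (simp_all add: quadratic_def quadratic_grad_def)
  have bounds: "?\<phi> \<xi> \<le> B * norm (\<xi> - \<xi>r)" "norm (?D\<phi> \<xi>) \<le> B" "\<beta> \<le> gv \<bullet> ?D\<phi> \<xi>" if "dist \<xi>r \<xi> \<le> r" for \<xi>
  proof -
    have x: "norm (\<xi> - \<xi>r) \<le> r" using that by (simp add: dist_norm norm_minus_commute)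
    have "q \<bullet> (\<xi> - \<xi>r) \<le> norm q * norm (\<xi> - \<xi>r)" by (rule norm_cauchy_schwarz)
    moreover have "(\<xi> - \<xi>r) \<bullet> (\<xi> - \<xi>r) \<le> 1 * norm (\<xi> - \<xi>r)"
      unfolding power2_norm_eq_inner[symmetric] power2_eq_square by (rule mult_right_mono) (use x r in auto)
    ultimately show "?\<phi> \<xi> \<le> B * norm (\<xi> - \<xi>r)"
      unfolding \<phi>_eq B_def by (simp add: distrib_right) (smt (verit) norm_ge_zero)
    show "norm (?D\<phi> \<xi>) \<le> B"
      unfolding D\<phi>_eq B_def using norm_triangle_ineq[of q "2 *\<^sub>R (\<xi> - \<xi>r)"] x r by simp
    have "\<bar>gv \<bullet> (\<xi> - \<xi>r)\<bar> \<le> norm gv * r"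
      using Cauchy_Schwarz_ineq2[of gv "\<xi> - \<xi>r"] mult_left_mono[OF x norm_ge_zero[of gv]] by linarith
    moreover have "r * (2 * norm gv + 1) \<le> gv \<bullet> q - \<beta>"
      using r(6) by (simp add: pos_le_divide_eq add_nonneg_pos)
    ultimately show "\<beta> \<le> gv \<bullet> ?D\<phi> \<xi>"
      unfolding D\<phi>_eq inner_add_right using r(1) by (simp add: distrib_left mult.commute)
  qed
  have frontier_pos: "0 < U s \<xi>" if "\<xi> \<in> closure E" "\<xi> \<noteq> \<xi>r" "dist \<xi>r \<xi> < r0" for \<xi>
  proof (cases "\<xi> \<in> E")
    case False
    then have "\<xi> \<in> frontier E" using that open_E unfolding frontier_def by (simp add: interior_open)
    from frontier_near[OF this that(3)] show ?thesis
    proof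
      assume "\<xi> \<in> \<sigma> ` J"
      then show ?thesis using shock_positive that by auto
    next
      assume "\<exists>l\<ge>0. \<xi> = \<xi>r + l *\<^sub>R e"
      then obtain l where l: "0 \<le> l" "\<xi> = \<xi>r + l *\<^sub>R e" by blast
      then have "0 < l" "l < r0" using that(2,3) frame(1) by (auto simp: dist_norm less_le)
      then show ?thesis using wall_positive that(1) l(2) by simp
    qed
  qed (use U_pos in \<open>simp add: U_def\<close>)
  obtain mS where mS: "0 < mS" "\<And>\<xi>. \<xi> \<in> closure E \<Longrightarrow> dist \<xi>r \<xi> = r \<Longrightarrow> mS \<le> U s \<xi>"
  proof (cases "closure E \<inter> sphere \<xi>r r = {}")
    case False
    have "compact (closure E \<inter> sphere \<xi>r r)" by (simp add: closed_Int_compact)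
    moreover have "continuous_on (closure E \<inter> sphere \<xi>r r) (U s)"
      by (rule continuous_on_subset[OF continuous_U]) auto
    ultimately obtain x where x: "x \<in> closure E \<inter> sphere \<xi>r r" "\<forall>\<xi>\<in>closure E \<inter> sphere \<xi>r r. U s x \<le> U s \<xi>"
      using continuous_attains_inf[OF _ False] by blast
    have "0 < U s x" by (rule frontier_pos) (use x r in auto)
    then show ?thesis using that x(2) by auto
  qed (use that[of 1] in force)
  \<comment> \<open>On the circle of radius \<open>r < 1\<close> the barrier is at most
    \<open>B r < B\<close>, so there \<open>k\<close> times it stays below the minimum
    \<open>mS\<close> of \<open>U\<close>.\<close>
  define k where "k = mS / B"
  have k: "0 < k" "k * B = mS" using mS B by (auto simp: k_def)
  have barrier: "k * ?\<phi> \<xi> \<le> U s \<xi>" if "\<xi> \<in> closure E" "dist \<xi>r \<xi> \<le> r" for \<xi>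
  proof (rule ccontr)
    assume neg: "\<not> ?thesis"
    let ?C = "closure E \<inter> cball \<xi>r r"
    have "compact ?C" by (simp add: closed_Int_compact)
    moreover have "continuous_on ?C (\<lambda>\<xi>. U s \<xi> - k * ?\<phi> \<xi>)"
      by (intro continuous_intros continuous_on_subset[OF continuous_U]) auto
    moreover have "?C \<noteq> {}" using that by auto
    ultimately obtain X where X: "X \<in> ?C" and min': "\<forall>\<xi>\<in>?C. U s X - k * ?\<phi> X \<le> U s \<xi> - k * ?\<phi> \<xi>"
      using continuous_attains_inf[of ?C "\<lambda>\<xi>. U s \<xi> - k * ?\<phi> \<xi>"] by blast
    have Xcl: "X \<in> closure E" "dist \<xi>r X \<le> r" using X by auto
    have min: "U s X - k * ?\<phi> X \<le> U s \<xi> - k * ?\<phi> \<xi>" if "\<xi> \<in> closure E" "dist \<xi>r \<xi> \<le> r" for \<xi>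
      using min' that by simp
    have UX: "U s X < k * ?\<phi> X" using min[OF that] neg by linarith
    have X_ne: "X \<noteq> \<xi>r" using UX by (auto simp: U_def \<phi>_eq)
    have X_lt: "dist \<xi>r X < r"
    proof (rule ccontr)
      assume "\<not> ?thesis"
      then have d: "dist \<xi>r X = r" using Xcl by simp
      have "?\<phi> X \<le> B * norm (X - \<xi>r)" by (rule bounds(1)[OF Xcl(2)])
      also have "\<dots> = B * r" using d by (simp add: dist_norm norm_minus_commute)
      also have "\<dots> \<le> B * 1" using r(5) B by (intro mult_left_mono) auto
      finally have "k * ?\<phi> X \<le> k * B" using k(1) by simp
      then show False using mS(2)[OF Xcl(1) d] UX k(2) by simp
    qed
    let ?F = "\<lambda>\<xi>. s * (\<psi> \<xi> - vr \<bullet> \<xi>) - s * (\<psi> \<xi>r - vr \<bullet> \<xi>r) - k * ?\<phi> \<xi>"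
    let ?f = "\<lambda>\<xi>. s *\<^sub>R (v \<xi> - vr) - k *\<^sub>R ?D\<phi> \<xi>"
    have no_descent: "0 \<le> ?f X \<bullet> p" if p: "\<forall>\<^sub>F \<epsilon> in at_right 0. X + \<epsilon> *\<^sub>R p \<in> E" for p
    proof (rule ccontr)
      assume "\<not> ?thesis"
      then have "?f X \<bullet> p < 0" by simp
      from C1_closure_descent[OF C1_closure_minus_quadratic[OF C1] Xcl(1) p this]
      have "\<forall>\<^sub>F \<epsilon> in at_right 0. ?F (X + \<epsilon> *\<^sub>R p) < ?F X" .
      moreover have "\<forall>\<^sub>F \<epsilon> in at_right 0. X + \<epsilon> *\<^sub>R p \<in> ball \<xi>r r"
        by (rule eventually_ray_in_open) (use X_lt in auto)
      ultimately have "\<forall>\<^sub>F \<epsilon> in at_right (0::real). False"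
        using p
      proof eventually_elim
        case (elim \<epsilon>)
        then have "X + \<epsilon> *\<^sub>R p \<in> closure E" "dist \<xi>r (X + \<epsilon> *\<^sub>R p) \<le> r"
          using closure_subset[of E] by auto
        from min[OF this] have "?F X \<le> ?F (X + \<epsilon> *\<^sub>R p)" unfolding U_def .
        then show False using elim by simp
      qed
      then show False by simp
    qed
    have "X \<notin> E"
    proof
      assume XE: "X \<in> E"
      have "open (E \<inter> ball \<xi>r r)" "X \<in> E \<inter> ball \<xi>r r" using open_E XE X_lt by auto
      then obtain \<epsilon> where \<epsilon>: "0 < \<epsilon>" "ball X \<epsilon> \<subseteq> E \<inter> ball \<xi>r r" unfolding open_contains_ball by blast
      have "norm (z X) < c X" by (rule z_less_c_E[OF XE])
      then have "z X \<bullet> z X < (c X)\<^sup>2"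
        unfolding power2_norm_eq_inner[symmetric] by (rule power_strict_mono) auto
      then have "0 < 2 * (c X)\<^sup>2 - z X \<bullet> z X" using zero_le_power2[of "c X"] by linarith
      from mult_pos_pos[OF k(1) this]
      have "0 < k * (0 * ((c X)\<^sup>2 * (q \<bullet> q) - (z X \<bullet> q)\<^sup>2) + 1 * (2 * (c X)\<^sup>2 - z X \<bullet> z X))"
        by (simp only: mult_zero_left mult_1 add_0)
      moreover have "s * (\<psi> X - vr \<bullet> X) - k * ?\<phi> X \<le> s * (\<psi> \<xi> - vr \<bullet> \<xi>) - k * ?\<phi> \<xi>"
        if "\<xi> \<in> ball X \<epsilon>" for \<xi>
      proof -
        have "\<xi> \<in> closure E" "dist \<xi>r \<xi> \<le> r" using that \<epsilon>(2) closure_subset[of E] by auto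
        from min[OF this] show ?thesis unfolding U_def by linarith
      qed
      ultimately show False
        using elliptic_no_local_min[OF C2 _ \<epsilon>(1) refl refl \<open>norm (z X) < c X\<close>] \<epsilon>(2) by (metis Int_subset_iff)
    qed
    then have Xfr: "X \<in> frontier E" using Xcl open_E unfolding frontier_def by (simp add: interior_open)
    have X_r0: "dist \<xi>r X < r0" using X_lt r by simp
    from frontier_near[OF Xfr X_r0] show False
    proof
      assume "\<exists>l\<ge>0. X = \<xi>r + l *\<^sub>R e"
      then obtain l where l: "0 \<le> l" "X = \<xi>r + l *\<^sub>R e" by blast
      then have l': "0 < l" "l < r0" using X_ne X_r0 frame(1) by (auto simp: dist_norm less_le)
      note Xl = Xcl(1)[unfolded l(2)]
      obtain \<rho> where \<rho>: "0 < \<rho>" "ball X \<rho> \<inter> {x. (x - \<xi>r) \<bullet> nW < 0} \<subseteq> E"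
        using wall_side[OF l' Xl] l(2) by blast
      \<comment> \<open>On the wall the slip conditions make \<open>U\<close> contribute nothing to
        the normal derivative, while the tilt of \<open>q\<close> makes the difference decrease
        along \<open>- nW\<close>, against minimality.\<close>
      have eW: "e \<bullet> nW = 0" using frame by (simp add: inner_commute)
      have "\<forall>\<^sub>F \<epsilon> in at_right 0. X + \<epsilon> *\<^sub>R - nW \<in> E"
        using eventually_at_right_0_less[OF \<rho>(1)]
      proof eventually_elim
        case (elim \<epsilon>)
        have "(X + \<epsilon> *\<^sub>R - nW - \<xi>r) \<bullet> nW = - \<epsilon>"
          using frame(2) l(2) by (simp add: inner_diff_left eW norm_eq_1)
        moreover have "dist X (X + \<epsilon> *\<^sub>R - nW) < \<rho>" using elim frame(2) by (simp add: dist_norm)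
        ultimately show ?case using \<rho>(2) elim by (auto simp: subset_eq)
      qed
      from no_descent[OF this] have "0 \<le> ?f X \<bullet> - nW" .
      moreover have "(v X - vr) \<bullet> nW = 0"
        using wall_slip[OF l' Xl] slip_r l(2) by (simp add: inner_diff_left)
      moreover have "?D\<phi> X \<bullet> nW = - \<delta>"
        unfolding D\<phi>_eq using qnW l(2) eW by (simp add: inner_add_left)
      ultimately have "?f X \<bullet> nW = k * \<delta>"
        unfolding inner_diff_left[of "s *\<^sub>R (v X - vr)"] inner_scaleR_left by simp
      then have "0 \<le> - (k * \<delta>)" using \<open>0 \<le> ?f X \<bullet> - nW\<close> by (simp only: inner_minus_right)
      then show False using mult_pos_pos[OF k(1) \<delta>] by simp
    next
      assume "X \<in> \<sigma> ` J"
      then obtain t where t: "t \<in> J" "X = \<sigma> t" by auto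
      have t0: "t \<noteq> 0" using X_ne t by auto
      have tr0: "dist \<xi>r (\<sigma> t) < r0" using X_r0 t by simp
      note near = shock_near[OF t(1) t0 tr0] and nearE = shock_near_E[OF t(1) t0 tr0]
      have ti: "t \<in> interior J" and tZ: "\<sigma> t \<notin> Z" using near by auto
      have "((\<lambda>t. ?F (\<sigma> t)) has_real_derivative ?f (\<sigma> t) \<bullet> T t) (at t)"
        by (rule along_shock[OF C1_closure_minus_quadratic[OF C1_flow] ti tZ])
      moreover obtain d1 where d1: "0 < d1" "ball t d1 \<subseteq> J" using ti unfolding mem_interior by auto
      moreover obtain d2 where d2: "0 < d2" "\<And>t'. dist t' t < d2 \<Longrightarrow> dist (\<sigma> t') (\<sigma> t) < r - dist \<xi>r (\<sigma> t)"
      proof -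
        have "isCont \<sigma> t" using C1_curve_continuous[OF curve] ti continuous_on_interior by blast
        then show ?thesis
          using that X_lt t(2) unfolding continuous_at_eps_delta by (meson diff_gt_0_iff_gt)
      qed
      moreover have "\<forall>t'. \<bar>t - t'\<bar> < min d1 d2 \<longrightarrow> ?F (\<sigma> t) \<le> ?F (\<sigma> t')"
      proof (intro allI impI)
        fix t' assume t': "\<bar>t - t'\<bar> < min d1 d2"
        then have tJ: "t' \<in> J" using d1(2) by (auto simp: dist_real_def)
        have "dist \<xi>r (\<sigma> t') \<le> r"
          using d2(2)[of t'] t' dist_triangle[of \<xi>r "\<sigma> t'" "\<sigma> t"]
          by (simp add: dist_real_def dist_commute abs_minus_commute)
        moreover have "\<sigma> t' \<in> closure E"
          using closure_near[OF shock_in_closure[OF tJ]] \<open>dist \<xi>r (\<sigma> t') \<le> r\<close> r(2) by simp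
        ultimately show "?F (\<sigma> t) \<le> ?F (\<sigma> t')"
          using min[of "\<sigma> t'"] t(2) unfolding U_def by blast
      qed
      ultimately have fT: "?f X \<bullet> T t = 0"
        using DERIV_local_min[of "\<lambda>t. ?F (\<sigma> t)" "?f (\<sigma> t) \<bullet> T t" t "min d1 d2"] t(2) by simp
      \<comment> \<open>At a minimum on the shock the tangential derivative vanishes, so the
        gradient is \<mu> times the normal, with a nonnegative \<mu>. No bound on \<mu> relative to
        \<open>k\<close> is known, so all estimates are kept proportional to
        \<open>k + \<mu>\<close>.\<close>
      define \<mu> where "\<mu> = ?f X \<bullet> n t"
      have \<mu>: "0 \<le> \<mu>" unfolding \<mu>_def by (rule no_descent) (use nearE(2) t(2) in simp)
      have fX: "?f X = \<mu> *\<^sub>R n t"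
      proof -
        let ?a = "T t /\<^sub>R norm (T t)"
        have "norm ?a = 1" "n t \<bullet> ?a = 0" using T_nonzero[OF t(1)] n(2)[OF t(1)] by auto
        from orthonormal_expansion[OF this(1) n(1)[OF t(1)] this(2), of "?f X"]
        have "?f X = (?f X \<bullet> ?a) *\<^sub>R ?a + \<mu> *\<^sub>R n t" unfolding \<mu>_def .
        moreover have "?f X \<bullet> ?a = 0" using fT by (simp only: inner_scaleR_right mult_zero_right)
        ultimately show ?thesis by (simp only: scaleR_zero_left add_0)
      qed
      define \<Delta> where "\<Delta> = v X - vr"
      have \<Delta>: "s *\<^sub>R \<Delta> = k *\<^sub>R ?D\<phi> X + \<mu> *\<^sub>R n t" using fX unfolding \<Delta>_def by (simp add: algebra_simps)
      have norm_\<Delta>: "norm \<Delta> \<le> B * (k + \<mu>)"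
      proof -
        have "norm \<Delta> = norm (s *\<^sub>R \<Delta>)" using s by auto
        also have "\<dots> \<le> norm (k *\<^sub>R ?D\<phi> X) + norm (\<mu> *\<^sub>R n t)" unfolding \<Delta> by (rule norm_triangle_ineq)
        also have "\<dots> = k * norm (?D\<phi> X) + \<mu>" using k(1) \<mu> n(1)[OF t(1)] by simp
        also have "\<dots> \<le> k * B + \<mu> * B"
        proof (rule add_mono)
          show "k * norm (?D\<phi> X) \<le> k * B" using bounds(2)[OF Xcl(2)] k(1) by simp
          show "\<mu> \<le> \<mu> * B" using mult_left_mono[of 1 B \<mu>] \<mu> B by simp
        qed
        finally show ?thesis by (simp add: algebra_simps)
      qed
      have small: "norm (v X - vr) < \<delta>v"
        using r1(2)[OF Xcl(1)] Xcl(2) r(3) by (simp add: dist_norm norm_minus_commute)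
      have x: "norm (X - \<xi>r) \<le> r" using Xcl(2) by (simp add: dist_norm norm_minus_commute)
      \<comment> \<open>The contradiction on the shock: obliqueness bounds \<open>gv\<close> on the
        velocity change from below, while \<open>g\<close> vanishes at both shock points, so by
        linearisation and the Lipschitz bound the same number is at most
        \<open>\<beta> / 2 * (k + \<mu>)\<close>.\<close>
      have "\<beta> * (k + \<mu>) \<le> gv \<bullet> (s *\<^sub>R \<Delta>)"
      proof -
        have "\<beta> < gv \<bullet> n t"
          using \<delta>N(2)[of "v X"] small unit_jump[OF t(1)] t(2) unfolding \<delta>v_def by simp
        then have "\<mu> * \<beta> \<le> \<mu> * (gv \<bullet> n t)" using \<mu> by (intro mult_left_mono) auto
        moreover have "k * \<beta> \<le> k * (gv \<bullet> ?D\<phi> X)" using bounds(3)[OF Xcl(2)] k(1) by simp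
        ultimately show ?thesis unfolding \<Delta> inner_add_right inner_scaleR_right by (simp add: algebra_simps)
      qed
      also have "\<dots> \<le> \<bar>gv \<bullet> \<Delta>\<bar>" using s by auto
      also have "\<dots> \<le> \<bar>g (v X) \<xi>r\<bar> + \<eta> * norm \<Delta>"
        using \<delta>g(2)[of "v X"] small unfolding \<delta>v_def \<Delta>_def by simp
      also have "\<bar>g (v X) \<xi>r\<bar> \<le> CL * \<bar>(vI - v X) \<bullet> (X - \<xi>r)\<bar>"
        using L(3)[of "v X" X] small x r(4) shock_g_zero[OF t(1)] t(2) unfolding \<delta>v_def by simp
      also have "\<bar>(vI - v X) \<bullet> (X - \<xi>r)\<bar> \<le> 2 * B * (k + \<mu>) * r"
      proof -
        have "(vI - v X) \<bullet> (X - \<xi>r) = (vI - vr) \<bullet> (X - \<xi>r) - \<Delta> \<bullet> (X - \<xi>r)"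
          unfolding \<Delta>_def inner_diff_left[symmetric] by simp
        also have "(vI - vr) \<bullet> (X - \<xi>r) = G 0 * H t"
          unfolding nG(2) H_def t(2) by (simp add: inner_commute)
        finally have 1: "\<bar>(vI - v X) \<bullet> (X - \<xi>r)\<bar> \<le> \<bar>G 0 * H t\<bar> + \<bar>\<Delta> \<bullet> (X - \<xi>r)\<bar>" by simp
        \<comment> \<open>Here the violated barrier inequality enters: it makes \<open>U\<close> at
          \<open>X\<close>, hence the height of \<open>X\<close> over the tangent, of size at most
          \<open>B k r\<close>.\<close>
        have "\<bar>G 0 * H t\<bar> = \<bar>U s X\<bar>" using U_shock[OF t(1), of s] t(2) s by auto
        also have "\<dots> \<le> k * ?\<phi> X" using UX U_nonneg[OF Xcl(1)] by simp
        also have "\<dots> \<le> k * (B * r)"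
        proof (rule mult_left_mono)
          show "?\<phi> X \<le> B * r"
            by (rule order_trans[OF bounds(1)[OF Xcl(2)] mult_left_mono[OF x]]) (use B in simp)
        qed (use k in simp)
        finally have 2: "\<bar>G 0 * H t\<bar> \<le> B * k * r" by (simp add: mult_ac)
        have "\<bar>\<Delta> \<bullet> (X - \<xi>r)\<bar> \<le> norm \<Delta> * norm (X - \<xi>r)" by (rule Cauchy_Schwarz_ineq2)
        also have "\<dots> \<le> B * (k + \<mu>) * r" by (rule mult_mono[OF norm_\<Delta> x]) (use B k \<mu> in auto)
        finally have 3: "\<bar>\<Delta> \<bullet> (X - \<xi>r)\<bar> \<le> B * (k + \<mu>) * r" .
        have "B * k * r \<le> B * (k + \<mu>) * r" using B \<mu> r(1) by (intro mult_right_mono mult_left_mono) auto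
        moreover have "2 * B * (k + \<mu>) * r = B * (k + \<mu>) * r + B * (k + \<mu>) * r" by simp
        ultimately show ?thesis using 1 2 3 by linarith
      qed
      finally have "\<beta> * (k + \<mu>) \<le> CL * (2 * B * (k + \<mu>) * r) + \<eta> * norm \<Delta>" using L(2) by simp
      also have "\<eta> * norm \<Delta> \<le> \<eta> * (B * (k + \<mu>))" using norm_\<Delta> \<eta>(1) by simp
      also have "\<dots> = \<beta> / 4 * (k + \<mu>)" using \<eta>(2) by (simp add: mult.assoc[symmetric])
      also have "CL * (2 * B * (k + \<mu>) * r) = (2 * CL * B * r) * (k + \<mu>)" by (simp add: mult_ac)
      also have "\<dots> \<le> \<beta> / 4 * (k + \<mu>)"
      proof (rule mult_right_mono)
        have "r * (8 * CL * B) \<le> \<beta>" using r(7) L(2) B by (simp add: pos_le_divide_eq)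
        then show "2 * CL * B * r \<le> \<beta> / 4" by (simp add: mult_ac)
      qed (use k \<mu> in simp)
      finally have "\<beta> * (k + \<mu>) \<le> \<beta> / 2 * (k + \<mu>)" by (simp add: algebra_simps)
      moreover have "0 < \<beta> * (k + \<mu>)" using \<beta>(1) k(1) \<mu> by simp
      ultimately show False by simp
    qed
  qed
  \<comment> \<open>The gradient at \<xi>r of \<open>s * G 0\<close> times the height minus
    \<open>k\<close> times the barrier. Along the shock tangent the height does not change to first
    order, so the derivative is \<open>- k (q \<bullet> T 0) < 0\<close>, whereas the barrier
    inequality requires it to be nonnegative.\<close>
  define a where "a = (s * G 0) *\<^sub>R nr - k *\<^sub>R q"
  have aT: "a \<bullet> T 0 < 0"
    unfolding a_def using n(2)[OF J(2)] k(1) qT by (simp add: inner_diff_left)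
  define \<eta>' where "\<eta>' = - (a \<bullet> T 0) / (2 * (norm a + 1))"
  have \<eta>': "0 < \<eta>'" unfolding \<eta>'_def using aT by (intro divide_pos_pos) (auto simp: add_nonneg_pos)
  obtain d3 where d3: "0 < d3"
    "\<And>t t'. \<lbrakk>t \<in> J; t' \<in> J; \<bar>t - 0\<bar> < d3; \<bar>t' - 0\<bar> < d3\<rbrakk> \<Longrightarrow>
       norm (\<sigma> t' - \<sigma> t - (t' - t) *\<^sub>R T 0) \<le> \<eta>' * \<bar>t' - t\<bar>"
    by (rule C1_curve_strictly_differentiable[OF curve J(1,2) \<eta>']) blast
  obtain d4 where d4: "0 < d4" "{0..d4} \<subseteq> J" using start by blast
  obtain d5 where d5: "0 < d5" "\<And>t. t \<in> J \<Longrightarrow> dist t 0 < d5 \<Longrightarrow> dist (\<sigma> t) \<xi>r < r"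
    using C1_curve_continuous[OF curve] J(2) r(1) unfolding continuous_on_iff by meson
  define t where "t = Min {d3, d4, d5} / 2"
  have t: "0 < t" "t < d3" "t < d4" "t < d5" using d3 d4 d5 by (auto simp: t_def)
  have tJ: "t \<in> J" using t d4 by auto
  have "dist \<xi>r (\<sigma> t) \<le> r" using d5(2)[OF tJ] t by (simp add: dist_commute)
  moreover have "\<sigma> t \<in> closure E"
    using closure_near[OF shock_in_closure[OF tJ]] \<open>dist \<xi>r (\<sigma> t) \<le> r\<close> r(2) by simp
  ultimately have "k * ?\<phi> (\<sigma> t) \<le> U s (\<sigma> t)" using barrier by blast
  moreover have "k * (q \<bullet> (\<sigma> t - \<xi>r)) \<le> k * ?\<phi> (\<sigma> t)" unfolding \<phi>_eq using k(1) by simp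
  ultimately have "k * (q \<bullet> (\<sigma> t - \<xi>r)) \<le> s * (G 0 * H t)" using U_shock[OF tJ, of s] by linarith
  then have 1: "0 \<le> a \<bullet> (\<sigma> t - \<xi>r)"
    unfolding a_def H_def
    by (simp add: inner_diff_left[of "(s * G 0) *\<^sub>R nr"] inner_commute[of nr "\<sigma> t - \<xi>r"])
  have "norm (\<sigma> t - \<xi>r - (t - 0) *\<^sub>R T 0) \<le> \<eta>' * \<bar>t - 0\<bar>"
    by (rule d3(2)) (use tJ J(2) t d3 in auto)
  then have "norm (\<sigma> t - \<xi>r - t *\<^sub>R T 0) \<le> \<eta>' * t" using t by simp
  then have "a \<bullet> (\<sigma> t - \<xi>r - t *\<^sub>R T 0) \<le> norm a * (\<eta>' * t)"
    using norm_cauchy_schwarz[of a "\<sigma> t - \<xi>r - t *\<^sub>R T 0"] by (smt (verit) mult_left_mono norm_ge_zero)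
  also have "\<dots> \<le> (norm a + 1) * (\<eta>' * t)" using \<eta>' t by (intro mult_right_mono) auto
  also have "\<dots> = - (a \<bullet> T 0) / 2 * t" unfolding \<eta>'_def by (simp add: field_simps add_nonneg_eq_0_iff)
  finally have "a \<bullet> (\<sigma> t - \<xi>r) - t * (a \<bullet> T 0) \<le> - (a \<bullet> T 0) / 2 * t"
    unfolding inner_diff_right[of a "\<sigma> t - \<xi>r"] inner_scaleR_right .
  then have "a \<bullet> (\<sigma> t - \<xi>r) \<le> (a \<bullet> T 0) / 2 * t" by (simp add: mult.commute)
  moreover have "(a \<bullet> T 0) / 2 * t < 0" using aT t(1) by (intro mult_neg_pos) auto
  ultimately show False using 1 by simp
qed

end

section \<open>Wall-corner reflection\<close>

lemma curve_first_order:
  assumes C1: "C1_curve J \<sigma>" "convex J" "t0 \<in> J" and pos: "0 < tangent J \<sigma> t0 \<bullet> m"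
  obtains \<delta> where "0 < \<delta>"
    "\<And>t. t \<in> J \<Longrightarrow> t0 < t \<Longrightarrow> t < t0 + \<delta> \<Longrightarrow> 0 < (\<sigma> t - \<sigma> t0) \<bullet> m"
    "\<And>t. t \<in> J \<Longrightarrow> t < t0 \<Longrightarrow> t0 - \<delta> < t \<Longrightarrow> (\<sigma> t - \<sigma> t0) \<bullet> m < 0"
proof -
  let ?w = "tangent J \<sigma> t0"
  define \<eta> where "\<eta> = (?w \<bullet> m) / (2 * (norm m + 1))"
  have \<eta>: "0 < \<eta>" unfolding \<eta>_def using pos by (intro divide_pos_pos) (auto simp: add_nonneg_pos)
  have \<eta>m: "\<eta> * norm m < ?w \<bullet> m"
  proof -
    have "\<eta> * norm m \<le> \<eta> * (norm m + 1)" using \<eta> by simp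
    also have "\<dots> = (?w \<bullet> m) / 2" unfolding \<eta>_def by (simp add: field_simps add_nonneg_eq_0_iff)
    finally show ?thesis using pos by linarith
  qed
  obtain \<delta> where \<delta>: "0 < \<delta>"
    "\<And>t t'. \<lbrakk>t \<in> J; t' \<in> J; \<bar>t - t0\<bar> < \<delta>; \<bar>t' - t0\<bar> < \<delta>\<rbrakk> \<Longrightarrow>
       norm (\<sigma> t' - \<sigma> t - (t' - t) *\<^sub>R ?w) \<le> \<eta> * \<bar>t' - t\<bar>"
    by (rule C1_curve_strictly_differentiable[OF C1 \<eta>]) blast
  have est: "\<bar>(\<sigma> t - \<sigma> t0) \<bullet> m - (t - t0) * (?w \<bullet> m)\<bar> < \<bar>t - t0\<bar> * (?w \<bullet> m)"
    if "t \<in> J" "\<bar>t - t0\<bar> < \<delta>" "t \<noteq> t0" for t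
  proof -
    have "norm (\<sigma> t - \<sigma> t0 - (t - t0) *\<^sub>R ?w) \<le> \<eta> * \<bar>t - t0\<bar>"
      by (rule \<delta>(2)) (use that C1 \<delta>(1) in auto)
    then have "\<bar>(\<sigma> t - \<sigma> t0 - (t - t0) *\<^sub>R ?w) \<bullet> m\<bar> \<le> \<eta> * \<bar>t - t0\<bar> * norm m"
      by (rule order_trans[OF Cauchy_Schwarz_ineq2 mult_right_mono]) simp
    also have "\<dots> < \<bar>t - t0\<bar> * (?w \<bullet> m)"
      using mult_strict_left_mono[OF \<eta>m, of "\<bar>t - t0\<bar>"] that by (simp add: mult_ac)
    finally show ?thesis by (simp add: inner_diff_left[of "\<sigma> t - \<sigma> t0"])
  qed
  show ?thesis
  proof (rule that[OF \<delta>(1)])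
    fix t assume t: "t \<in> J" "t0 < t" "t < t0 + \<delta>"
    then have "\<bar>t - t0\<bar> * (?w \<bullet> m) = (t - t0) * (?w \<bullet> m)" "t \<noteq> t0" "\<bar>t - t0\<bar> < \<delta>" by auto
    with est[OF t(1)] show "0 < (\<sigma> t - \<sigma> t0) \<bullet> m" by linarith
  next
    fix t assume t: "t \<in> J" "t < t0" "t0 - \<delta> < t"
    then have "\<bar>t - t0\<bar> = - (t - t0)" "t \<noteq> t0" "\<bar>t - t0\<bar> < \<delta>" by auto
    moreover from this(1) have "\<bar>t - t0\<bar> * (?w \<bullet> m) = - ((t - t0) * (?w \<bullet> m))"
      by (simp only: mult_minus_left)
    ultimately show "(\<sigma> t - \<sigma> t0) \<bullet> m < 0" using est[OF t(1)] by linarith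
  qed
qed

text \<open>A simple closed curve is homeomorphic to a circle, so this is the Jordan-Brouwer theorem
  in dimension two; the complex unit circle mediates between the two statements.\<close>

lemma frontier_inside_simple_closed_curve:
  fixes p :: "real \<Rightarrow> plane"
  assumes "simple_path p" "pathfinish p = pathstart p" and C: "C \<in> components (- path_image p)"
  shows "frontier C = path_image p"
proof -
  have "path_image p homeomorphic sphere (0::complex) 1"
    by (rule homeomorphic_simple_path_image_circle) (use assms in auto)
  also have "sphere (0::complex) 1 homeomorphic sphere (0::plane) 1"
    by (rule homeomorphic_spheres_gen) auto
  finally show ?thesis by (rule Jordan_Brouwer_frontier[OF _ C]) simp
qed

lemma halfplane: "open {x::plane. (x - k) \<bullet> m < 0}" "convex {x::plane. (x - k) \<bullet> m < 0}"
proof -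
  have eq: "{x. (x - k) \<bullet> m < 0} = {x. m \<bullet> x < m \<bullet> k}"
    by (simp add: inner_diff_left inner_commute[of m])
  show "open {x::plane. (x - k) \<bullet> m < 0}" "convex {x::plane. (x - k) \<bullet> m < 0}"
    unfolding eq by (rule open_halfspace_lt, rule convex_halfspace_lt)
qed

lemma angle_acute:
  assumes "0 < angle x y" "angle x y < pi / 2" "x \<noteq> 0" "y \<noteq> 0"
  shows "0 < x \<bullet> y" "x \<bullet> y < norm x * norm y"
proof -
  let ?q = "x \<bullet> y / (norm x * norm y)"
  have "\<bar>x \<bullet> y\<bar> \<le> norm x * norm y" by (rule Cauchy_Schwarz_ineq2)
  moreover have p: "0 < norm x * norm y" using assms by simp
  ultimately have q: "- 1 \<le> ?q" "?q \<le> 1" by (auto simp: field_simps abs_le_iff)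
  have "0 < ?q"
  proof (rule ccontr)
    assume "\<not> 0 < ?q"
    then have "arccos 0 \<le> arccos ?q" using q by (intro arccos_le_arccos) auto
    then show False using assms(2) unfolding angle_def by simp
  qed
  then show "0 < x \<bullet> y" using p by (simp add: zero_less_divide_iff)
  have "?q \<noteq> 1"
  proof
    assume "?q = 1"
    then show False using assms(1) unfolding angle_def by (simp only: arccos_1)
  qed
  with q(2) have "?q < 1" by (rule le_neq_trans)
  then show "x \<bullet> y < norm x * norm y" using p by (simp add: divide_less_eq)
qed

lemma angle_strict:
  assumes "norm a = 1" "norm b = 1" "0 < angle a b" "angle a b < pi"
  shows "b \<noteq> a" "b \<noteq> - a"
  using assms by (auto simp: angle_def dot_square_norm)

text \<open>The normals \<open>n\<close> and \<open>n'\<close> point into \<open>E\<close> and into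
  the upstream region. Having both sides of the shock is what later fixes the direction of the
  normal at the reflection point. \<alpha> and \<beta> are the distances of the two shock ends from
  the corner.\<close>

locale wall_corner = polytropic_gas +
  fixes k a b nA nB :: plane and RI :: "plane set" and vI :: plane and \<rho>I :: real and \<psi>I :: "plane \<Rightarrow> real"
    and \<sigma> :: "real \<Rightarrow> plane" and \<psi> :: "plane \<Rightarrow> real" and v :: "plane \<Rightarrow> plane" and n n' :: "real \<Rightarrow> plane"
    and E :: "plane set" and \<alpha> \<beta> :: real
  assumes E_def: "E = elliptic_region k \<sigma>"
    and ab: "norm a = 1" "norm b = 1" "0 < angle a b" "angle a b < pi"
    and nA: "outer_wall_normal k a E nA" and nB: "outer_wall_normal k b E nB"
    and C1_\<sigma>: "C1_curve {0..1} \<sigma>"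
    and \<alpha>: "0 < \<alpha>" "\<sigma> 0 = k + \<alpha> *\<^sub>R a" and \<beta>: "0 < \<beta>" "\<sigma> 1 = k + \<beta> *\<^sub>R b"
    and in_sector: "\<sigma> ` {0<..<1} \<subseteq> sector k a b"
    and angle_r: "0 < angle (tangent {0..1} \<sigma> 0) (k - \<sigma> 0)" "angle (tangent {0..1} \<sigma> 0) (k - \<sigma> 0) < pi / 2"
    and const: "constant_state \<pi> vI \<rho>I \<psi>I"
    and RI: "RI \<inter> closure E = {}" and n': "normal_into {0..1} \<sigma> RI n'"
    and slip_I: "(vI - k) \<bullet> nB = 0"
    and C1: "C1_closure E \<psi> v" and has_density: "\<And>\<xi>. \<xi> \<in> closure E \<Longrightarrow> has_density \<pi> \<psi> v \<xi>"
    and C2: "C2_potential_flow \<gamma> \<pi> E \<psi> v"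
    and subsonic: "\<And>\<xi>. \<xi> \<in> E \<Longrightarrow> pseudo_Mach \<gamma> \<pi> \<psi> v \<xi> < 1"
    and slip_A: "\<And>\<xi>. \<xi> \<in> closed_segment k (\<sigma> 0) \<Longrightarrow> (v \<xi> - \<xi>) \<bullet> nA = 0"
    and slip_B: "\<And>\<xi>. \<xi> \<in> closed_segment k (\<sigma> 1) \<Longrightarrow> (v \<xi> - \<xi>) \<bullet> nB = 0"
    and n_into: "normal_into {0..1} \<sigma> E n"
    and shock: "\<And>t. t \<in> {0..1} \<Longrightarrow> shock_at \<pi> vI \<rho>I \<psi>I \<psi> v (n t) (\<sigma> t)"
    and admissible: "\<And>t. t \<in> {0..1} \<Longrightarrow> admissible_at vI v (n t) (\<sigma> t)"
begin

abbreviation "segA \<equiv> closed_segment k (\<sigma> 0)"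
abbreviation "segB \<equiv> closed_segment k (\<sigma> 1)"
definition "Sec = {x. (x - k) \<bullet> nA < 0 \<and> (x - k) \<bullet> nB < 0}"
definition "bdry = path_image \<sigma> \<union> segA \<union> segB"

lemma nA_facts: "norm nA = 1" "nA \<bullet> a = 0" "a \<bullet> nA = 0" "\<And>x. x \<in> E \<Longrightarrow> (x - k) \<bullet> nA < 0"
  and nB_facts: "norm nB = 1" "nB \<bullet> b = 0" "b \<bullet> nB = 0" "\<And>x. x \<in> E \<Longrightarrow> (x - k) \<bullet> nB < 0"
  using nA nB unfolding outer_wall_normal_def by (auto simp: inner_commute)

lemma segA_eq: "segA = {k + l *\<^sub>R a | l. 0 \<le> l \<and> l \<le> \<alpha>}" and segB_eq: "segB = {k + l *\<^sub>R b | l. 0 \<le> l \<and> l \<le> \<beta>}"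
proof -
  have *: "closed_segment k (k + m *\<^sub>R d) = {k + l *\<^sub>R d | l. 0 \<le> l \<and> l \<le> m}" if "0 < m" for d :: plane and m :: real
  proof -
    have 1: "(1 - u) *\<^sub>R k + u *\<^sub>R (k + m *\<^sub>R d) = k + (u * m) *\<^sub>R d" for u
      by (simp add: algebra_simps)
    show ?thesis
    proof (intro subset_antisym subsetI)
      fix x assume "x \<in> closed_segment k (k + m *\<^sub>R d)"
      then obtain u where "0 \<le> u" "u \<le> 1" "x = k + (u * m) *\<^sub>R d" unfolding closed_segment_def 1 by auto
      then show "x \<in> {k + l *\<^sub>R d | l. 0 \<le> l \<and> l \<le> m}" using that mult_right_mono[of u 1 m] by auto
    next
      fix x assume "x \<in> {k + l *\<^sub>R d | l. 0 \<le> l \<and> l \<le> m}"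
      then obtain l where "0 \<le> l" "l \<le> m" "x = k + l *\<^sub>R d" by auto
      then show "x \<in> closed_segment k (k + m *\<^sub>R d)"
        unfolding closed_segment_def 1 using that by (auto intro!: exI[of _ "l / m"])
    qed
  qed
  show "segA = {k + l *\<^sub>R a | l. 0 \<le> l \<and> l \<le> \<alpha>}" "segB = {k + l *\<^sub>R b | l. 0 \<le> l \<and> l \<le> \<beta>}"
    using *[OF \<alpha>(1)] *[OF \<beta>(1)] unfolding \<alpha>(2) \<beta>(2) by auto
qed

lemma not_parallel: "b \<bullet> nA \<noteq> 0" "a \<bullet> nB \<noteq> 0"
proof -
  have *: "y = x \<or> y = - x" if "norm x = 1" "norm y = 1" "norm m = 1" "m \<bullet> x = 0" "y \<bullet> m = 0" for x y m :: plane
  proof -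
    have "y = (y \<bullet> x) *\<^sub>R x" using orthonormal_expansion[OF that(1,3,4), of y] that(5) by simp
    moreover from this have "\<bar>y \<bullet> x\<bar> = 1" using that(1,2) by (metis mult.right_neutral norm_scaleR)
    ultimately show ?thesis by (metis abs_eq_iff' abs_1 scaleR_one scaleR_minus_left)
  qed
  show "b \<bullet> nA \<noteq> 0" using *[OF ab(1,2) nA_facts(1,2)] angle_strict[OF ab] by auto
  show "a \<bullet> nB \<noteq> 0" using *[OF ab(2,1) nB_facts(1,2)] angle_strict[OF ab] by auto
qed

lemma arc_\<sigma>: "arc \<sigma>"
  unfolding arc_def path_def using C1_curve_continuous[OF C1_\<sigma>] C1_\<sigma> unfolding C1_curve_def by auto

lemma sector_coords:
  assumes "t \<in> {0<..<1}"
  obtains x y where "0 < x" "0 < y" "\<sigma> t = k + x *\<^sub>R a + y *\<^sub>R b"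
    "(\<sigma> t - k) \<bullet> nA = y * (b \<bullet> nA)" "(\<sigma> t - k) \<bullet> nB = x * (a \<bullet> nB)"
proof -
  have "\<sigma> t \<in> sector k a b" using in_sector assms by blast
  then obtain x y where "0 < x" "0 < y" "\<sigma> t = k + x *\<^sub>R a + y *\<^sub>R b" unfolding sector_def by auto
  then show ?thesis using that nA_facts nB_facts by (simp add: inner_add_left)
qed

lemma shock_cases:
  assumes "X \<in> path_image \<sigma>"
  obtains "X = \<sigma> 0" | "X = \<sigma> 1" | t where "t \<in> {0<..<1}" "X = \<sigma> t"
proof -
  obtain t where t: "0 \<le> t" "t \<le> 1" "X = \<sigma> t" using assms unfolding path_image_def by auto
  show ?thesis
  proof (cases "t = 0 \<or> t = 1")
    case True
    then show ?thesis using that t by auto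
  next
    case False
    then show ?thesis using that(3)[of t] t by auto
  qed
qed

lemma disjoint:
  "path_image \<sigma> \<inter> segA \<subseteq> {\<sigma> 0}" "path_image \<sigma> \<inter> segB \<subseteq> {\<sigma> 1}" "segA \<inter> segB \<subseteq> {k}"
proof -
  have A: "(X - k) \<bullet> nA = 0" if "X \<in> segA" for X using that nA_facts unfolding segA_eq by auto
  have B: "(X - k) \<bullet> nB = 0" if "X \<in> segB" for X using that nB_facts unfolding segB_eq by auto
  have 0: "\<sigma> 0 \<notin> segB" using B[of "\<sigma> 0"] \<alpha> not_parallel by auto
  have 1: "\<sigma> 1 \<notin> segA" using A[of "\<sigma> 1"] \<beta> not_parallel by auto
  have S: "(\<sigma> t - k) \<bullet> nA \<noteq> 0" "(\<sigma> t - k) \<bullet> nB \<noteq> 0" if t: "t \<in> {0<..<1}" for t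
  proof -
    obtain x y where "0 < x" "0 < y" "\<sigma> t = k + x *\<^sub>R a + y *\<^sub>R b" "(\<sigma> t - k) \<bullet> nA = y * (b \<bullet> nA)" "(\<sigma> t - k) \<bullet> nB = x * (a \<bullet> nB)"
      by (rule sector_coords[OF t])
    then show "(\<sigma> t - k) \<bullet> nA \<noteq> 0" "(\<sigma> t - k) \<bullet> nB \<noteq> 0" using not_parallel by simp_all
  qed
  show "path_image \<sigma> \<inter> segA \<subseteq> {\<sigma> 0}"
  proof
    fix X assume X: "X \<in> path_image \<sigma> \<inter> segA"
    then have "X \<in> path_image \<sigma>" by blast
    then show "X \<in> {\<sigma> 0}" by (cases rule: shock_cases) (use X A S(1) 1 in blast)+
  qed
  show "path_image \<sigma> \<inter> segB \<subseteq> {\<sigma> 1}"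
  proof
    fix X assume X: "X \<in> path_image \<sigma> \<inter> segB"
    then have "X \<in> path_image \<sigma>" by blast
    then show "X \<in> {\<sigma> 1}" by (cases rule: shock_cases) (use X B S(2) 0 in blast)+
  qed
  show "segA \<inter> segB \<subseteq> {k}"
  proof
    fix X assume X: "X \<in> segA \<inter> segB"
    then obtain l where "X = k + l *\<^sub>R a" unfolding segA_eq by auto
    then show "X \<in> {k}" using B[of X] X not_parallel by auto
  qed
qed

text \<open>Shock and wall segments form a simple closed curve, so each component of its complement
  has the whole curve as frontier. \<open>E\<close> is nonempty because the shock normal points into
  it, and it contains the component of each of its points. A value that is constant on one component
  therefore reaches every boundary point, and connectedness of \<open>E\<close> itself is
  bypassed.\<close>

lemma frontier_E: "frontier E = bdry"
  and component_frontier: "\<And>x. x \<in> E \<Longrightarrow> frontier (connected_component_set (- bdry) x) = bdry"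
  and component_subset: "\<And>x. x \<in> E \<Longrightarrow> connected_component_set (- bdry) x \<subseteq> E"
proof -
  have ne: "\<sigma> 0 \<noteq> k" "\<sigma> 1 \<noteq> k" using \<alpha> \<beta> ab by auto
  let ?q = "linepath (\<sigma> 1) k +++ linepath k (\<sigma> 0)"
  let ?p = "\<sigma> +++ ?q"
  have q: "arc ?q"
    by (rule arc_join) (use ne disjoint(3) in \<open>auto simp: closed_segment_commute Int_commute\<close>)
  have iq: "path_image ?q = segA \<union> segB"
    by (subst path_image_join) (auto simp: closed_segment_commute)
  have qs: "pathstart ?q = \<sigma> 1" "pathfinish ?q = \<sigma> 0" "pathstart \<sigma> = \<sigma> 0" "pathfinish \<sigma> = \<sigma> 1"
    by (simp, simp, simp_all only: pathstart_def pathfinish_def)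
  have "simple_path ?p"
  proof (rule simple_path_join_loop[OF arc_\<sigma> q])
    show "path_image \<sigma> \<inter> path_image ?q \<subseteq> {pathstart \<sigma>, pathstart ?q}"
      unfolding iq qs using disjoint(1,2) by blast
  qed (simp_all only: qs)
  moreover have "pathfinish ?p = pathstart ?p" using qs by simp
  moreover have ip: "path_image ?p = bdry"
    unfolding bdry_def by (subst path_image_join) (simp_all only: iq qs Un_assoc)
  ultimately have fr: "frontier C = bdry" if "C \<in> components (- bdry)" for C
    using frontier_inside_simple_closed_curve[of ?p C] that by simp
  have E: "E = inside bdry"
    unfolding E_def elliptic_region_def bdry_def pathstart_def pathfinish_def ..
  have cl: "closed bdry" unfolding bdry_def
    using arc_\<sigma> by (intro closed_Un closed_arc_image) auto
  show comp: "frontier (connected_component_set (- bdry) x) = bdry" if "x \<in> E" for x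
    by (rule fr, rule componentsI) (use that inside_no_overlap[of bdry] E in blast)
  show sub: "connected_component_set (- bdry) x \<subseteq> E" if "x \<in> E" for x
    using that inside_same_component unfolding E by fastforce
  have "\<sigma> (1 / 2) \<in> path_image \<sigma>" unfolding path_image_def by simp
  have "\<forall>\<^sub>F s in at_right 0. \<sigma> (1 / 2) + s *\<^sub>R n (1 / 2) \<in> E"
    using n_into unfolding normal_into_def by simp
  then obtain x where x: "x \<in> E"
    using eventually_happens'[OF trivial_limit_at_right_real] by blast
  have "bdry \<subseteq> closure E"
    using comp[OF x] closure_mono[OF sub[OF x]] unfolding frontier_def by blast
  moreover have "interior E \<inter> bdry = {}"
    using inside_no_overlap[of bdry] interior_subset[of E] unfolding E by blast
  ultimately show "frontier E = bdry"
    using frontier_inside_subset[OF cl] unfolding E frontier_def by blast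
qed

lemma open_E: "open E"
proof -
  have "closed bdry" unfolding frontier_E[symmetric] by simp
  moreover have "E = inside bdry"
    unfolding E_def elliptic_region_def bdry_def pathstart_def pathfinish_def ..
  ultimately show ?thesis by (simp add: open_inside)
qed

lemma compact_closure_E: "compact (closure E)"
proof -
  have "bounded bdry" unfolding bdry_def
    by (intro bounded_Un[THEN iffD2] conjI bounded_closed_segment bounded_arc_image[OF arc_\<sigma>])
  moreover have "E = inside bdry"
    unfolding E_def elliptic_region_def bdry_def pathstart_def pathfinish_def ..
  ultimately show ?thesis by (simp add: bounded_inside)
qed

lemma bdry_closure: "bdry \<subseteq> closure E"
  using frontier_E unfolding frontier_def by auto

lemma closure_cases: "X \<in> closure E \<Longrightarrow> X \<in> E \<or> X \<in> bdry"
  using frontier_E open_E unfolding frontier_def by (auto simp: interior_open)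

lemma bdry_notin: "X \<in> bdry \<Longrightarrow> X \<notin> E"
  using frontier_E open_E unfolding frontier_def by (auto simp: interior_open)

text \<open>Both shock ends lie in the closure of \<open>E\<close>, where the outer normals are
  nonpositive, and each lies off the other wall's line.\<close>

lemma wall_signs: "b \<bullet> nA < 0" "a \<bullet> nB < 0"
proof -
  have *: "(X - k) \<bullet> m \<le> 0" if "X \<in> closure E" "\<And>x. x \<in> E \<Longrightarrow> (x - k) \<bullet> m < 0" for X m
  proof -
    have "continuous_on (closure E) (\<lambda>x. (x - k) \<bullet> m)" by (intro continuous_intros)
    from continuous_le_on_closure[OF this that(1), of 0] show ?thesis using that(2) by fastforce
  qed
  have "\<sigma> 1 \<in> closure E" "\<sigma> 0 \<in> closure E"
    using bdry_closure unfolding bdry_def path_image_def by auto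
  from *[OF this(1) nA_facts(4)] *[OF this(2) nB_facts(4)]
  show "b \<bullet> nA < 0" "a \<bullet> nB < 0"
    using \<alpha> \<beta> not_parallel by (auto simp: mult_le_0_iff)
qed

lemma Sec: "open Sec" "convex Sec" "E \<subseteq> Sec"
proof -
  have eq: "Sec = {x. (x - k) \<bullet> nA < 0} \<inter> {x. (x - k) \<bullet> nB < 0}"
    unfolding Sec_def by auto
  show "open Sec" "convex Sec"
    unfolding eq by (intro open_Int convex_Int halfplane)+
  show "E \<subseteq> Sec" unfolding Sec_def using nA_facts nB_facts by auto
qed

lemma shock_in_Sec: "t \<in> {0<..<1} \<Longrightarrow> \<sigma> t \<in> Sec"
proof -
  assume "t \<in> {0<..<1}"
  then obtain x y where "0 < x" "0 < y" "\<sigma> t = k + x *\<^sub>R a + y *\<^sub>R b" "(\<sigma> t - k) \<bullet> nA = y * (b \<bullet> nA)" "(\<sigma> t - k) \<bullet> nB = x * (a \<bullet> nB)"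
    by (rule sector_coords)
  then show "\<sigma> t \<in> Sec" unfolding Sec_def using wall_signs by (simp add: mult_pos_neg)
qed

lemma walls_not_Sec: "X \<in> segA \<Longrightarrow> X \<notin> Sec" "X \<in> segB \<Longrightarrow> X \<notin> Sec"
  unfolding segA_eq segB_eq Sec_def using nA_facts nB_facts by auto

text \<open>Inside the open sector the frontier of \<open>E\<close> consists of shock points only,
  so a convex piece of the sector that avoids the shock and comes close to a point of the closure of
  \<open>E\<close> lies in \<open>E\<close>.\<close>

lemma part_of_Sec:
  assumes "open B" "convex B" "X \<in> B" "X \<in> closure E" "B \<inter> path_image \<sigma> \<inter> Sec = {}"
  shows "B \<inter> Sec \<subseteq> E"
proof (rule connected_subset_if_disjoint_frontier)
  show "connected (B \<inter> Sec)" using assms Sec by (intro convex_connected convex_Int)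
  have "B \<inter> E \<noteq> {}" using assms by (metis open_Int_closure_eq_empty disjoint_iff)
  then show "B \<inter> Sec \<inter> E \<noteq> {}" using Sec(3) by auto
  show "B \<inter> Sec \<inter> frontier E = {}" unfolding frontier_E bdry_def using assms(5) walls_not_Sec by auto
qed

lemma wallA_nbhd:
  assumes "0 < l" "l < \<alpha>"
  obtains \<rho> where "0 < \<rho>" "ball (k + l *\<^sub>R a) \<rho> \<inter> {x. (x - k) \<bullet> nA < 0} \<subseteq> E"
    "frontier E \<inter> ball (k + l *\<^sub>R a) \<rho> \<subseteq> {x. (x - k) \<bullet> nA = 0}"
proof -
  let ?X = "k + l *\<^sub>R a"
  have X: "?X \<in> segA" unfolding segA_eq using assms by auto
  have "?X \<noteq> \<sigma> 0" "?X \<noteq> k" using assms \<alpha> ab by auto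
  then have "?X \<notin> path_image \<sigma> \<union> segB" using X disjoint by auto
  moreover have "closed (path_image \<sigma> \<union> segB)" using arc_\<sigma> by (intro closed_Un closed_arc_image) auto
  ultimately have "open (- (path_image \<sigma> \<union> segB) \<inter> {x. (x - k) \<bullet> nB < 0})" "?X \<in> - (path_image \<sigma> \<union> segB) \<inter> {x. (x - k) \<bullet> nB < 0}"
    using wall_signs assms by (blast intro: open_Int open_Compl halfplane, simp add: mult_pos_neg)
  then obtain \<rho> where \<rho>: "0 < \<rho>" "ball ?X \<rho> \<subseteq> - (path_image \<sigma> \<union> segB) \<inter> {x. (x - k) \<bullet> nB < 0}"
    unfolding open_contains_ball by blast
  have "ball ?X \<rho> \<inter> path_image \<sigma> \<inter> Sec = {}" "?X \<in> closure E"
    using \<rho>(2) X bdry_closure unfolding bdry_def by blast+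
  then have "ball ?X \<rho> \<inter> Sec \<subseteq> E"
    by (intro part_of_Sec[of _ ?X]) (use \<rho>(1) in simp_all)
  moreover have "ball ?X \<rho> \<inter> {x. (x - k) \<bullet> nA < 0} \<subseteq> ball ?X \<rho> \<inter> Sec"
    using \<rho>(2) unfolding Sec_def by blast
  moreover have "frontier E \<inter> ball ?X \<rho> \<subseteq> segA" unfolding frontier_E bdry_def using \<rho>(2) by auto
  then have "frontier E \<inter> ball ?X \<rho> \<subseteq> {x. (x - k) \<bullet> nA = 0}" unfolding segA_eq using nA_facts by auto
  ultimately show ?thesis using that \<rho>(1) by blast
qed

lemma wallB_inward:
  assumes "0 < l" "l < \<beta>"
  shows "\<forall>\<^sub>F \<epsilon> in at_right 0. k + l *\<^sub>R b + \<epsilon> *\<^sub>R (- nB) \<in> E"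
proof -
  let ?X = "k + l *\<^sub>R b"
  have X: "?X \<in> segB" unfolding segB_eq using assms by auto
  have "?X \<noteq> \<sigma> 1" using assms \<beta> ab by auto
  then have "?X \<notin> path_image \<sigma>" using X disjoint by auto
  moreover have "closed (path_image \<sigma>)" using arc_\<sigma> by (rule closed_arc_image)
  ultimately have o: "open (- path_image \<sigma>)" "?X \<in> - path_image \<sigma>" by auto
  then obtain \<rho> where \<rho>: "0 < \<rho>" "ball ?X \<rho> \<subseteq> - path_image \<sigma>"
    unfolding open_contains_ball by blast
  have "ball ?X \<rho> \<inter> path_image \<sigma> \<inter> Sec = {}" "?X \<in> closure E"
    using \<rho>(2) X bdry_closure unfolding bdry_def by blast+
  then have sub: "ball ?X \<rho> \<inter> Sec \<subseteq> E"
    by (intro part_of_Sec[of _ ?X]) (use \<rho>(1) in simp_all)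
  have "\<forall>\<^sub>F \<epsilon> in at_right 0. ?X + \<epsilon> *\<^sub>R - nB \<in> ball ?X \<rho> \<inter> {x. (x - k) \<bullet> nA < 0}"
    by (rule eventually_ray_in_open)
      (use \<rho> wall_signs assms in \<open>auto intro!: open_Int halfplane simp: mult_pos_neg\<close>)
  with eventually_at_right_0_less[OF zero_less_one] show ?thesis
  proof eventually_elim
    case (elim \<epsilon>)
    have "(?X + \<epsilon> *\<^sub>R - nB - k) \<bullet> nB = - \<epsilon>"
      using nB_facts by (simp add: inner_diff_left norm_eq_1)
    moreover have "(?X + \<epsilon> *\<^sub>R - nB - k) \<bullet> nA < 0"
      using elim by simp
    ultimately have "?X + \<epsilon> *\<^sub>R - nB \<in> Sec" unfolding Sec_def using elim by simp
    then show ?case using sub elim by blast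
  qed
qed

lemma corner_inward:
  assumes "d \<bullet> nA < 0" "d \<bullet> nB < 0"
  shows "\<forall>\<^sub>F \<epsilon> in at_right 0. k + \<epsilon> *\<^sub>R d \<in> E"
proof -
  have k: "k \<in> segA" by simp
  have "k \<notin> path_image \<sigma>" using k disjoint(1) \<alpha> ab by auto
  moreover have "closed (path_image \<sigma>)" using arc_\<sigma> by (rule closed_arc_image)
  ultimately have o: "open (- path_image \<sigma>)" "k \<in> - path_image \<sigma>" by auto
  then obtain \<rho> where \<rho>: "0 < \<rho>" "ball k \<rho> \<subseteq> - path_image \<sigma>"
    unfolding open_contains_ball by blast
  have "ball k \<rho> \<inter> path_image \<sigma> \<inter> Sec = {}" "k \<in> closure E"
    using \<rho>(2) k bdry_closure unfolding bdry_def by blast+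
  then have sub: "ball k \<rho> \<inter> Sec \<subseteq> E"
    by (intro part_of_Sec[of _ k]) (use \<rho>(1) in simp_all)
  have "\<forall>\<^sub>F \<epsilon> in at_right 0. k + \<epsilon> *\<^sub>R d \<in> ball k \<rho>"
    by (rule eventually_ray_in_open) (use \<rho> in auto)
  with eventually_at_right_0_less[OF zero_less_one] show ?thesis
  proof eventually_elim
    case (elim \<epsilon>)
    have "k + \<epsilon> *\<^sub>R d \<in> Sec" unfolding Sec_def using elim assms by (simp add: mult_pos_neg)
    then show ?case using sub elim by blast
  qed
qed

lemma proper_\<sigma>: "proper_curve {0..1} \<sigma>"
  by (rule proper_curveI[OF C1_\<sigma>]) (auto intro: bounded_subset[OF bounded_closed_interval[of 0 1]])

sublocale shock_flow \<gamma> \<pi> E \<psi> v "{0..1}" \<sigma> n vI \<rho>I \<psi>I "segA \<union> segB"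
proof unfold_locales
  show "{0..1} \<subseteq> closure {t \<in> interior {0..1}. \<sigma> t \<notin> segA \<union> segB}"
  proof -
    have "{t \<in> interior {0..1}. \<sigma> t \<notin> segA \<union> segB} = {0<..<1}"
      unfolding interior_atLeastAtMost_real using shock_in_Sec walls_not_Sec by blast
    then show ?thesis by simp
  qed
  show "frontier E \<subseteq> \<sigma> ` {0..1} \<union> (segA \<union> segB)"
    unfolding frontier_E bdry_def path_image_def by auto
qed (use C1 has_density C1_\<sigma> proper_\<sigma> const n_into shock admissible in \<open>auto simp: normal_into_def\<close>)

sublocale elliptic_flow \<gamma> \<pi> E \<psi> v
  by unfold_locales (use open_E C1 has_density C2 subsonic in auto)

end

section \<open>Directions of tangent and normal at the reflection point\<close>

context wall_corner
begin

lemma tangent_r: "0 < T 0 \<bullet> - a" "T 0 \<bullet> nA < 0"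
proof -
  have T0: "T 0 \<noteq> 0" using T_nonzero[of 0] by simp
  have k: "k - \<xi>r = - (\<alpha> *\<^sub>R a)" using \<alpha>(2) by simp
  have ne: "k - \<xi>r \<noteq> 0" unfolding k using \<alpha> ab by auto
  have nk: "norm (k - \<xi>r) = \<alpha>" unfolding k using \<alpha> ab by simp
  note ac = angle_acute[OF angle_r T0 ne]
  have eq: "T 0 \<bullet> (k - \<xi>r) = \<alpha> * (T 0 \<bullet> - a)" unfolding k by simp
  show pos: "0 < T 0 \<bullet> - a" using ac(1) \<alpha>(1) unfolding eq by (metis zero_less_mult_pos)
  have lt: "T 0 \<bullet> - a < norm (T 0)" using ac(2) \<alpha>(1) unfolding eq nk by (simp only: mult.commute[of _ \<alpha>] mult_less_cancel_left_pos)
  have "T 0 \<bullet> nA \<noteq> 0"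
  proof
    assume "T 0 \<bullet> nA = 0"
    then have "T 0 = (T 0 \<bullet> a) *\<^sub>R a"
      using orthonormal_expansion[OF ab(1) nA_facts(1,2), of "T 0"] by simp
    then have "norm (T 0) = \<bar>T 0 \<bullet> a\<bar>" using ab(1) by (metis mult.right_neutral norm_scaleR)
    then show False using lt pos by simp
  qed
  moreover have "\<not> 0 < T 0 \<bullet> nA"
  proof
    assume "0 < T 0 \<bullet> nA"
    then obtain \<delta> where \<delta>: "0 < \<delta>" "\<And>t. t \<in> {0..1} \<Longrightarrow> 0 < t \<Longrightarrow> t < 0 + \<delta> \<Longrightarrow> 0 < (\<sigma> t - \<sigma> 0) \<bullet> nA"
      by (rule curve_first_order[OF C1_\<sigma>, rotated 2]) auto
    define t where "t = min \<delta> 1 / 2"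
    have t: "0 < t" "t < \<delta>" "t < 1" using \<delta>(1) by (auto simp: t_def)
    have "(\<sigma> t - \<sigma> 0) \<bullet> nA = (\<sigma> t - k) \<bullet> nA"
      using nA_facts unfolding \<alpha>(2) by (simp add: inner_diff_left inner_add_left)
    then show False using \<delta>(2)[of t] shock_in_Sec[of t] t unfolding Sec_def by auto
  qed
  ultimately show "T 0 \<bullet> nA < 0" by linarith
qed

text \<open>The normal into the upstream region is plus or minus \<open>n t\<close>; the plus sign
  would put points of \<open>E\<close> into a region disjoint from its closure.\<close>

lemma outside_of_shock:
  assumes "t \<in> {0<..<1}"
  shows "\<forall>\<^sub>F s in at_right 0. \<sigma> t + s *\<^sub>R (- n t) \<in> RI"
proof -
  have t: "t \<in> {0..1}" "t \<in> interior {0..1}" using assms by (auto simp: interior_atLeastAtMost_real)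
  have RIt: "\<forall>\<^sub>F s in at_right 0. \<sigma> t + s *\<^sub>R n' t \<in> RI" and Et: "\<forall>\<^sub>F s in at_right 0. \<sigma> t + s *\<^sub>R n t \<in> E"
    using n' n_into t unfolding normal_into_def by blast+
  have "n' t = n t \<or> n' t = - n t"
    using unit_perp_unique[of "n' t" "n t" "T t"] n' n_into t T_nonzero unfolding normal_into_def by blast
  moreover have "n' t \<noteq> n t"
  proof
    assume eq: "n' t = n t"
    have "\<forall>\<^sub>F s in at_right (0::real). False"
      using RIt[unfolded eq] Et by eventually_elim (use RI closure_subset in blast)
    then show False by simp
  qed
  ultimately show ?thesis using RIt by auto
qed

text \<open>
  If the normal pointed the wrong way, the short segment from a shock point near \<open>\<xi>r\<close> against its
  normal would reach the reflection wall inside \<open>E\<close>, although it starts in \<open>RI\<close>.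
\<close>

lemma normal_r: "nr \<bullet> a < 0" "0 < nr \<bullet> nA"
proof -
  have T0: "T 0 \<bullet> nr = 0" using shock_flow_axioms n(2)[of 0] by (simp add: inner_commute)
  have split: "(T 0 \<bullet> a) * (nr \<bullet> a) + (T 0 \<bullet> nA) * (nr \<bullet> nA) = 0"
    using orthonormal_inner[OF ab(1) nA_facts(1,2), of "T 0" nr] T0 by simp
  have Ta: "T 0 \<bullet> a < 0" using tangent_r by simp
  have "nr \<bullet> a \<noteq> 0"
  proof
    assume 0: "nr \<bullet> a = 0"
    then have "nr \<bullet> nA = 0" using split tangent_r by simp
    then have "nr = 0"
      using orthonormal_expansion[OF ab(1) nA_facts(1,2), of nr] 0 by simp
    then show False using n(1)[of 0] by simp
  qed
  moreover have "\<not> 0 < nr \<bullet> a"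
  proof
    assume na: "0 < nr \<bullet> a"
    then have "(T 0 \<bullet> a) * (nr \<bullet> a) < 0" using Ta by (simp add: mult_neg_pos)
    then have "0 < (T 0 \<bullet> nA) * (nr \<bullet> nA)" using split by linarith
    then have nn: "nr \<bullet> nA < 0" using tangent_r(2) by (simp add: zero_less_mult_iff)
    define p where "p = - (nr \<bullet> nA)"
    have p: "0 < p" using nn by (simp add: p_def)
    define w where "w = norm (T 0)"
    have w: "0 < w" unfolding w_def using T_nonzero[of 0] by simp
    \<comment> \<open>The three bounds give, for \<open>m = - n t\<close>: motion towards the wall
      line at rate at least \<open>p / 2\<close>, no motion away from the corner, and a component
      along \<open>T 0\<close> of at most a quarter of \<open>norm (T 0)\<close>.\<close>
    define \<eta> where "\<eta> = min (min (p / 2) (nr \<bullet> a / 2)) (1 / 4)"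
    have \<eta>: "0 < \<eta>" "\<eta> \<le> p / 2" "\<eta> \<le> nr \<bullet> a / 2" "\<eta> \<le> 1 / 4" using p na by (auto simp: \<eta>_def)
    obtain d1 where d1: "0 < d1"
      "\<And>t t'. \<lbrakk>t \<in> {0..1}; t' \<in> {0..1}; \<bar>t - 0\<bar> < d1; \<bar>t' - 0\<bar> < d1\<rbrakk> \<Longrightarrow>
         norm (\<sigma> t' - \<sigma> t - (t' - t) *\<^sub>R T 0) \<le> w / 4 * \<bar>t' - t\<bar>"
      by (rule C1_curve_strictly_differentiable[OF C1_\<sigma>, of 0 "w / 4"]) (use w in auto)
    have "continuous_on {0..1} n" using n_into unfolding normal_into_def by blast
    then obtain d2 where d2: "0 < d2" "\<And>t. t \<in> {0..1} \<Longrightarrow> dist t 0 < d2 \<Longrightarrow> dist (n t) nr < \<eta>"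
      using \<eta>(1) unfolding continuous_on_iff by (metis atLeastAtMost_iff order_refl zero_le_one)
    obtain d3 where d3: "0 < d3" "\<And>t. t \<in> {0..1} \<Longrightarrow> 0 < t \<Longrightarrow> t < 0 + d3 \<Longrightarrow> 0 < (\<sigma> t - \<sigma> 0) \<bullet> - a"
      by (rule curve_first_order[OF C1_\<sigma> _ _ tangent_r(1)]) auto
    obtain e1 where e1: "0 < e1" "\<And>t. t \<in> {0..1} \<Longrightarrow> d1 \<le> \<bar>t - 0\<bar> \<Longrightarrow> e1 \<le> dist (\<sigma> 0) (\<sigma> t)"
      using proper_\<sigma> d1(1) unfolding proper_curve_def by (metis atLeastAtMost_iff order_refl zero_le_one)
    have "\<sigma> 0 \<notin> segB"
    proof
      assume "\<sigma> 0 \<in> segB"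
      then have "(\<sigma> 0 - k) \<bullet> nB = 0" using nB_facts unfolding segB_eq by auto
      then show False using \<alpha> not_parallel by simp
    qed
    then obtain e2 where e2: "0 < e2" "ball (\<sigma> 0) e2 \<subseteq> - segB"
      using open_contains_ball[of "- segB"] by (auto simp: open_Compl)
    define e where "e = min (min e1 e2) \<alpha>"
    have e: "0 < e" "e \<le> e1" "e \<le> e2" "e \<le> \<alpha>" using e1 e2 \<alpha> by (auto simp: e_def)
    \<comment> \<open>Reaching the wall line at rate at least \<open>p / 2\<close> takes time at
      most \<open>2 / p\<close> times the distance of \<open>y\<close> from the reflection point, so
      the whole segment stays within \<open>M\<close> times that distance.\<close>
    define M where "M = 1 + 2 / p"
    have M: "1 \<le> M" unfolding M_def using p by simp
    have "continuous_on {0..1} \<sigma>" using C1_curve_continuous[OF C1_\<sigma>] .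
    moreover have "0 < e / M" using e M by simp
    ultimately obtain d4 where d4: "0 < d4" "\<And>t. t \<in> {0..1} \<Longrightarrow> dist t 0 < d4 \<Longrightarrow> dist (\<sigma> t) (\<sigma> 0) < e / M"
      unfolding continuous_on_iff by (metis atLeastAtMost_iff order_refl zero_le_one)
    define t where "t = min (min d1 d2) (min (min d3 d4) 1) / 2"
    have t: "0 < t" "t < d1" "t < d2" "t < d3" "t < d4" "t < 1" "t \<in> {0..1}"
      using d1(1) d2(1) d3(1) d4(1) by (auto simp: t_def)
    define m where "m = - n t"
    define y where "y = \<sigma> t"
    have nt: "norm (n t - nr) < \<eta>" using d2(2)[OF t(7)] t by (simp add: dist_norm)
    have near: "\<bar>(n t - nr) \<bullet> x\<bar> \<le> \<eta> * norm x" for x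
      by (rule order_trans[OF Cauchy_Schwarz_ineq2 mult_right_mono]) (use nt in auto)
    have mA: "p / 2 \<le> m \<bullet> nA"
      using near[of nA] nA_facts(1) \<eta>(2) unfolding m_def p_def by (simp add: inner_diff_left abs_le_iff)
    have ma: "m \<bullet> a \<le> 0"
      using near[of a] ab(1) \<eta>(3) unfolding m_def by (simp add: inner_diff_left abs_le_iff)
    have nm: "norm m = 1" using n(1)[OF t(7)] by (simp add: m_def)
    have ySec: "y \<in> Sec" unfolding y_def using shock_in_Sec[of t] t by simp
    define h where "h = - ((y - k) \<bullet> nA)"
    have h: "0 < h" using ySec unfolding h_def Sec_def by simp
    have \<xi>A: "(\<sigma> 0 - k) \<bullet> nA = 0" using \<alpha>(2) nA_facts by simp
    have dy: "norm (y - \<sigma> 0) < e / M" using d4(2)[OF t(7)] t unfolding y_def by (simp add: dist_norm)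
    have "h = - ((y - \<sigma> 0) \<bullet> nA)" unfolding h_def using \<xi>A by (simp add: inner_diff_left)
    then have hy: "h \<le> norm (y - \<sigma> 0)"
      using Cauchy_Schwarz_ineq2[of "y - \<sigma> 0" nA] nA_facts(1) by (simp add: abs_le_iff)
    define s' where "s' = h / (m \<bullet> nA)"
    have mA0: "0 < m \<bullet> nA" using mA p by simp
    have s': "0 < s'" "s' * (m \<bullet> nA) = h" unfolding s'_def using h mA0 by simp_all
    have "s' \<le> norm (y - \<sigma> 0) / (p / 2)"
      unfolding s'_def by (rule frac_le) (use hy mA p in auto)
    then have s'y: "s' \<le> norm (y - \<sigma> 0) * (2 / p)" by simp
    have short: "norm (y + s *\<^sub>R m - \<sigma> 0) < e" if "0 \<le> s" "s \<le> s'" for s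
    proof -
      have "norm (y + s *\<^sub>R m - \<sigma> 0) \<le> norm (y - \<sigma> 0) + s"
        using norm_triangle_ineq[of "y - \<sigma> 0" "s *\<^sub>R m"] nm that by (simp add: algebra_simps)
      also have "\<dots> \<le> norm (y - \<sigma> 0) * M" unfolding M_def using s'y that by (simp add: distrib_left)
      also have "\<dots> < e" using dy M by (simp add: pos_less_divide_eq)
      finally show ?thesis .
    qed
    define Y where "Y = y + s' *\<^sub>R m"
    have YA: "(Y - k) \<bullet> nA = 0"
    proof -
      have "(Y - k) \<bullet> nA = (y - k) \<bullet> nA + s' * (m \<bullet> nA)" unfolding Y_def by (simp add: inner_diff_left inner_add_left)
      then show ?thesis using s'(2) unfolding h_def by simp
    qed
    define l where "l = (Y - k) \<bullet> a"
    have Yl: "Y = k + l *\<^sub>R a"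
      using orthonormal_expansion[OF ab(1) nA_facts(1,2), of "Y - k"] YA unfolding l_def by (simp add: algebra_simps)
    have lY: "l - \<alpha> = (Y - \<sigma> 0) \<bullet> a" unfolding l_def \<alpha>(2) using ab(1) by (simp add: inner_diff_left inner_add_left norm_eq_1)
    have "l < \<alpha>"
    proof -
      have "(y - \<sigma> 0) \<bullet> a < 0" using d3(2)[OF t(7)] t unfolding y_def by simp
      moreover have "s' * (m \<bullet> a) \<le> 0" using s' ma by (simp add: mult_nonneg_nonpos)
      moreover have "(Y - \<sigma> 0) \<bullet> a = (y - \<sigma> 0) \<bullet> a + s' * (m \<bullet> a)" unfolding Y_def by (simp add: inner_diff_left inner_add_left)
      ultimately show ?thesis using lY by linarith
    qed
    moreover have "0 < l"
    proof -
      have "\<bar>(Y - \<sigma> 0) \<bullet> a\<bar> \<le> norm (Y - \<sigma> 0)" using Cauchy_Schwarz_ineq2[of "Y - \<sigma> 0" a] ab(1) by simp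
      also have "\<dots> < \<alpha>" using short[of s'] s' e unfolding Y_def by simp
      finally show ?thesis using lY by linarith
    qed
    ultimately obtain \<rho> where \<rho>: "0 < \<rho>" "ball Y \<rho> \<inter> {x. (x - k) \<bullet> nA < 0} \<subseteq> E"
      using wallA_nbhd[of l] unfolding Yl by metis
    let ?L = "(\<lambda>s. y + s *\<^sub>R m) ` {0<..<s'}"
    have hA: "(y + s *\<^sub>R m - k) \<bullet> nA < 0" if "0 < s" "s < s'" for s
    proof -
      have "(y + s *\<^sub>R m - k) \<bullet> nA = s * (m \<bullet> nA) - h" unfolding h_def by (simp add: inner_diff_left inner_add_left)
      also have "\<dots> < s' * (m \<bullet> nA) - h" using that mA0 by simp
      finally show ?thesis using s'(2) by simp
    qed
    have "?L \<subseteq> E"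
    proof (rule connected_subset_if_disjoint_frontier)
      show "connected ?L"
        by (rule connected_continuous_image) (auto intro!: continuous_intros)
      \<comment> \<open>A parameter so close to the end of the segment that the point lies in the
        half-disc at \<open>Y\<close>, which is known to be in \<open>E\<close>. From there the
        connected segment stays in \<open>E\<close> if it never meets the boundary.\<close>
      define s where "s = max (s' - \<rho> / 2) (s' / 2)"
      have s: "0 < s" "s < s'" "s' - s < \<rho>" using s' \<rho>(1) by (auto simp: s_def)
      have "dist Y (y + s *\<^sub>R m) = norm ((s' - s) *\<^sub>R m)" unfolding Y_def dist_norm by (simp add: algebra_simps)
      then have "y + s *\<^sub>R m \<in> ball Y \<rho>" using s nm by simp
      then have "y + s *\<^sub>R m \<in> E" using \<rho>(2) hA s by blast
      moreover have "y + s *\<^sub>R m \<in> ?L" using s by (intro imageI) simp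
      ultimately show "?L \<inter> E \<noteq> {}" by blast
      have "y + s *\<^sub>R m \<notin> bdry" if s: "0 < s" "s < s'" for s
      proof
        assume "y + s *\<^sub>R m \<in> bdry"
        moreover have "y + s *\<^sub>R m \<notin> segA" using hA[OF s] nA_facts unfolding segA_eq by auto
        moreover have "norm (y + s *\<^sub>R m - \<sigma> 0) < e" using short s by simp
        then have ds: "dist (\<sigma> 0) (y + s *\<^sub>R m) < e" by (simp add: dist_norm norm_minus_commute)
        then have "y + s *\<^sub>R m \<notin> segB" using e2(2) e(3) by (auto simp: subset_eq)
        ultimately have "y + s *\<^sub>R m \<in> path_image \<sigma>" unfolding bdry_def by blast
        then obtain t' where t': "t' \<in> {0..1}" "\<sigma> t' = y + s *\<^sub>R m" unfolding path_image_def by auto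
        have "\<bar>t' - 0\<bar> < d1" using e1(2)[OF t'(1)] ds e(2) t'(2) by fastforce
        then have "norm (\<sigma> t' - \<sigma> t - (t' - t) *\<^sub>R T 0) \<le> w / 4 * \<bar>t' - t\<bar>"
          using d1(2)[OF t(7) t'(1)] t by auto
        then have st: "norm (s *\<^sub>R m - (t' - t) *\<^sub>R T 0) \<le> w / 4 * \<bar>t' - t\<bar>"
          unfolding t'(2) y_def by simp
        have "norm (s *\<^sub>R m) \<le> norm ((t' - t) *\<^sub>R T 0) + norm (s *\<^sub>R m - (t' - t) *\<^sub>R T 0)"
          by (rule norm_triangle_sub)
        then have s_le: "s \<le> 5 / 4 * w * \<bar>t' - t\<bar>" using st nm s unfolding w_def by (simp add: mult.commute)
        have "\<bar>m \<bullet> T 0\<bar> \<le> \<eta> * w"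
          using near[of "T 0"] T0 unfolding m_def w_def by (simp add: inner_diff_left inner_commute)
        also have "\<dots> \<le> 1 / 4 * w" using \<eta>(4) w by (intro mult_right_mono) auto
        finally have mT: "\<bar>m \<bullet> T 0\<bar> \<le> w / 4" by simp
        have "\<bar>(s *\<^sub>R m - (t' - t) *\<^sub>R T 0) \<bullet> T 0\<bar> \<le> w / 4 * \<bar>t' - t\<bar> * w"
          unfolding w_def by (rule order_trans[OF Cauchy_Schwarz_ineq2 mult_right_mono]) (use st in \<open>auto simp: w_def\<close>)
        moreover have "(s *\<^sub>R m - (t' - t) *\<^sub>R T 0) \<bullet> T 0 = s * (m \<bullet> T 0) - (t' - t) * (w * w)"
          unfolding w_def by (simp add: inner_diff_left norm_eq_sqrt_inner)
        moreover have "\<bar>s * (m \<bullet> T 0)\<bar> \<le> (5 / 4 * w * \<bar>t' - t\<bar>) * (w / 4)"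
          unfolding abs_mult by (rule mult_mono) (use s_le s mT w in auto)
        moreover have "\<bar>(t' - t) * (w * w)\<bar> = \<bar>t' - t\<bar> * (w * w)" by (simp add: abs_mult)
        ultimately have "\<bar>t' - t\<bar> * (w * w) \<le> w / 4 * \<bar>t' - t\<bar> * w + (5 / 4 * w * \<bar>t' - t\<bar>) * (w / 4)"
          by linarith
        \<comment> \<open>One quarter comes from the chord not being exactly parallel to the
          tangent, five sixteenths from \<open>m\<close> not being exactly orthogonal to it; their
          sum is below 1.\<close>
        also have "\<dots> = 9 / 16 * (\<bar>t' - t\<bar> * (w * w))" by simp
        finally have "\<bar>t' - t\<bar> * (w * w) \<le> 0" by linarith
        then have "t' = t" using w by (simp add: mult_le_0_iff)
        then show False using t'(2) s nm unfolding y_def by auto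
      qed
      then show "?L \<inter> frontier E = {}" unfolding frontier_E by auto
    qed
    note L = this
    have "\<forall>\<^sub>F s in at_right 0. y + s *\<^sub>R m \<in> RI"
      using outside_of_shock[of t] t unfolding y_def m_def by simp
    then have "\<forall>\<^sub>F s in at_right (0::real). False"
      using eventually_at_right_0_less[OF s'(1)]
    proof eventually_elim
      case (elim s)
      then have "y + s *\<^sub>R m \<in> ?L" by (intro imageI) simp
      then have "y + s *\<^sub>R m \<in> closure E" using L closure_subset by blast
      then show False using elim(1) RI by blast
    qed
    then show False by simp
  qed
  ultimately show neg: "nr \<bullet> a < 0" by linarith
  then have "0 < (T 0 \<bullet> a) * (nr \<bullet> a)" using Ta by (simp add: mult_neg_neg)
  then have "(T 0 \<bullet> nA) * (nr \<bullet> nA) < 0" using split by linarith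
  then show "0 < nr \<bullet> nA" using tangent_r(2) by (simp add: mult_less_0_iff)
qed

section \<open>Sign of \<open>U\<close> on the elliptic region of the reflection\<close>

lemma min_principle:
  assumes x: "x \<in> E" and min: "\<And>\<xi>. \<xi> \<in> closure E \<Longrightarrow> U s x \<le> U s \<xi>" and X: "X \<in> bdry"
  shows "U s X = U s x"
    and "\<And>\<xi>. \<xi> \<in> connected_component_set (- bdry) x \<Longrightarrow> U s \<xi> = U s x"
proof -
  let ?C = "connected_component_set (- bdry) x"
  let ?m = "s * (\<psi> \<xi>r - vr \<bullet> \<xi>r) + U s x"
  have eq: "s * (\<psi> \<xi> - vr \<bullet> \<xi>) - ?m = U s \<xi> - U s x" for \<xi> unfolding U_def by simp
  have "closed bdry" unfolding frontier_E[symmetric] by simp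
  then have C: "open ?C" "connected ?C" "?C \<subseteq> E" "x \<in> ?C"
    using component_subset[OF x] bdry_notin x by (auto intro: open_connected_component)
  have "s * (\<psi> \<xi> - vr \<bullet> \<xi>) - ?m = 0" if "\<xi> \<in> ?C" for \<xi>
  proof (rule strong_minimum_principle[OF C(1-3) _ C(4) _ that])
    fix \<xi> assume "\<xi> \<in> ?C"
    then have "\<xi> \<in> closure E" using C closure_subset by blast
    then show "0 \<le> s * (\<psi> \<xi> - vr \<bullet> \<xi>) - ?m" unfolding eq using min by simp
  qed (simp add: eq)
  then show const: "U s \<xi> = U s x" if "\<xi> \<in> ?C" for \<xi> using that unfolding eq by simp
  have "X \<in> closure ?C" using component_frontier[OF x] X unfolding frontier_def by auto
  moreover have "continuous_on (closure ?C) (U s)"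
    using C1_U unfolding C1_closure_def by (meson C(3) closure_mono continuous_on_subset)
  ultimately show "U s X = U s x"
    using continuous_constant_on_closure[of ?C "U s" "U s x" X] const by blast
qed

lemma no_descent:
  assumes X: "X \<in> closure E" and min: "\<And>\<xi>. \<xi> \<in> closure E \<Longrightarrow> U s X \<le> U s \<xi>"
    and d: "\<forall>\<^sub>F \<epsilon> in at_right 0. X + \<epsilon> *\<^sub>R d \<in> E"
  shows "0 \<le> s * ((v X - vr) \<bullet> d)"
proof (rule ccontr)
  assume "\<not> ?thesis"
  then have "(s *\<^sub>R (v X - vr)) \<bullet> d < 0" by simp
  from C1_closure_descent[OF C1_U X d this] d
  have "\<forall>\<^sub>F \<epsilon> in at_right (0::real). False"
    by eventually_elim (use min closure_subset in fastforce)
  then show False by simp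
qed

text \<open>A negative minimum is excluded at each kind of boundary point. The sign \<open>s\<close>
  matters at the corner, on the wall \<open>B\<close>, at the end of the shock and, for
  \<open>s = - 1\<close>, at interior shock points; on the wall \<open>A\<close> Hopf's lemma
  contradicts the slip condition for either sign.\<close>

lemma U_nonneg:
  assumes s: "s = 1 \<or> s = - 1" and sn: "0 < s * (nr \<bullet> nB)" and \<xi>: "\<xi> \<in> closure E"
  shows "0 \<le> U s \<xi>"
proof (rule ccontr)
  assume neg: "\<not> 0 \<le> U s \<xi>"
  have "continuous_on (closure E) (U s)" using C1_U unfolding C1_closure_def by blast
  moreover have "closure E \<noteq> {}" using \<xi> by auto
  ultimately have "\<exists>X\<in>closure E. \<forall>\<xi>\<in>closure E. U s X \<le> U s \<xi>"
    using continuous_attains_inf[OF compact_closure_E] by metis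
  then obtain X where X: "X \<in> closure E" and min: "\<And>\<xi>. \<xi> \<in> closure E \<Longrightarrow> U s X \<le> U s \<xi>" by auto
  have UX: "U s X < 0" using min[OF \<xi>] neg by linarith
  have U0: "U s \<xi>r = 0" unfolding U_def by simp
  have X0: "X \<noteq> \<xi>r" using UX U0 by auto
  have G0: "0 < G 0" by (rule G_pos) simp
  have jump: "vI - vr = G 0 *\<^sub>R nr" using velocity_shock[of 0] by simp
  have vB: "(vI - vr) \<bullet> nB = (k - vr) \<bullet> nB" using slip_I by (simp add: inner_diff_left)
  have XE: "X \<notin> E"
  proof
    assume "X \<in> E"
    have "\<xi>r \<in> bdry" unfolding bdry_def by simp
    have "U s \<xi>r = U s X" by (rule min_principle(1)[OF \<open>X \<in> E\<close> _ \<open>\<xi>r \<in> bdry\<close>]) (rule min)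
    then show False using UX U0 by simp
  qed
  have XU: "U s X < U s x" if "x \<in> E" for x
  proof (rule ccontr)
    assume "\<not> ?thesis"
    then have eq: "U s x = U s X" using min[of x] that closure_subset by fastforce
    have "\<xi>r \<in> bdry" unfolding bdry_def by simp
    then have "U s \<xi>r = U s x" by (rule min_principle(1)[OF that, rotated]) (simp add: eq min)
    then show False using UX U0 eq by simp
  qed
  define lam where "lam = (vr - k) \<bullet> a"
  have vr_lam: "vr - k = lam *\<^sub>R a"
  proof -
    have "(vr - \<xi>r) \<bullet> nA = 0" using slip_A[of \<xi>r] by simp
    then have "(vr - k) \<bullet> nA = 0" using nA_facts unfolding \<alpha>(2) by (simp add: inner_diff_left inner_add_left)
    then show ?thesis
      using orthonormal_expansion[OF ab(1) nA_facts(1,2), of "vr - k"] unfolding lam_def by simp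
  qed
  \<comment> \<open>By slip at the reflection point \<open>vr - k\<close> is a multiple of
    \<open>a\<close>; since \<open>a \<bullet> nB < 0\<close>, the factor has the sign of
    \<open>nr \<bullet> nB\<close>. This sign decides the corner.\<close>
  have slam: "0 < s * lam"
  proof -
    have "G 0 * (nr \<bullet> nB) = (vI - vr) \<bullet> nB" unfolding jump by simp
    also have "\<dots> = - ((vr - k) \<bullet> nB)" unfolding vB by (simp add: inner_diff_left)
    also have "\<dots> = lam * (- (a \<bullet> nB))" unfolding vr_lam by simp
    finally have "G 0 * (s * (nr \<bullet> nB)) = (s * lam) * (- (a \<bullet> nB))" by (metis mult.left_commute mult.assoc)
    moreover have "0 < G 0 * (s * (nr \<bullet> nB))" using G0 sn by simp
    ultimately show ?thesis using wall_signs(2) by (simp add: zero_less_mult_iff mult_less_0_iff)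
  qed
  consider (k) "X = k" | (A) l where "0 < l" "l < \<alpha>" "X = k + l *\<^sub>R a" | (B) l where "0 < l" "l < \<beta>" "X = k + l *\<^sub>R b"
    | (E) "X = \<sigma> 1" | (S) t where "t \<in> {0<..<1}" "X = \<sigma> t"
  proof -
    have "X \<in> bdry" using closure_cases[OF X] XE by blast
    then consider "X \<in> path_image \<sigma>" | l where "0 \<le> l" "l \<le> \<alpha>" "X = k + l *\<^sub>R a" | l where "0 \<le> l" "l \<le> \<beta>" "X = k + l *\<^sub>R b"
      unfolding bdry_def segA_eq segB_eq by blast
    then show thesis
    proof cases
      case 1
      then show ?thesis by (rule shock_cases) (use X0 that(4,5) in blast)+
    next
      case (2 l)
      then have "l \<noteq> \<alpha>" using X0 \<alpha>(2) by auto
      then show ?thesis using 2 that(1) that(2)[of l] by (cases "l = 0") auto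
    next
      case (3 l)
      then show ?thesis using that(1) that(3)[of l] that(4) \<beta>(2) by (cases "l = 0"; cases "l = \<beta>") auto
    qed
  qed
  then show False
  proof cases
    case Xk: k
    then have XA: "X \<in> segA" by simp
    have "v k = k"
    proof -
      have A0: "(v k - k) \<bullet> nA = 0" and B0: "(v k - k) \<bullet> nB = 0" using slip_A[of k] slip_B[of k] by auto
      have "v k - k = ((v k - k) \<bullet> a) *\<^sub>R a"
        using orthonormal_expansion[OF ab(1) nA_facts(1,2), of "v k - k"] A0 by simp
      then have "(v k - k) \<bullet> nB = ((v k - k) \<bullet> a) * (a \<bullet> nB)" by (metis inner_scaleR_left)
      then have "(v k - k) \<bullet> a = 0" using B0 not_parallel by simp
      then have "v k - k = 0" using \<open>v k - k = ((v k - k) \<bullet> a) *\<^sub>R a\<close> by simp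
      then show ?thesis by simp
    qed
    \<comment> \<open>At the corner slip on both walls forces \<open>v k = k\<close>, so
      \<open>U\<close> decreases in direction \<open>a\<close>. That direction lies along the wall;
      it is tilted inward by half of what \<open>nB\<close> allows, as
      \<open>|nA \<bullet> nB| \<le> 1\<close>. The tilt leaves the derivative unchanged because
      \<open>a\<close> is orthogonal to \<open>nA\<close>.\<close>
    define \<epsilon> where "\<epsilon> = - (a \<bullet> nB) / 2"
    define d where "d = a - \<epsilon> *\<^sub>R nA"
    have "0 < \<epsilon>" using wall_signs(2) by (simp add: \<epsilon>_def)
    have "\<bar>nA \<bullet> nB\<bar> \<le> 1" using Cauchy_Schwarz_ineq2[of nA nB] nA_facts nB_facts by simp
    then have "\<epsilon> * - (nA \<bullet> nB) \<le> \<epsilon> * 1" using \<open>0 < \<epsilon>\<close> by (intro mult_left_mono) auto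
    then have "d \<bullet> nB < 0" using wall_signs(2) unfolding d_def inner_diff_left inner_scaleR_left \<epsilon>_def by linarith
    moreover have "d \<bullet> nA < 0" unfolding d_def using \<open>0 < \<epsilon>\<close> nA_facts by (simp add: inner_diff_left norm_eq_1)
    ultimately have "\<forall>\<^sub>F \<epsilon> in at_right 0. X + \<epsilon> *\<^sub>R d \<in> E" using corner_inward Xk by simp
    note inward = this
    have "0 \<le> s * ((v X - vr) \<bullet> d)" by (rule no_descent[OF X min]) (use inward in auto)
    then have "0 \<le> s * ((k - vr) \<bullet> d)" using Xk \<open>v k = k\<close> by simp
    moreover have "(k - vr) \<bullet> d = - lam"
    proof -
      have "k - vr = (- lam) *\<^sub>R a" using vr_lam by (simp add: algebra_simps)
      then show ?thesis unfolding d_def using ab(1) nA_facts by (simp add: inner_diff_right norm_eq_1)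
    qed
    ultimately show False using slam by simp
  next
    case (A l)
    note l = A and l' = A(1,2)
    have XsegA: "X \<in> segA" unfolding segA_eq using l by auto
    obtain \<rho> where \<rho>: "0 < \<rho>" "ball (k + l *\<^sub>R a) \<rho> \<inter> {x. (x - k) \<bullet> nA < 0} \<subseteq> E"
      "frontier E \<inter> ball (k + l *\<^sub>R a) \<rho> \<subseteq> {x. (x - k) \<bullet> nA = 0}"
      by (rule wallA_nbhd[OF l']) blast
    have XA: "(X - k) \<bullet> nA = 0" using l nA_facts by simp
    have slipX: "(v X - X) \<bullet> nA = 0" by (rule slip_A[OF XsegA])
    have vX: "(v X - vr) \<bullet> nA = 0"
    proof -
      have "(vr - k) \<bullet> nA = 0" unfolding vr_lam using nA_facts by simp
      then show ?thesis using slipX XA by (simp add: inner_diff_left)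
    qed
    let ?m = "s * (\<psi> \<xi>r - vr \<bullet> \<xi>r) + U s X"
    have eq: "s * (\<psi> \<xi> - vr \<bullet> \<xi>) - ?m = U s \<xi> - U s X" for \<xi> unfolding U_def by simp
    have "0 < s * ((v X - vr) \<bullet> - nA)"
    proof (rule hopf[where \<Omega> = E and r' = \<rho> and b = 1 and \<kappa>' = 0 and m = ?m])
      show "s * (\<psi> X - vr \<bullet> X) - ?m = 0" unfolding eq by simp
      show "0 < s * (\<psi> \<xi> - vr \<bullet> \<xi>) - ?m" if "\<xi> \<in> E" for \<xi> unfolding eq using XU[OF that] by simp
      show "norm (- nA) = 1" using nA_facts by simp
      show "(z X \<bullet> - nA)\<^sup>2 < (c X)\<^sup>2" using slipX c_pos[OF X] unfolding pseudo_velocity_def by simp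
      fix \<xi> assume \<xi>: "\<xi> \<in> frontier E" "dist X \<xi> < \<rho>"
      then have "(\<xi> - k) \<bullet> nA = 0" using \<rho>(3) l(3) by auto
      then have "(\<xi> - X) \<bullet> nA = 0" using XA by (simp add: inner_diff_left)
      moreover have "U s X \<le> U s \<xi>" using min \<xi>(1) unfolding frontier_def by simp
      ultimately show "1 * ((\<xi> - X) \<bullet> - nA - 0 * ((\<xi> - X) \<bullet> (\<xi> - X))) \<le> s * (\<psi> \<xi> - vr \<bullet> \<xi>) - ?m"
        unfolding eq by simp
    next
      show "\<forall>\<^sub>F \<epsilon> in at_right 0. X + \<epsilon> *\<^sub>R - nA \<in> E"
        using eventually_at_right_0_less[OF \<rho>(1)]
      proof eventually_elim
        case (elim \<epsilon>)
        have "(X + \<epsilon> *\<^sub>R - nA - k) \<bullet> nA = (X - k) \<bullet> nA - \<epsilon>"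
          using nA_facts by (simp add: inner_diff_left norm_eq_1)
        moreover have "dist X (X + \<epsilon> *\<^sub>R - nA) < \<rho>" using elim nA_facts by (simp add: dist_norm)
        ultimately show ?case using \<rho>(2) elim XA l(3) by (auto simp: subset_eq)
      qed
    qed (use open_E X \<rho> in auto)
    then show False using vX by simp
  next
    case (B l)
    note l = B and l' = B(1,2)
    have XsegB: "X \<in> segB" unfolding segB_eq using l by auto
    have "0 \<le> s * ((v X - vr) \<bullet> - nB)"
      by (rule no_descent[OF X min]) (use wallB_inward[OF l'] l(3) in auto)
    moreover have "(v X - vr) \<bullet> nB = G 0 * (nr \<bullet> nB)"
    proof -
      have "(v X - X) \<bullet> nB = 0" by (rule slip_B[OF XsegB])
      then have "(v X - vr) \<bullet> nB = (vI - vr) \<bullet> nB"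
        unfolding vB l(3) using nB_facts by (simp add: inner_diff_left inner_add_left)
      then show ?thesis unfolding jump by simp
    qed
    moreover have "0 < G 0 * (s * (nr \<bullet> nB))" using G0 sn by simp
    ultimately show False by (simp add: mult_ac)
  next
    case E
    \<comment> \<open>Up- and downstream velocity both satisfy slip on \<open>B\<close>, so the
      velocity jump is tangent to \<open>B\<close> and the shock ends at a right angle to it,
      running outward along \<open>nB\<close>. Since \<open>s * (nr \<bullet> nB) > 0\<close>,
      stepping back from the end along the shock lowers \<open>U\<close>.\<close>
    have G1: "0 < G 1" by (rule G_pos) simp
    have k1: "(\<sigma> 1 - k) \<bullet> nB = 0" unfolding \<beta>(2) using nB_facts by simp
    have "v (\<sigma> 1) = vI - G 1 *\<^sub>R n 1" by (rule velocity_shock) simp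
    moreover have "(v (\<sigma> 1) - \<sigma> 1) \<bullet> nB = 0" by (rule slip_B) simp
    ultimately have "G 1 * (n 1 \<bullet> nB) = 0" using slip_I k1 by (simp add: inner_diff_left)
    then have n1B: "n 1 \<bullet> nB = 0" using G1 by simp
    have "n 1 \<noteq> 0" using n(1)[of 1] by auto
    then have "n 1 \<bullet> b \<noteq> 0" using orthonormal_expansion[OF ab(2) nB_facts(1,2), of "n 1"] n1B by auto
    moreover have "(n 1 \<bullet> b) * (T 1 \<bullet> b) = 0"
      using orthonormal_inner[OF ab(2) nB_facts(1,2), of "n 1" "T 1"] n1B n(2)[of 1] by simp
    ultimately have "T 1 \<bullet> b = 0" by simp
    then have T1: "T 1 = (T 1 \<bullet> nB) *\<^sub>R nB"
      using orthonormal_expansion[OF ab(2) nB_facts(1,2), of "T 1"] by simp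
    then have "T 1 \<bullet> nB \<noteq> 0" using T_nonzero[of 1] by auto
    moreover have "\<not> T 1 \<bullet> nB < 0"
    proof
      assume "T 1 \<bullet> nB < 0"
      then have neg1: "0 < T 1 \<bullet> - nB" by simp
      obtain \<delta> where \<delta>: "0 < \<delta>" "\<And>t. t \<in> {0..1} \<Longrightarrow> t < 1 \<Longrightarrow> 1 - \<delta> < t \<Longrightarrow> (\<sigma> t - \<sigma> 1) \<bullet> - nB < 0"
        by (rule curve_first_order[OF C1_\<sigma> _ _ neg1]) auto
      define t where "t = max (1 - \<delta> / 2) (1 / 2)"
      have t: "t \<in> {0..1}" "t \<in> {0<..<1}" "t < 1" "1 - \<delta> < t" using \<delta>(1) by (auto simp: t_def)
      have "(\<sigma> t - \<sigma> 1) \<bullet> - nB = - ((\<sigma> t - k) \<bullet> nB)" using k1 by (simp add: inner_diff_left)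
      then show False using \<delta>(2)[OF t(1,3,4)] shock_in_Sec[OF t(2)] unfolding Sec_def by simp
    qed
    ultimately have "0 < (T 1 \<bullet> nB) * (s * (nr \<bullet> nB))" using sn by simp
    moreover have "T 1 \<bullet> (s *\<^sub>R nr) = (T 1 \<bullet> nB) * (s * (nr \<bullet> nB))"
      using arg_cong[OF T1, of "\<lambda>x. x \<bullet> (s *\<^sub>R nr)"] by (simp add: inner_commute[of nB nr])
    ultimately have pos1: "0 < T 1 \<bullet> (s *\<^sub>R nr)" by metis
    obtain \<delta> where \<delta>: "0 < \<delta>" "\<And>t. t \<in> {0..1} \<Longrightarrow> t < 1 \<Longrightarrow> 1 - \<delta> < t \<Longrightarrow> (\<sigma> t - \<sigma> 1) \<bullet> (s *\<^sub>R nr) < 0"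
      by (rule curve_first_order[OF C1_\<sigma> _ _ pos1]) auto
    define t where "t = max (1 - \<delta> / 2) (1 / 2)"
    have t: "t \<in> {0..1}" "t < 1" "1 - \<delta> < t" using \<delta>(1) by (auto simp: t_def)
    have "U s (\<sigma> t) - U s (\<sigma> 1) = G 0 * ((\<sigma> t - \<sigma> 1) \<bullet> (s *\<^sub>R nr))"
      using U_shock[OF t(1), of s] U_shock[of 1 s] unfolding H_def by (simp add: inner_diff_left algebra_simps)
    also have "\<dots> < 0" using \<delta>(2)[OF t] G0 by (simp add: mult_pos_neg)
    finally show False using min[OF shock_in_closure[OF t(1)]] E by simp
  next
    case (S t)
    have t: "t \<in> {0..1}" "t \<in> interior {0..1}" using S(1) by (auto simp: interior_atLeastAtMost_real)
    have "U s (\<sigma> t) \<le> U s \<xi>" if "\<xi> \<in> closure E" for \<xi> using min[OF that] S(2) by simp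
    note min_shock = negative_min_on_shock[OF t(2) s this UX[unfolded S(2)]]
    have nB: "nr \<bullet> nB < 0" using sn min_shock(1) by simp
    have nb: "nr \<bullet> b < 0"
    proof (rule ccontr)
      assume "\<not> nr \<bullet> b < 0"
      then have b0: "0 \<le> nr \<bullet> b" by simp
      \<comment> \<open>Expand in the frame of \<open>b\<close> and \<open>nB\<close>: the sign of
        \<open>nr \<bullet> a\<close> forces \<open>a \<bullet> b < 0\<close>, then
        \<open>a \<bullet> nA = 0\<close> forces \<open>nA \<bullet> nB > 0\<close>, and then
        \<open>nr \<bullet> nA\<close> would be negative.\<close>
      note oi = orthonormal_inner[OF ab(2) nB_facts(1,2)]
      have "0 < (nr \<bullet> nB) * (a \<bullet> nB)" using nB wall_signs(2) by (rule mult_neg_neg)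
      then have "(nr \<bullet> b) * (a \<bullet> b) < 0" using oi[of nr a] normal_r(1) by linarith
      then have "a \<bullet> b < 0" using b0 by (simp add: mult_less_0_iff)
      then have "0 < (a \<bullet> b) * (nA \<bullet> b)" using wall_signs(1) by (simp add: inner_commute[of nA b] mult_neg_neg)
      then have "(a \<bullet> nB) * (nA \<bullet> nB) < 0" using oi[of a nA] nA_facts(3) by linarith
      then have "0 < nA \<bullet> nB" using wall_signs(2) by (simp add: mult_less_0_iff)
      then have "(nr \<bullet> nB) * (nA \<bullet> nB) < 0" using nB by (simp add: mult_neg_pos)
      moreover have "(nr \<bullet> b) * (nA \<bullet> b) \<le> 0" using b0 wall_signs(1) by (simp add: inner_commute[of nA b] mult_nonneg_nonpos)
      ultimately show False using oi[of nr nA] normal_r(2) by linarith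
    qed
    \<comment> \<open>The part of the sector beyond the line through \<open>X\<close> orthogonal to
      \<open>nr\<close>. Because \<open>X\<close> maximises \<open>H\<close> on the shock, the shock
      does not enter it, and the corner lies on that side; so \<open>C\<close> lies in
      \<open>E\<close>. Then \<open>nr\<close> points from \<open>X\<close> into \<open>E\<close>,
      and \<open>U\<close> decreases in this direction.\<close>
    define C where "C = {\<xi>. (\<xi> - X) \<bullet> - nr < 0} \<inter> Sec"
    have C: "convex C" unfolding C_def by (intro convex_Int halfplane Sec)
    have kC: "k \<in> {\<xi>. (\<xi> - X) \<bullet> - nr < 0}"
    proof -
      obtain x y where "0 < x" "0 < y" "\<sigma> t = k + x *\<^sub>R a + y *\<^sub>R b" by (rule sector_coords[OF S(1)])
      moreover have "x * (nr \<bullet> a) < 0" "y * (nr \<bullet> b) < 0" using calculation normal_r(1) nb by (auto intro: mult_pos_neg)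
      moreover have "(k - \<sigma> t) \<bullet> - nr = x * (nr \<bullet> a) + y * (nr \<bullet> b)" unfolding calculation(3)
        by (simp add: inner_diff_left inner_add_left inner_commute[of a nr] inner_commute[of b nr])
      ultimately show ?thesis unfolding S(2) by simp
    qed
    have "C \<subseteq> E"
    proof (rule connected_subset_if_disjoint_frontier[OF convex_connected[OF C]])
      have "k \<in> closure E" using bdry_closure unfolding bdry_def by auto
      then have "{\<xi>. (\<xi> - X) \<bullet> - nr < 0} \<inter> E \<noteq> {}"
        using kC halfplane(1) by (metis open_Int_closure_eq_empty disjoint_iff)
      then show "C \<inter> E \<noteq> {}" unfolding C_def using Sec(3) by blast
      have "\<sigma> t' \<notin> C" if t': "t' \<in> {0..1}" for t'
      proof -
        have "- (G 0 * H t) \<le> - (G 0 * H t')"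
          using min[OF shock_in_closure[OF t']] U_shock[OF t', of s] U_shock[OF t(1), of s] min_shock(1) S(2) by simp
        then have "H t' \<le> H t" using G0 by simp
        then show ?thesis unfolding C_def H_def S(2) by (simp add: inner_diff_left)
      qed
      then show "C \<inter> frontier E = {}"
        unfolding frontier_E bdry_def path_image_def using walls_not_Sec C_def by blast
    qed
    moreover have "\<forall>\<^sub>F \<epsilon> in at_right 0. X + \<epsilon> *\<^sub>R nr \<in> C"
    proof -
      have "\<forall>\<^sub>F \<epsilon> in at_right 0. X + \<epsilon> *\<^sub>R nr \<in> Sec"
        by (rule eventually_ray_in_open[OF Sec(1)]) (use shock_in_Sec S in auto)
      moreover have "\<forall>\<^sub>F \<epsilon> in at_right 0. 0 < \<epsilon> \<and> \<epsilon> < (1::real)" by (rule eventually_at_right_0_less) simp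
      ultimately show ?thesis
        by eventually_elim (use n(1)[of 0] in \<open>simp add: C_def norm_eq_1\<close>)
    qed
    ultimately have "\<forall>\<^sub>F \<epsilon> in at_right 0. X + \<epsilon> *\<^sub>R nr \<in> E"
      by (auto elim: eventually_mono)
    from no_descent[OF X min this] have "0 \<le> - ((G 0 + G t) * (nr \<bullet> nr))"
      using opposite_normal(1)[OF t(1) min_shock(2)] min_shock(1) S(2) by simp
    then show False using G0 G_pos[OF t(1)] n(1)[of 0] by (simp add: norm_eq_1)
  qed
qed

text \<open>The angle hypothesis is used twice: it provides the sign \<open>s\<close>, and it
  excludes that \<open>U\<close> vanishes somewhere in \<open>E\<close>. In that case the velocity
  would equal \<open>vr\<close> on a whole component, hence at the shock end on \<open>B\<close>,
  where slip would make \<open>vI - vr\<close> orthogonal to \<open>nB\<close>.\<close>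

theorem strong_type_impossible:
  assumes ne: "(vI - vr) \<bullet> nB \<noteq> 0" and strong: "strong_type \<pi> vI \<rho>I \<psi>I v (\<sigma> 0)"
  shows False
proof -
  define s :: real where "s = (if 0 < nr \<bullet> nB then 1 else - 1)"
  have s: "s = 1 \<or> s = - 1" by (simp add: s_def)
  have jump: "vI - vr = G 0 *\<^sub>R nr" using velocity_shock[of 0] by simp
  have sn: "0 < s * (nr \<bullet> nB)" using ne unfolding jump by (auto simp: s_def)
  note nonneg = U_nonneg[OF s sn]
  have \<xi>A: "(\<sigma> 0 - k) \<bullet> nA = 0" unfolding \<alpha>(2) using nA_facts by simp
  have pos: "0 < U s x" if x: "x \<in> E" for x
  proof (rule ccontr)
    assume "\<not> 0 < U s x"
    moreover have "x \<in> closure E" using x closure_subset by blast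
    ultimately have U0: "U s x = 0" using nonneg[of x] by simp
    let ?C = "connected_component_set (- bdry) x"
    have min: "U s x \<le> U s \<xi>" if "\<xi> \<in> closure E" for \<xi> using nonneg[OF that] U0 by simp
    have "\<sigma> 1 \<in> bdry" unfolding bdry_def by simp
    have const_C: "U s \<xi> = U s x" if "\<xi> \<in> connected_component_set (- bdry) x" for \<xi>
      by (rule min_principle(2)[OF x _ \<open>\<sigma> 1 \<in> bdry\<close> that]) (rule min)
    have CE: "?C \<subseteq> E" by (rule component_subset[OF x])
    have vC: "v \<xi> = vr" if \<xi>: "\<xi> \<in> ?C" for \<xi>
    proof -
      have \<xi>E: "\<xi> \<in> E" "\<xi> \<in> closure E" using \<xi> CE closure_subset by auto
      let ?d = "- (s *\<^sub>R (v \<xi> - vr))"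
      have "0 \<le> s * ((v \<xi> - vr) \<bullet> ?d)"
        by (rule no_descent[OF \<xi>E(2) _ eventually_ray_in_open[OF open_E \<xi>E(1)]])
           (use min const_C[OF \<xi>] in simp)
      also have "\<dots> = - ((v \<xi> - vr) \<bullet> (v \<xi> - vr))" using s by auto
      finally have "(v \<xi> - vr) \<bullet> (v \<xi> - vr) = 0" using inner_ge_zero[of "v \<xi> - vr"] by linarith
      then show ?thesis by simp
    qed
    have "\<sigma> 1 \<in> closure ?C" using component_frontier[OF x] unfolding frontier_def bdry_def by auto
    moreover have "continuous_on (closure ?C) v"
      using C1 unfolding C1_closure_def by (meson CE closure_mono continuous_on_subset)
    ultimately have "v (\<sigma> 1) = vr"
      using continuous_constant_on_closure[of ?C v vr "\<sigma> 1"] vC by blast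
    moreover have "(v (\<sigma> 1) - \<sigma> 1) \<bullet> nB = 0" by (rule slip_B) simp
    moreover have "(\<sigma> 1 - k) \<bullet> nB = 0" unfolding \<beta>(2) using nB_facts by simp
    ultimately show False using ne slip_I by (simp add: inner_diff_left)
  qed
  have "\<sigma> 0 \<notin> segB"
  proof
    assume "\<sigma> 0 \<in> segB"
    then have "(\<sigma> 0 - k) \<bullet> nB = 0" using nB_facts unfolding segB_eq by auto
    then show False using \<alpha> not_parallel by simp
  qed
  then obtain r' where r': "0 < r'" "ball (\<sigma> 0) r' \<subseteq> - segB"
    using open_contains_ball[of "- segB"] by (auto simp: open_Compl)
  define r0 where "r0 = min r' \<alpha>"
  have r0: "0 < r0" "r0 \<le> \<alpha>" "\<And>\<xi>. dist (\<sigma> 0) \<xi> < r0 \<Longrightarrow> \<xi> \<notin> segB" using r' \<alpha>(1) by (auto simp: r0_def)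
  have wall: "\<sigma> 0 + l *\<^sub>R - a = k + (\<alpha> - l) *\<^sub>R a" for l unfolding \<alpha>(2) by (simp add: algebra_simps)
  have shift: "(x - \<sigma> 0) \<bullet> nA = (x - k) \<bullet> nA" for x using \<xi>A by (simp add: inner_diff_left)
  have "corner_flow \<gamma> \<pi> E \<psi> v {0..1} \<sigma> n vI \<rho>I \<psi>I (segA \<union> segB) E (- a) nA s r0"
  proof (intro corner_flow.intro corner_flow_axioms.intro shock_flow_axioms elliptic_flow_axioms)
    show "norm (- a) = 1" "norm nA = 1" "nA \<bullet> - a = 0" using ab nA_facts by auto
    show "0 < r0" "E \<subseteq> E" "E \<inter> ball (\<sigma> 0) r0 \<subseteq> E" using r0 by auto
    show "\<xi> \<in> \<sigma> ` {0..1} \<or> (\<exists>l\<ge>0. \<xi> = \<sigma> 0 + l *\<^sub>R - a)"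
      if "\<xi> \<in> frontier E" "dist (\<sigma> 0) \<xi> < r0" for \<xi>
    proof -
      have "\<xi> \<in> path_image \<sigma> \<or> \<xi> \<in> segA" using that r0(3) unfolding frontier_E bdry_def by blast
      moreover have "\<exists>l\<ge>0. \<xi> = \<sigma> 0 + l *\<^sub>R - a" if "\<xi> \<in> segA"
      proof -
        from that obtain l where "0 \<le> l" "l \<le> \<alpha>" "\<xi> = k + l *\<^sub>R a" unfolding segA_eq by blast
        then show ?thesis unfolding wall by (intro exI[of _ "\<alpha> - l"]) simp
      qed
      ultimately show ?thesis unfolding path_image_def by blast
    qed
    fix l :: real assume l: "0 < l" "l < r0"
    then have l': "0 < \<alpha> - l" "\<alpha> - l < \<alpha>" using r0 by auto
    have "\<sigma> 0 + l *\<^sub>R - a \<in> segA" unfolding wall segA_eq using l' l by auto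
    from slip_A[OF this] show "(v (\<sigma> 0 + l *\<^sub>R - a) - \<sigma> 0) \<bullet> nA = 0"
      using nA_facts by (simp add: inner_diff_left inner_add_left)
    show "\<exists>\<rho>>0. ball (\<sigma> 0 + l *\<^sub>R - a) \<rho> \<inter> {x. (x - \<sigma> 0) \<bullet> nA < 0} \<subseteq> E \<and>
        frontier E \<inter> ball (\<sigma> 0 + l *\<^sub>R - a) \<rho> \<subseteq> {x. (x - \<sigma> 0) \<bullet> nA = 0}"
      unfolding wall shift using wallA_nbhd[OF l'] by metis
  next
    fix t :: real assume t: "t \<in> {0..1}" "t \<noteq> 0" "dist (\<sigma> 0) (\<sigma> t) < r0"
    have "t \<noteq> 1" using r0(3)[OF t(3)] by auto
    then have t': "t \<in> {0<..<1}" using t by auto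
    have "\<sigma> t \<noteq> \<sigma> 0 + l *\<^sub>R - a" for l
    proof
      assume "\<sigma> t = \<sigma> 0 + l *\<^sub>R - a"
      then have "(\<sigma> t - k) \<bullet> nA = 0" unfolding wall using nA_facts by simp
      then show False using shock_in_Sec[OF t'] unfolding Sec_def by simp
    qed
    then show "t \<in> interior {0..1} \<and> \<sigma> t \<notin> segA \<union> segB \<and> (\<forall>l\<ge>0. \<sigma> t \<noteq> \<sigma> 0 + l *\<^sub>R - a)"
      using t' shock_in_Sec[OF t'] walls_not_Sec by (auto simp: interior_atLeastAtMost_real)
  next
    show "\<exists>d>0. {0..d} \<subseteq> {0..1::real}" by (intro exI[of _ 1]) simp
    show "(vr - \<sigma> 0) \<bullet> nA = 0" by (rule slip_A) simp
    show "0 < nr \<bullet> - a" "0 < T 0 \<bullet> - a" "T 0 \<bullet> nA \<le> 0" using normal_r tangent_r by auto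
    show "0 < s * (\<psi> \<xi> - vr \<bullet> \<xi>) - s * (\<psi> \<xi>r - vr \<bullet> \<xi>r)" if "\<xi> \<in> E" for \<xi>
      using pos[OF that] unfolding U_def .
  qed (use s strong in auto)
  then show False by (rule corner_flow.strong_corner_impossible)
qed

text \<open>If the jump were orthogonal to \<open>nB\<close>, \<open>vr\<close> would be horizontal
  as well as parallel to the inclined wall through the origin, hence zero. The shock normal would
  then be a positive multiple of \<open>vI\<close>, and admissibility would put the reflection point
  to the left of the corner.\<close>

lemma classical_angle:
  assumes "k = 0" "a = vector [cos \<theta>, sin \<theta>]" "b = vector [-1, 0]" "0 < \<theta>" "\<theta> < pi / 2"
    and \<xi>0: "0 < \<xi>0" "\<sigma> 0 = \<xi>0 *\<^sub>R vector [1, tan \<theta>]" and vI: "0 < vI $ 1" "vI $ 2 = 0"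
  shows "(vI - vr) \<bullet> nB \<noteq> 0"
proof
  assume "(vI - vr) \<bullet> nB = 0"
  moreover have "nB $ 1 = 0" using nB_facts(2) unfolding assms(3) by (simp add: plane_inner)
  moreover have "nB \<noteq> 0" using nB_facts(1) by auto
  ultimately have v2: "vr $ 2 = 0" using vI(2) by (simp add: plane_inner plane_eq_iff)
  have "(vr - \<sigma> 0) \<bullet> nA = 0" by (rule slip_A) simp
  then have "vr \<bullet> nA = 0" using \<alpha>(2) assms(1) nA_facts by (simp add: inner_diff_left)
  then have va: "vr = (vr \<bullet> a) *\<^sub>R a" using orthonormal_expansion[OF ab(1) nA_facts(1,2), of vr] by simp
  then have "vr $ 2 = (vr \<bullet> a) * sin \<theta>" using assms(2) by (metis vector_scaleR_component vector_2(2) real_scaleR_def)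
  moreover have "0 < sin \<theta>" using assms(4,5) by (intro sin_gt_zero) auto
  ultimately have "vr = 0" using v2 va by simp
  then have "vI = G 0 *\<^sub>R nr" using velocity_shock[of 0] by simp
  moreover have "0 < (vr - \<sigma> 0) \<bullet> nr" using admissible[of 0] unfolding admissible_at_def by simp
  then have "\<sigma> 0 \<bullet> nr < 0" using \<open>vr = 0\<close> by simp
  moreover have "0 < G 0" by (rule G_pos) simp
  ultimately have "\<sigma> 0 \<bullet> vI < 0" by (metis inner_scaleR_right mult_pos_neg)
  then show False using \<xi>0 vI unfolding \<xi>0(2) by (simp add: plane_inner mult_less_0_iff)
qed

end

lemma wall_corner_reflection_imp_wall_corner:
  assumes "polytropic_gas \<gamma> \<pi>" and "wall_corner_reflection \<gamma> \<pi> k a b nA nB RI vI \<rho>I \<psi>I \<sigma> \<psi> v"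
  obtains n n' \<alpha> \<beta> where "wall_corner \<gamma> \<pi> k a b nA nB RI vI \<rho>I \<psi>I \<sigma> \<psi> v n n' (elliptic_region k \<sigma>) \<alpha> \<beta>"
proof -
  note R = assms(2)[unfolded wall_corner_reflection_def Let_def pathstart_def pathfinish_def]
  have "\<sigma> 0 \<in> ray k a - {k}" "\<sigma> 1 \<in> ray k b - {k}" using R by blast+
  then obtain \<alpha> \<beta> where ab: "0 \<le> \<alpha>" "\<sigma> 0 = k + \<alpha> *\<^sub>R a" "\<alpha> \<noteq> 0" "0 \<le> \<beta>" "\<sigma> 1 = k + \<beta> *\<^sub>R b" "\<beta> \<noteq> 0"
    unfolding ray_def by auto
  obtain n' where n': "normal_into {0..1} \<sigma> RI n'" using R by blast
  obtain n where n: "normal_into {0..1} \<sigma> (elliptic_region k \<sigma>) n"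
    "\<And>t. t \<in> {0..1} \<Longrightarrow> shock_at \<pi> vI \<rho>I \<psi>I \<psi> v (n t) (\<sigma> t) \<and> admissible_at vI v (n t) (\<sigma> t)"
    using R unfolding admissible_shock_def by blast
  have "k \<in> ray k b" unfolding ray_def by (auto intro!: exI[of _ 0])
  then have "slip nB (\<lambda>_. vI) k" using R by blast
  then have slip_I: "(vI - k) \<bullet> nB = 0" unfolding slip_def pseudo_velocity_def .
  have "wall_corner \<gamma> \<pi> k a b nA nB RI vI \<rho>I \<psi>I \<sigma> \<psi> v n n' (elliptic_region k \<sigma>) \<alpha> \<beta>"
    by (intro wall_corner.intro wall_corner_axioms.intro assms(1) refl n' slip_I n(1))
       (use R ab n(2) in \<open>auto simp: slip_def pseudo_velocity_def\<close>)
  then show thesis by (rule that)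
qed

lemma no_strong_wall_corner_reflection:
  assumes "polytropic_gas \<gamma> \<pi>" and R: "wall_corner_reflection \<gamma> \<pi> k a b nA nB RI vI \<rho>I \<psi>I \<sigma> \<psi> v"
    and strong: "strong_type \<pi> vI \<rho>I \<psi>I v (pathstart \<sigma>)"
  shows "(vI - v (pathstart \<sigma>)) \<bullet> nB = 0"
proof -
  obtain n n' \<alpha> \<beta> where "wall_corner \<gamma> \<pi> k a b nA nB RI vI \<rho>I \<psi>I \<sigma> \<psi> v n n' (elliptic_region k \<sigma>) \<alpha> \<beta>"
    by (rule wall_corner_reflection_imp_wall_corner[OF assms(1) R])
  from wall_corner.strong_type_impossible[OF this] show ?thesis using strong unfolding pathstart_def by blast
qed

lemma no_strong_classical_regular_reflection:
  assumes "polytropic_gas \<gamma> \<pi>" and C: "classical_regular_reflection \<gamma> \<pi> \<theta> \<xi>0 \<rho>0 \<psi>0 nA nB vI \<rho>I \<psi>I \<sigma> \<psi> v"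
  shows "\<not> strong_type \<pi> vI \<rho>I \<psi>I v (pathstart \<sigma>)"
proof
  assume strong: "strong_type \<pi> vI \<rho>I \<psi>I v (pathstart \<sigma>)"
  let ?a = "vector [cos \<theta>, sin \<theta>] :: plane" and ?b = "vector [-1, 0] :: plane"
  obtain RI where R: "wall_corner_reflection \<gamma> \<pi> 0 ?a ?b nA nB RI vI \<rho>I \<psi>I \<sigma> \<psi> v"
    and *: "0 < \<theta>" "\<theta> < pi / 2" "0 < \<xi>0" "pathstart \<sigma> = \<xi>0 *\<^sub>R vector [1, tan \<theta>]" "0 < vI $ 1" "vI $ 2 = 0"
    using C unfolding classical_regular_reflection_def Let_def by blast
  obtain n n' \<alpha> \<beta> where "wall_corner \<gamma> \<pi> 0 ?a ?b nA nB RI vI \<rho>I \<psi>I \<sigma> \<psi> v n n' (elliptic_region 0 \<sigma>) \<alpha> \<beta>"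
    by (rule wall_corner_reflection_imp_wall_corner[OF assms(1) R])
  from wall_corner.classical_angle[OF this refl refl refl *(1-3) _ *(5,6)]
  show False using *(4) no_strong_wall_corner_reflection[OF assms(1) R strong] unfolding pathstart_def by blast
qed

lemma angle_eq_right: "x \<bullet> y = 0 \<Longrightarrow> angle x y = pi / 2"
  unfolding angle_def by simp

section \<open>Supersonic wedge flow\<close>

text \<open>
  The half-plane touching the disc at a boundary point near \<open>x0 + r *\<^sub>R m\<close> contains the fixed point
  \<open>x0 + (r + d / 2) *\<^sub>R m\<close>, so the outer half-discs near one point of a circle overlap.
\<close>

lemma outer_half_disc_centre:
  fixes m u x0 :: plane and r d \<rho> :: real
  assumes "norm m = 1" "norm u = 1" "0 < d" "d \<le> r / 2" "r \<le> \<rho>"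
    and near: "dist (x0 + r *\<^sub>R m) (x0 + \<rho> *\<^sub>R u) < d"
  shows "r < (r + d / 2) * (m \<bullet> u)"
proof -
  define q where "q = m \<bullet> u"
  have q1: "q \<le> 1" using Cauchy_Schwarz_ineq2[of m u] assms unfolding q_def by simp
  have "(dist (x0 + r *\<^sub>R m) (x0 + \<rho> *\<^sub>R u))\<^sup>2 = (r *\<^sub>R m - \<rho> *\<^sub>R u) \<bullet> (r *\<^sub>R m - \<rho> *\<^sub>R u)"
    unfolding dist_norm power2_norm_eq_inner by simp
  also have "\<dots> = (\<rho> - r)\<^sup>2 + 2 * (r * \<rho> * (1 - q))"
    using assms(1,2) unfolding q_def norm_eq_1
    by (simp add: inner_diff_left inner_diff_right inner_commute[of u m] power2_eq_square algebra_simps)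
  finally have "(\<rho> - r)\<^sup>2 + 2 * (r * \<rho> * (1 - q)) < d\<^sup>2"
    using near by (metis abs_of_nonneg abs_le_square_iff not_le zero_le_dist abs_of_pos assms(3))
  moreover have "0 \<le> (\<rho> - r)\<^sup>2" by simp
  moreover have "(r * r) * (1 - q) \<le> (r * \<rho>) * (1 - q)"
    using assms q1 by (intro mult_right_mono mult_left_mono) auto
  moreover have "d * d \<le> (r / 2) * d" using assms by (intro mult_right_mono) auto
  then have "d\<^sup>2 \<le> (r * d) / 2" by (simp add: power2_eq_square)
  ultimately have small: "4 * (r * r * (1 - q)) < r * d" by linarith
  have r: "0 < r" using assms by linarith
  have a: "4 * (r * (1 - q)) < d"
  proof (rule ccontr)
    assume "\<not> 4 * (r * (1 - q)) < d"
    then have "r * d \<le> r * (4 * (r * (1 - q)))" using r by (intro mult_left_mono) auto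
    also have "\<dots> = 4 * (r * r * (1 - q))" by simp
    finally show False using small by linarith
  qed
  have "d * (1 - q) \<le> (r / 2) * (1 - q)" using assms q1 by (intro mult_right_mono) auto
  then have b: "d * (1 - q) < d / 8" using a by simp
  have "(r + d / 2) * q = r + d / 2 - r * (1 - q) - d * (1 - q) / 2"
    by (simp add: algebra_simps add_divide_distrib diff_divide_distrib)
  then have "r < (r + d / 2) * q" using a b assms(3) by linarith
  then show ?thesis unfolding q_def .
qed

text \<open>Starting on the circle, a ray meets it again for at most one positive parameter, the
  root \<open>- b / k\<close> of the linear factor. This makes a direction that points into the
  region between shock and wall point into it minus the sonic arc.\<close>

lemma ray_avoids_sphere:
  fixes X q y :: plane and r :: real
  assumes "q \<noteq> 0"
  shows "\<forall>\<^sub>F \<epsilon> in at_right 0. X + \<epsilon> *\<^sub>R q \<notin> sphere y r"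
proof (cases "X \<in> sphere y r")
  case False
  have "\<forall>\<^sub>F \<epsilon> in at_right 0. X + \<epsilon> *\<^sub>R q \<in> - sphere y r"
    by (rule eventually_ray_in_open) (use False in \<open>auto simp: open_Compl\<close>)
  then show ?thesis by simp
next
  case True
  define b where "b = 2 * ((X - y) \<bullet> q)"
  define k where "k = q \<bullet> q"
  have k: "0 < k" using assms by (simp add: k_def)
  define R where "R = (if b < 0 then - b / k else 1)"
  have R: "0 < R" using k by (auto simp: R_def divide_neg_pos)
  have eq: "(X + \<epsilon> *\<^sub>R q - y) \<bullet> (X + \<epsilon> *\<^sub>R q - y) = (X - y) \<bullet> (X - y) + \<epsilon> * (b + \<epsilon> * k)" for \<epsilon>
    unfolding b_def k_def by (simp add: inner_diff_left inner_diff_right inner_add_left inner_add_right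
        inner_commute[of q X] inner_commute[of q y] inner_commute[of y X] algebra_simps)
  from eventually_at_right_0_less[OF R] show ?thesis
  proof eventually_elim
    case (elim \<epsilon>)
    have "b + \<epsilon> * k \<noteq> 0"
    proof (cases "b < 0")
      case True
      then have "\<epsilon> < - b / k" using elim by (simp add: R_def)
      then have "\<epsilon> * k < - b" using k by (simp only: pos_less_divide_eq)
      then show ?thesis by linarith
    next
      case False
      then show ?thesis using elim k by (smt (verit) mult_pos_pos)
    qed
    then have ne: "\<epsilon> * (b + \<epsilon> * k) \<noteq> 0" using elim by simp
    show ?case
    proof
      assume "X + \<epsilon> *\<^sub>R q \<in> sphere y r"
      then have "norm (X + \<epsilon> *\<^sub>R q - y) = norm (X - y)" using True by (simp add: dist_norm norm_minus_commute)
      then have "(X + \<epsilon> *\<^sub>R q - y) \<bullet> (X + \<epsilon> *\<^sub>R q - y) = (X - y) \<bullet> (X - y)"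
        unfolding power2_norm_eq_inner[symmetric] by simp
      then show False using eq ne by simp
    qed
  qed
qed

text \<open>\<open>K\<close> is the hyperbolic region; the letter \<open>H\<close> denotes the
  height over the shock tangent.\<close>

locale wedge = polytropic_gas +
  fixes e nW vI :: plane and \<rho>I :: real and \<psi>I :: "plane \<Rightarrow> real" and \<sigma> :: "real \<Rightarrow> plane"
    and D E K :: "plane set" and p :: "real \<Rightarrow> plane" and vH :: plane and \<rho>H :: real
    and \<psi> :: "plane \<Rightarrow> real" and v :: "plane \<Rightarrow> plane" and n :: "real \<Rightarrow> plane"
  assumes e: "norm e = 1" and nW: "outer_wall_normal (\<sigma> 0) e D nW"
    and const: "constant_state \<pi> vI \<rho>I \<psi>I"
    and into_wall: "0 < (vI - \<sigma> 0) \<bullet> nW"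
    and C1_\<sigma>: "C1_curve {0..} \<sigma>" and infinity: "filterlim \<sigma> at_infinity at_top"
    and fluid_side: "\<And>t. 0 < t \<Longrightarrow> (\<sigma> t - \<sigma> 0) \<bullet> nW < 0"
    and angle_r: "0 < angle (tangent {0..} \<sigma> 0) e" "angle (tangent {0..} \<sigma> 0) e < pi / 2"
    and D: "D \<in> components (- (\<sigma> ` {0..} \<union> ray (\<sigma> 0) e))"
    and p: "arc p" "pathstart p \<in> ray (\<sigma> 0) e" "pathfinish p \<in> \<sigma> ` {0..}" "p ` {0<..<1} \<subseteq> D"
    and sonic: "path_image p \<subseteq> sphere vH (sound_speed \<gamma> \<rho>H)"
    and EK: "components (D - path_image p) = {E, K}" and bounded_E: "bounded E" and unbounded_K: "\<not> bounded K"
    and tip: "\<sigma> 0 \<in> closure E"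
    and far_shock: "\<sigma> ` {0..} \<inter> closure K = ray (pathfinish p) e"
    and C1: "C1_closure (E \<union> K) \<psi> v"
    and has_density: "\<And>\<xi>. \<xi> \<in> closure (E \<union> K) \<Longrightarrow> has_density \<pi> \<psi> v \<xi>"
    and C2: "C2_potential_flow \<gamma> \<pi> E \<psi> v"
    and subsonic: "\<And>\<xi>. \<xi> \<in> E \<Longrightarrow> pseudo_Mach \<gamma> \<pi> \<psi> v \<xi> < 1"
    and hyperbolic: "\<And>\<xi>. \<xi> \<in> K \<Longrightarrow> v \<xi> = vH \<and> density \<pi> \<psi> v \<xi> = \<rho>H \<and> 1 < pseudo_Mach \<gamma> \<pi> \<psi> v \<xi>"
    and slip_W: "\<And>\<xi>. \<xi> \<in> ray (\<sigma> 0) e \<Longrightarrow> (v \<xi> - \<xi>) \<bullet> nW = 0"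
    and n_into: "normal_into {0..} \<sigma> D n"
    and shock: "\<And>t. t \<in> {0..} \<Longrightarrow> shock_at \<pi> vI \<rho>I \<psi>I \<psi> v (n t) (\<sigma> t)"
    and admissible: "\<And>t. t \<in> {0..} \<Longrightarrow> admissible_at vI v (n t) (\<sigma> t)"
begin

abbreviation "W \<equiv> ray (\<sigma> 0) e"
abbreviation "S \<equiv> \<sigma> ` {0..}"
abbreviation "P \<equiv> path_image p"
abbreviation "cH \<equiv> sound_speed \<gamma> \<rho>H"

lemma nW_facts: "norm nW = 1" "nW \<bullet> e = 0" "e \<bullet> nW = 0" "\<And>x. x \<in> D \<Longrightarrow> (x - \<sigma> 0) \<bullet> nW < 0"
  using nW unfolding outer_wall_normal_def by (auto simp: inner_commute)

lemma W_iff: "x \<in> W \<longleftrightarrow> (x - \<sigma> 0) \<bullet> nW = 0 \<and> 0 \<le> (x - \<sigma> 0) \<bullet> e"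
proof
  assume "x \<in> W"
  then obtain s where "0 \<le> s" "x = \<sigma> 0 + s *\<^sub>R e" unfolding ray_def by auto
  then show "(x - \<sigma> 0) \<bullet> nW = 0 \<and> 0 \<le> (x - \<sigma> 0) \<bullet> e" using nW_facts e by (simp add: norm_eq_1)
next
  assume a: "(x - \<sigma> 0) \<bullet> nW = 0 \<and> 0 \<le> (x - \<sigma> 0) \<bullet> e"
  then have "x - \<sigma> 0 = ((x - \<sigma> 0) \<bullet> e) *\<^sub>R e"
    using orthonormal_expansion[OF e nW_facts(1,2), of "x - \<sigma> 0"] by simp
  then have "x = \<sigma> 0 + ((x - \<sigma> 0) \<bullet> e) *\<^sub>R e" by (metis add.commute diff_add_cancel)
  then show "x \<in> W" unfolding ray_def using a by blast
qed

lemma closed_W: "closed W"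
proof -
  have "W = {x. (x - \<sigma> 0) \<bullet> nW = 0} \<inter> {x. 0 \<le> (x - \<sigma> 0) \<bullet> e}" using W_iff by auto
  also have "closed \<dots>" by (intro closed_Int closed_Collect_eq closed_Collect_le continuous_intros)
  finally show ?thesis .
qed

lemma shock_not_W: "0 < t \<Longrightarrow> \<sigma> t \<notin> W"
  using fluid_side[of t] by (simp add: W_iff)

lemma proper_\<sigma>: "proper_curve {0..} \<sigma>" and closed_S: "closed S"
proof -
  have "bounded {t \<in> {0..}. norm (\<sigma> t) \<le> R}" for R
  proof -
    have "\<forall>\<^sub>F t in at_top. max R 0 + 1 \<le> norm (\<sigma> t)"
      using infinity filterlim_at_infinity[of 0 \<sigma> at_top] by simp
    then obtain N where "\<And>t. N \<le> t \<Longrightarrow> max R 0 + 1 \<le> norm (\<sigma> t)" unfolding eventually_at_top_linorder by blast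
    then have "{t \<in> {0..}. norm (\<sigma> t) \<le> R} \<subseteq> {0..N}" by (auto, smt (verit))
    then show ?thesis by (rule bounded_subset[OF bounded_closed_interval])
  qed
  from proper_curveI[OF C1_\<sigma> closed_atLeast this] show "proper_curve {0..} \<sigma>" "closed S" .
qed

lemma D_facts: "open D" "connected D" "D \<inter> S = {}" "D \<inter> W = {}" "frontier D \<subseteq> S \<union> W"
proof -
  have SW: "closed (S \<union> W)" using closed_S closed_W by auto
  show "open D" using open_components[OF _ D] SW open_Compl by blast
  show "connected D" using D by (rule in_components_connected)
  show "D \<inter> S = {}" "D \<inter> W = {}" using in_components_subset[OF D] by auto
  show "frontier D \<subseteq> S \<union> W" using frontier_of_components_closed_complement[OF SW D] .
qed

lemma closed_P: "closed P" and P_cases: "\<xi> \<in> P \<Longrightarrow> \<xi> = pathstart p \<or> \<xi> = pathfinish p \<or> \<xi> \<in> p ` {0<..<1}"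
proof -
  show "closed P" using p(1) by (rule closed_arc_image)
  assume "\<xi> \<in> P"
  then obtain t where t: "0 \<le> t" "t \<le> 1" "\<xi> = p t" unfolding path_image_def by auto
  then show "\<xi> = pathstart p \<or> \<xi> = pathfinish p \<or> \<xi> \<in> p ` {0<..<1}"
    unfolding pathstart_def pathfinish_def by (cases "t = 0"; cases "t = 1") auto
qed

lemma D_Int_P: "D \<inter> P = p ` {0<..<1}"
proof -
  have "pathstart p \<notin> D" "pathfinish p \<notin> D" using p D_facts by auto
  moreover have "p ` {0<..<1} \<subseteq> P" unfolding path_image_def by auto
  ultimately show ?thesis using P_cases p(4) by blast
qed

lemma EK_facts: "E \<union> K = D - P" "open E" "open K" "connected E" "connected K" "E \<inter> K = {}" "E \<noteq> {}" "K \<noteq> {}"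
proof -
  have o: "open (D - P)" using D_facts closed_P by auto
  have c: "E \<in> components (D - P)" "K \<in> components (D - P)" using EK by auto
  show "E \<union> K = D - P" using Union_components[of "D - P"] EK by auto
  show "open E" "open K" using open_components[OF o] c by auto
  show "connected E" "connected K" "E \<noteq> {}" "K \<noteq> {}"
    using c in_components_connected in_components_nonempty by auto
  have "E \<noteq> K" using bounded_E unbounded_K by auto
  then show "E \<inter> K = {}" using components_nonoverlap[OF c] by simp
qed

lemma frontier_part:
  assumes "A = E \<or> A = K"
  shows "frontier A \<subseteq> S \<union> W \<union> P"
proof
  fix x assume x: "x \<in> frontier A"
  have AD: "A \<subseteq> D" using EK_facts(1) assms by auto
  show "x \<in> S \<union> W \<union> P"
  proof (cases "x \<in> D")
    case False
    have "x \<in> closure D" using x closure_mono[OF AD] unfolding frontier_def by auto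
    then have "x \<in> frontier D" using False D_facts(1) unfolding frontier_def by (simp add: interior_open)
    then show ?thesis using D_facts(5) by auto
  next
    case True
    have "x \<in> closure A" using x unfolding frontier_def by blast
    moreover have "x \<notin> A" using x assms EK_facts(2,3) unfolding frontier_def by (metis DiffD2 interior_open)
    moreover have "closure E \<inter> K = {}" "closure K \<inter> E = {}"
      using EK_facts open_Int_closure_eq_empty[of K E] open_Int_closure_eq_empty[of E K] by auto
    ultimately have "x \<notin> E \<union> K" using assms by blast
    then show ?thesis using True EK_facts(1) by auto
  qed
qed

lemma frontier_EK: "frontier (E \<union> K) \<subseteq> S \<union> (W \<union> P)"
  using frontier_Un_subset[of E K] frontier_part by blast

lemma eventually_off_arc:
  assumes "q \<noteq> 0" "\<forall>\<^sub>F \<epsilon> in at_right 0. X + \<epsilon> *\<^sub>R q \<in> D"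
  shows "\<forall>\<^sub>F \<epsilon> in at_right 0. X + \<epsilon> *\<^sub>R q \<in> E \<union> K"
  using ray_avoids_sphere[OF assms(1), of X vH cH] assms(2)
proof eventually_elim
  case (elim \<epsilon>)
  then have "X + \<epsilon> *\<^sub>R q \<in> D - P" using sonic by blast
  then show ?case by (simp only: EK_facts(1))
qed

text \<open>The open arc lies in \<open>D\<close> and so misses the shock. Only the parameters of
  the two arc ends have to be removed from the positive axis, and by injectivity they are finitely
  many.\<close>

lemma dense_off_arc: "{0..} \<subseteq> closure {t \<in> interior {0..}. \<sigma> t \<notin> W \<union> P}"
proof
  fix t :: real assume t: "t \<in> {0..}"
  let ?F = "\<sigma> -` {pathstart p, pathfinish p} \<inter> {0..}"
  have F: "finite ?F" using C1_\<sigma> unfolding C1_curve_def by (intro finite_vimage_IntI) auto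
  have "\<exists>t'\<in>{t \<in> interior {0..}. \<sigma> t \<notin> W \<union> P}. dist t' t < d" if d: "0 < d" for d
  proof -
    have "infinite {t<..<t + d}" using d by simp
    then have "{t<..<t + d} - ?F \<noteq> {}" using F by (metis finite.emptyI finite_Diff2)
    then obtain t' where "t' \<in> {t<..<t + d}" and t'F: "t' \<notin> ?F" by blast
    then have t': "t < t'" "t' < t + d" by auto
    have pos: "0 < t'" using t t' by simp
    have "\<sigma> t' \<notin> P"
    proof
      assume "\<sigma> t' \<in> P"
      then have "\<sigma> t' \<in> p ` {0<..<1}" using P_cases[of "\<sigma> t'"] t'F pos by auto
      then have "\<sigma> t' \<in> D" using p(4) by blast
      moreover have "\<sigma> t' \<in> S" using pos by simp
      ultimately show False using D_facts(3) by blast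
    qed
    then show ?thesis using shock_not_W[OF pos] pos t' by (intro bexI[of _ t']) (auto simp: dist_real_def)
  qed
  then show "t \<in> closure {t \<in> interior {0..}. \<sigma> t \<notin> W \<union> P}" unfolding closure_approachable by blast
qed

sublocale shock_flow \<gamma> \<pi> "E \<union> K" \<psi> v "{0..}" \<sigma> n vI \<rho>I \<psi>I "W \<union> P"
proof unfold_locales
  show "{0..} \<subseteq> closure {t \<in> interior {0..}. \<sigma> t \<notin> W \<union> P}" by (rule dense_off_arc)
  show "frontier (E \<union> K) \<subseteq> S \<union> (W \<union> P)" by (rule frontier_EK)
  show "closed (W \<union> P)" using closed_W closed_P by auto
  fix t :: real assume t: "t \<in> interior {0..}"
  then have t0: "t \<in> {0..}" using interior_subset by blast
  have "norm (n t) = 1" using n_into t0 unfolding normal_into_def by blast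
  then have "n t \<noteq> 0" by auto
  then show "\<forall>\<^sub>F s in at_right 0. \<sigma> t + s *\<^sub>R n t \<in> E \<union> K"
    by (rule eventually_off_arc) (use n_into t in \<open>auto simp: normal_into_def\<close>)
qed (use C1 has_density C1_\<sigma> proper_\<sigma> const n_into shock admissible in \<open>auto simp: normal_into_def\<close>)

sublocale elliptic_flow \<gamma> \<pi> E \<psi> v
proof unfold_locales
  show "C1_closure E \<psi> v" using C1 by (rule C1_closure_subset) simp
  show "has_density \<pi> \<psi> v \<xi>" if "\<xi> \<in> closure E" for \<xi>
    using has_density[of \<xi>] that closure_mono[of E "E \<union> K"] by auto
qed (use EK_facts C2 subsonic in auto)

lemma tangent_r: "0 < T 0 \<bullet> e" "T 0 \<bullet> nW < 0"
proof -
  have T0: "T 0 \<noteq> 0" using T_nonzero[of 0] by simp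
  have e0: "e \<noteq> 0" using e by auto
  note ac = angle_acute[OF angle_r T0 e0]
  show pos: "0 < T 0 \<bullet> e" by (rule ac(1))
  have lt: "T 0 \<bullet> e < norm (T 0)" using ac(2) e by simp
  have "T 0 \<bullet> nW \<noteq> 0"
  proof
    assume "T 0 \<bullet> nW = 0"
    then have "T 0 = (T 0 \<bullet> e) *\<^sub>R e" using orthonormal_expansion[OF e nW_facts(1,2), of "T 0"] by simp
    then have "norm (T 0) = \<bar>T 0 \<bullet> e\<bar>" using e by (metis mult.right_neutral norm_scaleR)
    then show False using lt pos by simp
  qed
  moreover have "\<not> 0 < T 0 \<bullet> nW"
  proof
    assume "0 < T 0 \<bullet> nW"
    then obtain \<delta> where \<delta>: "0 < \<delta>" "\<And>t. t \<in> {0..} \<Longrightarrow> 0 < t \<Longrightarrow> t < 0 + \<delta> \<Longrightarrow> 0 < (\<sigma> t - \<sigma> 0) \<bullet> nW"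
      by (rule curve_first_order[OF C1_\<sigma>, rotated 2]) auto
    then have t: "0 < \<delta> / 2" by simp
    then have "0 < (\<sigma> (\<delta> / 2) - \<sigma> 0) \<bullet> nW" using \<delta>(2)[of "\<delta> / 2"] by simp
    then show False using fluid_side[OF t] by linarith
  qed
  ultimately show "T 0 \<bullet> nW < 0" by linarith
qed

lemma slip_r: "(vr - \<sigma> 0) \<bullet> nW = 0"
  by (rule slip_W) (simp add: W_iff)

text \<open>The upstream flow points into the wall and \<open>vr\<close> is tangent to it, so the
  jump \<open>G 0 *\<^sub>R nr\<close> has a positive component along \<open>nW\<close>.
  Orthogonality to the tangent gives the other sign; no argument about the two sides of the shock is
  required here, unlike for the reflection.\<close>

lemma normal_r: "0 < nr \<bullet> nW" "0 < nr \<bullet> e"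
proof -
  have G0: "0 < G 0" by (rule G_pos) simp
  have "vI - vr = G 0 *\<^sub>R nr" using velocity_shock[of 0] by simp
  then have "(vI - vr) \<bullet> nW = G 0 * (nr \<bullet> nW)" by simp
  then have "0 < G 0 * (nr \<bullet> nW)" using slip_r into_wall by (simp add: inner_diff_left)
  then show nn: "0 < nr \<bullet> nW" using G0 by (simp add: zero_less_mult_iff)
  have "(T 0 \<bullet> e) * (nr \<bullet> e) + (T 0 \<bullet> nW) * (nr \<bullet> nW) = 0"
    using orthonormal_inner[OF e nW_facts(1,2), of "T 0" nr] n(2)[of 0] by (simp add: inner_commute[of nr "T 0"])
  moreover have "(T 0 \<bullet> nW) * (nr \<bullet> nW) < 0" using tangent_r(2) nn by (rule mult_neg_pos)
  ultimately have "0 < (T 0 \<bullet> e) * (nr \<bullet> e)" by linarith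
  then show "0 < nr \<bullet> e" using tangent_r(1) by (simp add: zero_less_mult_iff)
qed

section \<open>The hyperbolic region and the sonic arc\<close>

lemma closure_K_sub: "closure K \<subseteq> closure (E \<union> K)" and closure_E_sub: "closure E \<subseteq> closure (E \<union> K)"
  by (auto intro: closure_mono subsetD)

lemma v_hyperbolic: assumes "\<xi> \<in> closure K" shows "v \<xi> = vH"
proof -
  have "continuous_on (closure K) v"
    using C1_flow closure_K_sub unfolding C1_closure_def by (meson continuous_on_subset)
  from continuous_constant_on_closure[OF this _ assms, of vH] show ?thesis using hyperbolic by blast
qed

lemma psi_hyperbolic: obtains \<kappa> where "\<And>\<xi>. \<xi> \<in> closure K \<Longrightarrow> \<psi> \<xi> = vH \<bullet> \<xi> + \<kappa>"
proof -
  define f where "f \<xi> = \<psi> \<xi> - vH \<bullet> \<xi>" for \<xi>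
  have cont: "continuous_on (closure K) f"
    using C1_flow closure_K_sub unfolding C1_closure_def f_def
    by (intro continuous_intros) (meson continuous_on_subset)
  have "f constant_on K"
  proof (rule has_derivative_zero_connected_constant_on[of K "{}"])
    show "continuous_on K f" using cont closure_subset by (rule continuous_on_subset)
    have "(f has_derivative (\<lambda>h. 0)) (at x within K)" if x: "x \<in> K" for x
    proof -
      have "GDERIV \<psi> x :> v x" using C1_flow x unfolding C1_closure_def by blast
      then have "(\<psi> has_derivative (\<lambda>h. h \<bullet> vH)) (at x)" using hyperbolic[OF x] unfolding gderiv_def by simp
      then have "(f has_derivative (\<lambda>h. h \<bullet> vH - vH \<bullet> h)) (at x)"
        unfolding f_def by (auto intro!: derivative_eq_intros)
      then have "(f has_derivative (\<lambda>h. 0)) (at x)" by (simp add: inner_commute[of vH])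
      then show ?thesis by (rule has_derivative_at_withinI)
    qed
    then show "\<forall>x\<in>K - {}. (f has_derivative (\<lambda>h. 0)) (at x within K)" by blast
  qed (use EK_facts in auto)
  then obtain \<kappa> where "\<And>x. x \<in> K \<Longrightarrow> f x = \<kappa>" unfolding constant_on_def by blast
  then have "\<psi> \<xi> = vH \<bullet> \<xi> + \<kappa>" if "\<xi> \<in> closure K" for \<xi>
    using continuous_constant_on_closure[OF cont _ that, of \<kappa>] unfolding f_def by fastforce
  then show thesis by (rule that)
qed

text \<open>Two points of the straight shock part differ by \<open>e\<close>, and \<psi> agrees with
  \<psi>I at both, so \<open>vH\<close> and \<open>vI\<close> have the same component along the
  wall; \<open>vI\<close> exceeds \<open>vr\<close> there because the normal at the tip leans
  forward.\<close>

lemma hyperbolic_ahead: "0 < (vH - vr) \<bullet> e"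
proof -
  let ?q = "pathfinish p"
  have "?q \<in> ray ?q e" unfolding ray_def by (intro CollectI exI[of _ 0]) simp
  moreover have "?q + e \<in> ray ?q e" unfolding ray_def by (intro CollectI exI[of _ 1]) simp
  ultimately have q: "?q \<in> S" "?q \<in> closure K" "?q + e \<in> S" "?q + e \<in> closure K"
    using far_shock by blast+
  obtain \<kappa> where \<kappa>: "\<And>\<xi>. \<xi> \<in> closure K \<Longrightarrow> \<psi> \<xi> = vH \<bullet> \<xi> + \<kappa>" by (rule psi_hyperbolic) blast
  have I: "\<psi> \<xi> = \<psi>I 0 + vI \<bullet> \<xi>" if "\<xi> \<in> S" for \<xi> using that psi_shock by auto
  have "vH \<bullet> e = vI \<bullet> e"
    using \<kappa>[OF q(2)] \<kappa>[OF q(4)] I[OF q(1)] I[OF q(3)] by (simp add: inner_add_right)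
  moreover have "vI - vr = G 0 *\<^sub>R nr" using velocity_shock[of 0] by simp
  then have "vI \<bullet> e - vr \<bullet> e = G 0 * (nr \<bullet> e)" by (metis inner_diff_left inner_scaleR_left)
  moreover have "0 < G 0 * (nr \<bullet> e)" using G_pos[of 0] normal_r(2) by simp
  ultimately show ?thesis by (simp add: inner_diff_left)
qed

lemma tip_not_K: "\<sigma> 0 \<notin> closure K"
  using v_hyperbolic[of "\<sigma> 0"] hyperbolic_ahead by auto

lemma outside_sonic: "\<xi> \<in> K \<Longrightarrow> 0 < cH \<and> cH < dist vH \<xi>"
proof -
  assume \<xi>: "\<xi> \<in> K"
  then have "\<xi> \<in> closure (E \<union> K)" using closure_subset[of "E \<union> K"] by blast
  then have "0 < density \<pi> \<psi> v \<xi>" by (intro density_pos flow_density)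
  moreover have h: "v \<xi> = vH" "density \<pi> \<psi> v \<xi> = \<rho>H" "1 < pseudo_Mach \<gamma> \<pi> \<psi> v \<xi>" using hyperbolic[OF \<xi>] by auto
  ultimately have c: "0 < cH" by (simp add: sound_speed_pos)
  moreover have "1 < norm (vH - \<xi>) / cH"
    using h(3) unfolding pseudo_Mach_def local_sound_speed_def pseudo_velocity_def h(1,2) .
  ultimately show ?thesis by (simp add: dist_norm less_divide_eq)
qed

lemma cH_pos: "0 < cH"
  using EK_facts(8) outside_sonic by blast

text \<open>\<open>Q u\<close> is the part of a small disc beyond the tangent line of the sonic
  circle in direction \<open>u\<close>. It is convex, lies in \<open>D\<close> and misses the arc,
  so it is contained in \<open>K\<close> as soon as it meets \<open>K\<close>. All the half-discs
  used contain the one point \<open>b\<close>; hence a single point of \<open>K\<close> near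
  \<open>X\<close> puts them all into \<open>K\<close>, and each nearby arc point is a limit of its
  own half-disc.\<close>

lemma sonic_arc_spread:
  assumes X: "X \<in> p ` {0<..<1}" "X \<in> closure K"
  obtains r where "0 < r" "P \<inter> ball X r \<subseteq> closure K"
proof -
  have XD: "X \<in> D" and XP: "X \<in> P" using X(1) p(4) D_Int_P by auto
  define m where "m = (X - vH) /\<^sub>R cH"
  have "dist vH X = cH" using sonic XP by auto
  then have nX: "norm (X - vH) = cH" by (simp add: dist_norm norm_minus_commute)
  have m: "norm m = 1" unfolding m_def using nX cH_pos by simp
  have Xm: "X = vH + cH *\<^sub>R m" unfolding m_def using cH_pos by simp
  obtain r' where r': "0 < r'" "ball X r' \<subseteq> D" using D_facts(1) XD open_contains_ball by blast
  define r where "r = min r' (cH / 2)"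
  have r: "0 < r" "r \<le> cH / 2" "ball X r \<subseteq> D" using r' cH_pos by (auto simp: r_def)
  define b where "b = vH + (cH + r / 2) *\<^sub>R m"
  have "dist X b = norm ((r / 2) *\<^sub>R m)" unfolding b_def Xm dist_norm norm_minus_commute[of "_ + cH *\<^sub>R m"]
    by (simp add: algebra_simps)
  then have b_ball: "b \<in> ball X r" using m r(1) by simp
  define Q where "Q u = ball X r \<inter> {y. (y - vH) \<bullet> - u < - cH}" for u
  have Q_convex: "convex (Q u)" for u
  proof -
    have "(y - vH) \<bullet> - u < - cH \<longleftrightarrow> u \<bullet> y > cH + u \<bullet> vH" for y
      by (auto simp: inner_diff_left inner_commute[of y u] inner_commute[of vH u])
    then have "{y. (y - vH) \<bullet> - u < - cH} = {y. u \<bullet> y > cH + u \<bullet> vH}" by simp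
    then show ?thesis unfolding Q_def by (simp add: convex_Int convex_halfspace_gt)
  qed
  have Q_off: "Q u \<inter> frontier K = {}" if "norm u = 1" for u
  proof -
    have "cH < dist vH y" if "y \<in> Q u" for y
    proof -
      have "cH < (y - vH) \<bullet> u" using that unfolding Q_def by simp
      also have "\<dots> \<le> norm (y - vH)" using Cauchy_Schwarz_ineq2[of "y - vH" u] \<open>norm u = 1\<close> by simp
      finally show ?thesis by (simp add: dist_norm norm_minus_commute)
    qed
    then have "Q u \<inter> P = {}" using sonic by force
    moreover have "Q u \<subseteq> D" using r(3) unfolding Q_def by auto
    ultimately show ?thesis using frontier_part[of K] D_facts by blast
  qed
  have b_Q: "b \<in> Q u" if "norm u = 1" "cH \<le> \<rho>" "vH + \<rho> *\<^sub>R u \<in> ball X r" for u \<rho>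
  proof -
    have "cH < (cH + r / 2) * (m \<bullet> u)"
      by (rule outer_half_disc_centre[OF m that(1) r(1,2) that(2), of vH]) (use that(3) Xm in simp)
    then show ?thesis using b_ball unfolding Q_def b_def by simp
  qed
  have self: "vH + \<rho> *\<^sub>R u \<in> Q u" if "norm u = 1" "cH < \<rho>" "vH + \<rho> *\<^sub>R u \<in> ball X r" for u \<rho>
    using that unfolding Q_def by (simp add: norm_eq_1)
  have "X \<in> ball X r" using r(1) by simp
  then have "ball X r \<inter> K \<noteq> {}" using X(2) open_Int_closure_eq_empty[OF open_ball] by blast
  then obtain y where y: "y \<in> ball X r" "y \<in> K" by auto
  define \<rho> where "\<rho> = norm (y - vH)"
  define u where "u = (y - vH) /\<^sub>R \<rho>"
  have \<rho>: "cH < \<rho>" using outside_sonic[OF y(2)] unfolding \<rho>_def by (simp add: dist_norm norm_minus_commute)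
  have "\<rho> \<noteq> 0" using \<rho> cH_pos by simp
  then have u: "norm u = 1" "y = vH + \<rho> *\<^sub>R u" unfolding u_def by (auto simp: \<rho>_def)
  have "Q u \<subseteq> K"
    by (rule connected_subset_if_disjoint_frontier[OF convex_connected[OF Q_convex] _ Q_off[OF u(1)]])
       (use self[OF u(1) \<rho>] u(2) y in auto)
  then have bK: "b \<in> K" using b_Q[OF u(1), of \<rho>] \<rho> u(2) y(1) by auto
  have "Y \<in> closure K" if Y: "Y \<in> P" "Y \<in> ball X r" for Y
  proof -
    define w where "w = (Y - vH) /\<^sub>R cH"
    have "dist vH Y = cH" using sonic Y(1) by auto
    then have "norm (Y - vH) = cH" by (simp add: dist_norm norm_minus_commute)
    then have w: "norm w = 1" "Y = vH + cH *\<^sub>R w" unfolding w_def using cH_pos by auto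
    have QK: "Q w \<subseteq> K"
      by (rule connected_subset_if_disjoint_frontier[OF convex_connected[OF Q_convex] _ Q_off[OF w(1)]])
         (use b_Q[OF w(1), of cH] w(2) Y bK in auto)
    have "\<forall>\<^sub>F \<epsilon> in at_right 0. Y + \<epsilon> *\<^sub>R w \<in> ball X r"
      by (rule eventually_ray_in_open) (use Y in auto)
    then have "\<forall>\<^sub>F \<epsilon> in at_right 0. Y + \<epsilon> *\<^sub>R w \<in> closure K"
      using eventually_at_right_0_less[OF zero_less_one]
    proof eventually_elim
      case (elim \<epsilon>)
      have eq: "Y + \<epsilon> *\<^sub>R w = vH + (cH + \<epsilon>) *\<^sub>R w" unfolding w(2) by (simp add: scaleR_add_left)
      have "Y + \<epsilon> *\<^sub>R w \<in> Q w" unfolding eq by (rule self[OF w(1)]) (use elim eq in auto)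
      then show ?case using QK closure_subset[of K] by blast
    qed
    moreover have "((\<lambda>\<epsilon>. Y + \<epsilon> *\<^sub>R w) \<longlongrightarrow> Y + 0 *\<^sub>R w) (at_right 0)" by (intro tendsto_intros)
    ultimately have "Y + 0 *\<^sub>R w \<in> closure K"
      by (rule Lim_in_closed_set[OF closed_closure _ trivial_limit_at_right_real])
    then show ?thesis by simp
  qed
  then show thesis using that[OF r(1)] by blast
qed

text \<open>The points of the open arc in the closure of \<open>K\<close> form a relatively closed
  and, by the spreading lemma, relatively open subset. It is nonempty: otherwise \<open>K\<close>
  and the complement of its closure would separate \<open>D\<close>. Consequently the velocity is
  \<open>vH\<close> on the whole arc, and points of \<open>D\<close> off the closure of
  \<open>K\<close> belong to \<open>E\<close>.\<close>

lemma arc_in_closure_K: "P \<subseteq> closure K"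
proof -
  let ?P = "p ` {0<..<1}"
  have cp: "continuous_on {0..1} p" using p(1) unfolding arc_def path_def by blast
  have conn: "connected ?P"
    by (rule connected_continuous_image) (auto intro: continuous_on_subset[OF cp])
  have meets: "?P \<inter> closure K \<noteq> {}"
  proof
    assume no: "?P \<inter> closure K = {}"
    have "closure K \<inter> E = {}" using EK_facts open_Int_closure_eq_empty[of E K] by auto
    then have "D \<subseteq> K \<union> - closure K" using no EK_facts(1) D_Int_P by blast
    moreover have "D \<inter> K \<noteq> {}" "D \<inter> - closure K \<noteq> {}"
      using EK_facts(1,7,8) \<open>closure K \<inter> E = {}\<close> by blast+
    moreover have "K \<inter> - closure K \<inter> D = {}" using closure_subset[of K] by blast
    ultimately show False
      using connectedD[OF D_facts(2) EK_facts(3), of "- closure K"] by auto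
  qed
  define O1 where "O1 = \<Union> {B. open B \<and> P \<inter> B \<subseteq> closure K}"
  have PP: "?P \<subseteq> P" unfolding path_image_def by auto
  have "?P \<subseteq> closure K"
  proof (rule ccontr)
    assume "\<not> ?thesis"
    then have "- closure K \<inter> ?P \<noteq> {}" by blast
    moreover have "open O1" unfolding O1_def by auto
    moreover have cover: "x \<in> O1" if "x \<in> ?P" "x \<in> closure K" for x
    proof -
      from sonic_arc_spread[OF that] obtain r where "0 < r" "P \<inter> ball x r \<subseteq> closure K" .
      then show ?thesis unfolding O1_def by (intro UnionI[of "ball x r"]) auto
    qed
    then have "O1 \<inter> ?P \<noteq> {}" "?P \<subseteq> O1 \<union> - closure K" using meets by blast+
    moreover have "O1 \<inter> - closure K \<inter> ?P = {}" unfolding O1_def using PP by blast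
    ultimately show False using connectedD[OF conn, of O1 "- closure K"] by auto
  qed
  moreover have "continuous_on (closure {0<..<1}) p" using cp by simp
  ultimately have "p ` closure {0<..<1} \<subseteq> closure K" by (intro image_closure_subset) auto
  then show ?thesis unfolding path_image_def by simp
qed

lemma closure_cases: "X \<in> closure (E \<union> K) \<Longrightarrow> X \<in> D \<or> X \<in> S \<or> X \<in> W"
proof -
  assume "X \<in> closure (E \<union> K)"
  then have "X \<in> closure D" using closure_mono[of "E \<union> K" D] EK_facts(1) by blast
  then show ?thesis using D_facts(1,5) unfolding frontier_def by (auto simp: interior_open)
qed

lemma velocity_hyperbolic: "(vH - vr) \<bullet> nW = 0"
proof -
  have "pathstart p \<in> closure K" using arc_in_closure_K pathstart_in_path_image by blast
  then have "v (pathstart p) = vH" by (rule v_hyperbolic)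
  then have "(vH - pathstart p) \<bullet> nW = 0" using slip_W[OF p(2)] by simp
  moreover have "(pathstart p - \<sigma> 0) \<bullet> nW = 0" using p(2) W_iff by blast
  ultimately show ?thesis using slip_r by (simp add: inner_diff_left)
qed

lemma U_hyperbolic:
  obtains \<kappa> where "\<And>\<xi>. \<xi> \<in> closure K \<Longrightarrow> U 1 \<xi> = ((vH - vr) \<bullet> e) * ((\<xi> - \<sigma> 0) \<bullet> e) + \<kappa>"
proof -
  obtain \<kappa> where \<kappa>: "\<And>\<xi>. \<xi> \<in> closure K \<Longrightarrow> \<psi> \<xi> = vH \<bullet> \<xi> + \<kappa>" by (rule psi_hyperbolic) blast
  have lin: "(vH - vr) \<bullet> (\<xi> - \<sigma> 0) = ((vH - vr) \<bullet> e) * ((\<xi> - \<sigma> 0) \<bullet> e)" for \<xi>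
    using orthonormal_inner[OF e nW_facts(1,2), of "vH - vr" "\<xi> - \<sigma> 0"] velocity_hyperbolic by simp
  then have "U 1 \<xi> = ((vH - vr) \<bullet> e) * ((\<xi> - \<sigma> 0) \<bullet> e) + (\<kappa> + (vH - vr) \<bullet> \<sigma> 0 - (\<psi> \<xi>r - vr \<bullet> \<xi>r))"
    if "\<xi> \<in> closure K" for \<xi>
    unfolding U_def \<kappa>[OF that] lin[symmetric] by (simp add: inner_diff_left inner_diff_right)
  then show thesis by (rule that)
qed

section \<open>Sign of \<open>U\<close> on the unbounded flow region of the wedge\<close>

text \<open>
  The shock and the wall miss a connected set reaching across the wall line, far to the left of the
  tip and far above the wall; so \<open>D\<close> misses it too.
\<close>

lemma strip:
  obtains x0 y0 where "\<And>\<xi>. \<xi> \<in> closure (E \<union> K) \<Longrightarrow> x0 \<le> (\<xi> - \<sigma> 0) \<bullet> e \<and> y0 \<le> (\<xi> - \<sigma> 0) \<bullet> nW \<and> (\<xi> - \<sigma> 0) \<bullet> nW \<le> 0"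
proof -
  obtain R where R: "\<And>\<xi>. \<xi> \<in> closure E \<Longrightarrow> norm \<xi> \<le> R" using bounded_E bounded_closure bounded_iff by metis
  let ?q = "pathfinish p"
  let ?R = "R + norm (\<sigma> 0)"
  define x0 where "x0 = min (min (- ?R) ((?q - \<sigma> 0) \<bullet> e)) 0"
  define y0 where "y0 = min (min (- ?R) ((?q - \<sigma> 0) \<bullet> nW)) 0"
  have low: "x0 \<le> - ?R" "x0 \<le> (?q - \<sigma> 0) \<bullet> e" "x0 \<le> 0" "y0 \<le> - ?R" "y0 \<le> (?q - \<sigma> 0) \<bullet> nW" "y0 \<le> 0"
    unfolding x0_def y0_def by auto
  have SW: "x0 \<le> (\<xi> - \<sigma> 0) \<bullet> e \<and> y0 \<le> (\<xi> - \<sigma> 0) \<bullet> nW" if \<xi>: "\<xi> \<in> S \<union> W" for \<xi>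
  proof -
    \<comment> \<open>Shock points adjacent to \<open>E\<close> stay in a bounded set, and those
      adjacent to \<open>K\<close> lie on the straight part, which runs in direction
      \<open>e\<close>.\<close>
    consider "\<xi> \<in> W" | "\<xi> \<in> closure E" | "\<xi> \<in> S \<inter> closure K"
      using \<xi> shock_in_closure closure_Un[of E K] by blast
    then show ?thesis
    proof cases
      case 1
      then show ?thesis using low unfolding W_iff by linarith
    next
      case 2
      then have "norm (\<xi> - \<sigma> 0) \<le> ?R" using R[of \<xi>] norm_triangle_ineq4[of \<xi> "\<sigma> 0"] by linarith
      moreover have "\<bar>(\<xi> - \<sigma> 0) \<bullet> e\<bar> \<le> norm (\<xi> - \<sigma> 0)" "\<bar>(\<xi> - \<sigma> 0) \<bullet> nW\<bar> \<le> norm (\<xi> - \<sigma> 0)"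
        using Cauchy_Schwarz_ineq2[of "\<xi> - \<sigma> 0" e] Cauchy_Schwarz_ineq2[of "\<xi> - \<sigma> 0" nW] e nW_facts(1) by auto
      ultimately show ?thesis using low by linarith
    next
      case 3
      then obtain s where s: "0 \<le> s" "\<xi> = ?q + s *\<^sub>R e" using far_shock unfolding ray_def by auto
      have "(\<xi> - \<sigma> 0) \<bullet> e = (?q - \<sigma> 0) \<bullet> e + s" "(\<xi> - \<sigma> 0) \<bullet> nW = (?q - \<sigma> 0) \<bullet> nW"
        using e nW_facts unfolding s(2) by (auto simp: inner_diff_left inner_add_left norm_eq_1)
      then show ?thesis using s(1) low by linarith
    qed
  qed
  let ?A1 = "{\<xi>. (\<xi> - \<sigma> 0) \<bullet> e < x0}" and ?A2 = "{\<xi>. (\<xi> - \<sigma> 0) \<bullet> nW < y0}"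
  have conv: "convex {\<xi>. (\<xi> - \<sigma> 0) \<bullet> d < r}" and op: "open {\<xi>. (\<xi> - \<sigma> 0) \<bullet> d < r}" for d and r :: real
  proof -
    have "(\<xi> - \<sigma> 0) \<bullet> d < r \<longleftrightarrow> d \<bullet> \<xi> < r + d \<bullet> \<sigma> 0" for \<xi>
      by (auto simp: inner_diff_left inner_commute[of \<xi> d] inner_commute[of "\<sigma> 0" d])
    then have "{\<xi>. (\<xi> - \<sigma> 0) \<bullet> d < r} = {\<xi>. d \<bullet> \<xi> < r + d \<bullet> \<sigma> 0}" by simp
    then show "convex {\<xi>. (\<xi> - \<sigma> 0) \<bullet> d < r}" "open {\<xi>. (\<xi> - \<sigma> 0) \<bullet> d < r}"
      by (simp_all add: convex_halfspace_lt open_halfspace_lt)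
  qed
  \<comment> \<open>\<open>?b\<close> shows that the two half-planes overlap, so their union is
    connected; \<open>?b'\<close> lies in the union but beyond the wall line, outside
    \<open>D\<close>.\<close>
  let ?b = "\<sigma> 0 + (x0 - 1) *\<^sub>R e + (y0 - 1) *\<^sub>R nW" and ?b' = "\<sigma> 0 + (x0 - 1) *\<^sub>R e + 1 *\<^sub>R nW"
  have b: "?b \<in> ?A1 \<inter> ?A2" "?b' \<in> ?A1" "0 < (?b' - \<sigma> 0) \<bullet> nW"
    using e nW_facts by (auto simp: inner_add_left norm_eq_1)
  have "connected (?A1 \<union> ?A2)"
    by (rule connected_Un[OF convex_connected[OF conv] convex_connected[OF conv]]) (use b in blast)
  moreover have "(?A1 \<union> ?A2) \<inter> frontier D = {}" using SW D_facts(5) by force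
  moreover have "?b' \<notin> D" using b(3) nW_facts(4)[of ?b'] by (meson less_asym)
  then have "\<not> (?A1 \<union> ?A2) \<subseteq> D" using b(2) by blast
  ultimately have "(?A1 \<union> ?A2) \<inter> D = {}" using connected_subset_if_disjoint_frontier by blast
  moreover have "open (?A1 \<union> ?A2)" using op by blast
  ultimately have "(?A1 \<union> ?A2) \<inter> closure D = {}" using open_Int_closure_eq_empty by blast
  moreover have sub: "closure (E \<union> K) \<subseteq> closure D" by (rule closure_mono) (use EK_facts(1) in auto)
  ultimately have 1: "x0 \<le> (\<xi> - \<sigma> 0) \<bullet> e \<and> y0 \<le> (\<xi> - \<sigma> 0) \<bullet> nW" if "\<xi> \<in> closure (E \<union> K)" for \<xi>
    using that by (metis (mono_tags, lifting) IntI UnI1 UnI2 empty_iff mem_Collect_eq not_le subsetD)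
  have 2: "(\<xi> - \<sigma> 0) \<bullet> nW \<le> 0" if "\<xi> \<in> closure (E \<union> K)" for \<xi>
  proof -
    have "continuous_on (closure D) (\<lambda>x. (x - \<sigma> 0) \<bullet> nW)" by (intro continuous_intros)
    then show ?thesis using continuous_le_on_closure[of D "\<lambda>x. (x - \<sigma> 0) \<bullet> nW" \<xi> 0] that sub nW_facts(4) by fastforce
  qed
  show thesis by (rule that) (use 1 2 in blast)
qed

text \<open>Compactness is recovered for a sublevel set: in the hyperbolic region \<open>U\<close>
  is affine with positive slope along \<open>e\<close>, which bounds the set in that direction, and
  the strip bounds it in the others.\<close>

lemma U_attains_min:
  assumes "\<xi> \<in> closure (E \<union> K)"
  obtains X where "X \<in> closure (E \<union> K)" "\<And>\<zeta>. \<zeta> \<in> closure (E \<union> K) \<Longrightarrow> U 1 X \<le> U 1 \<zeta>"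
proof -
  obtain x0 y0 where xy: "\<And>\<xi>. \<xi> \<in> closure (E \<union> K) \<Longrightarrow> x0 \<le> (\<xi> - \<sigma> 0) \<bullet> e \<and> y0 \<le> (\<xi> - \<sigma> 0) \<bullet> nW \<and> (\<xi> - \<sigma> 0) \<bullet> nW \<le> 0"
    by (rule strip) blast
  obtain \<kappa> where \<kappa>: "\<And>\<xi>. \<xi> \<in> closure K \<Longrightarrow> U 1 \<xi> = ((vH - vr) \<bullet> e) * ((\<xi> - \<sigma> 0) \<bullet> e) + \<kappa>"
    by (rule U_hyperbolic) blast
  obtain R where R: "\<And>\<xi>. \<xi> \<in> closure E \<Longrightarrow> norm \<xi> \<le> R" using bounded_E bounded_closure bounded_iff by metis
  let ?L = "{\<zeta> \<in> closure (E \<union> K). U 1 \<zeta> \<le> U 1 \<xi>}"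
  have cont: "continuous_on (closure (E \<union> K)) (U 1)" using C1_U[of 1] unfolding C1_closure_def by simp
  have "closed ?L" using continuous_closed_preimage[OF cont closed_closure closed_atMost[of "U 1 \<xi>"]]
    by (simp add: vimage_def Int_def)
  moreover define M where "M = max ((U 1 \<xi> - \<kappa>) / ((vH - vr) \<bullet> e)) 0"
  have "norm \<zeta> \<le> max R (norm (\<sigma> 0) + (M + \<bar>x0\<bar> + \<bar>y0\<bar>))" if \<zeta>: "\<zeta> \<in> ?L" for \<zeta>
  proof (cases "\<zeta> \<in> closure E")
    case True
    then show ?thesis using R by fastforce
  next
    case False
    then have "\<zeta> \<in> closure K" using \<zeta> closure_Un[of E K] by auto
    then have "((vH - vr) \<bullet> e) * ((\<zeta> - \<sigma> 0) \<bullet> e) \<le> U 1 \<xi> - \<kappa>" using \<kappa>[of \<zeta>] \<zeta> by simp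
    then have "(\<zeta> - \<sigma> 0) \<bullet> e \<le> (U 1 \<xi> - \<kappa>) / ((vH - vr) \<bullet> e)"
      using hyperbolic_ahead by (simp add: pos_le_divide_eq mult.commute)
    moreover have "x0 \<le> (\<zeta> - \<sigma> 0) \<bullet> e" "y0 \<le> (\<zeta> - \<sigma> 0) \<bullet> nW" "(\<zeta> - \<sigma> 0) \<bullet> nW \<le> 0" using xy \<zeta> by auto
    ultimately have "\<bar>(\<zeta> - \<sigma> 0) \<bullet> e\<bar> + \<bar>(\<zeta> - \<sigma> 0) \<bullet> nW\<bar> \<le> M + \<bar>x0\<bar> + \<bar>y0\<bar>" unfolding M_def by linarith
    moreover have "norm (\<zeta> - \<sigma> 0) \<le> \<bar>(\<zeta> - \<sigma> 0) \<bullet> e\<bar> + \<bar>(\<zeta> - \<sigma> 0) \<bullet> nW\<bar>"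
      using norm_triangle_ineq[of "((\<zeta> - \<sigma> 0) \<bullet> e) *\<^sub>R e" "((\<zeta> - \<sigma> 0) \<bullet> nW) *\<^sub>R nW"]
        orthonormal_expansion[OF e nW_facts(1,2), of "\<zeta> - \<sigma> 0"] e nW_facts(1) by simp
    moreover have "norm \<zeta> \<le> norm (\<sigma> 0) + norm (\<zeta> - \<sigma> 0)" by (rule norm_triangle_sub)
    ultimately show ?thesis by linarith
  qed
  then have "bounded ?L" unfolding bounded_iff by blast
  ultimately have "compact ?L" by (simp add: compact_eq_bounded_closed)
  moreover have "?L \<noteq> {}" using assms by auto
  moreover have "continuous_on ?L (U 1)" by (rule continuous_on_subset[OF cont]) auto
  ultimately have "\<exists>X\<in>?L. \<forall>\<zeta>\<in>?L. U 1 X \<le> U 1 \<zeta>" by (rule continuous_attains_inf)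
  then obtain X where X: "X \<in> ?L" and min: "\<And>\<zeta>. \<zeta> \<in> ?L \<Longrightarrow> U 1 X \<le> U 1 \<zeta>" by blast
  show thesis
  proof (rule that)
    show "X \<in> closure (E \<union> K)" using X by simp
    fix \<zeta> assume "\<zeta> \<in> closure (E \<union> K)"
    then show "U 1 X \<le> U 1 \<zeta>" using min[of \<zeta>] X by (cases "U 1 \<zeta> \<le> U 1 \<xi>") auto
  qed
qed

lemma wall_nbhd:
  assumes X: "X \<in> closure (E \<union> K)" "X \<in> W" and r: "ball X r \<inter> S = {}" "0 < r"
  shows "ball X r \<inter> {x. (x - \<sigma> 0) \<bullet> nW < 0} \<subseteq> D"
proof (rule connected_subset_if_disjoint_frontier)
  show "connected (ball X r \<inter> {x. (x - \<sigma> 0) \<bullet> nW < 0})"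
    by (intro convex_connected convex_Int halfplane convex_ball)
  have "X \<in> closure D" using X(1) closure_mono[of "E \<union> K" D] EK_facts(1) by blast
  moreover have "X \<in> ball X r" using r(2) by simp
  ultimately have "ball X r \<inter> D \<noteq> {}" using open_Int_closure_eq_empty[OF open_ball] by blast
  then show "ball X r \<inter> {x. (x - \<sigma> 0) \<bullet> nW < 0} \<inter> D \<noteq> {}" using nW_facts(4) by blast
  show "ball X r \<inter> {x. (x - \<sigma> 0) \<bullet> nW < 0} \<inter> frontier D = {}"
    using D_facts(5) r(1) W_iff by fastforce
qed

lemma wall_nbhd_E:
  assumes X: "X \<in> closure E" "X \<in> W" "X \<notin> S" "X \<notin> closure K"
  obtains r where "0 < r" "ball X r \<inter> {x. (x - \<sigma> 0) \<bullet> nW < 0} \<subseteq> E"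
    "frontier E \<inter> ball X r \<subseteq> {x. (x - \<sigma> 0) \<bullet> nW = 0}"
proof -
  have "open (- S \<inter> - closure K)" using closed_S by (intro open_Int) auto
  then obtain r where r: "0 < r" "ball X r \<subseteq> - S \<inter> - closure K"
    using X(3,4) open_contains_ball by (metis ComplI IntI)
  have XEK: "X \<in> closure (E \<union> K)" using X(1) closure_E_sub by blast
  have "ball X r \<inter> {x. (x - \<sigma> 0) \<bullet> nW < 0} \<subseteq> D" by (rule wall_nbhd[OF XEK X(2)]) (use r in auto)
  moreover have "D - closure K \<subseteq> E" using EK_facts(1) arc_in_closure_K closure_subset[of K] by blast
  ultimately have "ball X r \<inter> {x. (x - \<sigma> 0) \<bullet> nW < 0} \<subseteq> E" using r(2) by blast
  moreover have "frontier E \<inter> ball X r \<subseteq> W" using frontier_part[of E] r(2) arc_in_closure_K by blast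
  then have "frontier E \<inter> ball X r \<subseteq> {x. (x - \<sigma> 0) \<bullet> nW = 0}" using W_iff by blast
  ultimately show thesis using that r(1) by blast
qed

lemma no_descent:
  assumes X: "X \<in> closure (E \<union> K)" and min: "\<And>\<xi>. \<xi> \<in> closure (E \<union> K) \<Longrightarrow> U 1 X \<le> U 1 \<xi>"
    and d: "d \<noteq> 0" "\<forall>\<^sub>F \<epsilon> in at_right 0. X + \<epsilon> *\<^sub>R d \<in> D"
  shows "0 \<le> (v X - vr) \<bullet> d"
proof (rule ccontr)
  assume "\<not> ?thesis"
  then have neg: "(1 *\<^sub>R (v X - vr)) \<bullet> d < 0" by simp
  note ev = eventually_off_arc[OF d]
  from C1_closure_descent[OF C1_U X ev neg] ev
  have "\<forall>\<^sub>F \<epsilon> in at_right (0::real). False"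
    by eventually_elim (use min closure_subset in fastforce)
  then show False by simp
qed

lemma min_on_E:
  assumes X: "X \<in> E" and min: "\<And>\<xi>. \<xi> \<in> closure (E \<union> K) \<Longrightarrow> U 1 X \<le> U 1 \<xi>" and \<xi>: "\<xi> \<in> closure E"
  shows "U 1 \<xi> = U 1 X"
proof -
  let ?m = "1 * (\<psi> \<xi>r - vr \<bullet> \<xi>r) + U 1 X"
  have eq: "1 * (\<psi> \<xi> - vr \<bullet> \<xi>) - ?m = U 1 \<xi> - U 1 X" for \<xi> unfolding U_def by simp
  have "1 * (\<psi> \<xi> - vr \<bullet> \<xi>) - ?m = 0" if "\<xi> \<in> E" for \<xi>
  proof (rule strong_minimum_principle[OF EK_facts(2,4) order_refl _ X _ that])
    fix \<xi> assume "\<xi> \<in> E"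
    then have "\<xi> \<in> closure (E \<union> K)" using closure_subset[of "E \<union> K"] by blast
    then show "0 \<le> 1 * (\<psi> \<xi> - vr \<bullet> \<xi>) - ?m" unfolding eq using min by simp
  next
    show "1 * (\<psi> X - vr \<bullet> X) - ?m = 0" unfolding eq by simp
  qed
  then have const_E: "U 1 \<xi> = U 1 X" if "\<xi> \<in> E" for \<xi> using that unfolding eq by simp
  have "continuous_on (closure E) (U 1)"
    using C1_U[of 1] closure_E_sub unfolding C1_closure_def by (meson continuous_on_subset)
  from continuous_constant_on_closure[OF this const_E \<xi>] show ?thesis .
qed

lemma U_tip: "U 1 (\<sigma> 0) = 0"
  unfolding U_def by simp

text \<open>With the sign \<open>+1\<close> a negative minimum on the shock is impossible at once.
  In the closure of \<open>K\<close> the direction \<open>- e\<close> descends, and on the wall next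
  to \<open>E\<close> Hopf's lemma contradicts the slip condition.\<close>

lemma U_nonneg:
  assumes \<xi>: "\<xi> \<in> closure (E \<union> K)"
  shows "0 \<le> U 1 \<xi>"
proof (rule ccontr)
  assume neg: "\<not> 0 \<le> U 1 \<xi>"
  obtain X where X: "X \<in> closure (E \<union> K)" and min: "\<And>\<zeta>. \<zeta> \<in> closure (E \<union> K) \<Longrightarrow> U 1 X \<le> U 1 \<zeta>"
    by (rule U_attains_min[OF \<xi>]) blast
  have UX: "U 1 X < 0" using min[OF \<xi>] neg by linarith
  have XE: "X \<notin> E"
  proof
    assume "X \<in> E"
    from min_on_E[OF this _ tip] have "U 1 (\<sigma> 0) = U 1 X" using min by blast
    then show False using UX U_tip by simp
  qed
  have XU: "U 1 X < U 1 x" if x: "x \<in> E" for x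
  proof (rule ccontr)
    assume le: "\<not> ?thesis"
    have "U 1 (\<sigma> 0) = U 1 x" by (rule min_on_E[OF x _ tip]) (use min le in fastforce)
    then show False using UX U_tip le by simp
  qed
  have XS: "X \<notin> S"
  proof
    assume "X \<in> S"
    then obtain t where t: "0 \<le> t" "X = \<sigma> t" by auto
    have "t \<noteq> 0" using UX U_tip t by auto
    then have "t \<in> interior {0..}" using t by simp
    then show False using negative_min_on_shock(1)[of t 1] min UX unfolding t(2) by auto
  qed
  have K: "X \<notin> closure K"
  proof
    assume XK: "X \<in> closure K"
    have vX: "v X = vH" by (rule v_hyperbolic[OF XK])
    from closure_cases[OF X] XS consider "X \<in> D" | "X \<in> W" by blast
    then show False
    proof cases
      case 1
      have "\<forall>\<^sub>F \<epsilon> in at_right 0. X + \<epsilon> *\<^sub>R - e \<in> D" by (rule eventually_ray_in_open[OF D_facts(1) 1])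
      moreover have "- e \<noteq> 0" using e by auto
      ultimately have "0 \<le> (v X - vr) \<bullet> - e" using no_descent[OF X, of "- e"] min by blast
      then show False using hyperbolic_ahead unfolding vX by simp
    next
      case 2
      obtain r where r: "0 < r" "ball X r \<subseteq> - S"
        using XS closed_S open_contains_ball by (metis ComplI open_Compl)
      have half: "ball X r \<inter> {x. (x - \<sigma> 0) \<bullet> nW < 0} \<subseteq> D" by (rule wall_nbhd[OF X 2]) (use r in auto)
      \<comment> \<open>On the wall \<open>- e\<close> only runs along the boundary. The added
        \<open>- nW\<close> leads into \<open>D\<close> and does not change the derivative, since
        \<open>vH\<close> and \<open>vr\<close> have the same normal component.\<close>
      let ?d = "- e - nW"
      have dn: "?d \<bullet> nW = - 1" using nW_facts by (simp add: inner_diff_left norm_eq_1)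
      then have d0: "?d \<noteq> 0" by (metis inner_zero_left zero_neq_neg_one)
      have "\<forall>\<^sub>F \<epsilon> in at_right 0. X + \<epsilon> *\<^sub>R ?d \<in> ball X r"
        by (rule eventually_ray_in_open) (use r in auto)
      then have "\<forall>\<^sub>F \<epsilon> in at_right 0. X + \<epsilon> *\<^sub>R ?d \<in> D"
        using eventually_at_right_0_less[OF zero_less_one]
      proof eventually_elim
        case (elim \<epsilon>)
        have "(X + \<epsilon> *\<^sub>R ?d - \<sigma> 0) \<bullet> nW = (X - \<sigma> 0) \<bullet> nW + \<epsilon> * (?d \<bullet> nW)"
          by (simp add: inner_diff_left inner_add_left)
        also have "\<dots> < 0" using 2 W_iff elim unfolding dn by simp
        finally show ?case using half elim by blast
      qed
      then have "0 \<le> (v X - vr) \<bullet> ?d" using no_descent[OF X _ d0] min by blast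
      moreover have "(v X - vr) \<bullet> ?d = - ((vH - vr) \<bullet> e) - (vH - vr) \<bullet> nW"
        unfolding vX by (simp only: inner_diff_right inner_minus_right)
      ultimately show False using hyperbolic_ahead velocity_hyperbolic by simp
    qed
  qed
  have XEc: "X \<in> closure E" using X K closure_Un[of E K] by auto
  have XW: "X \<in> W"
  proof -
    have "X \<in> frontier E" using XEc XE EK_facts(2) unfolding frontier_def by (simp add: interior_open)
    then show ?thesis using frontier_part[of E] XS K arc_in_closure_K by blast
  qed
  obtain r where r: "0 < r" "ball X r \<inter> {x. (x - \<sigma> 0) \<bullet> nW < 0} \<subseteq> E"
    "frontier E \<inter> ball X r \<subseteq> {x. (x - \<sigma> 0) \<bullet> nW = 0}"
    by (rule wall_nbhd_E[OF XEc XW XS K])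
  have Xn: "(X - \<sigma> 0) \<bullet> nW = 0" using XW W_iff by blast
  have slipX: "(v X - X) \<bullet> nW = 0" by (rule slip_W[OF XW])
  have vX: "(v X - vr) \<bullet> nW = 0" using slipX slip_r Xn by (simp add: inner_diff_left)
  let ?m = "1 * (\<psi> \<xi>r - vr \<bullet> \<xi>r) + U 1 X"
  have eq: "1 * (\<psi> \<xi> - vr \<bullet> \<xi>) - ?m = U 1 \<xi> - U 1 X" for \<xi> unfolding U_def by simp
  have "0 < 1 * ((v X - vr) \<bullet> - nW)"
  proof (rule hopf[where \<Omega> = E and r' = r and b = 1 and \<kappa>' = 0 and m = ?m])
    show "1 * (\<psi> X - vr \<bullet> X) - ?m = 0" unfolding eq by simp
    show "0 < 1 * (\<psi> \<xi> - vr \<bullet> \<xi>) - ?m" if "\<xi> \<in> E" for \<xi> unfolding eq using XU[OF that] by simp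
    show "norm (- nW) = 1" using nW_facts by simp
    show "(z X \<bullet> - nW)\<^sup>2 < (c X)\<^sup>2" using slipX c_pos[OF XEc] unfolding pseudo_velocity_def by simp
    fix \<xi> assume \<xi>: "\<xi> \<in> frontier E" "dist X \<xi> < r"
    then have "(\<xi> - \<sigma> 0) \<bullet> nW = 0" using r(3) by auto
    then have "(\<xi> - X) \<bullet> nW = 0" using Xn by (simp add: inner_diff_left)
    moreover have "U 1 X \<le> U 1 \<xi>" using min[of \<xi>] \<xi>(1) closure_E_sub unfolding frontier_def by blast
    ultimately show "1 * ((\<xi> - X) \<bullet> - nW - 0 * ((\<xi> - X) \<bullet> (\<xi> - X))) \<le> 1 * (\<psi> \<xi> - vr \<bullet> \<xi>) - ?m"
      unfolding eq by simp
  next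
    show "\<forall>\<^sub>F \<epsilon> in at_right 0. X + \<epsilon> *\<^sub>R - nW \<in> E"
      using eventually_at_right_0_less[OF r(1)]
    proof eventually_elim
      case (elim \<epsilon>)
      have "(X + \<epsilon> *\<^sub>R - nW - \<sigma> 0) \<bullet> nW = (X - \<sigma> 0) \<bullet> nW - \<epsilon>"
        using nW_facts by (simp add: inner_diff_left norm_eq_1)
      moreover have "dist X (X + \<epsilon> *\<^sub>R - nW) < r" using elim nW_facts by (simp add: dist_norm)
      ultimately show ?case using r(2) elim Xn by (auto simp: subset_eq)
    qed
  qed (use EK_facts XEc r in auto)
  then show False using vX by simp
qed

text \<open>A zero in \<open>E\<close> makes the velocity equal to \<open>vr\<close> throughout
  \<open>E\<close>. Since \<open>D\<close> is connected, the closures of \<open>E\<close> and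
  \<open>K\<close> meet, and there the velocity is also \<open>vH\<close>, which exceeds
  \<open>vr\<close> along the wall.\<close>

lemma U_positive:
  assumes x: "x \<in> E"
  shows "0 < U 1 x"
proof (rule ccontr)
  assume "\<not> 0 < U 1 x"
  moreover have xc: "x \<in> closure (E \<union> K)" using x closure_subset[of "E \<union> K"] by blast
  ultimately have U0: "U 1 x = 0" using U_nonneg[OF xc] by simp
  have zero: "U 1 \<xi> = 0" if "\<xi> \<in> closure E" for \<xi>
    using min_on_E[OF x _ that] U_nonneg U0 by simp
  have vE: "v \<xi> = vr" if \<xi>: "\<xi> \<in> E" for \<xi>
  proof (rule ccontr)
    assume ne: "v \<xi> \<noteq> vr"
    let ?d = "- (v \<xi> - vr)"
    have \<xi>': "\<xi> \<in> closure (E \<union> K)" "\<xi> \<in> closure E" "\<xi> \<in> D" using \<xi> closure_subset[of "E \<union> K"] closure_subset[of E] EK_facts(1) by blast+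
    have "0 \<le> (v \<xi> - vr) \<bullet> ?d"
      by (rule no_descent[OF \<xi>'(1) _ _ eventually_ray_in_open[OF D_facts(1) \<xi>'(3)]])
         (use zero[OF \<xi>'(2)] U_nonneg ne in auto)
    then have "(v \<xi> - vr) \<bullet> (v \<xi> - vr) = 0" using inner_ge_zero[of "v \<xi> - vr"] unfolding inner_minus_right by linarith
    then show False using ne by simp
  qed
  have "closure E \<inter> closure K \<noteq> {}"
  proof
    assume no: "closure E \<inter> closure K = {}"
    then have "D \<subseteq> E \<union> - closure E" using EK_facts(1) arc_in_closure_K closure_subset[of K] no by blast
    moreover have "D \<inter> E \<noteq> {}" "D \<inter> - closure E \<noteq> {}"
      using EK_facts(1,7,8) no closure_subset[of K] by blast+
    moreover have "E \<inter> - closure E \<inter> D = {}" using closure_subset[of E] by blast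
    ultimately show False
      using connectedD[OF D_facts(2) EK_facts(2), of "- closure E"] by auto
  qed
  then obtain Y where Y: "Y \<in> closure E" "Y \<in> closure K" by blast
  have "v Y = vr" using continuous_constant_on_closure[OF continuous_v vE Y(1)] .
  then show False using v_hyperbolic[OF Y(2)] hyperbolic_ahead by simp
qed

theorem strong_type_impossible:
  assumes strong: "strong_type \<pi> vI \<rho>I \<psi>I v (\<sigma> 0)"
  shows False
proof -
  obtain r0 where r0: "0 < r0" "ball (\<sigma> 0) r0 \<subseteq> - closure K"
    using tip_not_K open_contains_ball[of "- closure K"] by (auto simp: open_Compl)
  have near: "\<xi> \<notin> closure K" "\<xi> \<notin> P" if "dist (\<sigma> 0) \<xi> < r0" for \<xi>
    using that r0(2) arc_in_closure_K by (auto simp: subset_eq)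
  have wall: "\<sigma> 0 + l *\<^sub>R e \<in> W" if "0 \<le> l" for l using that unfolding ray_def by auto
  have "corner_flow \<gamma> \<pi> (E \<union> K) \<psi> v {0..} \<sigma> n vI \<rho>I \<psi>I (W \<union> P) E e nW 1 r0"
  proof (intro corner_flow.intro corner_flow_axioms.intro shock_flow_axioms elliptic_flow_axioms)
    show "norm e = 1" "norm nW = 1" "nW \<bullet> e = 0" using e nW_facts by auto
    show "0 < r0" "E \<subseteq> E \<union> K" using r0 by auto
    show "(E \<union> K) \<inter> ball (\<sigma> 0) r0 \<subseteq> E" using near(1) closure_subset[of K] by (auto simp: subset_eq)
    show "\<xi> \<in> \<sigma> ` {0..} \<or> (\<exists>l\<ge>0. \<xi> = \<sigma> 0 + l *\<^sub>R e)"
      if "\<xi> \<in> frontier E" "dist (\<sigma> 0) \<xi> < r0" for \<xi>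
    proof -
      have "\<xi> \<in> S \<union> W" using frontier_part[of E] that near(2)[of \<xi>] by blast
      then show ?thesis unfolding ray_def by blast
    qed
    fix l :: real assume l: "0 < l" "l < r0" "\<sigma> 0 + l *\<^sub>R e \<in> closure E"
    have lW: "\<sigma> 0 + l *\<^sub>R e \<in> W" using wall l by simp
    from slip_W[OF this] show "(v (\<sigma> 0 + l *\<^sub>R e) - \<sigma> 0) \<bullet> nW = 0"
      using nW_facts by (simp add: inner_diff_left inner_add_left)
    have lS: "\<sigma> 0 + l *\<^sub>R e \<notin> S"
    proof
      assume "\<sigma> 0 + l *\<^sub>R e \<in> S"
      then obtain t where t: "0 \<le> t" "\<sigma> t = \<sigma> 0 + l *\<^sub>R e" by auto
      then have "t \<noteq> 0" using l e by auto
      then show False using shock_not_W[of t] t lW by simp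
    qed
    have lK: "\<sigma> 0 + l *\<^sub>R e \<notin> closure K" by (rule near(1)) (use l e in \<open>simp add: dist_norm\<close>)
    show "\<exists>\<rho>>0. ball (\<sigma> 0 + l *\<^sub>R e) \<rho> \<inter> {x. (x - \<sigma> 0) \<bullet> nW < 0} \<subseteq> E \<and>
        frontier E \<inter> ball (\<sigma> 0 + l *\<^sub>R e) \<rho> \<subseteq> {x. (x - \<sigma> 0) \<bullet> nW = 0}"
      using wall_nbhd_E[OF l(3) lW lS lK] by metis
  next
    fix t :: real assume t: "t \<in> {0..}" "t \<noteq> 0" "dist (\<sigma> 0) (\<sigma> t) < r0"
    then have "0 < t" by simp
    then show "t \<in> interior {0..} \<and> \<sigma> t \<notin> W \<union> P \<and> (\<forall>l\<ge>0. \<sigma> t \<noteq> \<sigma> 0 + l *\<^sub>R e)"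
      using near(2)[OF t(3)] shock_not_W wall by (metis UnE greaterThan_iff interior_real_atLeast)
  next
    show "\<exists>d>0. {0..d} \<subseteq> {0::real..}" by (intro exI[of _ 1]) simp
    show "(vr - \<sigma> 0) \<bullet> nW = 0" by (rule slip_r)
    show "0 < nr \<bullet> e" "0 < T 0 \<bullet> e" "T 0 \<bullet> nW \<le> 0" using normal_r tangent_r by auto
    show "0 < 1 * (\<psi> \<xi> - vr \<bullet> \<xi>) - 1 * (\<psi> \<xi>r - vr \<bullet> \<xi>r)" if "\<xi> \<in> E" for \<xi>
      using U_positive[OF that] unfolding U_def .
  qed (use strong in auto)
  then show False by (rule corner_flow.strong_corner_impossible)
qed

end

lemma no_strong_supersonic_wedge_flow:
  assumes "polytropic_gas \<gamma> \<pi>"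
    and F: "supersonic_wedge_flow \<gamma> \<pi> \<xi>r e nW vI \<rho>I \<psi>I \<sigma> D E H p vH \<rho>H \<psi> v"
  shows "\<not> strong_type \<pi> vI \<rho>I \<psi>I v \<xi>r"
proof -
  note F' = F[unfolded supersonic_wedge_flow_def Let_def]
  have tip: "\<sigma> 0 = \<xi>r" by (insert F', elim conjE, assumption)
  have "admissible_shock \<pi> vI \<rho>I \<psi>I \<psi> v {0..} \<sigma> D" by (insert F', elim conjE, assumption)
  then obtain n where "normal_into {0..} \<sigma> D n"
    "\<forall>t\<in>{0..}. shock_at \<pi> vI \<rho>I \<psi>I \<psi> v (n t) (\<sigma> t) \<and> admissible_at vI v (n t) (\<sigma> t)"
    unfolding admissible_shock_def by blast
  then have n: "normal_into {0..} \<sigma> D n"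
    "\<And>t. t \<in> {0..} \<Longrightarrow> shock_at \<pi> vI \<rho>I \<psi>I \<psi> v (n t) (\<sigma> t)"
    "\<And>t. t \<in> {0..} \<Longrightarrow> admissible_at vI v (n t) (\<sigma> t)" by blast+
  have flow: "norm e = 1" "outer_wall_normal \<xi>r e D nW" "constant_state \<pi> vI \<rho>I \<psi>I"
    "(vI - \<xi>r) \<bullet> nW > 0" "C1_curve {0..} \<sigma>" "filterlim \<sigma> at_infinity at_top"
    "0 < angle (tangent {0..} \<sigma> 0) e" "angle (tangent {0..} \<sigma> 0) e < pi / 2"
    "D \<in> components (- (\<sigma> ` {0..} \<union> ray \<xi>r e))"
    "arc p" "pathstart p \<in> ray \<xi>r e" "pathfinish p \<in> \<sigma> ` {0..}" "p ` {0<..<1} \<subseteq> D"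
    "path_image p \<subseteq> sphere vH (sound_speed \<gamma> \<rho>H)"
    "components (D - path_image p) = {E, H}" "bounded E" "\<not> bounded H" "\<xi>r \<in> closure E"
    "\<sigma> ` {0..} \<inter> closure H = ray (pathfinish p) e"
    "C1_closure (E \<union> H) \<psi> v" "C2_potential_flow \<gamma> \<pi> E \<psi> v"
    by (insert F', elim conjE, assumption)+
  have pointwise: "\<And>t. 0 < t \<Longrightarrow> (\<sigma> t - \<xi>r) \<bullet> nW < 0"
    "\<And>\<xi>. \<xi> \<in> closure (E \<union> H) \<Longrightarrow> has_density \<pi> \<psi> v \<xi>"
    "\<And>\<xi>. \<xi> \<in> E \<Longrightarrow> pseudo_Mach \<gamma> \<pi> \<psi> v \<xi> < 1"
    "\<And>\<xi>. \<xi> \<in> H \<Longrightarrow> v \<xi> = vH \<and> density \<pi> \<psi> v \<xi> = \<rho>H \<and> 1 < pseudo_Mach \<gamma> \<pi> \<psi> v \<xi>"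
    using F' by blast+
  have slip: "(v \<xi> - \<xi>) \<bullet> nW = 0" if "\<xi> \<in> ray \<xi>r e" for \<xi>
  proof -
    have "\<forall>\<xi>\<in>ray \<xi>r e. slip nW v \<xi>" by (insert F', elim conjE, assumption)
    then show ?thesis using that unfolding slip_def pseudo_velocity_def by blast
  qed
  have "wedge \<gamma> \<pi> e nW vI \<rho>I \<psi>I \<sigma> D E H p vH \<rho>H \<psi> v n"
    by (intro wedge.intro wedge_axioms.intro assms(1))
       (rule flow[folded tip] pointwise[folded tip] slip[folded tip] n; assumption)+
  from wedge.strong_type_impossible[OF this] show ?thesis unfolding tip by blast
qed

theorem mainTheorem1:
  fixes \<gamma> :: real and \<pi> :: "real \<Rightarrow> real"
  assumes "\<gamma> \<ge> 1" and "is_enthalpy \<gamma> \<pi>"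
  shows
    "\<not> (\<exists>k a b nA nB RI vI \<rho>I \<psi>I \<sigma> \<psi> v.
          wall_corner_reflection \<gamma> \<pi> k a b nA nB RI vI \<rho>I \<psi>I \<sigma> \<psi> v \<and>
          angle (vI - v (pathstart \<sigma>)) nB \<noteq> pi / 2 \<and>
          strong_type \<pi> vI \<rho>I \<psi>I v (pathstart \<sigma>)) \<and>
     \<not> (\<exists>\<theta> \<xi>0 \<rho>0 \<psi>0 nA nB vI \<rho>I \<psi>I \<sigma> \<psi> v.
          classical_regular_reflection \<gamma> \<pi> \<theta> \<xi>0 \<rho>0 \<psi>0 nA nB vI \<rho>I \<psi>I \<sigma> \<psi> v \<and>
          strong_type \<pi> vI \<rho>I \<psi>I v (pathstart \<sigma>)) \<and>
     \<not> (\<exists>\<xi>r e nW vI \<rho>I \<psi>I \<sigma> D E H p vH \<rho>H \<psi> v.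
          supersonic_wedge_flow \<gamma> \<pi> \<xi>r e nW vI \<rho>I \<psi>I \<sigma> D E H p vH \<rho>H \<psi> v \<and>
          strong_type \<pi> vI \<rho>I \<psi>I v \<xi>r)"
proof -
  have gas: "polytropic_gas \<gamma> \<pi>" using assms by (rule polytropic_gas.intro)
  show ?thesis
  proof (intro conjI)
    show "\<not> (\<exists>k a b nA nB RI vI \<rho>I \<psi>I \<sigma> \<psi> v.
        wall_corner_reflection \<gamma> \<pi> k a b nA nB RI vI \<rho>I \<psi>I \<sigma> \<psi> v \<and>
        angle (vI - v (pathstart \<sigma>)) nB \<noteq> pi / 2 \<and>
        strong_type \<pi> vI \<rho>I \<psi>I v (pathstart \<sigma>))"
      using no_strong_wall_corner_reflection[OF gas] angle_eq_right by blast
    show "\<not> (\<exists>\<theta> \<xi>0 \<rho>0 \<psi>0 nA nB vI \<rho>I \<psi>I \<sigma> \<psi> v.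
        classical_regular_reflection \<gamma> \<pi> \<theta> \<xi>0 \<rho>0 \<psi>0 nA nB vI \<rho>I \<psi>I \<sigma> \<psi> v \<and>
        strong_type \<pi> vI \<rho>I \<psi>I v (pathstart \<sigma>))"
      using no_strong_classical_regular_reflection[OF gas] by blast
    show "\<not> (\<exists>\<xi>r e nW vI \<rho>I \<psi>I \<sigma> D E H p vH \<rho>H \<psi> v.
        supersonic_wedge_flow \<gamma> \<pi> \<xi>r e nW vI \<rho>I \<psi>I \<sigma> D E H p vH \<rho>H \<psi> v \<and>
        strong_type \<pi> vI \<rho>I \<psi>I v \<xi>r)"
      using no_strong_supersonic_wedge_flow[OF gas] by blast
  qed
qed

end
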